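(* Let $N\ge2$, $1<p\le N$, $p-1<q<q_c:=\frac{N(p-1)}{N-1}$, let $\Omega\subset\mathbb{R}^N$ be an open set containing $0$ and $\Omega^*=\Omega\setminus\{0\}$. If $u\in C^1(\Omega^* )$ is a nonnegative solution of $-\Delta_pu+|\nabla u|^q=0$ in $\Omega^*$, then we have the following alternative. (i) Either there exists $k\ge0$ such that $$\lim_{x\to0}\frac{u(x)}{\mu_p(x)}=k\qquad(1)$$ and $u$ satisfies $$-\Delta_pu+|\nabla u|^q=c_{N,p}k^{p-1}\delta_0\quad\text{in }\mathcal{D}'(\Omega).$$ (ii) Or $$\lim_{x\to0}|x|^{\beta_q}u(x)=\lambda_{N,p,q},\qquad(2)$$ where $\beta_q=\frac{p-q}{q+1-p}$ and $\lambda_{N,p,q}=\beta_q^{-1}\big(\beta_q(p-1)+p-N\big)^{\frac{1}{q+1-p}}$. Furthermore, if $\Omega$ is bounded, a nonnegative solution $u$ in $C(\overline\Omega\setminus\{0\})$ is uniquely determined by its data on $\partial\Omega$ and its behaviour (1) or (2) at $0$: two nonnegative $C^1(\Omega^* )$ solutions in $\Omega^*$, continuous on $\overline\Omega\setminus\{0\}$, which coincide on $\partial\Omega$ and which either both satisfy (1) with the same $k$ or both satisfy (2), are equal.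
   Context: $\Delta_p u=\operatorname{div}(|\nabla u|^{p-2}\nabla u)$; $C^1$ solutions are understood in the distributional sense. $\mu_p(x)=|x|^{\frac{p-N}{p-1}}$ if $1<p<N$ and $\mu_N(x)=-\ln|x|$ if $p=N$. $c_{N,p}>0$ is the constant such that $-\Delta_p\mu_p=c_{N,p}\delta_0$ in $\mathcal{D}'(\mathbb{R}^N)$, where $\delta_0$ is the Dirac mass at $0$. *)

theory Defs
  imports "HOL-Analysis.Analysis"
begin

text \<open>The ambient space is a Euclidean space \<open>'a\<close>, and \<open>N = DIM('a)\<close>.\<close>

definition grad :: "('a::euclidean_space \<Rightarrow> real) \<Rightarrow> 'a \<Rightarrow> 'a"
  where "grad f x = (THE D. GDERIV f x :> D)"

lemma grad_eqI:
  assumes "GDERIV f x :> D"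
  shows "grad f x = D"
  unfolding grad_def
proof (rule the_equality)
  fix D' assume D': "GDERIV f x :> D'"
  have "(\<lambda>h. h \<bullet> D') = (\<lambda>h. h \<bullet> D)"
    using D' assms unfolding gderiv_def by (rule has_derivative_unique)
  then have "\<forall>b. b \<bullet> D' = b \<bullet> D"
    by (intro allI) (rule fun_cong)
  then show "D' = D"
    by (rule iffD1[OF vector_eq_ldot])
qed (fact assms)

definition C1_on :: "'a::euclidean_space set \<Rightarrow> ('a \<Rightarrow> real) \<Rightarrow> bool"
  where "C1_on S u \<longleftrightarrow> (\<forall>x\<in>S. u differentiable (at x)) \<and> continuous_on S (grad u)"

primrec iterated_deriv :: "'a::euclidean_space list \<Rightarrow> ('a \<Rightarrow> real) \<Rightarrow> 'a \<Rightarrow> real"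
  where
    "iterated_deriv [] f = f"
  | "iterated_deriv (v # vs) f = (\<lambda>x. frechet_derivative (iterated_deriv vs f) (at x) v)"

definition smooth :: "('a::euclidean_space \<Rightarrow> real) \<Rightarrow> bool"
  where "smooth f \<longleftrightarrow>
    (\<forall>vs. set vs \<subseteq> Basis \<longrightarrow> (\<forall>x. iterated_deriv vs f differentiable (at x)))"

text \<open>Elements of \<open>C\<^sub>c\<^sup>\<infinity>(\<Omega>)\<close>, extended by zero to the whole space.\<close>

definition test_functions :: "'a::euclidean_space set \<Rightarrow> ('a \<Rightarrow> real) set"
  where "test_functions \<Omega> =
    {\<phi>. smooth \<phi> \<and> compact (closure (support_on UNIV \<phi>)) \<and> closure (support_on UNIV \<phi>) \<subseteq> \<Omega>}"

definition locally_integrable ::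
    "'a::euclidean_space set \<Rightarrow> ('a \<Rightarrow> 'b::{banach, second_countable_topology}) \<Rightarrow> bool"
  where "locally_integrable \<Omega> f \<longleftrightarrow>
    (\<forall>K. compact K \<and> K \<subseteq> \<Omega> \<longrightarrow> set_integrable lborel K f)"

definition plap_flux :: "real \<Rightarrow> ('a::euclidean_space \<Rightarrow> real) \<Rightarrow> 'a \<Rightarrow> 'a"
  where "plap_flux p u x = norm (grad u x) powr (p - 2) *\<^sub>R grad u x"

text \<open>
  The equation \<open>-\<Delta>\<^sub>p u + f = T\<close> in \<open>D'(\<Omega>)\<close>, for a distribution \<open>T\<close> given by its values on
  test functions. The gradient is the pointwise one: in all uses \<open>u\<close> is \<open>C\<^sup>1\<close> off the origin, a
  null set, so the (arbitrary) value of \<open>grad u 0\<close> is irrelevant. Local integrability in \<open>\<Omega>\<close>, and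
  in particular near the origin if \<open>0 \<in> \<Omega>\<close>, is what makes both terms on the left distributions
  in \<open>\<Omega>\<close>, and is part of the assertion.
\<close>

definition neg_plap_plus_eq_in_distr ::
    "'a::euclidean_space set \<Rightarrow> real \<Rightarrow> ('a \<Rightarrow> real) \<Rightarrow> ('a \<Rightarrow> real) \<Rightarrow> (('a \<Rightarrow> real) \<Rightarrow> real) \<Rightarrow> bool"
  where "neg_plap_plus_eq_in_distr \<Omega> p u f T \<longleftrightarrow>
    locally_integrable \<Omega> (plap_flux p u) \<and> locally_integrable \<Omega> f \<and>
    (\<forall>\<phi>\<in>test_functions \<Omega>.
      (LINT x:\<Omega>|lborel. plap_flux p u x \<bullet> grad \<phi> x + f x * \<phi> x) = T \<phi>)"

definition dirac :: "('a::euclidean_space \<Rightarrow> real) \<Rightarrow> real"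
  where "dirac \<phi> = \<phi> 0"

definition nonneg_solution ::
    "real \<Rightarrow> real \<Rightarrow> 'a::euclidean_space set \<Rightarrow> ('a \<Rightarrow> real) \<Rightarrow> bool"
  where "nonneg_solution p q U u \<longleftrightarrow>
    C1_on U u \<and> (\<forall>x\<in>U. 0 \<le> u x) \<and>
    neg_plap_plus_eq_in_distr U p u (\<lambda>x. norm (grad u x) powr q) (\<lambda>_. 0)"

definition mu :: "real \<Rightarrow> 'a::euclidean_space \<Rightarrow> real"
  where "mu p x =
    (if p = real DIM('a) then - ln (norm x) else norm x powr ((p - real DIM('a)) / (p - 1)))"

definition c_dirac :: "'a::euclidean_space itself \<Rightarrow> real \<Rightarrow> real"
  where "c_dirac _ p =
    (THE c. 0 < c \<and>
      neg_plap_plus_eq_in_distr (UNIV :: 'a set) p (mu p) (\<lambda>_. 0) (\<lambda>\<phi>. c * dirac \<phi>))"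

definition q_crit :: "'a::euclidean_space itself \<Rightarrow> real \<Rightarrow> real"
  where "q_crit _ p = real DIM('a) * (p - 1) / (real DIM('a) - 1)"

definition beta :: "real \<Rightarrow> real \<Rightarrow> real"
  where "beta p q = (p - q) / (q + 1 - p)"

definition lambda :: "'a::euclidean_space itself \<Rightarrow> real \<Rightarrow> real \<Rightarrow> real"
  where "lambda _ p q =
    inverse (beta p q) * (beta p q * (p - 1) + p - real DIM('a)) powr (1 / (q + 1 - p))"

definition mu_behaviour :: "real \<Rightarrow> real \<Rightarrow> ('a::euclidean_space \<Rightarrow> real) \<Rightarrow> bool"
  where "mu_behaviour p k u \<longleftrightarrow> ((\<lambda>x. u x / mu p x) \<longlongrightarrow> k) (at 0)"

definition strong_behaviour :: "real \<Rightarrow> real \<Rightarrow> ('a::euclidean_space \<Rightarrow> real) \<Rightarrow> bool"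
  where "strong_behaviour p q u \<longleftrightarrow>
    ((\<lambda>x. norm x powr beta p q * u x) \<longlongrightarrow> lambda TYPE('a) p q) (at 0)"

end

theory Submission
 imports Defs
begin

text \<open>
 A strict subsolution cannot touch a strict supersolution from below at a point where one gradient does not vanish,
 not even at an isolated singularity, because a point has zero \<open>p\<close>-capacity for \<open>p \<le> N\<close>: this follows from a
 De Giorgi iteration on superlevel sets of the difference. Doubling variables turns it into a comparison
 principle across the origin. Comparing \<open>u\<close> with multiples \<open>l u\<close>, \<open>l > 1\<close>, of its reflections in hyperplanes shows
 that the oscillation of \<open>u\<close> on small spheres around the origin is bounded by a constant \<open>C\<close>. On an annulus,
 \<open>u\<close> is therefore within \<open>C\<close> of an explicit radial solution, which depends on one parameter \<open>K\<close>; shrinking the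
 hole yields a limiting \<open>K \<ge> 0\<close>, and \<open>K > 0\<close>, \<open>K = 0\<close> and boundedness of \<open>u\<close> are the behaviours (1) with \<open>k > 0\<close>,
 (2), and (1) with \<open>k = 0\<close>. Testing with truncations of \<open>\<kappa> \<mu>\<^sub>p - u\<close> and \<open>u - \<kappa> \<mu>\<^sub>p\<close> for \<open>\<kappa>\<close> close to \<open>k\<close>, the
 monotonicity of the flux gives the integrability of \<open>|\<nabla>u|\<^sup>q\<close> and the value of the mass at the origin.
 Uniqueness follows by comparing \<open>u\<close> with \<open>l v\<close> and letting \<open>l\<close> tend to \<open>1\<close>.
\<close>

section \<open>Gradients, vector fields and weak solutions\<close>

text \<open>Solutions are only C^1 and the operator degenerates (p > 2) or becomes singular (p < 2)
  where the gradient vanishes, so second derivatives at a contact point make no sense and comparison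
  has to be made on integrals. Ellipticity returns as soon as one of the two gradients is near a
  fixed nonzero vector, whatever the other one does; contact points where both gradients vanish are
  the reason for doubling variables. Strictness comes from homogeneity: the flux has degree p-1 and
  the absorption term degree q > p-1, so l u with l > 1 solves the equation with a coefficient below
  1. The condition q < q_c says exactly that the exponent \<open>\<theta>\<close> below is positive:
  the radial equation integrates to w^(-s1) = K + const r^\<theta>, which tends to K at 0, so that K
  > 0 gives profiles comparable to \<open>mu\<close> and K = 0 a pure power. Reflections play the
  part of a Harnack inequality, and the identity for the integral of x . grad g + N g that of polar
  coordinates.\<close>

definition vflux :: "real \<Rightarrow> 'a::euclidean_space \<Rightarrow> 'a"
 where "vflux p g = norm g powr (p - 2) *\<^sub>R g"

text \<open>C^1 is the right class because the functions tested with are built from solutions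
  (squares of positive parts, truncations) and are no smoother than these. The passage from smooth
  test functions is a mollification near the end.\<close>

definition c1c :: "'a::euclidean_space set \<Rightarrow> ('a \<Rightarrow> real) \<Rightarrow> bool"
 where "c1c U \<phi> \<longleftrightarrow> C1_on UNIV \<phi> \<and> (\<exists>K. compact K \<and> K \<subseteq> U \<and> (\<forall>x. x \<notin> K \<longrightarrow> \<phi> x = 0))"

text \<open>Weak solutions of \<open>- \<Delta>\<^sub>p u + a |\<nabla>u|\<^sup>q = 0\<close>, tested with \<open>C\<^sup>1\<close> functions. The factor \<open>a\<close> keeps track of
 multiples: if \<open>u\<close> is a solution for \<open>a\<close>, then \<open>l u\<close> is one for \<open>a l\<^bsup>p-1-q\<^esup>\<close>, and \<open>- u\<close> is one for \<open>- a\<close>.\<close>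

definition wsol :: "real \<Rightarrow> real \<Rightarrow> real \<Rightarrow> 'a::euclidean_space set \<Rightarrow> ('a \<Rightarrow> real) \<Rightarrow> bool"
 where "wsol p q a U u \<longleftrightarrow> C1_on U u \<and>
  (\<forall>\<phi>. c1c U \<phi> \<longrightarrow>
   (LINT x|lborel. vflux p (grad u x) \<bullet> grad \<phi> x + a * norm (grad u x) powr q * \<phi> x) = 0)"

lemma norm_vflux: "norm (vflux p g) = norm g powr (p - 1)"
proof (cases "g = 0")
 case False
 then have "norm g powr (p - 1) = norm g powr (p - 2) * norm g"
  using powr_add[of "norm g" "p - 2" 1] by simp
 then show ?thesis by (simp add: vflux_def)
qed (simp add: vflux_def)

lemma vflux_0 [simp]: "vflux p 0 = 0"
 by (simp add: vflux_def)

lemma vflux_scaleR: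
 assumes "0 \<le> c" shows "vflux p (c *\<^sub>R g) = c powr (p - 1) *\<^sub>R vflux p g"
proof (cases "c = 0")
 case False
 then have c: "c > 0" using assms by simp
 then have "c powr (p - 2) * c = c powr (p - 1)"
  using powr_add[of c "p - 2" 1] by simp
 then show ?thesis using c by (simp add: vflux_def powr_mult mult.commute mult.left_commute)
qed simp

lemma vflux_minus: "vflux p (- g) = - vflux p g"
 by (simp add: vflux_def)

lemma inner_vflux_self: "vflux p g \<bullet> g = norm g powr p"
proof (cases "g = 0")
 case False
 then have "norm g powr (p - 2) * norm g powr 2 = norm g powr p"
  by (simp add: powr_add[symmetric] del: powr_numeral)
 then show ?thesis using False by (simp add: vflux_def dot_square_norm)
qed simp

lemma continuous_on_vflux:
 assumes "1 < p" shows "continuous_on S (vflux p)"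
proof -
 have "isCont (vflux p) g" for g :: 'a
 proof (cases "g = 0")
  case True
  \<comment> \<open>For p < 2 the scalar factor is unbounded near 0; only the norm of the product,
    of degree p-1 > 0, tends to 0.\<close>
  have "((\<lambda>h::'a. norm h powr (p - 1)) \<longlongrightarrow> 0) (at 0)"
   by (rule tendsto_zero_powrI) (use assms in \<open>auto intro!: tendsto_norm_zero tendsto_eq_intros\<close>)
  then have "(vflux p \<longlongrightarrow> 0) (at (0::'a))"
   by (rule Lim_null_comparison[rotated]) (simp add: norm_vflux)
  then show ?thesis using True by (simp add: isCont_def)
 next
  case False
  then show ?thesis unfolding vflux_def by (intro continuous_intros) auto
 qed
 then show ?thesis by (simp add: continuous_at_imp_continuous_on)
qed

text \<open>By Cauchy-Schwarz the inner product is at least (|\<alpha>|^(p-1) - |\<beta>|^(p-1))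
  (|\<alpha>| - |\<beta>|), a product of two factors of the same sign.\<close>

lemma vflux_monotone:
 fixes \<alpha> \<beta> :: "'a::euclidean_space"
 assumes "1 < p" shows "0 \<le> (vflux p \<alpha> - vflux p \<beta>) \<bullet> (\<alpha> - \<beta>)"
proof -
 have a: "vflux p \<alpha> \<bullet> \<beta> \<le> norm \<alpha> powr (p - 1) * norm \<beta>" for \<alpha> \<beta> :: 'a
  using norm_cauchy_schwarz[of "vflux p \<alpha>" \<beta>] by (simp add: norm_vflux)
 have b: "norm \<alpha> powr p = norm \<alpha> powr (p - 1) * norm \<alpha>" for \<alpha> :: 'a
  using powr_add[of "norm \<alpha>" "p - 1" 1] by simp
 have "0 \<le> (norm \<alpha> powr (p - 1) - norm \<beta> powr (p - 1)) * (norm \<alpha> - norm \<beta>)"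
 proof (cases "norm \<alpha> \<le> norm \<beta>")
  case True then show ?thesis using assms by (intro mult_nonpos_nonpos) (auto intro: powr_mono2)
 next
  case False then show ?thesis using assms by (intro mult_nonneg_nonneg) (auto intro: powr_mono2)
 qed
 then show ?thesis
  using a[of \<alpha> \<beta>] a[of \<beta> \<alpha>]
  by (simp add: inner_diff_left inner_diff_right inner_vflux_self b algebra_simps)
qed

section \<open>Calculus of the pointwise gradient and of C^1 functions\<close>

lemma GDERIV_grad:
 assumes "u differentiable (at x)" shows "GDERIV u x :> grad u x"
proof -
 obtain D where D: "(u has_derivative D) (at x)" using assms by (auto simp: differentiable_def)
 then have "linear D" by (rule has_derivative_linear)
 have "D = (\<lambda>h. h \<bullet> (\<Sum>b\<in>Basis. D b *\<^sub>R b))"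
 proof
  fix h
  have "D h = D (\<Sum>b\<in>Basis. (h \<bullet> b) *\<^sub>R b)" by (simp add: euclidean_representation)
  also have "\<dots> = (\<Sum>b\<in>Basis. (h \<bullet> b) *\<^sub>R D b)"
   using \<open>linear D\<close> by (simp add: linear_sum linear_scale)
  finally show "D h = h \<bullet> (\<Sum>b\<in>Basis. D b *\<^sub>R b)"
   by (simp add: inner_sum_right mult.commute)
 qed
 then have "GDERIV u x :> (\<Sum>b\<in>Basis. D b *\<^sub>R b)" unfolding gderiv_def using D by simp
 then show ?thesis using grad_eqI by metis
qed

lemma GDERIV_differentiable: "GDERIV u x :> D \<Longrightarrow> u differentiable (at x)"
 by (auto simp: gderiv_def differentiable_def)

lemma C1_onI:
 assumes "\<And>x. x \<in> U \<Longrightarrow> GDERIV u x :> D x" "continuous_on U D"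
 shows "C1_on U u"
proof -
 have "continuous_on U (grad u)"
  using assms grad_eqI by (metis (mono_tags, lifting) continuous_on_cong)
 then show ?thesis unfolding C1_on_def using assms(1) GDERIV_differentiable by blast
qed

lemma C1_onD:
 assumes "C1_on U u"
 shows "x \<in> U \<Longrightarrow> GDERIV u x :> grad u x" "continuous_on U (grad u)"
 using assms GDERIV_grad by (auto simp: C1_on_def)

lemma C1_on_subset: "C1_on U u \<Longrightarrow> V \<subseteq> U \<Longrightarrow> C1_on V u"
 by (auto simp: C1_on_def intro: continuous_on_subset)

lemma C1_on_isCont: "C1_on U u \<Longrightarrow> x \<in> U \<Longrightarrow> isCont u x"
 by (auto simp: C1_on_def intro: differentiable_imp_continuous_within)

lemma C1_on_continuous_on: "C1_on U u \<Longrightarrow> continuous_on U u"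
 by (simp add: C1_on_isCont continuous_at_imp_continuous_on)

lemma GDERIV_local:
 assumes "open U" "x \<in> U" "\<And>y. y \<in> U \<Longrightarrow> u y = v y" "GDERIV u x :> D"
 shows "GDERIV v x :> D"
 using assms unfolding gderiv_def by (blast intro: has_derivative_transform_within_open)

lemma grad_local:
 assumes "open U" "x \<in> U" "\<And>y. y \<in> U \<Longrightarrow> u y = v y"
 shows "grad u x = grad v x"
 unfolding grad_def using GDERIV_local[OF assms(1,2), of u v] GDERIV_local[OF assms(1,2), of v u] assms(3)
 by (intro arg_cong[where f=The] ext) (metis (no_types, lifting))

lemma C1_on_cong:
 assumes "open U" "\<And>y. y \<in> U \<Longrightarrow> u y = v y" "C1_on U u"
 shows "C1_on U v"
 using assms C1_onD[OF assms(3)] by (intro C1_onI[where D="grad u"]) (auto intro: GDERIV_local)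

lemma C1_on_const: "C1_on U (\<lambda>_. c)"
 by (rule C1_onI[where D="\<lambda>_. 0"]) (auto intro: GDERIV_const)

lemma grad_const [simp]: "grad (\<lambda>_. c) x = 0"
 by (intro grad_eqI GDERIV_const)

lemma grad_diff:
 assumes "u differentiable (at x)" "v differentiable (at x)"
 shows "grad (\<lambda>x. u x - v x) x = grad u x - grad v x"
 by (intro grad_eqI GDERIV_diff GDERIV_grad assms)

lemma grad_mult:
 assumes "u differentiable (at x)" "v differentiable (at x)"
 shows "grad (\<lambda>x. u x * v x) x = u x *\<^sub>R grad v x + v x *\<^sub>R grad u x"
 by (intro grad_eqI GDERIV_mult GDERIV_grad assms)

lemma grad_cmult:
 assumes "u differentiable (at x)"
 shows "grad (\<lambda>x. c * u x) x = c *\<^sub>R grad u x"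
 using grad_mult[OF differentiable_const assms, of c] by simp

lemma grad_compose:
 assumes "u differentiable (at x)" "DERIV h (u x) :> d"
 shows "grad (\<lambda>x. h (u x)) x = d *\<^sub>R grad u x"
 by (intro grad_eqI GDERIV_DERIV_compose GDERIV_grad assms)

text \<open>Both gradients are definite descriptions of equivalent predicates, so the identity holds
  at every point, differentiable or not.\<close>

lemma grad_add_const: "grad (\<lambda>x. u x + c) x = grad u x"
proof -
 have "GDERIV (\<lambda>x. u x + c) x :> D \<longleftrightarrow> GDERIV u x :> D" for D
  using GDERIV_add[OF _ GDERIV_const[of c], of u x D]
   GDERIV_diff[OF _ GDERIV_const[of c], of "\<lambda>x. u x + c" x D] by auto
 then show ?thesis by (simp add: grad_def)
qed

lemma C1_on_differentiable: "C1_on U u \<Longrightarrow> x \<in> U \<Longrightarrow> u differentiable (at x)"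
 by (simp add: C1_on_def)

lemma C1_on_add:
 assumes "C1_on U u" "C1_on U v" shows "C1_on U (\<lambda>x. u x + v x)"
 by (rule C1_onI[where D="\<lambda>x. grad u x + grad v x"])
   (auto intro!: GDERIV_add C1_onD[OF assms(1)] C1_onD[OF assms(2)] continuous_intros)

lemma C1_on_diff:
 assumes "C1_on U u" "C1_on U v" shows "C1_on U (\<lambda>x. u x - v x)"
 by (rule C1_onI[where D="\<lambda>x. grad u x - grad v x"])
   (auto intro!: GDERIV_diff C1_onD[OF assms(1)] C1_onD[OF assms(2)] continuous_intros)

lemma C1_on_mult:
 assumes "C1_on U u" "C1_on U v" shows "C1_on U (\<lambda>x. u x * v x)"
 by (rule C1_onI[where D="\<lambda>x. u x *\<^sub>R grad v x + v x *\<^sub>R grad u x"])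
   (auto intro!: GDERIV_mult C1_onD[OF assms(1)] C1_onD[OF assms(2)] continuous_intros
    C1_on_continuous_on assms)

lemma C1_on_cmult: "C1_on U u \<Longrightarrow> C1_on U (\<lambda>x. c * u x)"
 by (rule C1_on_mult[OF C1_on_const])

lemma C1_on_compose:
 assumes "C1_on U u" "\<And>x. x \<in> U \<Longrightarrow> DERIV h (u x) :> h' (u x)" "continuous_on (u ` U) h'"
 shows "C1_on U (\<lambda>x. h (u x))"
proof (rule C1_onI[where D="\<lambda>x. h' (u x) *\<^sub>R grad u x"])
 show "GDERIV (\<lambda>x. h (u x)) x :> h' (u x) *\<^sub>R grad u x" if "x \<in> U" for x
  using GDERIV_DERIV_compose[OF C1_onD(1)[OF assms(1) that] assms(2)[OF that]] .
 have "continuous_on U (\<lambda>x. h' (u x))"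
  by (rule continuous_on_compose2[OF assms(3) C1_on_continuous_on[OF assms(1)]]) auto
 then show "continuous_on U (\<lambda>x. h' (u x) *\<^sub>R grad u x)"
  by (intro continuous_intros C1_onD(2)[OF assms(1)])
qed

lemma C1_on_power:
 assumes "C1_on U u" shows "C1_on U (\<lambda>x. u x ^ n)"
 by (rule C1_on_compose[OF assms, where h'="\<lambda>t. n * t ^ (n - 1)"])
   (auto intro!: derivative_eq_intros continuous_intros)

section \<open>Test functions, weak solutions and their scaling\<close>

text \<open>The open sets V and -K cover the space, and on -K the function is constantly 0; C^1
  regularity is local.\<close>

lemma c1c_I:
 assumes "open V" "C1_on V \<phi>" "compact K" "K \<subseteq> V" "K \<subseteq> U" "\<And>x. x \<notin> K \<Longrightarrow> \<phi> x = 0"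
 shows "c1c U \<phi>"
proof -
 have K: "open (- K)" using assms(3) by (simp add: compact_imp_closed open_Compl)
 have C: "C1_on (- K) \<phi>"
  by (rule C1_on_cong[OF K _ C1_on_const[of _ 0]]) (simp add: assms(6))
 have "C1_on (V \<union> - K) \<phi>"
  using assms(2) C unfolding C1_on_def
  by (auto intro: continuous_on_open_Un[OF \<open>open V\<close> K])
 moreover have "V \<union> - K = UNIV" using assms(4) by auto
 ultimately show ?thesis unfolding c1c_def using assms by auto
qed

lemma c1c_C1: "c1c U \<phi> \<Longrightarrow> C1_on V \<phi>"
 by (auto simp: c1c_def intro: C1_on_subset)

lemma c1c_mono: "c1c U \<phi> \<Longrightarrow> U \<subseteq> V \<Longrightarrow> c1c V \<phi>"
 by (auto simp: c1c_def)

lemma c1c_E: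
 assumes "c1c U \<phi>"
 obtains K where "compact K" "K \<subseteq> U" "\<And>x. x \<notin> K \<Longrightarrow> \<phi> x = 0" "\<And>x. x \<notin> K \<Longrightarrow> grad \<phi> x = 0"
  "C1_on UNIV \<phi>" "continuous_on UNIV (grad \<phi>)" "continuous_on UNIV \<phi>"
proof -
 obtain K where K: "compact K" "K \<subseteq> U" "\<And>x. x \<notin> K \<Longrightarrow> \<phi> x = 0" and C: "C1_on UNIV \<phi>"
  using assms by (auto simp: c1c_def)
 have "grad \<phi> x = 0" if "x \<notin> K" for x
  using grad_local[of "- K" x \<phi> "\<lambda>_. 0"] that K
  by (simp add: compact_imp_closed open_Compl)
 then show ?thesis using that K C C1_onD[OF C] C1_on_continuous_on[OF C] by blast
qed

lemma integrable_compact_support: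
 fixes f :: "'a::euclidean_space \<Rightarrow> 'b::euclidean_space"
 assumes "compact K" "continuous_on K f" "\<And>x. x \<notin> K \<Longrightarrow> f x = 0"
 shows "integrable lborel f"
proof -
 have "(\<lambda>x. indicator K x *\<^sub>R f x) = f" using assms(3) by (auto simp: indicator_def)
 then show ?thesis using borel_integrable_compact[OF assms(1,2)] by simp
qed

lemma continuous_on_norm_powr:
 assumes "0 < q" "continuous_on S f" shows "continuous_on S (\<lambda>x. norm (f x) powr q)"
 by (rule continuous_on_powr') (use assms in \<open>auto intro!: continuous_intros\<close>)

lemma continuous_on_vflux_compose:
 assumes "1 < p" "continuous_on S f" shows "continuous_on S (\<lambda>x. vflux p (f x))"
 by (rule continuous_on_compose2[OF continuous_on_vflux[OF assms(1)] assms(2)]) auto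

lemma wsol_integrable:
 assumes "C1_on U u" "c1c U \<phi>" "1 < p" "0 < q"
 shows "integrable lborel (\<lambda>x. vflux p (grad u x) \<bullet> grad \<phi> x)"
  "integrable lborel (\<lambda>x. norm (grad u x) powr q * \<phi> x)"
proof -
 obtain K where K: "compact K" "K \<subseteq> U" "\<And>x. x \<notin> K \<Longrightarrow> \<phi> x = 0" "\<And>x. x \<notin> K \<Longrightarrow> grad \<phi> x = 0"
  "C1_on UNIV \<phi>" "continuous_on UNIV (grad \<phi>)" "continuous_on UNIV \<phi>" using c1c_E[OF assms(2)] by metis
 have c: "continuous_on K (grad u)" using C1_onD(2)[OF assms(1)] K(2) continuous_on_subset by blast
 have c1: "continuous_on K (grad \<phi>)" "continuous_on K \<phi>"
  using K(6,7) continuous_on_subset by blast+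
 show "integrable lborel (\<lambda>x. vflux p (grad u x) \<bullet> grad \<phi> x)"
  by (rule integrable_compact_support[OF K(1)])
    (auto intro!: continuous_intros continuous_on_vflux_compose c c1 assms simp: K)
 show "integrable lborel (\<lambda>x. norm (grad u x) powr q * \<phi> x)"
  by (rule integrable_compact_support[OF K(1)])
    (auto intro!: continuous_on_mult continuous_on_norm_powr c c1 assms simp: K)
qed

lemma wsol_subset: "wsol p q a U u \<Longrightarrow> V \<subseteq> U \<Longrightarrow> wsol p q a V u"
 unfolding wsol_def using C1_on_subset c1c_mono by blast

lemma wsol_C1: "wsol p q a U u \<Longrightarrow> C1_on U u"
 by (simp add: wsol_def)

lemma wsolD:
 assumes "wsol p q a U u" "c1c U \<phi>" "1 < p" "0 < q"
 shows "(LINT x|lborel. vflux p (grad u x) \<bullet> grad \<phi> x)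
  + a * (LINT x|lborel. norm (grad u x) powr q * \<phi> x) = 0"
proof -
 note i = wsol_integrable[OF wsol_C1[OF assms(1)] assms(2-4)]
 have "(LINT x|lborel. vflux p (grad u x) \<bullet> grad \<phi> x + a * (norm (grad u x) powr q * \<phi> x)) = 0"
  using assms by (simp add: wsol_def mult.assoc)
 then show ?thesis using i by simp
qed

lemma wsol_cong:
 assumes "open U" "\<And>y. y \<in> U \<Longrightarrow> u y = v y" "wsol p q a U u"
 shows "wsol p q a U v"
proof -
 have g: "grad u x = grad v x" if "x \<in> U" for x using grad_local assms that by metis
 have "(\<lambda>x. vflux p (grad u x) \<bullet> grad \<phi> x + a * norm (grad u x) powr q * \<phi> x)
   = (\<lambda>x. vflux p (grad v x) \<bullet> grad \<phi> x + a * norm (grad v x) powr q * \<phi> x)" if phi: "c1c U \<phi>" for \<phi>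
 proof
  fix x
  obtain K where K: "compact K" "K \<subseteq> U" "\<And>x. x \<notin> K \<Longrightarrow> \<phi> x = 0" "\<And>x. x \<notin> K \<Longrightarrow> grad \<phi> x = 0"
   using c1c_E[OF phi] by metis
  show "vflux p (grad u x) \<bullet> grad \<phi> x + a * norm (grad u x) powr q * \<phi> x
   = vflux p (grad v x) \<bullet> grad \<phi> x + a * norm (grad v x) powr q * \<phi> x"
   using K g[of x] by (cases "x \<in> K") auto
 qed
 then show ?thesis using assms C1_on_cong[OF assms(1,2)] by (simp add: wsol_def)
qed

lemma wsol_add_const: "wsol p q a U u \<Longrightarrow> wsol p q a U (\<lambda>x. u x + c)"
 using C1_on_add[OF _ C1_on_const] by (auto simp: wsol_def grad_add_const)

lemma wsol_scale:
 assumes "wsol p q a U u" "0 < l" "1 < p" "0 < q"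
 shows "wsol p q (a * l powr (p - 1 - q)) U (\<lambda>x. l * u x)"
 unfolding wsol_def
proof (intro conjI allI impI)
 note C = wsol_C1[OF assms(1)]
 show "C1_on U (\<lambda>x. l * u x)" using C by (rule C1_on_cmult)
 fix \<phi> :: "'a \<Rightarrow> real" assume phi: "c1c U \<phi>"
 obtain K where K: "compact K" "K \<subseteq> U" "\<And>x. x \<notin> K \<Longrightarrow> \<phi> x = 0" "\<And>x. x \<notin> K \<Longrightarrow> grad \<phi> x = 0"
  using c1c_E[OF phi] by metis
 have "(\<lambda>x. vflux p (grad (\<lambda>x. l * u x) x) \<bullet> grad \<phi> x
   + a * l powr (p - 1 - q) * norm (grad (\<lambda>x. l * u x) x) powr q * \<phi> x)
  = (\<lambda>x. l powr (p - 1) * (vflux p (grad u x) \<bullet> grad \<phi> x + a * norm (grad u x) powr q * \<phi> x))"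
 proof
  fix x
  have "l powr (p - 1 - q) * l powr q = l powr (p - 1)" by (simp add: powr_add[symmetric])
  moreover have "grad (\<lambda>x. l * u x) x = l *\<^sub>R grad u x" if "x \<in> K"
   using C1_on_differentiable[OF C] that K by (intro grad_cmult) auto
  ultimately show "vflux p (grad (\<lambda>x. l * u x) x) \<bullet> grad \<phi> x
   + a * l powr (p - 1 - q) * norm (grad (\<lambda>x. l * u x) x) powr q * \<phi> x
   = l powr (p - 1) * (vflux p (grad u x) \<bullet> grad \<phi> x + a * norm (grad u x) powr q * \<phi> x)"
   using K assms(2) by (cases "x \<in> K")
    (auto simp: vflux_scaleR powr_mult algebra_simps)
 qed
 then show "(LINT x|lborel. vflux p (grad (\<lambda>x. l * u x) x) \<bullet> grad \<phi> x
   + a * l powr (p - 1 - q) * norm (grad (\<lambda>x. l * u x) x) powr q * \<phi> x) = 0"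
  using assms(1) phi by (simp add: wsol_def)
qed

section \<open>Isometries and Lebesgue measure\<close>

lemma nn_integral_lborel_translate:
 fixes f :: "'a::euclidean_space \<Rightarrow> ennreal"
 assumes [measurable]: "f \<in> borel_measurable borel"
 shows "(\<integral>\<^sup>+x. f (x + c) \<partial>lborel) = (\<integral>\<^sup>+x. f x \<partial>lborel)"
proof -
 have "(\<integral>\<^sup>+x. f x \<partial>lborel) = (\<integral>\<^sup>+x. f x \<partial>distr lborel borel ((+) c))"
  by (simp add: lborel_distr_plus)
 also have "\<dots> = (\<integral>\<^sup>+x. f (c + x) \<partial>lborel)" by (subst nn_integral_distr) auto
 finally show ?thesis by (simp add: add.commute)
qed

lemma nn_integral_lborel_scale:
 fixes f :: "'a::euclidean_space \<Rightarrow> ennreal"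
 assumes [measurable]: "f \<in> borel_measurable borel" and "c \<noteq> 0"
 shows "(\<integral>\<^sup>+x. f x \<partial>lborel) = ennreal (\<bar>c\<bar> ^ DIM('a)) * (\<integral>\<^sup>+x. f (c *\<^sub>R x) \<partial>lborel)"
proof -
 have "(\<integral>\<^sup>+x. f x \<partial>lborel)
   = (\<integral>\<^sup>+x. f x \<partial>density (distr lborel borel (\<lambda>x::'a. 0 + c *\<^sub>R x)) (\<lambda>_. \<bar>c\<bar>^DIM('a)))"
  using lborel_affine[OF assms(2), of "0::'a"] by simp
 also have "\<dots> = (\<integral>\<^sup>+x. ennreal (\<bar>c\<bar> ^ DIM('a)) * f (0 + c *\<^sub>R x) \<partial>lborel)"
  by (subst nn_integral_density) (auto simp: nn_integral_distr)
 finally show ?thesis by (simp add: nn_integral_cmult)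
qed

text \<open>The indicator B of the unit ball is invariant under Q. The double integral of f(Q x) B(y
  + Q x) is evaluated in both orders, using only translations and the dilation by -1; it equals the
  left-hand side times |B| and also the right-hand side times |B|. Involutions cover what is needed
  later: reflections, and translations with Q the identity.\<close>

lemma nn_integral_lborel_isometry:
 fixes f :: "'a::euclidean_space \<Rightarrow> ennreal"
 assumes [measurable]: "f \<in> borel_measurable borel"
  and Q: "linear Q" "\<And>x. norm (Q x) = norm x" "\<And>x. Q (Q x) = x"
 shows "(\<integral>\<^sup>+x. f (Q x) \<partial>lborel) = (\<integral>\<^sup>+x. f x \<partial>lborel)"
proof -
 define B :: "'a \<Rightarrow> ennreal" where "B = indicator (ball 0 1)"
 have [measurable]: "B \<in> borel_measurable borel"
  unfolding B_def by (rule borel_measurable_indicator) auto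
 have [measurable]: "Q \<in> borel_measurable borel"
  using Q(1) by (intro borel_measurable_continuous_onI linear_continuous_on) (simp add: linear_conv_bounded_linear)
 have QB: "B (Q x) = B x" for x by (simp add: B_def indicator_def Q(2))
 have neg: "(\<integral>\<^sup>+y. f (c - y) \<partial>lborel) = (\<integral>\<^sup>+x. f x \<partial>lborel)" for c
 proof -
  have "(\<integral>\<^sup>+y. f (c - y) \<partial>lborel) = (\<integral>\<^sup>+x. f (c - (-1) *\<^sub>R x) \<partial>lborel)"
   using nn_integral_lborel_scale[of "\<lambda>y. f (c - y)" "-1"] by simp
  also have "\<dots> = (\<integral>\<^sup>+x. f x \<partial>lborel)"
   using nn_integral_lborel_translate[of f c] by (simp add: add.commute)
  finally show ?thesis .
 qed
 let ?I = "\<integral>\<^sup>+x. B x \<partial>lborel"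
 have "(\<integral>\<^sup>+x. f (Q x) \<partial>lborel) * ?I = (\<integral>\<^sup>+x. f (Q x) * ?I \<partial>lborel)"
  by (simp add: nn_integral_multc)
 also have "\<dots> = (\<integral>\<^sup>+x. (\<integral>\<^sup>+y. f (Q x) * B (y + Q x) \<partial>lborel) \<partial>lborel)"
  by (simp add: nn_integral_cmult nn_integral_lborel_translate)
 also have "\<dots> = (\<integral>\<^sup>+y. (\<integral>\<^sup>+x. f (Q x) * B (y + Q x) \<partial>lborel) \<partial>lborel)"
  by (rule lborel_pair.Fubini'[symmetric]) measurable
 also have "\<dots> = (\<integral>\<^sup>+y. (\<integral>\<^sup>+x. f (Q x - y) * B (Q x) \<partial>lborel) \<partial>lborel)"
 proof (rule nn_integral_cong)
  fix y
  have e: "Q (x + - Q y) = Q x - y" for x using Q by (simp add: linear_diff)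
  have "(\<integral>\<^sup>+x. f (Q x) * B (y + Q x) \<partial>lborel) = (\<integral>\<^sup>+x. f (Q (x + - Q y)) * B (y + Q (x + - Q y)) \<partial>lborel)"
   by (rule nn_integral_lborel_translate[symmetric]) measurable
  then show "(\<integral>\<^sup>+x. f (Q x) * B (y + Q x) \<partial>lborel) = (\<integral>\<^sup>+x. f (Q x - y) * B (Q x) \<partial>lborel)"
   unfolding e by simp
 qed
 also have "\<dots> = (\<integral>\<^sup>+x. (\<integral>\<^sup>+y. f (Q x - y) * B (Q x) \<partial>lborel) \<partial>lborel)"
  by (rule lborel_pair.Fubini') measurable
 also have "\<dots> = (\<integral>\<^sup>+x. f x \<partial>lborel) * ?I"
  by (simp add: nn_integral_multc neg QB nn_integral_cmult)
 finally have e: "(\<integral>\<^sup>+x. f (Q x) \<partial>lborel) * ?I = (\<integral>\<^sup>+x. f x \<partial>lborel) * ?I" .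
 have "?I = ennreal (unit_ball_vol (DIM('a)))"
  by (simp add: B_def emeasure_ball)
 then have I: "?I \<noteq> 0" "?I \<noteq> \<infinity>"
  using unit_ball_vol_pos[of "real DIM('a)"] by (auto simp: ennreal_eq_0_iff simp del: unit_ball_vol_pos)
 then have "(\<integral>\<^sup>+x. f (Q x) \<partial>lborel) * ?I / ?I = (\<integral>\<^sup>+x. f x \<partial>lborel) * ?I / ?I" by (simp only: e)
 then show ?thesis using I by (simp add: ennreal_mult_divide_eq)
qed

lemma distr_lborel_isometry:
 fixes Q :: "'a::euclidean_space \<Rightarrow> 'a"
 assumes Q: "linear Q" "\<And>x. norm (Q x) = norm x" "\<And>x. Q (Q x) = x"
 shows "distr lborel borel (\<lambda>x. Q x + b) = lborel"
proof (rule measure_eqI)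
 have [measurable]: "Q \<in> borel_measurable borel"
  using Q(1) by (intro borel_measurable_continuous_onI linear_continuous_on) (simp add: linear_conv_bounded_linear)
 fix A assume "A \<in> sets (distr lborel borel (\<lambda>x. Q x + b))"
 then have [measurable]: "A \<in> sets borel" by simp
 have "(\<integral>\<^sup>+x. indicator A x \<partial>distr lborel borel (\<lambda>x. Q x + b)) = (\<integral>\<^sup>+x. indicator A (Q x + b) \<partial>lborel)"
  by (rule nn_integral_distr) measurable
 then have "emeasure (distr lborel borel (\<lambda>x. Q x + b)) A = (\<integral>\<^sup>+x. indicator A (Q x + b) \<partial>lborel)"
  by simp
 also have "\<dots> = emeasure lborel A"
  by (subst nn_integral_lborel_isometry[of "\<lambda>y. indicator A (y + b)" Q])
    (auto simp: Q nn_integral_lborel_translate)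
 finally show "emeasure (distr lborel borel (\<lambda>x. Q x + b)) A = emeasure lborel A" .
qed auto

lemma integral_lborel_isometry:
 fixes f :: "'a::euclidean_space \<Rightarrow> real"
 assumes f: "f \<in> borel_measurable borel"
  and Q: "linear Q" "\<And>x. norm (Q x) = norm x" "\<And>x. Q (Q x) = x"
 shows "(LINT x|lborel. f (Q x + b)) = (LINT x|lborel. f x)"
proof -
 have [measurable]: "Q \<in> borel_measurable borel"
  using Q(1) by (intro borel_measurable_continuous_onI linear_continuous_on) (simp add: linear_conv_bounded_linear)
 have "(LINT x|lborel. f x) = (LINT x|distr lborel borel (\<lambda>x. Q x + b). f x)"
  by (simp add: distr_lborel_isometry[OF Q])
 also have "\<dots> = (LINT x|lborel. f (Q x + b))"
  using f by (subst integral_distr) auto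
 finally show ?thesis by simp
qed

lemma integral_lborel_scale:
 fixes f :: "'a::euclidean_space \<Rightarrow> real"
 assumes f: "f \<in> borel_measurable borel" and "c > 0"
 shows "(LINT x|lborel. f (c *\<^sub>R x)) = (LINT x|lborel. f x) / c ^ DIM('a)"
proof -
 have "(LINT x|lborel. f x)
   = (LINT x|density (distr lborel borel (\<lambda>x::'a. 0 + c *\<^sub>R x)) (\<lambda>_. ennreal (\<bar>c\<bar>^DIM('a))). f x)"
  using lborel_affine[of c "0::'a"] assms(2) by simp
 also have "\<dots> = c ^ DIM('a) * (LINT x|lborel. f (c *\<^sub>R x))"
  using assms by (subst integral_density) (auto simp: integral_distr)
 finally show ?thesis using assms(2) by simp
qed

section \<open>Weak solutions under isometries\<close>

lemma GDERIV_isometry: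
 fixes u :: "'a::euclidean_space \<Rightarrow> real"
 assumes Q: "linear Q" "\<And>x. norm (Q x) = norm x" "\<And>x. Q (Q x) = x"
  and u: "GDERIV u (Q x + b) :> D"
 shows "GDERIV (\<lambda>x. u (Q x + b)) x :> Q D"
proof -
 have bl: "bounded_linear Q" using Q(1) by (simp add: linear_conv_bounded_linear)
 have ot: "orthogonal_transformation Q" using Q by (simp add: orthogonal_transformation)
 have "((\<lambda>x. Q x + b) has_derivative Q) (at x)"
  using bounded_linear_imp_has_derivative[OF bl] by (auto intro!: derivative_eq_intros)
 from has_derivative_compose[OF this u[unfolded gderiv_def]]
 have "((\<lambda>x. u (Q x + b)) has_derivative (\<lambda>h. Q h \<bullet> D)) (at x)" .
 \<comment> \<open>An orthogonal involution is its own adjoint.\<close>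
 moreover have "Q h \<bullet> D = h \<bullet> Q D" for h
  using ot Q(3)[of D] by (metis orthogonal_transformation_def)
 ultimately show ?thesis by (simp add: gderiv_def)
qed

lemma C1_on_isometry:
 fixes u :: "'a::euclidean_space \<Rightarrow> real"
 assumes Q: "linear Q" "\<And>x. norm (Q x) = norm x" "\<And>x. Q (Q x) = x"
  and u: "C1_on U u"
 shows "C1_on {x. Q x + b \<in> U} (\<lambda>x. u (Q x + b))"
  "Q x + b \<in> U \<Longrightarrow> grad (\<lambda>x. u (Q x + b)) x = Q (grad u (Q x + b))"
proof -
 have bl: "bounded_linear Q" using Q(1) by (simp add: linear_conv_bounded_linear)
 have g: "GDERIV (\<lambda>x. u (Q x + b)) x :> Q (grad u (Q x + b))" if "Q x + b \<in> U" for x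
  using GDERIV_isometry[OF Q C1_onD(1)[OF u that]] .
 have "continuous_on {x. Q x + b \<in> U} (\<lambda>x. Q (grad u (Q x + b)))"
  by (intro bounded_linear.continuous_on[OF bl] continuous_on_compose2[OF C1_onD(2)[OF u]]
    continuous_intros bounded_linear.continuous_on[OF bl] continuous_on_id) auto
 with g show "C1_on {x. Q x + b \<in> U} (\<lambda>x. u (Q x + b))"
  by (intro C1_onI) auto
 show "Q x + b \<in> U \<Longrightarrow> grad (\<lambda>x. u (Q x + b)) x = Q (grad u (Q x + b))"
  using g by (rule grad_eqI)
qed

lemma wsol_isometry:
 fixes u :: "'a::euclidean_space \<Rightarrow> real"
 assumes Q: "linear Q" "\<And>x. norm (Q x) = norm x" "\<And>x. Q (Q x) = x"
  and u: "wsol p q a U u" and pq: "1 < p" "0 < q"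
 shows "wsol p q a {x. Q x + b \<in> U} (\<lambda>x. u (Q x + b))"
 unfolding wsol_def
proof (intro conjI allI impI)
 let ?T = "\<lambda>x. Q x + b" and ?V = "{x. Q x + b \<in> U}"
 note C = wsol_C1[OF u]
 show "C1_on ?V (\<lambda>x. u (Q x + b))" by (rule C1_on_isometry[OF Q C])
 have bl: "bounded_linear Q" using Q(1) by (simp add: linear_conv_bounded_linear)
 have ot: "orthogonal_transformation Q" using Q by (simp add: orthogonal_transformation)
 fix \<phi> :: "'a \<Rightarrow> real" assume phi: "c1c ?V \<phi>"
 obtain K where K: "compact K" "K \<subseteq> ?V" "\<And>x. x \<notin> K \<Longrightarrow> \<phi> x = 0" "\<And>x. x \<notin> K \<Longrightarrow> grad \<phi> x = 0"
  "C1_on UNIV \<phi>" using c1c_E[OF phi] by metis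
 \<comment> \<open>The pull-back of \<open>\<phi>\<close> by the inverse y -> Q y - Q b of x -> Q x
   + b.\<close>
 define \<psi> where "\<psi> = (\<lambda>y. \<phi> (Q y + - Q b))"
 have ST: "Q (Q x + b) + - Q b = x" for x using Q by (simp add: linear_add)
 have TS: "Q (Q y + - Q b) + b = y" for y using Q by (simp add: linear_diff)
 have "C1_on UNIV \<psi>" using C1_on_isometry(1)[OF Q K(5), of "- Q b"] by (simp add: \<psi>_def)
 moreover have "compact (?T ` K)"
  by (intro compact_continuous_image K(1) continuous_intros bounded_linear.continuous_on[OF bl] continuous_on_id)
 moreover have "\<psi> y = 0" if "y \<notin> ?T ` K" for y
 proof -
  have "Q y + - Q b \<notin> K" using that TS by (metis imageI)
  then show ?thesis using K(3) by (simp add: \<psi>_def)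
 qed
 ultimately have psi: "c1c U \<psi>" unfolding c1c_def using K(2) by (intro conjI exI[of _ "?T ` K"]) auto
 let ?F = "\<lambda>x. vflux p (grad u x) \<bullet> grad \<psi> x + a * norm (grad u x) powr q * \<psi> x"
 have "integrable lborel ?F"
  using wsol_integrable[OF C psi pq] by (auto simp: mult.assoc)
 then have "(LINT x|lborel. ?F (Q x + b)) = (LINT x|lborel. ?F x)"
  by (intro integral_lborel_isometry Q) (use borel_measurable_integrable in auto)
 also have "\<dots> = 0" using u psi by (simp add: wsol_def)
 finally have 1: "(LINT x|lborel. ?F (Q x + b)) = 0" .
 have "?F (Q x + b) = vflux p (grad (\<lambda>x. u (Q x + b)) x) \<bullet> grad \<phi> x
   + a * norm (grad (\<lambda>x. u (Q x + b)) x) powr q * \<phi> x" for x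
 proof -
  have gp: "grad \<psi> (Q x + b) = Q (grad \<phi> x)"
   using C1_on_isometry(2)[OF Q K(5), of "Q x + b" "- Q b"] ST by (simp add: \<psi>_def)
  have pp: "\<psi> (Q x + b) = \<phi> x" using ST by (simp add: \<psi>_def)
  show ?thesis
  proof (cases "x \<in> K")
   case True
   then have g: "grad (\<lambda>x. u (Q x + b)) x = Q (grad u (Q x + b))"
    using K(2) by (intro C1_on_isometry(2)[OF Q C]) auto
   have "vflux p (Q w) = Q (vflux p w)" for w
    using Q by (simp add: vflux_def linear_scale)
   then have "vflux p (Q w) \<bullet> v = vflux p w \<bullet> Q v" for w v
    using ot Q(3)[of v] by (metis orthogonal_transformation_def)
   then show ?thesis using Q(2,3) by (simp add: g gp pp)
  next
   case False
   then show ?thesis using K(3,4) linear_0[OF Q(1)] by (simp add: gp pp)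
  qed
 qed
 then show "(LINT x|lborel. vflux p (grad (\<lambda>x. u (Q x + b)) x) \<bullet> grad \<phi> x
   + a * norm (grad (\<lambda>x. u (Q x + b)) x) powr q * \<phi> x) = 0"
  using 1 by simp
qed

lemma wsol_translate:
 assumes "wsol p q a U u" "1 < p" "0 < q"
 shows "wsol p q a {x. x + b \<in> U} (\<lambda>x. u (x + b))"
 using wsol_isometry[of "\<lambda>x. x" p q a U u b] assms by (simp add: linear_iff)

section \<open>The divergence theorem and a Sobolev inequality\<close>

lemma c1c_lipschitz:
 assumes "c1c U \<phi>"
 obtains M where "0 \<le> M" "\<And>x. norm (grad \<phi> x) \<le> M" "\<And>x y. \<bar>\<phi> x - \<phi> y\<bar> \<le> M * norm (x - y)"
proof -
 obtain K where K: "compact K" "\<And>x. x \<notin> K \<Longrightarrow> grad \<phi> x = 0"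
  "C1_on UNIV \<phi>" "continuous_on UNIV (grad \<phi>)" using c1c_E[OF assms] by metis
 have "bounded (grad \<phi> ` K)"
  using K(1,4) by (intro compact_imp_bounded compact_continuous_image) (auto intro: continuous_on_subset)
 then obtain M where M: "\<And>x. x \<in> K \<Longrightarrow> norm (grad \<phi> x) \<le> M" "0 \<le> M"
  unfolding bounded_pos by (metis imageI less_imp_le)
 have M': "norm (grad \<phi> x) \<le> M" for x using M K(2) by (cases "x \<in> K") auto
 have "norm (\<phi> x - \<phi> y) \<le> M * norm (x - y)" for x y
 proof (rule differentiable_bound[OF convex_UNIV])
  show "(\<phi> has_derivative (\<lambda>h. h \<bullet> grad \<phi> z)) (at z within UNIV)" for z
   using C1_onD(1)[OF K(3), of z] by (simp add: gderiv_def)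
  show "onorm (\<lambda>h. h \<bullet> grad \<phi> z) \<le> M" for z
   by (rule onorm_bound[OF M(2)])
    (metis M' Cauchy_Schwarz_ineq2 mult.commute mult_right_mono norm_ge_zero order_trans real_norm_def)
 qed auto
 then show ?thesis using that M(2) M' by simp
qed

text \<open>The divergence theorem for \<open>g x\<close>, obtained from the behaviour of Lebesgue measure under
 dilations.\<close>

lemma integral_dilation_zero:
 fixes g :: "'a::euclidean_space \<Rightarrow> real"
 assumes "c1c UNIV g"
 shows "(LINT x|lborel. x \<bullet> grad g x + DIM('a) * g x) = 0"
proof -
 obtain K where K: "compact K" "\<And>x. x \<notin> K \<Longrightarrow> g x = 0" "\<And>x. x \<notin> K \<Longrightarrow> grad g x = 0"
  "C1_on UNIV g" "continuous_on UNIV (grad g)" "continuous_on UNIV g" using c1c_E[OF assms] by metis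
 obtain M where M: "0 \<le> M" "\<And>x y. \<bar>g x - g y\<bar> \<le> M * norm (x - y)"
  using c1c_lipschitz[OF assms] by metis
 obtain R where R: "\<And>x. x \<in> K \<Longrightarrow> norm x \<le> R"
  using compact_imp_bounded[OF K(1)] by (auto simp: bounded_iff)
 \<comment> \<open>\<open>f n\<close> is the difference quotient at s = 1 of s -> g(s x). Its
   integral is computed once from the scaling factor s^(-N), with derivative -N, and once by
   dominated convergence.\<close>
 define t :: "nat \<Rightarrow> real" where "t n = 1 + 1 / (n + 1)" for n
 define f where "f n x = (real n + 1) * (g (t n *\<^sub>R x) - g x)" for n x
 have t1: "t n > 1" for n by (simp add: t_def)
 have gint: "integrable lborel g"
  by (rule integrable_compact_support[OF K(1)]) (use K in \<open>auto intro: continuous_on_subset\<close>)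
 have gtint: "integrable lborel (\<lambda>x. g (t n *\<^sub>R x))" for n
 proof (rule integrable_compact_support[OF compact_cball[of 0 R]])
  show "continuous_on (cball 0 R) (\<lambda>x. g (t n *\<^sub>R x))"
   by (intro continuous_on_compose2[OF K(6)] continuous_intros) auto
  fix x :: 'a assume "x \<notin> cball 0 R"
  then have "R < norm x" by simp
  also have "norm x \<le> t n * norm x" using t1[of n] by (simp add: mult_le_cancel_right1)
  finally have "t n *\<^sub>R x \<notin> K" using R[of "t n *\<^sub>R x"] t1[of n] by auto
  then show "g (t n *\<^sub>R x) = 0" by (rule K)
 qed
 have ft: "(LINT x|lborel. f n x) = (real n + 1) * ((1 / t n ^ DIM('a)) - 1) * (LINT x|lborel. g x)" for n
 proof -
  have "(LINT x|lborel. f n x) = (real n + 1) * ((LINT x|lborel. g (t n *\<^sub>R x)) - (LINT x|lborel. g x))"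
   unfolding f_def using gint gtint by simp
  also have "(LINT x|lborel. g (t n *\<^sub>R x)) = (LINT x|lborel. g x) / t n ^ DIM('a)"
   using gint t1[of n] by (intro integral_lborel_scale) (auto dest: borel_measurable_integrable)
  finally show ?thesis by (simp add: algebra_simps)
 qed
 have "((\<lambda>h. ((1 / (1 + h) ^ DIM('a)) - 1) / h) \<longlongrightarrow> - real DIM('a)) (at (0::real))"
 proof -
  have "((\<lambda>s. 1 / s ^ DIM('a)) has_real_derivative - real DIM('a)) (at 1)"
   by (auto intro!: derivative_eq_intros)
  then show ?thesis by (simp add: DERIV_def)
 qed
 moreover have "filterlim (\<lambda>n. 1 / (real n + 1)) (at 0) sequentially"
  by (auto simp: filterlim_at add.commute intro!: LIMSEQ_inverse_real_of_nat[unfolded inverse_eq_divide]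
     filterlim_cong[THEN iffD1, OF refl refl _ LIMSEQ_inverse_real_of_nat] simp: inverse_eq_divide)
 ultimately have "(\<lambda>n. ((1 / (1 + 1 / (real n + 1)) ^ DIM('a)) - 1) / (1 / (real n + 1))) \<longlonglongrightarrow> - real DIM('a)"
  by (rule filterlim_compose)
 then have "(\<lambda>n. (real n + 1) * ((1 / t n ^ DIM('a)) - 1)) \<longlonglongrightarrow> - real DIM('a)"
  by (simp add: t_def mult.commute)
 from tendsto_mult_right[OF this, of "LINT x|lborel. g x"]
 have l1: "(\<lambda>n. LINT x|lborel. f n x) \<longlonglongrightarrow> - real DIM('a) * (LINT x|lborel. g x)"
  unfolding ft .
 have l2: "(\<lambda>n. LINT x|lborel. f n x) \<longlonglongrightarrow> (LINT x|lborel. x \<bullet> grad g x)"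
 proof (rule integral_dominated_convergence[where w="\<lambda>x. M * R * indicator (cball 0 R) x"])
  have 1: "\<And>x. x \<notin> K \<Longrightarrow> x \<bullet> grad g x = 0" using K by simp
  show "(\<lambda>x. x \<bullet> grad g x) \<in> borel_measurable lborel"
   by (rule borel_measurable_integrable, rule integrable_compact_support[OF K(1)])
     (auto intro!: continuous_intros continuous_on_subset[OF K(5)] simp: 1)
  show "f n \<in> borel_measurable lborel" for n
   unfolding f_def using gint gtint by (intro borel_measurable_integrable) auto
  show "integrable lborel (\<lambda>x. M * R * indicator (cball (0::'a) R) x)"
   by (intro integrable_mult_right integrable_real_indicator) (use emeasure_lborel_cball_finite[of "0::'a" R] in auto)
  show "AE x in lborel. (\<lambda>n. f n x) \<longlonglongrightarrow> x \<bullet> grad g x"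
  proof (rule AE_I2)
   fix x :: 'a
   have "(g has_derivative (\<lambda>h. h \<bullet> grad g x)) (at x)"
    using C1_onD(1)[OF K(4), of x] by (simp add: gderiv_def)
   then have "((\<lambda>s::real. g (s *\<^sub>R x)) has_derivative (\<lambda>h. (h *\<^sub>R x) \<bullet> grad g x)) (at 1)"
    by (intro has_derivative_compose[where f="\<lambda>s::real. s *\<^sub>R x" and g=g and s=UNIV, simplified])
      (auto intro!: derivative_eq_intros)
   then have "((\<lambda>s::real. g (s *\<^sub>R x)) has_real_derivative (x \<bullet> grad g x)) (at 1)"
    by (simp add: has_field_derivative_def mult_commute_abs)
   then have "((\<lambda>h. (g ((1 + h) *\<^sub>R x) - g x) / h) \<longlongrightarrow> x \<bullet> grad g x) (at 0)"
    by (simp add: DERIV_def)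
   moreover have "filterlim (\<lambda>n. 1 / (real n + 1)) (at 0) sequentially"
    by fact
   ultimately have "(\<lambda>n. (g ((1 + 1 / (real n + 1)) *\<^sub>R x) - g x) / (1 / (real n + 1))) \<longlonglongrightarrow> x \<bullet> grad g x"
    by (rule filterlim_compose)
   then show "(\<lambda>n. f n x) \<longlonglongrightarrow> x \<bullet> grad g x"
    by (simp add: f_def t_def mult.commute)
  qed
  show "AE x in lborel. norm (f n x) \<le> M * R * indicator (cball 0 R) x" for n
  proof (rule AE_I2)
   fix x :: 'a
   show "norm (f n x) \<le> M * R * indicator (cball 0 R) x"
   proof (cases "norm x \<le> R")
    case True
    have "\<bar>g (t n *\<^sub>R x) - g x\<bar> \<le> M * norm (t n *\<^sub>R x - x)" by (rule M)
    also have "t n *\<^sub>R x - x = (1 / (real n + 1)) *\<^sub>R x" by (simp add: t_def algebra_simps)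
    finally have "(real n + 1) * \<bar>g (t n *\<^sub>R x) - g x\<bar> \<le> M * norm x"
     by (simp add: field_simps)
    also have "\<dots> \<le> M * R" using True M by (simp add: mult_left_mono)
    finally show ?thesis using True by (simp add: f_def abs_mult)
   next
    case False
    have "norm x \<le> t n * norm x" using t1[of n] by (simp add: mult_le_cancel_right1)
    then have "t n *\<^sub>R x \<notin> K" "x \<notin> K" using R[of "t n *\<^sub>R x"] R[of x] t1[of n] False by auto
    then show ?thesis using K False by (simp add: f_def)
   qed
  qed
 qed
 have 1: "integrable lborel (\<lambda>x. x \<bullet> grad g x)"
  by (rule integrable_compact_support[OF K(1)])
    (auto intro!: continuous_intros continuous_on_subset[OF K(5)] simp: K)
 have "(LINT x|lborel. x \<bullet> grad g x) = - real DIM('a) * (LINT x|lborel. g x)"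
  using LIMSEQ_unique[OF l2 l1] .
 then show ?thesis using 1 gint by simp
qed

text \<open>Compare \<open>\<psi>\<close> with its translates by h in the ball B of radius \<rho>:
  |\<psi>(x)| is at most |\<psi>(x) - \<psi>(x+h)| plus 1_E(x) |\<psi>(x+h)|, where E is the set
  where \<psi> is nonzero. Integrating over x and h gives |B| I <= |B| \<rho> G + |E| I, and |E| <=
  |B|/2 absorbs the last term. The gain of a factor \<rho>, of the order of |E|^(1/N), is what
  drives the De Giorgi iteration.\<close>

lemma sobolev_small_support:
 fixes \<psi> :: "'a::euclidean_space \<Rightarrow> real"
 assumes c: "c1c UNIV \<psi>" and P: "measure lborel {x. \<psi> x \<noteq> 0} \<le> P"
  and rho: "0 < \<rho>" "2 * P \<le> measure lborel (ball (0::'a) \<rho>)"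
 shows "(LINT x|lborel. \<bar>\<psi> x\<bar>) \<le> 2 * \<rho> * (LINT x|lborel. norm (grad \<psi> x))"
proof -
 obtain K where K: "compact K" "\<And>x. x \<notin> K \<Longrightarrow> \<psi> x = 0" "\<And>x. x \<notin> K \<Longrightarrow> grad \<psi> x = 0"
  "C1_on UNIV \<psi>" "continuous_on UNIV (grad \<psi>)" "continuous_on UNIV \<psi>" using c1c_E[OF c] by metis
 have m[measurable]: "\<psi> \<in> borel_measurable borel" "grad \<psi> \<in> borel_measurable borel"
  using K by (auto intro: borel_measurable_continuous_onI)
 define E where "E = {x. \<psi> x \<noteq> 0}"
 define B where "B = ball (0::'a) \<rho>"
 have [measurable]: "E \<in> sets borel" "B \<in> sets borel" unfolding E_def B_def by measurable
 have i1: "integrable lborel (\<lambda>x. \<bar>\<psi> x\<bar>)"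
  by (rule integrable_compact_support[OF K(1)])
    (use K in \<open>auto intro!: continuous_intros intro: continuous_on_subset\<close>)
 have i2: "integrable lborel (\<lambda>x. norm (grad \<psi> x))"
  by (rule integrable_compact_support[OF K(1)])
    (use K in \<open>auto intro!: continuous_intros intro: continuous_on_subset\<close>)
 define I where "I = (LINT x|lborel. \<bar>\<psi> x\<bar>)"
 define G where "G = (LINT x|lborel. norm (grad \<psi> x))"
 have I: "(\<integral>\<^sup>+x. ennreal \<bar>\<psi> x\<bar> \<partial>lborel) = ennreal I"
  unfolding I_def using i1 by (intro nn_integral_eq_integral) auto
 have G: "(\<integral>\<^sup>+x. ennreal (norm (grad \<psi> x)) \<partial>lborel) = ennreal G"
  unfolding G_def using i2 by (intro nn_integral_eq_integral) auto
 have IG: "0 \<le> I" "0 \<le> G" by (auto simp: I_def G_def)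
 have "E \<subseteq> K" using K by (auto simp: E_def)
 then have "emeasure lborel E < \<infinity>"
  using emeasure_mono[of E K lborel] K(1) emeasure_compact_finite[OF K(1)]
  by (auto simp: compact_imp_closed borel_compact)
 then have eE: "emeasure lborel E = ennreal (measure lborel E)"
  by (simp add: emeasure_eq_ennreal_measure less_top)
 have eB: "emeasure lborel B = ennreal (measure lborel B)"
  unfolding B_def using emeasure_lborel_ball_finite[of "0::'a" \<rho>]
  by (simp add: emeasure_eq_ennreal_measure less_top)
 have shift: "(\<integral>\<^sup>+x. ennreal \<bar>\<psi> x - \<psi> (x + h)\<bar> \<partial>lborel) \<le> ennreal (\<rho> * G)" if h: "norm h \<le> \<rho>" for h
 proof -
  have pw: "ennreal \<bar>\<psi> x - \<psi> (x + h)\<bar>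
    \<le> ennreal \<rho> * (\<integral>\<^sup>+t. indicator {0..1} t * ennreal (norm (grad \<psi> (x + t *\<^sub>R h))) \<partial>lborel)" for x
  proof -
   have d: "((\<lambda>t. \<psi> (x + t *\<^sub>R h)) has_vector_derivative (h \<bullet> grad \<psi> (x + t *\<^sub>R h))) (at t within {0..1})" for t
   proof -
    have "(\<psi> has_derivative (\<lambda>k. k \<bullet> grad \<psi> (x + t *\<^sub>R h))) (at (x + t *\<^sub>R h))"
     using C1_onD(1)[OF K(4)] by (simp add: gderiv_def)
    then have "((\<lambda>t. \<psi> (x + t *\<^sub>R h)) has_derivative (\<lambda>s. (s *\<^sub>R h) \<bullet> grad \<psi> (x + t *\<^sub>R h))) (at t within {0..1})"
     by (rule has_derivative_compose[rotated]) (auto intro!: derivative_eq_intros)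
    then show ?thesis by (simp add: has_vector_derivative_def)
   qed
   have ci: "continuous_on {0..1} (\<lambda>t. h \<bullet> grad \<psi> (x + t *\<^sub>R h))"
    by (intro continuous_intros continuous_on_compose2[OF K(5)]) auto
   have cn: "continuous_on {0..1} (\<lambda>t. norm (grad \<psi> (x + t *\<^sub>R h)))"
    by (intro continuous_intros continuous_on_compose2[OF K(5)]) auto
   have e: "(LINT t|lborel. indicator {0..1} t *\<^sub>R (h \<bullet> grad \<psi> (x + t *\<^sub>R h))) = \<psi> (x + h) - \<psi> x"
    using integral_FTC_atLeastAtMost[of 0 1 "\<lambda>t. \<psi> (x + t *\<^sub>R h)", OF _ d ci] by simp
   have in1: "integrable lborel (\<lambda>t. indicator {0..1} t *\<^sub>R norm (grad \<psi> (x + t *\<^sub>R h)))"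
    by (rule borel_integrable_compact[OF _ cn]) auto
   have in2: "integrable lborel (\<lambda>t. indicator {0..1} t *\<^sub>R (h \<bullet> grad \<psi> (x + t *\<^sub>R h)))"
    by (rule borel_integrable_compact[OF _ ci]) auto
   have "\<bar>\<psi> x - \<psi> (x + h)\<bar> \<le> (LINT t|lborel. \<bar>indicator {0..1} t *\<^sub>R (h \<bullet> grad \<psi> (x + t *\<^sub>R h))\<bar>)"
    using integral_norm_bound[of lborel "\<lambda>t. indicator {0..1} t *\<^sub>R (h \<bullet> grad \<psi> (x + t *\<^sub>R h))"]
    unfolding e by (simp only: real_norm_def abs_minus_commute)
   also have "\<dots> \<le> (LINT t|lborel. \<rho> * (indicator {0..1} t *\<^sub>R norm (grad \<psi> (x + t *\<^sub>R h))))"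
   proof (rule integral_mono)
    show "\<bar>indicator {0..1} t *\<^sub>R (h \<bullet> grad \<psi> (x + t *\<^sub>R h))\<bar>
     \<le> \<rho> * (indicator {0..1} t *\<^sub>R norm (grad \<psi> (x + t *\<^sub>R h)))" for t :: real
     using Cauchy_Schwarz_ineq2[of h "grad \<psi> (x + t *\<^sub>R h)"] h
      mult_right_mono[OF h, of "norm (grad \<psi> (x + t *\<^sub>R h))"]
     by (auto simp: indicator_def)
   qed (use in1 in2 in auto)
   also have "\<dots> = \<rho> * (LINT t|lborel. (indicator {0..1} t *\<^sub>R norm (grad \<psi> (x + t *\<^sub>R h))))"
    by simp
   finally have "ennreal \<bar>\<psi> x - \<psi> (x + h)\<bar>
     \<le> ennreal \<rho> * ennreal (LINT t|lborel. (indicator {0..1} t *\<^sub>R norm (grad \<psi> (x + t *\<^sub>R h))))"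
    using rho by (simp add: ennreal_mult'[symmetric] ennreal_leI)
   also have "ennreal (LINT t|lborel. (indicator {0..1} t *\<^sub>R norm (grad \<psi> (x + t *\<^sub>R h))))
    = (\<integral>\<^sup>+t. ennreal (indicator {0..1} t *\<^sub>R norm (grad \<psi> (x + t *\<^sub>R h))) \<partial>lborel)"
    using in1 by (intro nn_integral_eq_integral[symmetric]) auto
   also have "\<dots> = (\<integral>\<^sup>+t. indicator {0..1} t * ennreal (norm (grad \<psi> (x + t *\<^sub>R h))) \<partial>lborel)"
    by (intro nn_integral_cong) (auto simp: indicator_def)
   finally show ?thesis .
  qed
  have "(\<integral>\<^sup>+x. ennreal \<bar>\<psi> x - \<psi> (x + h)\<bar> \<partial>lborel)
   \<le> (\<integral>\<^sup>+x. ennreal \<rho> * (\<integral>\<^sup>+t. indicator {0..1} t * ennreal (norm (grad \<psi> (x + t *\<^sub>R h))) \<partial>lborel) \<partial>lborel)"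
   by (intro nn_integral_mono pw)
  also have "\<dots> = ennreal \<rho> * (\<integral>\<^sup>+x. (\<integral>\<^sup>+t. indicator {0..1} t * ennreal (norm (grad \<psi> (x + t *\<^sub>R h))) \<partial>lborel) \<partial>lborel)"
   by (intro nn_integral_cmult) measurable
  also have "(\<integral>\<^sup>+x. (\<integral>\<^sup>+t. indicator {0..1} t * ennreal (norm (grad \<psi> (x + t *\<^sub>R h))) \<partial>lborel) \<partial>lborel)
    = (\<integral>\<^sup>+t. (\<integral>\<^sup>+x. indicator {0..1} t * ennreal (norm (grad \<psi> (x + t *\<^sub>R h))) \<partial>lborel) \<partial>lborel)"
   by (rule lborel_pair.Fubini') measurable
  also have "\<dots> = (\<integral>\<^sup>+t. indicator {0..1::real} t * ennreal G \<partial>lborel)"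
  proof (rule nn_integral_cong)
   fix t :: real
   have "(\<integral>\<^sup>+x. indicator {0..1} t * ennreal (norm (grad \<psi> (x + t *\<^sub>R h))) \<partial>lborel)
    = indicator {0..1} t * (\<integral>\<^sup>+x. ennreal (norm (grad \<psi> (x + t *\<^sub>R h))) \<partial>lborel)"
    by (intro nn_integral_cmult) measurable
   then show "(\<integral>\<^sup>+x. indicator {0..1} t * ennreal (norm (grad \<psi> (x + t *\<^sub>R h))) \<partial>lborel)
     = indicator {0..1} t * ennreal G"
    using nn_integral_lborel_translate[of "\<lambda>x. ennreal (norm (grad \<psi> x))" "t *\<^sub>R h"] G by simp
  qed
  also have "\<dots> = ennreal G" by (simp add: nn_integral_multc)
  finally show ?thesis using rho IG by (simp add: ennreal_mult)
 qed
 have "ennreal (measure lborel B) * ennreal I = (\<integral>\<^sup>+h. indicator B h * ennreal I \<partial>lborel)"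
  by (simp add: nn_integral_multc eB)
 also have "\<dots> \<le> (\<integral>\<^sup>+h. indicator B h * ennreal (\<rho> * G)
   + indicator B h * (\<integral>\<^sup>+x. indicator E x * ennreal \<bar>\<psi> (x + h)\<bar> \<partial>lborel) \<partial>lborel)"
 proof (rule nn_integral_mono)
  fix h
  show "indicator B h * ennreal I \<le> indicator B h * ennreal (\<rho> * G)
   + indicator B h * (\<integral>\<^sup>+x. indicator E x * ennreal \<bar>\<psi> (x + h)\<bar> \<partial>lborel)"
  proof (cases "h \<in> B")
   case True
   have "ennreal I \<le> (\<integral>\<^sup>+x. ennreal \<bar>\<psi> x - \<psi> (x + h)\<bar> + indicator E x * ennreal \<bar>\<psi> (x + h)\<bar> \<partial>lborel)"
    unfolding I[symmetric]
   proof (rule nn_integral_mono)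
    show "ennreal \<bar>\<psi> x\<bar> \<le> ennreal \<bar>\<psi> x - \<psi> (x + h)\<bar> + indicator E x * ennreal \<bar>\<psi> (x + h)\<bar>" for x
     by (auto simp: E_def indicator_def ennreal_plus[symmetric] simp del: ennreal_plus intro!: ennreal_leI)
   qed
   also have "\<dots> = (\<integral>\<^sup>+x. ennreal \<bar>\<psi> x - \<psi> (x + h)\<bar> \<partial>lborel)
     + (\<integral>\<^sup>+x. indicator E x * ennreal \<bar>\<psi> (x + h)\<bar> \<partial>lborel)"
    by (rule nn_integral_add) measurable
   also have "\<dots> \<le> ennreal (\<rho> * G) + (\<integral>\<^sup>+x. indicator E x * ennreal \<bar>\<psi> (x + h)\<bar> \<partial>lborel)"
    using True by (intro add_right_mono shift) (auto simp: B_def)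
   finally show ?thesis using True by simp
  qed simp
 qed
 also have "\<dots> = ennreal (measure lborel B) * ennreal (\<rho> * G)
   + (\<integral>\<^sup>+h. (\<integral>\<^sup>+x. indicator B h * (indicator E x * ennreal \<bar>\<psi> (x + h)\<bar>) \<partial>lborel) \<partial>lborel)"
  by (subst nn_integral_add) (auto simp: nn_integral_multc nn_integral_cmult eB)
 also have "(\<integral>\<^sup>+h. (\<integral>\<^sup>+x. indicator B h * (indicator E x * ennreal \<bar>\<psi> (x + h)\<bar>) \<partial>lborel) \<partial>lborel)
   = (\<integral>\<^sup>+x. (\<integral>\<^sup>+h. indicator B h * (indicator E x * ennreal \<bar>\<psi> (x + h)\<bar>) \<partial>lborel) \<partial>lborel)"
  by (rule lborel_pair.Fubini') measurable
 also have "\<dots> \<le> (\<integral>\<^sup>+x. indicator E x * ennreal I \<partial>lborel)"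
 proof (rule nn_integral_mono)
  fix x
  have "(\<integral>\<^sup>+h. indicator B h * (indicator E x * ennreal \<bar>\<psi> (x + h)\<bar>) \<partial>lborel)
   \<le> (\<integral>\<^sup>+h. indicator E x * ennreal \<bar>\<psi> (h + x)\<bar> \<partial>lborel)"
   by (intro nn_integral_mono) (auto simp: indicator_def add.commute)
  also have "\<dots> = indicator E x * ennreal I"
   using nn_integral_lborel_translate[of "\<lambda>x. ennreal \<bar>\<psi> x\<bar>" x] I by (simp add: nn_integral_cmult)
  finally show "(\<integral>\<^sup>+h. indicator B h * (indicator E x * ennreal \<bar>\<psi> (x + h)\<bar>) \<partial>lborel) \<le> indicator E x * ennreal I" .
 qed
 also have "\<dots> = ennreal (measure lborel E) * ennreal I"
  by (simp add: nn_integral_multc eE)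
 finally have "ennreal (measure lborel B * I) \<le> ennreal (measure lborel B * (\<rho> * G) + measure lborel E * I)"
  using IG rho by (simp add: ennreal_mult' ennreal_mult add_left_mono)
 then have *: "measure lborel B * I \<le> measure lborel B * (\<rho> * G) + measure lborel E * I"
  using IG rho by (subst (asm) ennreal_le_iff) auto
 have "2 * measure lborel E \<le> measure lborel B" using P rho by (simp add: E_def B_def)
 from mult_right_mono[OF this IG(1)] *
 have "measure lborel B * I \<le> measure lborel B * (2 * \<rho> * G)" by (simp add: algebra_simps)
 moreover have "measure lborel B > 0"
  unfolding B_def using rho by (simp add: content_ball_pos)
 ultimately show ?thesis by (simp add: I_def G_def)
qed

section \<open>Cut-off functions around a point\<close>

text \<open>The square makes the positive part C^1, hence admissible in test functions.\<close>

definition pos_sq :: "real \<Rightarrow> real" where "pos_sq t = (max 0 t)\<^sup>2"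

lemma DERIV_pos_sq: "DERIV pos_sq t :> 2 * max 0 t"
proof -
 consider "t > 0" | "t < 0" | "t = 0" by linarith
 then show ?thesis
 proof cases
  case 1
  have "((\<lambda>t. t\<^sup>2) has_real_derivative 2 * t) (at t)" by (auto intro!: derivative_eq_intros)
  then have "DERIV pos_sq t :> 2 * t"
   by (rule has_field_derivative_transform_within_open[of _ _ _ "{0<..}"]) (use 1 in \<open>auto simp: pos_sq_def\<close>)
  then show ?thesis using 1 by simp
 next
  case 2
  have "((\<lambda>t. 0) has_real_derivative 0) (at t)" by simp
  then have "DERIV pos_sq t :> 0"
   by (rule has_field_derivative_transform_within_open[of _ _ _ "{..<0}"]) (use 2 in \<open>auto simp: pos_sq_def\<close>)
  then show ?thesis using 2 by simp
 next
  case 3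
  have "((\<lambda>h. pos_sq h / h) \<longlongrightarrow> 0) (at 0)"
  proof (rule Lim_null_comparison)
   show "\<forall>\<^sub>F h in at 0. norm (pos_sq h / h) \<le> \<bar>h\<bar>"
    by (rule always_eventually) (auto simp: pos_sq_def max_def power2_eq_square)
   show "((\<lambda>h::real. \<bar>h\<bar>) \<longlongrightarrow> 0) (at 0)" by (auto intro!: tendsto_eq_intros)
  qed
  then show ?thesis using 3 by (simp add: DERIV_def pos_sq_def)
 qed
qed

text \<open>A C^1 step that rises from 0 to 1 on [0,1]; the denominator is positive because t and 1
  - t are never both nonpositive.\<close>

definition sstep :: "real \<Rightarrow> real" where "sstep t = pos_sq t / (pos_sq t + pos_sq (1 - t))"

definition sstep' :: "real \<Rightarrow> real"
 where "sstep' t = (2 * max 0 t * pos_sq (1 - t) + 2 * max 0 (1 - t) * pos_sq t) / (pos_sq t + pos_sq (1 - t))\<^sup>2"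

lemma sstep_denom: "pos_sq t + pos_sq (1 - t) > 0"
 by (cases "t > 0") (auto simp: pos_sq_def max_def intro: add_pos_nonneg add_nonneg_pos)

lemma sstep_props:
 "t \<le> 0 \<Longrightarrow> sstep t = 0" "1 \<le> t \<Longrightarrow> sstep t = 1" "0 \<le> sstep t" "sstep t \<le> 1"
 "t \<le> 0 \<Longrightarrow> sstep' t = 0" "1 \<le> t \<Longrightarrow> sstep' t = 0" "0 \<le> sstep' t"
 using sstep_denom[of t]
 by (auto simp: sstep_def sstep'_def pos_sq_def max_def divide_simps)

lemma continuous_on_pos_sq: "continuous_on S pos_sq"
 unfolding pos_sq_def by (intro continuous_intros)

lemma DERIV_sstep: "DERIV sstep t :> sstep' t"
proof -
 have 1: "DERIV (\<lambda>t. pos_sq (1 - t)) t :> - (2 * max 0 (1 - t))"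
 proof -
  have "((\<lambda>t. 1 - t) has_real_derivative -1) (at t)" by (auto intro!: derivative_eq_intros)
  from DERIV_chain2[OF DERIV_pos_sq this] show ?thesis by simp
 qed
 show ?thesis
  unfolding sstep_def[abs_def] sstep'_def
  by (rule derivative_eq_intros DERIV_pos_sq 1 refl)+
    (use sstep_denom[of t] in \<open>auto simp: power2_eq_square field_simps\<close>)
qed

lemma continuous_on_sstep': "continuous_on S sstep'"
proof -
 have "continuous_on UNIV sstep'" unfolding sstep'_def
  by (intro continuous_intros continuous_on_compose2[OF continuous_on_pos_sq[of UNIV]])
    (use sstep_denom in \<open>auto simp: less_imp_neq[THEN not_sym]\<close>)
 then show ?thesis by (rule continuous_on_subset) auto
qed

lemma GDERIV_norm_sq: "GDERIV (\<lambda>x::'a::euclidean_space. (norm (x - x0))\<^sup>2) x :> 2 *\<^sub>R (x - x0)"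
 unfolding gderiv_def power2_norm_eq_inner
 by (auto intro!: derivative_eq_intros simp: inner_commute)

text \<open>The constants map |x|^2 from [1/4, 1] onto [0, 1], so the transition takes place in 1/2
  <= |x| <= 1; the squared norm keeps the function C^1 at 0.\<close>

definition chi :: "'a::euclidean_space \<Rightarrow> real"
 where "chi x = sstep ((4 / 3) * (norm (x - 0))\<^sup>2 - 1 / 3)"

lemma chi_props:
 fixes x :: "'a::euclidean_space"
 shows "norm x \<le> 1 / 2 \<Longrightarrow> chi x = 0" "1 \<le> norm x \<Longrightarrow> chi x = 1" "0 \<le> chi x" "chi x \<le> 1"
 "C1_on UNIV (chi :: 'a \<Rightarrow> real)" "GDERIV chi x :> (sstep' ((4 / 3) * (norm x)\<^sup>2 - 1 / 3) * (8 / 3)) *\<^sub>R x"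
 "norm x \<le> 1 / 2 \<Longrightarrow> grad chi x = 0" "1 \<le> norm x \<Longrightarrow> grad chi x = 0"
proof -
 have a: "(4 / 3) * (norm x)\<^sup>2 - 1 / 3 \<le> 0" if "norm x \<le> 1 / 2"
  using power_mono[OF that, of 2] by (simp add: power2_eq_square)
 have b: "1 \<le> (4 / 3) * (norm x)\<^sup>2 - 1 / 3" if "1 \<le> norm x"
  using power_mono[OF that, of 2] by (simp add: power2_eq_square)
 show "norm x \<le> 1 / 2 \<Longrightarrow> chi x = 0" "1 \<le> norm x \<Longrightarrow> chi x = 1" "0 \<le> chi x" "chi x \<le> 1"
  using sstep_props a b by (auto simp: chi_def)
 have c: "GDERIV (\<lambda>x::'a. (4 / 3) * (norm (x - 0))\<^sup>2 - 1 / 3) x :> (4 / 3) *\<^sub>R (2 *\<^sub>R (x - 0)) + (norm (x - 0))\<^sup>2 *\<^sub>R 0 - 0" for x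
  by (intro GDERIV_diff GDERIV_mult GDERIV_const GDERIV_norm_sq)
 have d: "GDERIV chi x :> (sstep' ((4 / 3) * (norm x)\<^sup>2 - 1 / 3) * (8 / 3)) *\<^sub>R x" for x :: 'a
  using GDERIV_DERIV_compose[OF c DERIV_sstep, of x] unfolding chi_def[abs_def] by (simp add: mult.commute)
 then show "GDERIV chi x :> (sstep' ((4 / 3) * (norm x)\<^sup>2 - 1 / 3) * (8 / 3)) *\<^sub>R x" .
 show "C1_on UNIV (chi :: 'a \<Rightarrow> real)"
  by (rule C1_onI[OF d]) (intro continuous_intros continuous_on_compose2[OF continuous_on_sstep'[of UNIV]], auto)
 show "norm x \<le> 1 / 2 \<Longrightarrow> grad chi x = 0" "1 \<le> norm x \<Longrightarrow> grad chi x = 0"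
  using grad_eqI[OF d[of x]] sstep_props a b by auto
qed

lemma integral_scale_powr_grad_chi:
 assumes "0 < p" "0 < c"
 shows "integrable lborel (\<lambda>x::'a::euclidean_space. norm (grad chi (c *\<^sub>R x)) powr p)"
  "(LINT x|lborel. norm (grad chi (c *\<^sub>R x :: 'a)) powr p)
   = (LINT x|lborel. norm (grad chi (x::'a)) powr p) / c ^ DIM('a)"
proof -
 have cont: "continuous_on UNIV (\<lambda>x::'a. norm (grad chi x) powr p)"
  by (intro continuous_on_norm_powr C1_onD(2) chi_props assms)
 show "integrable lborel (\<lambda>x::'a. norm (grad chi (c *\<^sub>R x)) powr p)"
 proof (rule integrable_compact_support[of "cball 0 (1 / c)"])
  show "continuous_on (cball 0 (1 / c)) (\<lambda>x::'a. norm (grad chi (c *\<^sub>R x)) powr p)"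
   by (intro continuous_on_compose2[OF cont] continuous_intros) auto
  fix x :: 'a assume "x \<notin> cball 0 (1 / c)"
  then have "1 \<le> norm (c *\<^sub>R x)" using assms(2) by (simp add: field_simps)
  then show "norm (grad chi (c *\<^sub>R x)) powr p = 0" by (simp add: chi_props)
 qed simp
 show "(LINT x|lborel. norm (grad chi (c *\<^sub>R x :: 'a)) powr p)
   = (LINT x|lborel. norm (grad chi (x::'a)) powr p) / c ^ DIM('a)"
  by (rule integral_lborel_scale[of "\<lambda>x. norm (grad chi x) powr p"])
   (use assms cont in \<open>auto intro: borel_measurable_continuous_onI\<close>)
qed

lemma chi_scaled:
 fixes x :: "'a::euclidean_space"
 shows "GDERIV (\<lambda>x::'a. chi (c *\<^sub>R x)) x :> c *\<^sub>R grad chi (c *\<^sub>R x)" "C1_on UNIV (\<lambda>x::'a. chi (c *\<^sub>R x))"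
proof -
 show 1: "GDERIV (\<lambda>x::'a. chi (c *\<^sub>R x)) x :> c *\<^sub>R grad chi (c *\<^sub>R x)" for x
 proof -
  have "(chi has_derivative (\<lambda>h. h \<bullet> grad chi (c *\<^sub>R x))) (at (c *\<^sub>R x))"
   using C1_onD(1)[OF chi_props(5)] by (simp add: gderiv_def)
  from has_derivative_compose[where f="\<lambda>x. c *\<^sub>R x" and s=UNIV, OF has_derivative_scaleR_right[OF has_derivative_ident] this]
  show ?thesis by (simp add: gderiv_def)
 qed
 show "C1_on UNIV (\<lambda>x::'a. chi (c *\<^sub>R x))"
  by (rule C1_onI[OF 1]) (auto intro!: continuous_intros continuous_on_compose2[OF C1_onD(2)[OF chi_props(5)]])
qed

text \<open>Averaging rescaled cut-offs over \<open>n + 1\<close> disjoint dyadic shells makes the \<open>p\<close>-energy tend to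
 zero even in the borderline case where \<open>p\<close> is the dimension.\<close>

definition hole_cutoff :: "nat \<Rightarrow> 'a::euclidean_space \<Rightarrow> real"
 where "hole_cutoff n x = (\<Sum>j\<in>{n..2*n}. chi ((2::real) ^ j *\<^sub>R x)) / (n + 1)"

lemma hole_cutoff_props:
 fixes x :: "'a::euclidean_space"
 shows "0 \<le> hole_cutoff n x" "hole_cutoff n x \<le> 1"
  "norm x \<le> 1 / 2 ^ (2 * n + 1) \<Longrightarrow> hole_cutoff n x = 0"
  "1 / 2 ^ n \<le> norm x \<Longrightarrow> hole_cutoff n x = 1"
  "1 / 2 ^ n \<le> norm x \<Longrightarrow> grad (hole_cutoff n) x = 0"
  "C1_on U (hole_cutoff n :: 'a \<Rightarrow> real)"
  "0 < p \<Longrightarrow> norm (grad (hole_cutoff n) x) powr p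
   = (\<Sum>j\<in>{n..2*n}. ((2::real) ^ j / (n + 1)) powr p * norm (grad chi ((2::real) ^ j *\<^sub>R x)) powr p)"
  "norm (grad (hole_cutoff n) x) \<le> (\<Sum>j\<in>{n..2*n}. ((2::real) ^ j / (n + 1)) * norm (grad chi ((2::real) ^ j *\<^sub>R x)))"
proof -
 have card: "card {n..2*n} = n + 1" by simp
 show "0 \<le> hole_cutoff n x" unfolding hole_cutoff_def by (intro divide_nonneg_pos sum_nonneg chi_props) auto
 have "(\<Sum>j\<in>{n..2*n}. chi ((2::real) ^ j *\<^sub>R x)) \<le> (\<Sum>j\<in>{n..2*n}. 1)" by (intro sum_mono chi_props)
 then show "hole_cutoff n x \<le> 1" unfolding hole_cutoff_def by (simp add: field_simps)
 show "hole_cutoff n x = 0" if hx: "norm x \<le> 1 / 2 ^ (2 * n + 1)"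
 proof -
  have "chi ((2::real) ^ j *\<^sub>R x) = 0" if j: "j \<in> {n..2*n}" for j
  proof (rule chi_props)
   have "norm ((2::real) ^ j *\<^sub>R x) \<le> 2 ^ (2*n) * (1 / 2 ^ (2 * n + 1))"
    unfolding norm_scaleR using hx j
    by (intro mult_mono) (auto intro: power_increasing)
   then show "norm ((2::real) ^ j *\<^sub>R x) \<le> 1 / 2" by simp
  qed
  then show ?thesis by (simp add: hole_cutoff_def)
 qed
 have big: "1 \<le> norm ((2::real) ^ j *\<^sub>R x)" if "1 / 2 ^ n \<le> norm x" "j \<in> {n..2*n}" for j
 proof -
  have "2 ^ n * (1 / 2 ^ n) \<le> 2 ^ j * norm x"
   using that by (intro mult_mono) (auto intro: power_increasing)
  then show ?thesis by simp
 qed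
 show "hole_cutoff n x = 1" if "1 / 2 ^ n \<le> norm x"
 proof -
  have "(\<Sum>j\<in>{n..2*n}. chi ((2::real) ^ j *\<^sub>R x)) = (\<Sum>j\<in>{n..2*n}. 1)"
   by (rule sum.cong) (use chi_props(2)[OF big[OF that]] in auto)
  then show ?thesis by (simp add: hole_cutoff_def)
 qed
 note gs = chi_scaled(1)
 have G: "GDERIV (hole_cutoff n) x :> (\<Sum>j\<in>{n..2*n}. ((2::real) ^ j / (n + 1)) *\<^sub>R grad chi ((2::real) ^ j *\<^sub>R x))"
  for x :: 'a
 proof -
  have 1: "(hole_cutoff n has_derivative (\<lambda>h. (\<Sum>j\<in>{n..2*n}. h \<bullet> ((2::real) ^ j *\<^sub>R grad chi ((2::real) ^ j *\<^sub>R x))) / (n + 1))) (at x)"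
   unfolding hole_cutoff_def[abs_def]
   by (intro bounded_linear.has_derivative[OF bounded_linear_divide] has_derivative_sum gs[unfolded gderiv_def])
  have 2: "(\<Sum>j\<in>{n..2*n}. h \<bullet> ((2::real) ^ j *\<^sub>R grad chi ((2::real) ^ j *\<^sub>R x))) / (n + 1)
   = h \<bullet> (\<Sum>j\<in>{n..2*n}. ((2::real) ^ j / (n + 1)) *\<^sub>R grad chi ((2::real) ^ j *\<^sub>R x))" for h :: 'a
   by (simp add: inner_sum_right sum_divide_distrib)
  show ?thesis unfolding gderiv_def using 1 unfolding 2 .
 qed
 note g = grad_eqI[OF G]
 have cont: "continuous_on U (\<lambda>x. (\<Sum>j\<in>{n..2*n}. ((2::real) ^ j / (n + 1)) *\<^sub>R grad chi ((2::real) ^ j *\<^sub>R (x::'a))))"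
  by (intro continuous_intros continuous_on_compose2[OF C1_onD(2)[OF chi_props(5)]]) auto
 show "C1_on U (hole_cutoff n :: 'a \<Rightarrow> real)"
  by (rule C1_onI[OF G cont])
 show "grad (hole_cutoff n) x = 0" if "1 / 2 ^ n \<le> norm x"
  unfolding g by (rule sum.neutral) (use chi_props(8)[OF big[OF that]] in auto)
 show "norm (grad (hole_cutoff n) x) \<le> (\<Sum>j\<in>{n..2*n}. ((2::real) ^ j / (n + 1)) * norm (grad chi ((2::real) ^ j *\<^sub>R x)))"
  unfolding g by (rule order_trans[OF norm_sum]) simp
 show "norm (grad (hole_cutoff n) x) powr p
   = (\<Sum>j\<in>{n..2*n}. ((2::real) ^ j / (n + 1)) powr p * norm (grad chi ((2::real) ^ j *\<^sub>R x)) powr p)"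
  if p: "0 < p"
 proof (cases "\<exists>i\<in>{n..2*n}. grad chi ((2::real) ^ i *\<^sub>R x) \<noteq> 0")
  case False
  then show ?thesis unfolding g by auto
 next
  case True
  then obtain i where i: "i \<in> {n..2*n}" "grad chi ((2::real) ^ i *\<^sub>R x) \<noteq> 0" by auto
  \<comment> \<open>The gradient of the j-th summand lives in the shell 1/2 < 2^j |x| < 1. These
    shells are disjoint, so at most one summand contributes at x and the p-th power of the norm
    passes through the sum.\<close>
  have sh: "1 / 2 < 2 ^ j * norm x \<and> 2 ^ j * norm x < 1" if "grad chi ((2::real) ^ j *\<^sub>R x) \<noteq> 0" for j
   using chi_props(7,8)[of "(2::real) ^ j *\<^sub>R x"] that by force
  have z: "grad chi ((2::real) ^ j *\<^sub>R x) = 0" if "j \<noteq> i" for j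
  proof (rule ccontr)
   assume "grad chi ((2::real) ^ j *\<^sub>R x) \<noteq> 0"
   note s = sh[OF this] sh[OF i(2)]
   have *: False if "a < b" "1 / 2 < 2 ^ a * norm x" "2 ^ b * norm x < 1" for a b :: nat
   proof -
    have "2 ^ (Suc a) * norm x \<le> 2 ^ b * norm x"
     using that(1) by (intro mult_right_mono power_increasing) auto
    then show False using that by simp
   qed
   show False using *[of i j] *[of j i] s that by linarith
  qed
  have "(\<Sum>j\<in>{n..2*n}. ((2::real) ^ j / (n + 1)) *\<^sub>R grad chi ((2::real) ^ j *\<^sub>R x))
    = (2 ^ i / (n + 1)) *\<^sub>R grad chi ((2::real) ^ i *\<^sub>R x)"
   using sum.remove[OF _ i(1), of "\<lambda>j. ((2::real) ^ j / (n + 1)) *\<^sub>R grad chi ((2::real) ^ j *\<^sub>R x)"] z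
   by (simp add: sum.neutral)
  moreover have "(\<Sum>j\<in>{n..2*n}. ((2::real) ^ j / (n + 1)) powr p * norm (grad chi ((2::real) ^ j *\<^sub>R x)) powr p)
    = (2 ^ i / (n + 1)) powr p * norm (grad chi ((2::real) ^ i *\<^sub>R x)) powr p"
   using sum.remove[OF _ i(1), of "\<lambda>j. ((2::real) ^ j / (n + 1)) powr p * norm (grad chi ((2::real) ^ j *\<^sub>R x)) powr p"] z
   by (simp add: sum.neutral)
  ultimately show ?thesis unfolding g by (simp add: powr_mult powr_divide)
 qed
qed

text \<open>Scaling turns the j-th shell into (2^j / (n+1))^p 2^(-jN) I, at most (n+1)^(-p) I
  because p <= N. The n+1 shells add up to I (n+1)^(1-p), which tends to 0 because p > 1.\<close>

lemma hole_cutoff_energy: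
 fixes p :: real
 assumes "1 < p" "p \<le> DIM('a::euclidean_space)"
 shows "integrable lborel (\<lambda>x::'a. norm (grad (hole_cutoff n) x) powr p)"
  "(\<lambda>n. LINT x|lborel. norm (grad (hole_cutoff n) (x::'a)) powr p) \<longlonglongrightarrow> 0"
proof -
 have p: "0 < p" using assms by simp
 define I where "I = (LINT x|lborel. norm (grad chi (x::'a)) powr p)"
 have I: "0 \<le> I" by (simp add: I_def)
 note int = integral_scale_powr_grad_chi[OF p, where 'a='a]
 show "integrable lborel (\<lambda>x::'a. norm (grad (hole_cutoff n) x) powr p)" for n
  unfolding hole_cutoff_props(7)[OF p] by (intro Bochner_Integration.integrable_sum integrable_mult_right int) simp
 have bnd: "(LINT x|lborel. norm (grad (hole_cutoff n) (x::'a)) powr p) \<le> I * real (n + 1) powr (1 - p)" for n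
 proof -
  have "(LINT x|lborel. norm (grad (hole_cutoff n) (x::'a)) powr p)
    = (\<Sum>j\<in>{n..2*n}. ((2::real) ^ j / (n + 1)) powr p * (I / (2 ^ j) ^ DIM('a)))"
   unfolding hole_cutoff_props(7)[OF p] I_def
   by (subst Bochner_Integration.integral_sum) (auto intro!: integrable_mult_right int simp: int(2))
  also have "\<dots> \<le> (\<Sum>j\<in>{n..2*n}. real (n + 1) powr (- p) * I)"
  proof (rule sum_mono)
   fix j
   have e: "(2 ^ j) powr real DIM('a) = ((2::real) ^ j) ^ DIM('a)" by (simp add: powr_realpow)
   have e2: "((2::real) ^ j / (n + 1)) powr p = (2 ^ j) powr p * real (n + 1) powr (- p)"
    by (simp add: powr_divide powr_minus_divide)
   have "((2::real) ^ j) powr p \<le> (2 ^ j) powr real DIM('a)"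
    using assms by (intro powr_mono) auto
   then have "((2::real) ^ j) powr p / (2 ^ j) ^ DIM('a) \<le> 1" unfolding e by simp
   then have "real (n + 1) powr (- p) * I * (((2::real) ^ j) powr p / (2 ^ j) ^ DIM('a)) \<le> real (n + 1) powr (- p) * I * 1"
    using I by (intro mult_left_mono) auto
   then show "((2::real) ^ j / (n + 1)) powr p * (I / (2 ^ j) ^ DIM('a)) \<le> real (n + 1) powr (- p) * I"
    unfolding e2 by (simp only: divide_inverse mult_ac)
  qed
  also have "\<dots> = (real (n + 1) powr (- p) * real (n + 1) powr 1) * I" by (simp add: mult.commute)
  also have "\<dots> = I * real (n + 1) powr (1 - p)" unfolding powr_add[symmetric] by simp
  finally show ?thesis .
 qed
 show "(\<lambda>n. LINT x|lborel. norm (grad (hole_cutoff n) (x::'a)) powr p) \<longlonglongrightarrow> 0"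
 proof (rule tendsto_sandwich[OF _ _ tendsto_const])
  have "filterlim (\<lambda>n. real (n + 1)) at_top sequentially"
   using filterlim_compose[OF filterlim_real_sequentially filterlim_Suc] by simp
  then have "(\<lambda>n. real (n + 1) powr (1 - p)) \<longlonglongrightarrow> 0"
   using assms by (intro tendsto_neg_powr) auto
  from tendsto_mult_right_zero[OF this, of I] show "(\<lambda>n. I * real (n + 1) powr (1 - p)) \<longlonglongrightarrow> 0" .
 qed (use bnd in auto)
qed

section \<open>Touching of strict sub- and supersolutions\<close>

lemma vflux_has_derivative:
 fixes g :: "'a::euclidean_space"
 assumes "g \<noteq> 0"
 shows "(vflux p has_derivative (\<lambda>h. norm g powr (p - 2) *\<^sub>R h
  + ((p - 2) * norm g powr (p - 3) * (h \<bullet> sgn g)) *\<^sub>R g)) (at g)"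
proof -
 have n: "(norm has_derivative (\<lambda>h. h \<bullet> sgn g)) (at g)"
  using GDERIV_norm[OF assms] by (simp add: gderiv_def)
 have "((\<lambda>t. t powr (p - 2)) has_derivative (\<lambda>s. ((p - 2) * norm g powr (p - 2 - 1)) * s)) (at (norm g))"
  using has_real_derivative_powr[of "norm g" "p - 2"] assms by (simp add: has_field_derivative_def)
 from has_derivative_compose[OF n this]
 have 1: "((\<lambda>g::'a. norm g powr (p - 2)) has_derivative (\<lambda>h. (p - 2) * norm g powr (p - 3) * (h \<bullet> sgn g))) (at g)"
  by simp
 show ?thesis unfolding vflux_def[abs_def]
  using has_derivative_scaleR[OF 1 has_derivative_ident] by simp
qed

lemma powr_between:
 fixes lo hi t s :: real
 assumes "0 < lo" "lo \<le> t" "t \<le> hi"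
 shows "min (lo powr s) (hi powr s) \<le> t powr s" "t powr s \<le> max (lo powr s) (hi powr s)"
proof -
 have "lo powr s \<le> t powr s \<and> t powr s \<le> hi powr s \<or> hi powr s \<le> t powr s \<and> t powr s \<le> lo powr s"
 proof (cases "0 \<le> s")
  case True then show ?thesis using assms by (intro disjI1 conjI powr_mono2) auto
 next
  case False then show ?thesis using assms by (intro disjI2 conjI powr_mono2') auto
 qed
 then show "min (lo powr s) (hi powr s) \<le> t powr s" "t powr s \<le> max (lo powr s) (hi powr s)" by auto
qed

text \<open>Away from 0 the flux is smooth; its derivative at \<gamma> is |\<gamma>|^(p-2) times the
  identity plus p-2 times the projection onto \<gamma>, with eigenvalues |\<gamma>|^(p-2) and
  (p-1)|\<gamma>|^(p-2). On the ball of radius |\<xi>|/2 about \<xi> these are bounded above and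
  below; the mean value theorem does the rest.\<close>

lemma vflux_local:
 fixes \<xi> :: "'a::euclidean_space"
 assumes "\<xi> \<noteq> 0" "1 < p"
 obtains r c C where "0 < r" "0 < c" "0 \<le> C"
  "\<And>\<alpha> \<beta>. norm (\<alpha> - \<xi>) \<le> r \<Longrightarrow> norm (\<beta> - \<xi>) \<le> r \<Longrightarrow>
    c * (norm (\<alpha> - \<beta>))\<^sup>2 \<le> (vflux p \<alpha> - vflux p \<beta>) \<bullet> (\<alpha> - \<beta>)"
  "\<And>\<alpha> \<beta>. norm (\<alpha> - \<xi>) \<le> r \<Longrightarrow> norm (\<beta> - \<xi>) \<le> r \<Longrightarrow>
    norm (vflux p \<alpha> - vflux p \<beta>) \<le> C * norm (\<alpha> - \<beta>)"
proof -
 define r where "r = norm \<xi> / 2"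
 define lo where "lo = norm \<xi> / 2"
 define hi where "hi = 2 * norm \<xi>"
 define m where "m = min (lo powr (p - 2)) (hi powr (p - 2))"
 define Mx where "Mx = max (lo powr (p - 2)) (hi powr (p - 2))"
 have pos: "0 < r" "0 < lo" "0 < hi" "0 < m" "0 < Mx" using assms by (auto simp: r_def lo_def hi_def m_def Mx_def less_max_iff_disj)
 have rng: "lo \<le> norm \<gamma> \<and> norm \<gamma> \<le> hi \<and> \<gamma> \<noteq> 0" if "norm (\<gamma> - \<xi>) \<le> r" for \<gamma>
  using that norm_triangle_ineq3[of \<gamma> \<xi>] pos by (auto simp: r_def lo_def hi_def)
 have rng2: "m \<le> norm \<gamma> powr (p - 2) \<and> norm \<gamma> powr (p - 2) \<le> Mx" if "norm (\<gamma> - \<xi>) \<le> r" for \<gamma>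
  using rng[OF that] powr_between[OF pos(2), of "norm \<gamma>" hi "p - 2"] by (simp add: m_def Mx_def)
 have conv: "convex (cball \<xi> r)" by (rule convex_cball)
 let ?D = "\<lambda>\<gamma> h. norm \<gamma> powr (p - 2) *\<^sub>R h + ((p - 2) * norm \<gamma> powr (p - 3) * (h \<bullet> sgn \<gamma>)) *\<^sub>R \<gamma>"
 have Deq: "((p - 2) * norm \<gamma> powr (p - 3) * (h \<bullet> sgn \<gamma>)) *\<^sub>R \<gamma> = ((p - 2) * norm \<gamma> powr (p - 2) * (h \<bullet> sgn \<gamma>)) *\<^sub>R sgn \<gamma>"
  if "\<gamma> \<noteq> 0" for \<gamma> h :: 'a
 proof -
  have "norm \<gamma> powr (p - 2) = norm \<gamma> powr (p - 3) * norm \<gamma>"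
   using powr_add[of "norm \<gamma>" "p - 3" 1] by simp
  then show ?thesis using that by (simp add: sgn_div_norm)
 qed
 have sg: "\<bar>h \<bullet> sgn \<gamma>\<bar> \<le> norm h" for h \<gamma> :: 'a
  using Cauchy_Schwarz_ineq2[of h "sgn \<gamma>"] by (simp add: norm_sgn split: if_splits)
 show ?thesis
 proof (rule that[of r "min 1 (p - 1) * m" "(1 + \<bar>p - 2\<bar>) * Mx"])
  fix \<alpha> \<beta> :: 'a assume ab: "norm (\<alpha> - \<xi>) \<le> r" "norm (\<beta> - \<xi>) \<le> r"
  define g where "g = \<alpha> - \<beta>"
  have seg: "norm (\<beta> + t *\<^sub>R g - \<xi>) \<le> r" if "0 \<le> t" "t \<le> 1" for t
  proof -
   have "(1 - t) *\<^sub>R \<beta> + t *\<^sub>R \<alpha> \<in> cball \<xi> r"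
    using convexD[OF conv, of \<beta> \<alpha> "1 - t" t] ab that by (auto simp: dist_norm norm_minus_commute)
   moreover have "(1 - t) *\<^sub>R \<beta> + t *\<^sub>R \<alpha> = \<beta> + t *\<^sub>R g" by (simp add: g_def algebra_simps)
   ultimately show ?thesis by (simp add: dist_norm norm_minus_commute)
  qed
  have der: "((\<lambda>t. vflux p (\<beta> + t *\<^sub>R g) \<bullet> g) has_real_derivative (?D (\<beta> + t *\<^sub>R g) g \<bullet> g)) (at t)"
   if t: "0 \<le> t" "t \<le> 1" for t
  proof -
   have l: "((\<lambda>t. \<beta> + t *\<^sub>R g) has_derivative (\<lambda>s. s *\<^sub>R g)) (at t)" by (auto intro!: derivative_eq_intros)
   have "((\<lambda>t. vflux p (\<beta> + t *\<^sub>R g)) has_derivative (\<lambda>s. ?D (\<beta> + t *\<^sub>R g) (s *\<^sub>R g))) (at t)"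
    using has_derivative_compose[OF l vflux_has_derivative] rng[OF seg[OF t]] by simp
   then have "((\<lambda>t. vflux p (\<beta> + t *\<^sub>R g) \<bullet> g) has_derivative (\<lambda>s. ?D (\<beta> + t *\<^sub>R g) (s *\<^sub>R g) \<bullet> g)) (at t)"
    by (rule has_derivative_inner_left)
   moreover have "(\<lambda>s. ?D (\<beta> + t *\<^sub>R g) (s *\<^sub>R g) \<bullet> g) = (*) (?D (\<beta> + t *\<^sub>R g) g \<bullet> g)"
    by (auto simp: algebra_simps)
   ultimately show ?thesis by (simp add: has_field_derivative_def)
  qed
  have "\<exists>z>0. z < 1 \<and> vflux p (\<beta> + 1 *\<^sub>R g) \<bullet> g - vflux p (\<beta> + 0 *\<^sub>R g) \<bullet> g = (1 - 0) * (?D (\<beta> + z *\<^sub>R g) g \<bullet> g)"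
   by (rule MVT2) (use der in auto)
  then obtain t where t: "0 < t" "t < 1" "(vflux p \<alpha> - vflux p \<beta>) \<bullet> g = ?D (\<beta> + t *\<^sub>R g) g \<bullet> g"
   by (auto simp: g_def inner_diff_left)
  define \<gamma> where "\<gamma> = \<beta> + t *\<^sub>R g"
  have g0: "norm (\<gamma> - \<xi>) \<le> r" using seg[of t] t by (simp add: \<gamma>_def)
  define k where "k = norm \<gamma> powr (p - 2)"
  have k: "m \<le> k" "0 < k" using rng2[OF g0] pos by (auto simp: k_def)
  have "?D \<gamma> g \<bullet> g = k * ((norm g)\<^sup>2 + (p - 2) * (g \<bullet> sgn \<gamma>)\<^sup>2)"
   using rng[OF g0] by (subst Deq) (auto simp: k_def dot_square_norm power2_eq_square inner_add_left algebra_simps inner_commute)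
  moreover have "min 1 (p - 1) * (norm g)\<^sup>2 \<le> (norm g)\<^sup>2 + (p - 2) * (g \<bullet> sgn \<gamma>)\<^sup>2"
  proof (cases "p \<ge> 2")
   case False
   have "(g \<bullet> sgn \<gamma>)\<^sup>2 \<le> (norm g)\<^sup>2" using sg[of g \<gamma>] by (simp add: abs_le_square_iff[symmetric])
   then have "(p - 2) * (norm g)\<^sup>2 \<le> (p - 2) * (g \<bullet> sgn \<gamma>)\<^sup>2"
    using False by (intro mult_left_mono_neg) auto
   then show ?thesis using False by (simp add: algebra_simps)
  qed simp
  ultimately have "k * (min 1 (p - 1) * (norm g)\<^sup>2) \<le> ?D \<gamma> g \<bullet> g"
   using k by (simp add: mult_left_mono)
  moreover have "m * (min 1 (p - 1) * (norm g)\<^sup>2) \<le> k * (min 1 (p - 1) * (norm g)\<^sup>2)"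
   using k assms by (intro mult_right_mono) auto
  ultimately show "min 1 (p - 1) * m * (norm (\<alpha> - \<beta>))\<^sup>2 \<le> (vflux p \<alpha> - vflux p \<beta>) \<bullet> (\<alpha> - \<beta>)"
   using t(3) by (simp add: g_def \<gamma>_def mult_ac)
  show "norm (vflux p \<alpha> - vflux p \<beta>) \<le> (1 + \<bar>p - 2\<bar>) * Mx * norm (\<alpha> - \<beta>)"
  proof (rule differentiable_bound[OF conv, of _ "?D"])
   fix \<gamma> assume "\<gamma> \<in> cball \<xi> r"
   then have g: "norm (\<gamma> - \<xi>) \<le> r" by (simp add: dist_norm norm_minus_commute)
   show "(vflux p has_derivative ?D \<gamma>) (at \<gamma> within cball \<xi> r)"
    using vflux_has_derivative rng[OF g] by (blast intro: has_derivative_at_withinI)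
   show "onorm (?D \<gamma>) \<le> (1 + \<bar>p - 2\<bar>) * Mx"
   proof (rule onorm_bound)
    fix h
    have k: "norm \<gamma> powr (p - 2) \<le> Mx" using rng2[OF g] by simp
    have "norm (?D \<gamma> h) \<le> norm \<gamma> powr (p - 2) * norm h + \<bar>p - 2\<bar> * norm \<gamma> powr (p - 2) * \<bar>h \<bullet> sgn \<gamma>\<bar>"
     using rng[OF g] by (subst Deq) (auto intro!: order_trans[OF norm_triangle_ineq] simp: abs_mult norm_sgn)
    also have "\<dots> \<le> Mx * norm h + \<bar>p - 2\<bar> * Mx * norm h"
     using k sg[of h \<gamma>] pos by (intro add_mono mult_mono) auto
    finally show "norm (?D \<gamma> h) \<le> (1 + \<bar>p - 2\<bar>) * Mx * norm h" by (simp add: algebra_simps)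
   qed (use pos in auto)
  qed (use ab in \<open>auto simp: dist_norm norm_minus_commute\<close>)
 qed (use pos assms in auto)
qed

text \<open>Only \<beta> is controlled. Up to distance K B, monotonicity along the ray from \<beta>
  to \<alpha> propagates the quadratic estimate at distance r to a bound linear in x = |\<alpha> -
  \<beta>|, which is comparable to x^p there. Beyond K B, the term |\<alpha>|^p dominates both mixed
  terms, K being large enough for the one with B^(p-1) x.\<close>

lemma vflux_far:
 fixes \<beta> \<alpha> e :: "'a::euclidean_space"
 assumes p: "1 < p" and r: "0 < r" "0 < c0" "0 \<le> B" "norm \<beta> \<le> B" "r \<le> norm (\<alpha> - \<beta>)"
  and near: "\<And>\<alpha>'. norm (\<alpha>' - \<beta>) \<le> r \<Longrightarrow> c0 * (norm (\<alpha>' - \<beta>))\<^sup>2 \<le> (vflux p \<alpha>' - vflux p \<beta>) \<bullet> (\<alpha>' - \<beta>)"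
  and K: "4 \<le> K" "K powr (1 - p) \<le> 1 / (4 * 2 powr p)" "r \<le> K * B"
 shows "min (c0 * r * (K * B) powr (1 - p)) (1 / (4 * 2 powr p)) * norm (\<alpha> - \<beta>) powr p
  \<le> (vflux p \<alpha> - vflux p \<beta>) \<bullet> (\<alpha> - \<beta>)"
proof -
 define g where "g = \<alpha> - \<beta>"
 define x where "x = norm g"
 define e where "e = g /\<^sub>R x"
 have x: "r \<le> x" "0 < x" using r by (auto simp: x_def g_def)
 have ge: "g = x *\<^sub>R e" "norm e = 1" using x by (auto simp: e_def x_def)
 have xp: "x powr p = x powr (p - 1) * x" using powr_add[of x "p - 1" 1] x by simp
 \<comment> \<open>The point at distance r from \<beta> on the segment to \<alpha>, where
   \<open>near\<close> applies.\<close>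
 define \<alpha>' where "\<alpha>' = \<beta> + r *\<^sub>R e"
 have "c0 * r\<^sup>2 \<le> (vflux p \<alpha>' - vflux p \<beta>) \<bullet> (r *\<^sub>R e)"
  using near[of \<alpha>'] r ge by (simp add: \<alpha>'_def)
 then have "r * (c0 * r) \<le> r * ((vflux p \<alpha>' - vflux p \<beta>) \<bullet> e)" by (simp add: power2_eq_square mult_ac)
 then have 1: "c0 * r \<le> (vflux p \<alpha>' - vflux p \<beta>) \<bullet> e" using r by (simp add: mult_le_cancel_left)
 have a: "\<alpha> - \<alpha>' = (x - r) *\<^sub>R e" by (simp add: \<alpha>'_def ge(1)[symmetric] scaleR_diff_left g_def)
 have 2: "0 \<le> (vflux p \<alpha> - vflux p \<alpha>') \<bullet> e"
 proof (cases "x = r")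
  case True then have "\<alpha> = \<alpha>'" using a by simp then show ?thesis by simp
 next
  case False
  have "0 \<le> (vflux p \<alpha> - vflux p \<alpha>') \<bullet> (\<alpha> - \<alpha>')" by (rule vflux_monotone[OF p])
  then have "0 \<le> (x - r) * ((vflux p \<alpha> - vflux p \<alpha>') \<bullet> e)" unfolding a by simp
  then show ?thesis using False x by (simp add: zero_le_mult_iff)
 qed
 have 3: "c0 * r * x \<le> (vflux p \<alpha> - vflux p \<beta>) \<bullet> g"
 proof -
  have "c0 * r \<le> (vflux p \<alpha> - vflux p \<beta>) \<bullet> e" using 1 2 by (simp add: inner_diff_left)
  then show ?thesis using x by (simp add: ge(1) mult.commute mult_left_mono)
 qed
 show ?thesis
 proof (cases "x \<le> K * B")
  case True
  have "(K * B) powr (1 - p) \<le> x powr (1 - p)" using True x p by (intro powr_mono2') auto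
  then have "(K * B) powr (1 - p) * x powr p \<le> x powr (1 - p) * x powr p" by (intro mult_right_mono) auto
  also have "\<dots> = x" using x by (simp add: powr_add[symmetric])
  finally have "c0 * r * ((K * B) powr (1 - p) * x powr p) \<le> c0 * r * x" using r by (intro mult_left_mono) auto
  then have "c0 * r * (K * B) powr (1 - p) * x powr p \<le> (vflux p \<alpha> - vflux p \<beta>) \<bullet> g" using 3 by (simp add: mult.assoc)
  moreover have "min (c0 * r * (K * B) powr (1 - p)) (1 / (4 * 2 powr p)) * x powr p \<le> c0 * r * (K * B) powr (1 - p) * x powr p"
   by (intro mult_right_mono) auto
  ultimately show ?thesis by (simp add: g_def x_def)
 next
  case False
  have "4 * B \<le> K * B" using K r by (intro mult_right_mono) auto
  then have xB: "4 * B \<le> x" using False by simp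
  define y where "y = norm \<alpha>"
  have y: "x / 2 \<le> y" "2 * B \<le> y" "0 \<le> y"
   using norm_triangle_ineq4[of \<alpha> \<beta>] r(4) xB r(3) by (auto simp: x_def g_def y_def)
  have yp: "y powr p = y powr (p - 1) * y" using powr_add[of y "p - 1" 1] y by simp
  have cs1: "vflux p \<alpha> \<bullet> \<beta> \<le> y powr (p - 1) * B"
  proof -
   have "vflux p \<alpha> \<bullet> \<beta> \<le> norm (vflux p \<alpha>) * norm \<beta>" by (rule norm_cauchy_schwarz)
   also have "\<dots> \<le> y powr (p - 1) * B" using r by (simp add: norm_vflux y_def mult_left_mono)
   finally show ?thesis .
  qed
  have cs2: "vflux p \<beta> \<bullet> g \<le> B powr (p - 1) * x"
  proof -
   have "vflux p \<beta> \<bullet> g \<le> norm (vflux p \<beta>) * norm g" by (rule norm_cauchy_schwarz)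
   also have "\<dots> \<le> B powr (p - 1) * x"
    using r p by (auto simp: norm_vflux x_def intro!: mult_right_mono powr_mono2)
   finally show ?thesis .
  qed
  have "y powr (p - 1) * B \<le> y powr (p - 1) * (y / 2)" using y by (intro mult_left_mono) auto
  then have "y powr (p - 1) * B \<le> y powr p / 2" by (simp add: yp)
  moreover have "(x / 2) powr p \<le> y powr p" using y x p by (intro powr_mono2) auto
  then have "x powr p / 2 powr p \<le> y powr p" using x by (simp add: powr_divide)
  moreover have "B powr (p - 1) * x \<le> (1 / (4 * 2 powr p)) * x powr p"
  proof -
   have "B \<le> x / K" using False K by (simp add: field_simps)
   then have "B powr (p - 1) \<le> (x / K) powr (p - 1)" using r p by (intro powr_mono2) auto
   also have "\<dots> = K powr (1 - p) * x powr (p - 1)"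
   proof -
    have "K powr (1 - p) = 1 / K powr (p - 1)" using powr_minus_divide[of K "p - 1"] by simp
    moreover have "(x / K) powr (p - 1) = x powr (p - 1) / K powr (p - 1)" using x K by (simp add: powr_divide)
    ultimately show ?thesis by simp
   qed
   also have "\<dots> \<le> (1 / (4 * 2 powr p)) * x powr (p - 1)" using K by (intro mult_right_mono) auto
   finally have "B powr (p - 1) * x \<le> (1 / (4 * 2 powr p)) * x powr (p - 1) * x" using x by (intro mult_right_mono) auto
   then show ?thesis by (simp add: xp)
  qed
  moreover have "(vflux p \<alpha> - vflux p \<beta>) \<bullet> g = y powr p - vflux p \<alpha> \<bullet> \<beta> - vflux p \<beta> \<bullet> g"
   by (simp add: g_def inner_diff_left inner_diff_right inner_vflux_self y_def)
  ultimately have "(1 / (4 * 2 powr p)) * x powr p \<le> (vflux p \<alpha> - vflux p \<beta>) \<bullet> g"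
   using cs1 cs2 by simp
  moreover have "min (c0 * r * (K * B) powr (1 - p)) (1 / (4 * 2 powr p)) * x powr p \<le> (1 / (4 * 2 powr p)) * x powr p"
   by (intro mult_right_mono) auto
  ultimately show ?thesis by (simp add: g_def x_def)
 qed
qed

text \<open>Only one of the two gradients has to be near \<xi>. If the other is close to it, both
  lie where the flux is uniformly elliptic, and by a2 < a1 the lower-order terms differ by a
  definite negative amount. If it is far, the p-th power of the distance controls everything, the
  lower-order terms because q <= p.\<close>

lemma two_regimes:
 fixes \<xi> :: "'a::euclidean_space"
 assumes xi: "\<xi> \<noteq> 0" and p: "1 < p" and q: "0 < q" "q \<le> p" and a: "a2 < a1"
 obtains \<rho> c C \<delta> where "0 < \<rho>" "0 < c" "0 < C" "0 < \<delta>"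
  "\<forall>\<alpha> \<beta>. (norm (\<alpha> - \<xi>) \<le> \<rho> \<or> norm (\<beta> - \<xi>) \<le> \<rho>) \<longrightarrow> norm (\<alpha> - \<beta>) \<le> \<rho> \<longrightarrow>
   c * (norm (\<alpha> - \<beta>))\<^sup>2 \<le> (vflux p \<alpha> - vflux p \<beta>) \<bullet> (\<alpha> - \<beta>)
   \<and> norm (vflux p \<alpha> - vflux p \<beta>) \<le> C * norm (\<alpha> - \<beta>)
   \<and> a2 * norm \<beta> powr q - a1 * norm \<alpha> powr q \<le> - \<delta>"
  "\<forall>\<alpha> \<beta>. (norm (\<alpha> - \<xi>) \<le> \<rho> \<or> norm (\<beta> - \<xi>) \<le> \<rho>) \<longrightarrow> \<rho> \<le> norm (\<alpha> - \<beta>) \<longrightarrow>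
   c * norm (\<alpha> - \<beta>) powr p \<le> (vflux p \<alpha> - vflux p \<beta>) \<bullet> (\<alpha> - \<beta>)
   \<and> norm (vflux p \<alpha> - vflux p \<beta>) \<le> C * norm (\<alpha> - \<beta>) powr (p - 1)
   \<and> a2 * norm \<beta> powr q - a1 * norm \<alpha> powr q \<le> C * norm (\<alpha> - \<beta>) powr p"
proof -
 obtain r c0 C0 where r: "0 < r" "0 < c0" "0 \<le> C0"
  and v1: "\<And>\<alpha> \<beta>. norm (\<alpha> - \<xi>) \<le> r \<Longrightarrow> norm (\<beta> - \<xi>) \<le> r \<Longrightarrow>
    c0 * (norm (\<alpha> - \<beta>))\<^sup>2 \<le> (vflux p \<alpha> - vflux p \<beta>) \<bullet> (\<alpha> - \<beta>)"
  and v2: "\<And>\<alpha> \<beta>. norm (\<alpha> - \<xi>) \<le> r \<Longrightarrow> norm (\<beta> - \<xi>) \<le> r \<Longrightarrow>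
    norm (vflux p \<alpha> - vflux p \<beta>) \<le> C0 * norm (\<alpha> - \<beta>)"
  using vflux_local[OF xi p] by metis
 define X where "X = norm \<xi> powr q"
 have X: "0 < X" using xi by (simp add: X_def)
 \<comment> \<open>Half of the gap (a1 - a2) |\<xi>|^q; \<open>\<eta>\<close> is the oscillation of
   |w|^q near \<xi> that costs at most the other half.\<close>
 define \<delta> where "\<delta> = (a1 - a2) * X / 2"
 have d: "0 < \<delta>" using a X by (simp add: \<delta>_def)
 define \<eta> where "\<eta> = \<delta> / (\<bar>a1\<bar> + \<bar>a2\<bar> + 1)"
 have eta: "0 < \<eta>" "(\<bar>a1\<bar> + \<bar>a2\<bar>) * \<eta> \<le> \<delta>"
  using d by (auto simp: \<eta>_def field_simps add_pos_nonneg)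
 have "isCont (\<lambda>w::'a. norm w powr q) \<xi>" using xi by (intro continuous_intros) auto
 from LIM_D[OF this[unfolded isCont_def] eta(1)] obtain s where
  s0: "0 < s" "\<forall>w. w \<noteq> \<xi> \<and> norm (w - \<xi>) < s \<longrightarrow> norm (norm w powr q - norm \<xi> powr q) < \<eta>"
  by blast
 have s: "0 < s" "\<bar>norm w powr q - X\<bar> < \<eta>" if "norm (w - \<xi>) < s" for w
  using s0 that eta(1) by (auto simp: X_def, cases "w = \<xi>", auto)
 define \<rho> where "\<rho> = min r s / 4"
 have rho: "0 < \<rho>" "2 * \<rho> \<le> r" "2 * \<rho> < s" using r s0 by (auto simp: \<rho>_def)
 define B where "B = norm \<xi> + \<rho>"
 have B: "0 < B" "\<rho> \<le> B" using rho by (auto simp: B_def add_nonneg_pos)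
 \<comment> \<open>The smallest K >= 4 with K^(1-p) <= 1 / (4 * 2^p), as \<open>vflux_far\<close>
   requires.\<close>
 define K where "K = max 4 ((4 * 2 powr p) powr (1 / (p - 1)))"
 have K: "4 \<le> K" by (simp add: K_def)
 have K2: "K powr (1 - p) \<le> 1 / (4 * 2 powr p)"
 proof -
  have "K powr (1 - p) \<le> ((4 * 2 powr p) powr (1 / (p - 1))) powr (1 - p)"
   using p by (intro powr_mono2') (auto simp: K_def)
  also have "\<dots> = (4 * 2 powr p) powr (- 1)"
  proof -
   have "1 / (p - 1) * (1 - p) = - 1" using p by (simp add: field_simps)
   then show ?thesis by (simp add: powr_powr)
  qed
  also have "\<dots> = 1 / (4 * 2 powr p)" by (simp add: powr_minus_divide)
  finally show ?thesis .
 qed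
 have K3: "\<rho> \<le> K * B" using B rho mult_right_mono[OF K less_imp_le[OF B(1)]] by linarith
 define c1 where "c1 = min (c0 * \<rho> * (K * B) powr (1 - p)) (1 / (4 * 2 powr p))"
 have c1: "0 < c1" using r rho K B by (simp add: c1_def)
 \<comment> \<open>In the far regime each gradient is at most D times their distance, because the
   distance is at least \<rho> and one gradient is at most B.\<close>
 define D where "D = 1 + B / \<rho>"
 have D: "1 < D" using rho B by (simp add: D_def)
 define C1 where "C1 = 2 * D powr (p - 1)"
 define C2 where "C2 = (\<bar>a1\<bar> + \<bar>a2\<bar>) * D powr q * \<rho> powr (q - p)"
 define C where "C = max 1 (max C0 (max C1 C2))"
 have C: "1 \<le> C" "C0 \<le> C" "C1 \<le> C" "C2 \<le> C" by (auto simp: C_def)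
 have mono: "c1 * norm (\<alpha> - \<beta>) powr p \<le> (vflux p \<alpha> - vflux p \<beta>) \<bullet> (\<alpha> - \<beta>)
   \<and> norm \<alpha> \<le> D * norm (\<alpha> - \<beta>) \<and> norm \<beta> \<le> D * norm (\<alpha> - \<beta>)"
  if b: "norm (\<beta> - \<xi>) \<le> \<rho>" "\<rho> \<le> norm (\<alpha> - \<beta>)" for \<alpha> \<beta>
 proof -
  have bB: "norm \<beta> \<le> B" using norm_triangle_sub[of \<beta> \<xi>] b by (simp add: B_def)
  have 1: "c1 * norm (\<alpha> - \<beta>) powr p \<le> (vflux p \<alpha> - vflux p \<beta>) \<bullet> (\<alpha> - \<beta>)"
   unfolding c1_def
  proof (rule vflux_far[OF p rho(1) r(2) _ bB b(2) _ K K2 K3])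
   fix \<alpha>' assume "norm (\<alpha>' - \<beta>) \<le> \<rho>"
   then have "norm (\<alpha>' - \<xi>) \<le> r" using norm_triangle_ineq[of "\<alpha>' - \<beta>" "\<beta> - \<xi>"] b rho by simp
   then show "c0 * (norm (\<alpha>' - \<beta>))\<^sup>2 \<le> (vflux p \<alpha>' - vflux p \<beta>) \<bullet> (\<alpha>' - \<beta>)"
    using b rho by (intro v1) auto
  qed (use B in auto)
  have "B / \<rho> * \<rho> \<le> B / \<rho> * norm (\<alpha> - \<beta>)" using b B rho by (intro mult_left_mono) auto
  then have "B \<le> B / \<rho> * norm (\<alpha> - \<beta>)" using rho by simp
  then have "norm \<beta> \<le> B / \<rho> * norm (\<alpha> - \<beta>)" using bB by simp
  moreover have "norm \<alpha> \<le> norm \<beta> + norm (\<alpha> - \<beta>)" using norm_triangle_sub[of \<alpha> \<beta>] by simp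
  moreover have "D * norm (\<alpha> - \<beta>) = norm (\<alpha> - \<beta>) + B / \<rho> * norm (\<alpha> - \<beta>)" by (simp add: D_def algebra_simps)
  ultimately show ?thesis using 1 by (auto intro: order_trans)
 qed
 have R1: "min c0 c1 * (norm (\<alpha> - \<beta>))\<^sup>2 \<le> (vflux p \<alpha> - vflux p \<beta>) \<bullet> (\<alpha> - \<beta>)
   \<and> norm (vflux p \<alpha> - vflux p \<beta>) \<le> C * norm (\<alpha> - \<beta>)
   \<and> a2 * norm \<beta> powr q - a1 * norm \<alpha> powr q \<le> - \<delta>"
  if h: "norm (\<alpha> - \<xi>) \<le> \<rho> \<or> norm (\<beta> - \<xi>) \<le> \<rho>" and s1: "norm (\<alpha> - \<beta>) \<le> \<rho>" for \<alpha> \<beta>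
 proof -
   have n: "norm (\<alpha> - \<xi>) \<le> 2 * \<rho>" "norm (\<beta> - \<xi>) \<le> 2 * \<rho>"
    using h s1 rho(1) norm_triangle_ineq[of "\<alpha> - \<beta>" "\<beta> - \<xi>"] norm_triangle_ineq[of "\<beta> - \<alpha>" "\<alpha> - \<xi>"]
    by (auto simp: norm_minus_commute)
   have "min c0 c1 * (norm (\<alpha> - \<beta>))\<^sup>2 \<le> c0 * (norm (\<alpha> - \<beta>))\<^sup>2" by (intro mult_right_mono) auto
   then have 1: "min c0 c1 * (norm (\<alpha> - \<beta>))\<^sup>2 \<le> (vflux p \<alpha> - vflux p \<beta>) \<bullet> (\<alpha> - \<beta>)"
    using v1[of \<alpha> \<beta>] n rho by simp
   have "C0 * norm (\<alpha> - \<beta>) \<le> C * norm (\<alpha> - \<beta>)" using C by (intro mult_right_mono) auto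
   then have 2: "norm (vflux p \<alpha> - vflux p \<beta>) \<le> C * norm (\<alpha> - \<beta>)"
    using v2[of \<alpha> \<beta>] n rho by simp
   have e: "\<bar>norm \<alpha> powr q - X\<bar> \<le> \<eta>" "\<bar>norm \<beta> powr q - X\<bar> \<le> \<eta>"
    using s(2)[of \<alpha>] s(2)[of \<beta>] n rho by auto
   have ct: "\<bar>a * t\<bar> \<le> \<bar>a\<bar> * \<eta>" if "\<bar>t\<bar> \<le> \<eta>" for a t :: real
    unfolding abs_mult using that by (rule mult_left_mono) simp
   have "a2 * (norm \<beta> powr q - X) \<le> \<bar>a2\<bar> * \<eta>" "- (a1 * (norm \<alpha> powr q - X)) \<le> \<bar>a1\<bar> * \<eta>"
    using ct[OF e(2), of a2] ct[OF e(1), of a1] by linarith+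
   then have 3: "a2 * norm \<beta> powr q - a1 * norm \<alpha> powr q \<le> - \<delta>"
   proof -
    have "a2 * (norm \<beta> powr q - X) = a2 * norm \<beta> powr q - a2 * X"
     "- (a1 * (norm \<alpha> powr q - X)) = a1 * X - a1 * norm \<alpha> powr q"
     "(\<bar>a1\<bar> + \<bar>a2\<bar>) * \<eta> = \<bar>a1\<bar> * \<eta> + \<bar>a2\<bar> * \<eta>" "a1 * X - a2 * X = 2 * \<delta>"
     by (simp_all add: \<delta>_def algebra_simps)
    moreover note eta(2)
    ultimately show ?thesis
     using \<open>a2 * (norm \<beta> powr q - X) \<le> \<bar>a2\<bar> * \<eta>\<close> \<open>- (a1 * (norm \<alpha> powr q - X)) \<le> \<bar>a1\<bar> * \<eta>\<close>
     by linarith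
   qed
   show ?thesis using 1 2 3 by blast
 qed
 have R2: "min c0 c1 * norm (\<alpha> - \<beta>) powr p \<le> (vflux p \<alpha> - vflux p \<beta>) \<bullet> (\<alpha> - \<beta>)
   \<and> norm (vflux p \<alpha> - vflux p \<beta>) \<le> C * norm (\<alpha> - \<beta>) powr (p - 1)
   \<and> a2 * norm \<beta> powr q - a1 * norm \<alpha> powr q \<le> C * norm (\<alpha> - \<beta>) powr p"
  if h: "norm (\<alpha> - \<xi>) \<le> \<rho> \<or> norm (\<beta> - \<xi>) \<le> \<rho>" and s2: "\<rho> \<le> norm (\<alpha> - \<beta>)" for \<alpha> \<beta>
 proof -
   define x where "x = norm (\<alpha> - \<beta>)"
   have x: "\<rho> \<le> x" "0 < x" using s2 rho by (auto simp: x_def)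
   have m: "c1 * x powr p \<le> (vflux p \<alpha> - vflux p \<beta>) \<bullet> (\<alpha> - \<beta>)
    \<and> norm \<alpha> \<le> D * x \<and> norm \<beta> \<le> D * x"
    using h
   proof
    assume "norm (\<alpha> - \<xi>) \<le> \<rho>"
    from mono[OF this, of \<beta>] s2 show ?thesis
     by (simp add: x_def norm_minus_commute inner_diff_left inner_diff_right algebra_simps)
   qed (use mono s2 x_def in blast)
   have "min c0 c1 * x powr p \<le> c1 * x powr p" by (intro mult_right_mono) auto
   then have 1: "min c0 c1 * x powr p \<le> (vflux p \<alpha> - vflux p \<beta>) \<bullet> (\<alpha> - \<beta>)" using m by simp
   have pw: "norm \<alpha> powr t \<le> D powr t * x powr t" "norm \<beta> powr t \<le> D powr t * x powr t" if "0 \<le> t" for t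
    using m that x D powr_mono2[of t "norm \<alpha>" "D * x"] powr_mono2[of t "norm \<beta>" "D * x"]
    by (auto simp: powr_mult)
   have "norm (vflux p \<alpha> - vflux p \<beta>) \<le> norm \<alpha> powr (p - 1) + norm \<beta> powr (p - 1)"
    using norm_triangle_ineq4[of "vflux p \<alpha>" "vflux p \<beta>"] by (simp add: norm_vflux)
   also have "\<dots> \<le> C1 * x powr (p - 1)" using pw[of "p - 1"] p by (simp add: C1_def)
   also have "\<dots> \<le> C * x powr (p - 1)" using C by (intro mult_right_mono) auto
   finally have 2: "norm (vflux p \<alpha> - vflux p \<beta>) \<le> C * x powr (p - 1)" .
   have "a2 * norm \<beta> powr q - a1 * norm \<alpha> powr q \<le> \<bar>a2\<bar> * norm \<beta> powr q + \<bar>a1\<bar> * norm \<alpha> powr q"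
    using mult_right_mono[OF abs_ge_self[of a2], of "norm \<beta> powr q"]
     mult_right_mono[OF abs_ge_minus_self[of a1], of "norm \<alpha> powr q"] by simp
   also have "\<dots> \<le> \<bar>a2\<bar> * (D powr q * x powr q) + \<bar>a1\<bar> * (D powr q * x powr q)"
    using pw[of q] q by (intro add_mono mult_left_mono) auto
   also have "\<dots> = (\<bar>a1\<bar> + \<bar>a2\<bar>) * D powr q * x powr q" by (simp add: algebra_simps)
   also have "\<dots> \<le> (\<bar>a1\<bar> + \<bar>a2\<bar>) * D powr q * (\<rho> powr (q - p) * x powr p)"
   proof (intro mult_left_mono)
    have "x powr (q - p) \<le> \<rho> powr (q - p)" using x rho q by (intro powr_mono2') auto
    then have "x powr (q - p) * x powr p \<le> \<rho> powr (q - p) * x powr p" by (intro mult_right_mono) auto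
    then show "x powr q \<le> \<rho> powr (q - p) * x powr p" by (simp add: powr_add[symmetric])
   qed auto
   also have "\<dots> = C2 * x powr p" by (simp add: C2_def)
   also have "\<dots> \<le> C * x powr p" using C by (intro mult_right_mono) auto
   finally have 3: "a2 * norm \<beta> powr q - a1 * norm \<alpha> powr q \<le> C * x powr p" .
   show ?thesis using 1 2 3 by (simp add: x_def)
 qed
 show ?thesis
 proof (rule that[of \<rho> "min c0 c1" C \<delta>])
  show "0 < \<rho>" "0 < min c0 c1" "0 < C" "0 < \<delta>" using rho r c1 C d by auto
 qed (intro allI impI, rule R1 R2; assumption)+
qed

section \<open>The pointwise energy inequality\<close>

text \<open>Young's inequality by cases: either y <= \<eta> \<kappa> x, and the first term wins, or
  \<kappa> x < y / \<eta>, and the second does. The exponent n >= p of the cut-off gives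
  \<kappa>^(n-1) <= \<kappa>^(p-1), the power that goes with x^(p-1).\<close>

lemma young_cutoff:
 fixes n :: nat and p \<eta> \<kappa> x y :: real
 assumes p: "1 < p" "p \<le> n" and e: "0 < \<eta>" and k: "0 \<le> \<kappa>" "\<kappa> \<le> 1" and x: "0 < x" and y: "0 \<le> y"
 shows "\<kappa> ^ (n - 1) * x powr (p - 1) * y \<le> \<eta> * \<kappa> ^ n * x powr p + \<eta> powr (1 - p) * y powr p"
proof -
 have n: "n \<ge> 2" using p by linarith
 have xp: "x powr p = x powr (p - 1) * x" using powr_add[of x "p - 1" 1] x by simp
 have kn: "\<kappa> ^ n = \<kappa> ^ (n - 1) * \<kappa>" using n by (cases n) auto
 show ?thesis
 proof (cases "y \<le> \<eta> * \<kappa> * x")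
  case True
  have "\<kappa> ^ (n - 1) * x powr (p - 1) * y \<le> \<kappa> ^ (n - 1) * x powr (p - 1) * (\<eta> * \<kappa> * x)"
   using True k by (intro mult_left_mono) auto
  also have "\<dots> = \<eta> * \<kappa> ^ n * x powr p" by (simp add: xp kn)
  finally show ?thesis by (simp add: add_increasing2)
 next
  case False
  have y0: "0 < y" using False e k x by (smt (verit) mult_nonneg_nonneg)
  have kx: "\<kappa> * x \<le> y / \<eta>" using False e by (simp add: field_simps)
  have "\<kappa> ^ (n - 1) \<le> \<kappa> powr (p - 1)"
  proof (cases "\<kappa> = 0")
   case False
   then have "\<kappa> ^ (n - 1) = \<kappa> powr real (n - 1)" using k by (simp add: powr_realpow)
   also have "\<dots> \<le> \<kappa> powr (p - 1)" using k p n False by (intro powr_mono') (auto simp: of_nat_diff)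
   finally show ?thesis .
  qed (use n in \<open>auto simp: power_0_left\<close>)
  then have "\<kappa> ^ (n - 1) * x powr (p - 1) * y \<le> \<kappa> powr (p - 1) * x powr (p - 1) * y"
   using y by (intro mult_right_mono) auto
  also have "\<dots> = (\<kappa> * x) powr (p - 1) * y" using k x by (simp add: powr_mult)
  also have "\<dots> \<le> (y / \<eta>) powr (p - 1) * y" using kx k x p y by (intro mult_right_mono powr_mono2) auto
  also have "\<dots> = \<eta> powr (1 - p) * y powr p"
  proof -
   have "(y / \<eta>) powr (p - 1) = y powr (p - 1) / \<eta> powr (p - 1)" using y e by (simp add: powr_divide)
   moreover have "\<eta> powr (1 - p) = 1 / \<eta> powr (p - 1)" using powr_minus_divide[of \<eta> "p - 1"] by simp
   moreover have "y powr p = y powr (p - 1) * y" using powr_add[of y "p - 1" 1] y0 by simp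
   ultimately show ?thesis by simp
  qed
  finally show ?thesis using e k by (simp add: add_increasing)
 qed
qed

text \<open>This is the integrand of the energy estimate in real variables: Y is the truncated
  difference, \<kappa> the cut-off with y = |grad \<kappa>|, x the distance of the gradients, S and
  H the inner product and the norm of the flux difference, f the difference of lower-order terms,
  and Z bounds the gradient of a quadratic perturbation. The restriction Y <= eps lets the quadratic
  terms in Y be absorbed in the far regime. The jump at y = 0 makes the remainder dominate y itself
  also for small y, where y^p is too small.\<close>

lemma energy_pointwise:
 fixes n :: nat and p \<rho> c C \<delta> Z :: real
 assumes p: "1 < p" "p \<le> n" and pos: "0 < \<rho>" "0 < c" "0 < C" "0 < \<delta>" "0 \<le> Z"
 obtains eps0 C1 C2 where "0 < eps0" "eps0 \<le> 1" "0 \<le> C1" "0 \<le> C2"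
  "\<forall>eps Y (\<kappa>::real) x S H f y. 0 < eps \<longrightarrow> eps \<le> eps0 \<longrightarrow> 0 \<le> Y \<longrightarrow> Y \<le> eps \<longrightarrow> 0 \<le> \<kappa> \<longrightarrow> \<kappa> \<le> 1 \<longrightarrow>
   0 \<le> x \<longrightarrow> 0 \<le> y \<longrightarrow>
   (x \<le> \<rho> \<longrightarrow> c * x\<^sup>2 \<le> S \<and> H \<le> C * x \<and> f \<le> - \<delta>) \<longrightarrow>
   (\<rho> \<le> x \<longrightarrow> c * x powr p \<le> S \<and> H \<le> C * x powr (p - 1) \<and> f \<le> C * x powr p) \<longrightarrow>
   eps * \<kappa> ^ n * Y * x + \<delta> * \<kappa> ^ n * Y\<^sup>2 - C1 * eps\<^sup>2 * \<kappa> ^ n * Y - C2 * (y powr p + (if y = 0 then 0 else 1))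
   \<le> 2 * Y * \<kappa> ^ n * (S - eps * Z * H) - n * \<kappa> ^ (n - 1) * Y\<^sup>2 * (H * y) - f * \<kappa> ^ n * Y\<^sup>2"
proof -
 have n: "n \<ge> 2" using p by linarith
 \<comment> \<open>Makes the first Young term equal to a quarter of c x^p.\<close>
 define \<eta> where "\<eta> = c / (4 * n * C)"
 have eta: "0 < \<eta>" using pos n by (simp add: \<eta>_def)
 \<comment> \<open>The constant that completes the square 2 c x^2 - (2 Z C + 1) eps x + C1
   eps^2.\<close>
 define C1 where "C1 = (2 * Z * C + 1)\<^sup>2 / (8 * c)"
 define C2 where "C2 = max (n * C * \<rho>) (n * C * \<eta> powr (1 - p))"
 \<comment> \<open>Each entry but the first bounds one error of the far regime by a quarter of c
   x^p; the coercive term 2 c x^p absorbs all of them together with the Young term.\<close>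
 define eps0 where "eps0 = Min {1, c * \<rho> / (8 * C * (Z + 1)), c / (4 * C), c * \<rho> powr (p - 1) / 4, c * \<rho> powr p / (4 * \<delta>)}"
 have e0: "0 < eps0" "eps0 \<le> 1" "eps0 \<le> c * \<rho> / (8 * C * (Z + 1))" "eps0 \<le> c / (4 * C)"
  "eps0 \<le> c * \<rho> powr (p - 1) / 4" "eps0 \<le> c * \<rho> powr p / (4 * \<delta>)"
 proof -
  show "0 < eps0" using pos by (auto simp: eps0_def)
 qed (unfold eps0_def, rule Min_le; simp)+
 show ?thesis
 proof (rule that[of eps0 C1 C2], goal_cases)
  case 5
  show ?case
  proof (intro allI impI, goal_cases)
  case (1 eps Y \<kappa> x S H f y)
  note e = 1(1,2) and Y = 1(3,4) and k = 1(5,6) and x = 1(7) and y = 1(8)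
   and sm = 1(9)[rule_format] and la = 1(10)[rule_format]
  define k where "k = \<kappa> ^ n"
  have k1: "0 \<le> k" "k \<le> 1" "0 \<le> \<kappa> ^ (n - 1)" "\<kappa> ^ (n - 1) \<le> 1" using k by (auto simp: k_def power_le_one)
  have Y1: "Y \<le> 1" using Y e e0 by linarith
  have Y2: "0 \<le> Y\<^sup>2" "Y\<^sup>2 \<le> 1" using Y Y1 by (auto simp: power_le_one)
  have Y3: "Y\<^sup>2 \<le> Y" using Y Y1 by (auto simp: power2_eq_square mult_left_le)
  define j where "j = (if y = 0 then 0 else 1::real)"
  define D where "D = y powr p + j"
  have D: "y \<le> D" "y powr p \<le> D" "0 \<le> D"
  proof -
   have "y \<le> y powr p" if "1 \<le> y" using powr_mono[of 1 p y] that p by simp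
   then show "y \<le> D" using y by (cases "1 \<le> y") (auto simp: D_def j_def intro: add_increasing add_increasing2)
  qed (auto simp: D_def j_def)
  have C2D: "n * C * \<rho> * D \<le> C2 * D" "n * C * \<eta> powr (1 - p) * D \<le> C2 * D"
   using D by (auto simp: C2_def intro!: mult_right_mono)
  have Yk: "0 \<le> Y * k" "0 \<le> k * Y\<^sup>2" using Y k1 by auto
  have "eps * k * Y * x + \<delta> * k * Y\<^sup>2 - C1 * eps\<^sup>2 * k * Y - C2 * D
   \<le> 2 * Y * k * (S - eps * Z * H) - n * \<kappa> ^ (n - 1) * Y\<^sup>2 * (H * y) - f * k * Y\<^sup>2"
  proof (cases "x \<le> \<rho>")
   case True
   note s = sm[OF True]
   have 1: "n * \<kappa> ^ (n - 1) * Y\<^sup>2 * (H * y) \<le> C2 * D"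
   proof -
    have a: "H * y \<le> C * \<rho> * D"
    proof -
     have "H * y \<le> (C * \<rho>) * y" using s True pos y by (intro mult_right_mono) (auto intro: order_trans mult_left_mono)
     also have "\<dots> \<le> (C * \<rho>) * D" using D pos by (intro mult_left_mono) auto
     finally show ?thesis .
    qed
    have "n * \<kappa> ^ (n - 1) * Y\<^sup>2 * (H * y) \<le> n * \<kappa> ^ (n - 1) * Y\<^sup>2 * (C * \<rho> * D)"
     using a k1 Y2 by (intro mult_left_mono) auto
    also have "\<dots> \<le> real n * 1 * (C * \<rho> * D)"
    proof (intro mult_right_mono)
     have "\<kappa> ^ (n - 1) * Y\<^sup>2 \<le> 1 * 1" using k1 Y2 by (intro mult_mono) auto
     then show "n * \<kappa> ^ (n - 1) * Y\<^sup>2 \<le> real n * 1" by (simp add: mult.assoc mult_left_le)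
    qed (use D pos in auto)
    finally show ?thesis using C2D by (simp add: mult.assoc)
   qed
   have 2: "eps * x - C1 * eps\<^sup>2 \<le> 2 * (S - eps * Z * H)"
   proof -
    have "eps * Z * H \<le> eps * Z * (C * x)" using s e pos by (intro mult_left_mono) auto
    then have "2 * c * x\<^sup>2 - 2 * (eps * Z * (C * x)) \<le> 2 * (S - eps * Z * H)" using s by simp
    moreover have "0 \<le> 2 * c * (x - (2 * Z * C + 1) * eps / (4 * c))\<^sup>2" using pos by simp
    moreover have "2 * c * (x - (2 * Z * C + 1) * eps / (4 * c))\<^sup>2
     = 2 * c * x\<^sup>2 - (2 * Z * C + 1) * eps * x + C1 * eps\<^sup>2"
     using pos by (simp add: C1_def power2_eq_square field_simps)
    ultimately show ?thesis by (simp add: algebra_simps)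
   qed
   have 3: "f * (k * Y\<^sup>2) \<le> - \<delta> * (k * Y\<^sup>2)" using s Yk by (intro mult_right_mono) auto
   have "(Y * k) * (eps * x - C1 * eps\<^sup>2) \<le> (Y * k) * (2 * (S - eps * Z * H))"
    using 2 Yk by (intro mult_left_mono) auto
   then show ?thesis using 1 3 by (simp add: algebra_simps)
  next
   case False
   then have x0: "\<rho> \<le> x" "0 < x" using pos by auto
   note s = la[OF x0(1)]
   define X where "X = x powr p"
   have X: "0 < X" using x0 by (simp add: X_def)
   have xX: "x powr (p - 1) * \<rho> \<le> X"
   proof -
    have "x powr (p - 1) * \<rho> \<le> x powr (p - 1) * x" using x0 by (intro mult_left_mono) auto
    then show ?thesis using powr_add[of x "p - 1" 1] x0 by (simp add: X_def)
   qed
   have xX2: "x * \<rho> powr (p - 1) \<le> X"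
   proof -
    have "x * \<rho> powr (p - 1) \<le> x * x powr (p - 1)" using x0 pos p by (intro mult_left_mono powr_mono2) auto
    then show ?thesis using powr_add[of x "p - 1" 1] x0 by (simp add: X_def mult.commute)
   qed
   have xX3: "\<rho> powr p \<le> X" using x0 pos p unfolding X_def by (intro powr_mono2) auto
   have 1: "2 * (eps * Z * H) \<le> c / 4 * X"
   proof -
    have "eps * Z * H \<le> eps * Z * (C * x powr (p - 1))" using s e pos by (intro mult_left_mono) auto
    also have "\<dots> \<le> eps * (Z + 1) * (C * x powr (p - 1))" using e pos by (intro mult_right_mono mult_left_mono) auto
    also have "\<dots> \<le> c * \<rho> / (8 * C * (Z + 1)) * (Z + 1) * (C * x powr (p - 1))"
     using e e0 pos by (intro mult_right_mono) auto
    also have "\<dots> = c / 8 * (x powr (p - 1) * \<rho>)"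
    proof -
     have "c * \<rho> / (8 * C * W) * W * (C * t) = c / 8 * (t * \<rho>)" if "W \<noteq> 0" for W t
      using pos that by (simp add: field_simps)
     then show ?thesis using pos by simp
    qed
    also have "\<dots> \<le> c / 8 * X" using xX pos by (intro mult_left_mono) auto
    finally show ?thesis by simp
   qed
   have 2: "n * \<kappa> ^ (n - 1) * Y\<^sup>2 * (H * y) \<le> (Y * k) * (c / 4 * X) + C2 * D"
   proof -
    have "H * y \<le> C * x powr (p - 1) * y" using s y by (intro mult_right_mono) auto
    then have "n * \<kappa> ^ (n - 1) * Y\<^sup>2 * (H * y) \<le> n * \<kappa> ^ (n - 1) * Y\<^sup>2 * (C * x powr (p - 1) * y)"
     using k1 Y2 by (intro mult_left_mono) auto
    also have "\<dots> = n * C * Y\<^sup>2 * (\<kappa> ^ (n - 1) * x powr (p - 1) * y)" by simp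
    also have "\<dots> \<le> n * C * Y\<^sup>2 * (\<eta> * \<kappa> ^ n * x powr p + \<eta> powr (1 - p) * y powr p)"
     by (intro mult_left_mono young_cutoff p eta k x0 y) (use pos Y2 in auto)
    also have "\<dots> = Y\<^sup>2 * (k * (c / 4 * X)) + n * C * \<eta> powr (1 - p) * y powr p * Y\<^sup>2"
     using pos n by (simp add: \<eta>_def k_def X_def field_simps)
    also have "\<dots> \<le> Y * (k * (c / 4 * X)) + n * C * \<eta> powr (1 - p) * y powr p * 1"
     using Y2 Y3 k1 pos X by (intro add_mono mult_right_mono mult_left_mono) auto
    also have "\<dots> \<le> Y * (k * (c / 4 * X)) + n * C * \<eta> powr (1 - p) * D"
     using D pos by (simp add: mult_left_mono)
    finally show ?thesis using C2D by (simp add: mult.assoc)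
   qed
   have Ye: "Y\<^sup>2 \<le> Y * eps" using Y by (simp add: power2_eq_square mult_left_mono)
   have 3: "f * (k * Y\<^sup>2) \<le> (Y * k) * (c / 4 * X)"
   proof -
    have "f * (k * Y\<^sup>2) \<le> (C * X) * (k * Y\<^sup>2)" using s Yk by (intro mult_right_mono) (auto simp: X_def)
    also have "\<dots> \<le> (C * X) * (k * (Y * eps))" using Ye k1 pos X by (intro mult_left_mono) auto
    also have "\<dots> = (Y * k * X * C) * eps" by simp
    also have "\<dots> \<le> (Y * k * X * C) * (c / (4 * C))" using e e0 Y k1 X pos by (intro mult_left_mono) auto
    finally show ?thesis using pos by (simp add: field_simps)
   qed
   have 4: "eps * x \<le> c / 4 * X"
   proof -
    have "eps * x \<le> c * \<rho> powr (p - 1) / 4 * x" using e e0 x0 by (intro mult_right_mono) auto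
    also have "\<dots> = c / 4 * (x * \<rho> powr (p - 1))" by simp
    also have "\<dots> \<le> c / 4 * X" using xX2 pos by (intro mult_left_mono) auto
    finally show ?thesis .
   qed
   have 5: "\<delta> * (k * Y\<^sup>2) \<le> (Y * k) * (c / 4 * X)"
   proof -
    have "\<delta> * (k * Y\<^sup>2) \<le> \<delta> * (k * (Y * eps))" using Ye k1 pos by (intro mult_left_mono) auto
    also have "\<dots> = (Y * k * \<delta>) * eps" by simp
    also have "\<dots> \<le> (Y * k * \<delta>) * (c * \<rho> powr p / (4 * \<delta>))" using e e0 Y k1 pos by (intro mult_left_mono) auto
    also have "\<dots> = (Y * k) * (c / 4 * \<rho> powr p)" using pos by (simp add: field_simps)
    also have "\<dots> \<le> (Y * k) * (c / 4 * X)" using xX3 pos Yk by (intro mult_left_mono) auto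
    finally show ?thesis .
   qed
   have 6: "(Y * k) * (eps * x) \<le> (Y * k) * (c / 4 * X)" using 4 Yk by (intro mult_left_mono) auto
   have 7: "(Y * k) * (2 * c * X - c / 4 * X) \<le> (Y * k) * (2 * (S - eps * Z * H))"
    using s 1 Yk by (intro mult_left_mono) (auto simp: X_def)
   have 8: "0 \<le> C1 * eps\<^sup>2 * k * Y" using k1 Y pos by (auto simp: C1_def)
   have 9: "0 \<le> (Y * k) * (c * X)" using Yk pos X by auto
   show ?thesis using 2 3 5 6 7 8 9 by (simp add: algebra_simps)
  qed
  then show ?case by (simp add: k_def D_def j_def)
  qed
 qed (use e0 pos in \<open>auto simp: C1_def C2_def le_max_iff_disj\<close>)
qed

section \<open>Energy on superlevel sets and De Giorgi iteration\<close>

text \<open>With \<tau> = 4^(-1/\<alpha>), one has 4 \<tau>^\<alpha> = 1, so the bound X j <= X 0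
  \<tau>^j reproduces itself: the superlinear gain \<tau>^(j \<alpha>) cancels 4^j, and the
  smallness of X 0 supplies the next factor \<tau>.\<close>

lemma fast_geometric_decay:
 fixes X :: "nat \<Rightarrow> real"
 assumes "\<And>j. 0 \<le> X j" and rec: "\<And>j. X (Suc j) \<le> C * 4 ^ j * X j powr (1 + \<alpha>)"
  and "0 < \<alpha>" "0 \<le> C" "C * X 0 powr \<alpha> \<le> 4 powr (- 1 / \<alpha>)"
 shows "X \<longlonglongrightarrow> 0"
proof -
 define \<tau> :: real where "\<tau> = 4 powr (- 1 / \<alpha>)"
 have tau: "0 < \<tau>" "\<tau> < 1" "4 * \<tau> powr \<alpha> = 1"
 proof -
  have "\<tau> powr \<alpha> = 4 powr (- 1)" unfolding \<tau>_def powr_powr using assms(3) by simp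
  then show "4 * \<tau> powr \<alpha> = 1" by (simp add: powr_minus_divide)
 qed (use assms(3) in \<open>auto simp: \<tau>_def powr_less_one\<close>)
 have bound: "X j \<le> X 0 * \<tau> ^ j" for j
 proof (induction j)
  case (Suc j)
  have "(4 * \<tau> powr \<alpha>) ^ j = 1" using tau by simp
  then have t: "4 ^ j * (\<tau> ^ j) powr \<alpha> = 1"
   using tau by (simp add: power_mult_distrib powr_power powr_realpow[symmetric] powr_powr mult.commute)
  have "X j powr (1 + \<alpha>) \<le> (X 0 * \<tau> ^ j) powr (1 + \<alpha>)"
   using Suc assms by (intro powr_mono2) auto
  also have "\<dots> = (X 0 * \<tau> ^ j) * (X 0 powr \<alpha> * (\<tau> ^ j) powr \<alpha>)"
   using assms(1)[of 0] tau by (simp add: powr_add powr_mult)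
  finally have "C * 4 ^ j * X j powr (1 + \<alpha>) \<le> C * 4 ^ j * ((X 0 * \<tau> ^ j) * (X 0 powr \<alpha> * (\<tau> ^ j) powr \<alpha>))"
   using assms by (intro mult_left_mono) auto
  also have "\<dots> = (C * X 0 powr \<alpha>) * (X 0 * \<tau> ^ j) * (4 ^ j * (\<tau> ^ j) powr \<alpha>)" by simp
  also have "\<dots> = (C * X 0 powr \<alpha>) * (X 0 * \<tau> ^ j)" unfolding t by simp
  also have "\<dots> \<le> \<tau> * (X 0 * \<tau> ^ j)" using assms tau by (intro mult_right_mono) (auto simp: \<tau>_def)
  finally show ?case using rec[of j] by (simp add: mult_ac)
 qed simp
 show ?thesis
 proof (rule tendsto_sandwich[OF _ _ tendsto_const])
  show "(\<lambda>j. X 0 * \<tau> ^ j) \<longlonglongrightarrow> 0"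
   using tau by (intro tendsto_mult_right_zero LIMSEQ_realpow_zero) auto
 qed (use bound assms in auto)
qed

lemma GDERIV_translate:
 fixes u :: "'a::euclidean_space \<Rightarrow> real"
 assumes "GDERIV u (x - b) :> D" shows "GDERIV (\<lambda>x. u (x - b)) x :> D"
 using GDERIV_isometry[of "\<lambda>x. x" u x "- b" D] assms by (simp add: linear_iff)

lemma hole_cutoff_translate:
 fixes x0 :: "'a::euclidean_space"
 shows "C1_on U (\<lambda>x. hole_cutoff m (x - x0))"
  "grad (\<lambda>x. hole_cutoff m (x - x0)) x = grad (hole_cutoff m) (x - x0)"
  "GDERIV (\<lambda>x. hole_cutoff m (x - x0)) x :> grad (hole_cutoff m) (x - x0)"
proof -
 have C: "C1_on UNIV (hole_cutoff m :: 'a \<Rightarrow> real)" by (rule hole_cutoff_props)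
 have 1: "GDERIV (\<lambda>x. hole_cutoff m (x - x0)) x :> grad (hole_cutoff m) (x - x0)" for x
  by (rule GDERIV_translate) (use C1_onD(1)[OF C] in auto)
 then show "GDERIV (\<lambda>x. hole_cutoff m (x - x0)) x :> grad (hole_cutoff m) (x - x0)"
  "grad (\<lambda>x. hole_cutoff m (x - x0)) x = grad (hole_cutoff m) (x - x0)"
  by (auto intro: grad_eqI)
 show "C1_on U (\<lambda>x. hole_cutoff m (x - x0))"
  by (rule C1_onI[OF 1]) (intro continuous_on_compose2[OF C1_onD(2)[OF C]] continuous_intros, auto)
qed

text \<open>The indicator pays for the jump at y = 0 in the remainder of the pointwise energy
  inequality: the gradient of the cut-off vanishes outside the ball.\<close>

lemma hole_energy:
 fixes x0 :: "'a::euclidean_space" and p :: real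
 assumes "1 < p" "p \<le> DIM('a)"
 defines "E \<equiv> \<lambda>m x. norm (grad (hole_cutoff m) (x - x0)) powr p + indicator (ball x0 (1 / 2 ^ m)) x"
 shows "integrable lborel (E m)" "(\<lambda>m. LINT x|lborel. E m x) \<longlonglongrightarrow> 0"
  "(\<lambda>m. measure lborel (ball x0 (1 / 2 ^ m))) \<longlonglongrightarrow> 0"
proof -
 note e = hole_cutoff_energy[OF assms(1,2)]
 let ?f = "\<lambda>m (x::'a). norm (grad (hole_cutoff m) x) powr p"
 have bm: "?f m \<in> borel_measurable borel" for m
  using e(1)[of m] borel_measurable_integrable by auto
 have i1: "integrable lborel (\<lambda>x. ?f m (x - x0))" for m
 proof (rule integrable_compact_support[of "cball x0 1"])
  have C: "C1_on UNIV (hole_cutoff m :: 'a \<Rightarrow> real)" by (rule hole_cutoff_props)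
  show "continuous_on (cball x0 1) (\<lambda>x. ?f m (x - x0))"
   using assms by (intro continuous_on_norm_powr continuous_on_compose2[OF C1_onD(2)[OF C]] continuous_intros) auto
  fix x assume "x \<notin> cball x0 1"
  then have "1 \<le> norm (x - x0)" by (simp add: dist_norm norm_minus_commute)
  moreover have "1 / 2 ^ m \<le> (1::real)" by simp
  ultimately have "grad (hole_cutoff m) (x - x0) = 0" by (intro hole_cutoff_props) linarith
  then show "?f m (x - x0) = 0" by simp
 qed simp
 have i2: "integrable lborel (indicator (ball x0 (1 / 2 ^ m)) :: 'a \<Rightarrow> real)" for m
  using emeasure_lborel_ball_finite[of x0 "1 / 2 ^ m"] by (intro integrable_real_indicator) auto
 show "integrable lborel (E m)" for m unfolding E_def using i1 i2 by (intro Bochner_Integration.integrable_add)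
 show l3: "(\<lambda>m. measure lborel (ball x0 (1 / 2 ^ m))) \<longlonglongrightarrow> 0"
 proof -
  have "(\<lambda>m. unit_ball_vol DIM('a) * (1 / 2 ^ m) ^ DIM('a)) \<longlonglongrightarrow> unit_ball_vol DIM('a) * 0 ^ DIM('a)"
   using LIMSEQ_realpow_zero[of "1/2::real"] by (intro tendsto_intros) (simp add: power_one_over)
  then show ?thesis by (simp add: content_ball power_0_left)
 qed
 have "(LINT x|lborel. E m x) = (LINT x|lborel. ?f m x) + measure lborel (ball x0 (1 / 2 ^ m))" for m
 proof -
  have "(LINT x|lborel. E m x) = (LINT x|lborel. ?f m (x - x0)) + (LINT x|lborel. indicator (ball x0 (1 / 2 ^ m)) x)"
   unfolding E_def using i1 i2 by (rule Bochner_Integration.integral_add)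
  moreover have "(LINT x|lborel. ?f m (x - x0)) = (LINT x|lborel. ?f m x)"
   using integral_lborel_isometry[OF bm, of "\<lambda>x. x" m "- x0"] by (simp add: linear_iff)
  ultimately show ?thesis by simp
 qed
 then show "(\<lambda>m. LINT x|lborel. E m x) \<longlonglongrightarrow> 0"
  using tendsto_add[OF e(2) l3] by simp
qed

text \<open>\<open>Psi\<close> is the difference v - z, lowered by M and lifted by a small
  paraboloid of height eps that confines its positive part to the ball of half radius. Both
  equations are tested with \<kappa>^n times the squared positive part of \<open>Psi\<close>,
  \<kappa> cutting out the centre, and subtracted. Keeping the term with \<open>\<delta>\<close>
  gives a bound cubic in eps, which later makes the first superlevel set small; keeping the gradient
  term and applying the Sobolev inequality gives the superlinear recursion.\<close>

lemma level_energy: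
 fixes x0 :: "'a::euclidean_space" and v z :: "'a \<Rightarrow> real" and n m :: nat and p q a1 a2 r1 eps l :: real
 assumes p: "1 < p" "p \<le> DIM('a)" "p \<le> n" and q: "0 < q" and r1: "0 < r1"
  and v: "wsol p q a1 (ball x0 r1 - {x0}) v" and z: "wsol p q a2 (ball x0 r1 - {x0}) z"
  and M: "\<And>x. x \<in> ball x0 r1 - {x0} \<Longrightarrow> v x - z x \<le> M"
  and reg1: "\<And>x. x \<in> ball x0 r1 - {x0} \<Longrightarrow> norm (grad v x - grad z x) \<le> \<rho> \<Longrightarrow>
   c * (norm (grad v x - grad z x))\<^sup>2 \<le> (vflux p (grad v x) - vflux p (grad z x)) \<bullet> (grad v x - grad z x)
   \<and> norm (vflux p (grad v x) - vflux p (grad z x)) \<le> C * norm (grad v x - grad z x)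
   \<and> a2 * norm (grad z x) powr q - a1 * norm (grad v x) powr q \<le> - \<delta>"
  and reg2: "\<And>x. x \<in> ball x0 r1 - {x0} \<Longrightarrow> \<rho> \<le> norm (grad v x - grad z x) \<Longrightarrow>
   c * norm (grad v x - grad z x) powr p \<le> (vflux p (grad v x) - vflux p (grad z x)) \<bullet> (grad v x - grad z x)
   \<and> norm (vflux p (grad v x) - vflux p (grad z x)) \<le> C * norm (grad v x - grad z x) powr (p - 1)
   \<and> a2 * norm (grad z x) powr q - a1 * norm (grad v x) powr q \<le> C * norm (grad v x - grad z x) powr p"
  and PW: "\<And>Y (\<kappa>::real) x S H f y. 0 \<le> Y \<Longrightarrow> Y \<le> eps \<Longrightarrow> 0 \<le> \<kappa> \<Longrightarrow> \<kappa> \<le> 1 \<Longrightarrow>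
   0 \<le> x \<Longrightarrow> 0 \<le> y \<Longrightarrow>
   (x \<le> \<rho> \<Longrightarrow> c * x\<^sup>2 \<le> S \<and> H \<le> C * x \<and> f \<le> - \<delta>) \<Longrightarrow>
   (\<rho> \<le> x \<Longrightarrow> c * x powr p \<le> S \<and> H \<le> C * x powr (p - 1) \<and> f \<le> C * x powr p) \<Longrightarrow>
   eps * \<kappa> ^ n * Y * x + \<delta> * \<kappa> ^ n * Y\<^sup>2 - C1 * eps\<^sup>2 * \<kappa> ^ n * Y - C2 * (y powr p + (if y = 0 then 0 else 1))
   \<le> 2 * Y * \<kappa> ^ n * (S - eps * (4 / r1) * H) - n * \<kappa> ^ (n - 1) * Y\<^sup>2 * (H * y) - f * \<kappa> ^ n * Y\<^sup>2"
  and eps: "0 < eps" "eps \<le> 1" "0 \<le> l" "0 \<le> C1" "0 \<le> C2" "0 < \<delta>"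
 defines "Psi \<equiv> \<lambda>x. v x - z x - M + eps * (1 - (norm (x - x0))\<^sup>2 / (r1 / 2)\<^sup>2 - l)"
 defines "P \<equiv> measure lborel {x \<in> ball x0 r1 - {x0}. 0 < Psi x}"
 defines "Y \<equiv> \<lambda>x. if x \<in> ball x0 r1 - {x0} then max 0 (Psi x) else 0"
 defines "E \<equiv> \<lambda>x. norm (grad (hole_cutoff m) (x - x0)) powr p + indicator (ball x0 (1 / 2 ^ m)) x"
 defines "\<phi> \<equiv> \<lambda>x. hole_cutoff m (x - x0) ^ n * (Y x)\<^sup>2"
 shows "integrable lborel \<phi>"
  "\<delta> * (LINT x|lborel. \<phi> x) \<le> C1 * eps ^ 3 * P + C2 * (LINT x|lborel. E x)"
  "0 < R \<Longrightarrow> 2 * P \<le> measure lborel (ball (0::'a) R) \<Longrightarrow>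
   (LINT x|lborel. \<phi> x) \<le> 2 * R * ((2 * C1 + 8 / r1) * eps\<^sup>2 * P + (2 * C2 / eps + n) * (LINT x|lborel. E x))"
proof -
 define V where "V = ball x0 r1 - {x0}"
 define r2 where "r2 = r1 / 2"
 define K where "K = cball x0 r2 - ball x0 (1 / 2 ^ (2 * m + 1))"
 define \<kappa> where "\<kappa> = (\<lambda>x. hole_cutoff m (x - x0))"
 define \<kappa>' where "\<kappa>' = (\<lambda>x. grad (hole_cutoff m) (x - x0))"
 define g where "g = (\<lambda>x. grad v x - grad z x)"
 define G where "G = (\<lambda>x. vflux p (grad v x) - vflux p (grad z x))"
 define f where "f = (\<lambda>x. a2 * norm (grad z x) powr q - a1 * norm (grad v x) powr q)"
 have n2: "2 \<le> n" using p by linarith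
 have r2: "0 < r2" "r2 < r1" using r1 by (auto simp: r2_def)
 have V: "open V" by (auto simp: V_def)
 have K: "compact K" "K \<subseteq> V" using r2 by (auto simp: K_def V_def intro!: compact_diff)
 note Cv = wsol_C1[OF v, folded V_def] and Cz = wsol_C1[OF z, folded V_def]
 have kap: "0 \<le> \<kappa> x" "\<kappa> x \<le> 1" "0 \<le> \<kappa> x ^ n" "\<kappa> x ^ n \<le> 1" for x
  by (auto simp: \<kappa>_def hole_cutoff_props intro!: power_le_one)
 have kder: "GDERIV \<kappa> x :> \<kappa>' x" for x unfolding \<kappa>_def \<kappa>'_def by (rule hole_cutoff_translate)
 have Ck: "C1_on U \<kappa>" for U unfolding \<kappa>_def by (rule hole_cutoff_translate)
 have contk': "continuous_on U \<kappa>'" for U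
 proof -
  have "grad \<kappa> = \<kappa>'" using grad_eqI[OF kder] by auto
  then show ?thesis using C1_onD(2)[OF Ck[of U]] by simp
 qed
 define \<zeta>' where "\<zeta>' = (\<lambda>x. (- 2 / r2\<^sup>2) *\<^sub>R (x - x0))"
 have Pder: "GDERIV Psi x :> g x + eps *\<^sub>R \<zeta>' x" if "x \<in> V" for x
 proof -
  have 1: "GDERIV (\<lambda>x. (v x - z x - M) + eps * (1 - (1 / (r1 / 2)\<^sup>2) * (norm (x - x0))\<^sup>2 - l)) x :>
   (grad v x - grad z x - 0) + (eps *\<^sub>R (0 - ((1 / (r1 / 2)\<^sup>2) *\<^sub>R (2 *\<^sub>R (x - x0)) + (norm (x - x0))\<^sup>2 *\<^sub>R 0) - 0)
    + (1 - (1 / (r1 / 2)\<^sup>2) * (norm (x - x0))\<^sup>2 - l) *\<^sub>R 0)"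
   by (intro GDERIV_add GDERIV_diff GDERIV_mult GDERIV_const GDERIV_norm_sq C1_onD(1)[OF Cv that] C1_onD(1)[OF Cz that])
  have 2: "(\<lambda>x. (v x - z x - M) + eps * (1 - (1 / (r1 / 2)\<^sup>2) * (norm (x - x0))\<^sup>2 - l)) = Psi"
   by (simp add: Psi_def fun_eq_iff)
  show ?thesis using 1 unfolding 2 by (simp add: g_def \<zeta>'_def r2_def)
 qed
 have CP: "C1_on V Psi"
 proof (rule C1_onI[OF Pder])
  show "continuous_on V (\<lambda>x. g x + eps *\<^sub>R \<zeta>' x)"
   unfolding g_def \<zeta>'_def by (intro continuous_intros C1_onD(2)[OF Cv] C1_onD(2)[OF Cz])
 qed
 \<comment> \<open>This is where the value 4 / r1 for the Z of the pointwise inequality comes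
   from.\<close>
 have z': "norm (\<zeta>' x) \<le> 4 / r1" if "x \<in> K" for x
 proof -
  have "norm (x - x0) \<le> r2" using that by (simp add: K_def dist_norm norm_minus_commute)
  then have "2 / r2\<^sup>2 * norm (x - x0) \<le> 2 / r2\<^sup>2 * r2" by (intro mult_left_mono) auto
  then show ?thesis using r2 r1 by (simp add: \<zeta>'_def power2_eq_square r2_def)
 qed
 have Yle: "0 \<le> Y x \<and> Y x \<le> eps" for x
 proof -
  have "Psi x \<le> eps * 1" if "x \<in> V"
  proof -
   have "eps * (1 - (norm (x - x0))\<^sup>2 / (r1 / 2)\<^sup>2 - l) \<le> eps * 1"
    using eps by (intro mult_left_mono) (auto intro: order_trans[of _ 0])
   then show ?thesis using M[of x] that by (simp add: Psi_def V_def)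
  qed
  then show ?thesis using eps by (auto simp: Y_def V_def)
 qed
 have Yout: "Y x = 0" if "r2 < norm (x - x0)" for x
 proof (cases "x \<in> V")
  case True
  have "r2\<^sup>2 < (norm (x - x0))\<^sup>2" using that r2 by (intro power_strict_mono) auto
  then have "1 < (norm (x - x0))\<^sup>2 / r2\<^sup>2" using r2 by simp
  then have "1 - (norm (x - x0))\<^sup>2 / (r1 / 2)\<^sup>2 - l < 0" using eps by (simp add: r2_def)
  then have "eps * (1 - (norm (x - x0))\<^sup>2 / (r1 / 2)\<^sup>2 - l) < 0" using eps by (simp add: mult_pos_neg)
  then have "Psi x < 0" using M[of x] True by (simp add: Psi_def V_def)
  then show ?thesis by (simp add: Y_def)
 qed (auto simp: Y_def V_def)
 have Ksplit: "Y x = 0 \<or> \<kappa> x ^ n = 0" if "x \<notin> K" for x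
 proof (cases "norm (x - x0) \<le> r2")
  case True
  then have "norm (x - x0) \<le> 1 / 2 ^ (2 * m + 1)"
   using that by (simp add: K_def dist_norm norm_minus_commute)
  then have "\<kappa> x = 0" unfolding \<kappa>_def by (rule hole_cutoff_props)
  then show ?thesis using n2 by simp
 qed (use Yout in auto)
 have phi: "\<phi> x = \<kappa> x ^ n * (Y x)\<^sup>2" for x by (simp add: \<phi>_def \<kappa>_def)
 have phiV: "\<phi> x = \<kappa> x ^ n * pos_sq (Psi x)" if "x \<in> V" for x
  using that by (simp add: phi Y_def V_def pos_sq_def)
 have phiC1: "C1_on V \<phi>"
 proof (rule C1_on_cong[OF V])
  show "C1_on V (\<lambda>x. \<kappa> x ^ n * pos_sq (Psi x))"
   by (intro C1_on_mult C1_on_power Ck C1_on_compose[OF CP, where h'="\<lambda>t. 2 * max 0 t"] DERIV_pos_sq continuous_intros)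
 qed (simp add: phiV)
 have phi0: "\<phi> x = 0" if "x \<notin> K" for x using Ksplit[OF that] by (auto simp: phi)
 have c1: "c1c V \<phi>" by (rule c1c_I[OF V phiC1 K K(2) phi0])
 have c2: "c1c UNIV \<phi>" by (rule c1c_mono[OF c1]) simp
 have gphi: "grad \<phi> x = (\<kappa> x ^ n * (2 * Y x)) *\<^sub>R (g x + eps *\<^sub>R \<zeta>' x) + ((Y x)\<^sup>2 * (n * \<kappa> x ^ (n - 1))) *\<^sub>R \<kappa>' x"
  if x: "x \<in> V" for x
 proof (rule grad_eqI)
  have 1: "GDERIV (\<lambda>x. pos_sq (Psi x)) x :> (2 * max 0 (Psi x)) *\<^sub>R (g x + eps *\<^sub>R \<zeta>' x)"
   by (rule GDERIV_DERIV_compose[OF Pder[OF x] DERIV_pos_sq])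
  have 2: "GDERIV (\<lambda>x. \<kappa> x ^ n) x :> (n * \<kappa> x ^ (n - 1)) *\<^sub>R \<kappa>' x"
   by (rule GDERIV_DERIV_compose[OF kder]) (auto intro!: derivative_eq_intros)
  have "GDERIV (\<lambda>x. \<kappa> x ^ n * pos_sq (Psi x)) x :> (\<kappa> x ^ n * (2 * Y x)) *\<^sub>R (g x + eps *\<^sub>R \<zeta>' x) + ((Y x)\<^sup>2 * (n * \<kappa> x ^ (n - 1))) *\<^sub>R \<kappa>' x"
   using GDERIV_mult[OF 2 1] x by (simp add: Y_def V_def pos_sq_def)
  then show "GDERIV \<phi> x :> (\<kappa> x ^ n * (2 * Y x)) *\<^sub>R (g x + eps *\<^sub>R \<zeta>' x) + ((Y x)\<^sup>2 * (n * \<kappa> x ^ (n - 1))) *\<^sub>R \<kappa>' x"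
   by (rule GDERIV_local[OF V x, rotated]) (simp add: phiV)
 qed
 have gphi0: "grad \<phi> x = 0" if "x \<notin> K" for x
  using grad_local[of "- K" x \<phi> "\<lambda>_. 0"] that K phi0 by (simp add: compact_imp_closed open_Compl)
 have q0: "0 < q" by fact
 note iv = wsol_integrable[OF wsol_C1[OF v] _ p(1) q0, folded V_def, OF c1]
  and iz = wsol_integrable[OF wsol_C1[OF z] _ p(1) q0, folded V_def, OF c1]
 define T where "T = (\<lambda>x. G x \<bullet> grad \<phi> x - f x * \<phi> x)"
 have Teq: "T = (\<lambda>x. (vflux p (grad v x) \<bullet> grad \<phi> x + a1 * (norm (grad v x) powr q * \<phi> x))
   - (vflux p (grad z x) \<bullet> grad \<phi> x + a2 * (norm (grad z x) powr q * \<phi> x)))"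
  by (auto simp: T_def G_def f_def inner_diff_left algebra_simps)
 have Tint: "integrable lborel T" unfolding Teq using iv iz by auto
 have T0: "(LINT x|lborel. T x) = 0"
  using wsolD[OF v _ p(1) q0, folded V_def, OF c1] wsolD[OF z _ p(1) q0, folded V_def, OF c1] iv iz
  unfolding Teq by simp
 have contY: "continuous_on K Y"
 proof -
  have "continuous_on V (\<lambda>x. max 0 (Psi x))" using C1_on_continuous_on[OF CP] by (intro continuous_intros)
  then have "continuous_on V Y" by (rule continuous_on_eq) (simp add: Y_def V_def)
  then show ?thesis using K(2) by (rule continuous_on_subset)
 qed
 have contg: "continuous_on K g"
  unfolding g_def using K(2) C1_onD(2)[OF Cv] C1_onD(2)[OF Cz] by (intro continuous_intros) (auto intro: continuous_on_subset)
 have contk: "continuous_on K \<kappa>" by (rule C1_on_continuous_on[OF Ck])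
 define A where "A = (\<lambda>x. \<kappa> x ^ n * Y x * norm (g x))"
 define D where "D = (\<lambda>x. \<kappa> x ^ n * Y x)"
 have AD0: "A x = 0" "D x = 0" if "x \<notin> K" for x
  using Ksplit[OF that] by (elim disjE; simp only: A_def D_def mult_zero_left mult_zero_right)+
 have Aint: "integrable lborel A"
  by (rule integrable_compact_support[OF K(1) _ AD0(1)]) (auto simp: A_def intro!: continuous_intros contY contg contk)
 have Dint: "integrable lborel D"
  by (rule integrable_compact_support[OF K(1) _ AD0(2)]) (auto simp: D_def intro!: continuous_intros contY contg contk)
 show pint: "integrable lborel \<phi>"
  by (rule integrable_compact_support[OF K(1)])
   (use phi0 C1_on_continuous_on[OF phiC1] K(2) in \<open>auto intro: continuous_on_subset\<close>)
 have Eint: "integrable lborel E" unfolding E_def by (rule hole_energy(1)[OF p(1,2)])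
 have E0: "0 \<le> E x" for x by (simp add: E_def)
 have yE: "norm (\<kappa>' x) powr p + (if norm (\<kappa>' x) = 0 then 0 else 1) \<le> E x" for x
 proof (cases "x \<in> ball x0 (1 / 2 ^ m)")
  case False
  then have "\<kappa>' x = 0" unfolding \<kappa>'_def by (intro hole_cutoff_props) (simp add: dist_norm norm_minus_commute)
  then show ?thesis by (simp add: E_def \<kappa>'_def)
 qed (auto simp: E_def \<kappa>'_def)
 \<comment> \<open>\<open>T\<close> is the integrand of the difference of the two weak equations and
   integrates to 0. Cauchy-Schwarz on the gradients of paraboloid and cut-off reduces it to the
   pointwise inequality.\<close>
 have main: "eps * A x + \<delta> * \<phi> x - C1 * eps\<^sup>2 * D x - C2 * E x \<le> T x" for x
 proof (cases "x \<in> K")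
  case False
  then show ?thesis using AD0[OF False] gphi0[OF False] phi0[OF False] eps E0[of x]
   by (simp add: T_def)
 next
  case True
  then have xV: "x \<in> V" "x \<in> ball x0 r1 - {x0}" using K by (auto simp: V_def)
  let ?S = "G x \<bullet> g x" and ?H = "norm (G x)" and ?y = "norm (\<kappa>' x)"
  have pw: "eps * \<kappa> x ^ n * Y x * norm (g x) + \<delta> * \<kappa> x ^ n * (Y x)\<^sup>2 - C1 * eps\<^sup>2 * \<kappa> x ^ n * Y x
    - C2 * (?y powr p + (if ?y = 0 then 0 else 1))
   \<le> 2 * Y x * \<kappa> x ^ n * (?S - eps * (4 / r1) * ?H) - n * \<kappa> x ^ (n - 1) * (Y x)\<^sup>2 * (?H * ?y) - f x * \<kappa> x ^ n * (Y x)\<^sup>2"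
  proof (rule PW)
   show "norm (g x) \<le> \<rho> \<Longrightarrow> c * (norm (g x))\<^sup>2 \<le> ?S \<and> ?H \<le> C * norm (g x) \<and> f x \<le> - \<delta>"
    unfolding G_def g_def f_def by (rule reg1[OF xV(2)])
   show "\<rho> \<le> norm (g x) \<Longrightarrow> c * norm (g x) powr p \<le> ?S \<and> ?H \<le> C * norm (g x) powr (p - 1) \<and> f x \<le> C * norm (g x) powr p"
    unfolding G_def g_def f_def by (rule reg2[OF xV(2)])
  qed (use Yle[of x] kap[of x] in auto)
  have t1: "?S - eps * (4 / r1) * ?H \<le> G x \<bullet> (g x + eps *\<^sub>R \<zeta>' x)"
  proof -
   have "- (G x \<bullet> \<zeta>' x) \<le> ?H * norm (\<zeta>' x)" using norm_cauchy_schwarz[of "G x" "- \<zeta>' x"] by simp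
   also have "\<dots> \<le> ?H * (4 / r1)" using z'[OF True] by (intro mult_left_mono) auto
   finally have "eps * - (G x \<bullet> \<zeta>' x) \<le> eps * (?H * (4 / r1))" using eps by (intro mult_left_mono) auto
   then show ?thesis by (simp add: inner_add_right algebra_simps)
  qed
  have "2 * Y x * \<kappa> x ^ n * (?S - eps * (4 / r1) * ?H) \<le> 2 * Y x * \<kappa> x ^ n * (G x \<bullet> (g x + eps *\<^sub>R \<zeta>' x))"
   using Yle[of x] kap[of x] t1 by (intro mult_left_mono) auto
  moreover have "n * \<kappa> x ^ (n - 1) * (Y x)\<^sup>2 * - (?H * ?y) \<le> n * \<kappa> x ^ (n - 1) * (Y x)\<^sup>2 * (G x \<bullet> \<kappa>' x)"
  proof (intro mult_left_mono)
   show "- (?H * ?y) \<le> G x \<bullet> \<kappa>' x" using norm_cauchy_schwarz[of "G x" "- \<kappa>' x"] by simp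
  qed (use kap[of x] in auto)
  moreover have "T x = 2 * Y x * \<kappa> x ^ n * (G x \<bullet> (g x + eps *\<^sub>R \<zeta>' x)) + n * \<kappa> x ^ (n - 1) * (Y x)\<^sup>2 * (G x \<bullet> \<kappa>' x) - f x * \<kappa> x ^ n * (Y x)\<^sup>2"
   by (simp add: T_def gphi[OF xV(1)] phi inner_add_right algebra_simps)
  moreover have "C2 * (?y powr p + (if ?y = 0 then 0 else 1)) \<le> C2 * E x"
   using yE[of x] eps by (intro mult_left_mono) auto
  ultimately show ?thesis using pw by (simp add: A_def D_def phi mult.assoc)
 qed
 have ineq: "eps * (LINT x|lborel. A x) + \<delta> * (LINT x|lborel. \<phi> x)
   \<le> C1 * eps\<^sup>2 * (LINT x|lborel. D x) + C2 * (LINT x|lborel. E x)"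
 proof -
  have "(LINT x|lborel. eps * A x + \<delta> * \<phi> x - C1 * eps\<^sup>2 * D x - C2 * E x) \<le> (LINT x|lborel. T x)"
   by (intro integral_mono main Tint) (use Aint Dint pint Eint in auto)
  then show ?thesis unfolding T0 using Aint Dint pint Eint by simp
 qed
 define S where "S = {x \<in> ball x0 r1 - {x0}. 0 < Psi x}"
 have Sopen: "open S"
 proof -
  have "S = V \<inter> Psi -` {0<..}" by (auto simp: S_def V_def)
  then show ?thesis using continuous_open_preimage[OF C1_on_continuous_on[OF CP] V, of "{0<..}"] by simp
 qed
 have Sfin: "emeasure lborel S < \<infinity>"
 proof -
  have "emeasure lborel S \<le> emeasure lborel (ball x0 r1)" by (intro emeasure_mono) (auto simp: S_def)
  then show ?thesis using emeasure_lborel_ball_finite[of x0 r1] by simp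
 qed
 have Dle: "(LINT x|lborel. D x) \<le> eps * P"
 proof -
  have "(LINT x|lborel. D x) \<le> (LINT x|lborel. eps * indicator S x)"
  proof (rule integral_mono[OF Dint])
   show "integrable lborel (\<lambda>x. eps * indicator S x)"
    using Sopen Sfin by (intro integrable_mult_right integrable_real_indicator) auto
   fix x
   show "D x \<le> eps * indicator S x"
   proof (cases "x \<in> S")
    case True
    have "\<kappa> x ^ n * Y x \<le> 1 * eps" using kap[of x] Yle[of x] by (intro mult_mono) auto
    then show ?thesis using True by (simp add: D_def)
   next
    case False
    then have "Y x = 0" by (auto simp: S_def Y_def max_def)
    then show ?thesis using False by (simp add: D_def)
   qed
  qed
  then show ?thesis by (simp add: P_def S_def)
 qed
 have A0: "0 \<le> (LINT x|lborel. A x)" using kap Yle by (intro Bochner_Integration.integral_nonneg) (auto simp: A_def)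
 have ph0: "0 \<le> \<phi> x" for x using kap by (simp add: phi)
 have p0: "0 \<le> (LINT x|lborel. \<phi> x)" using ph0 by (intro Bochner_Integration.integral_nonneg)
 have e2D: "C1 * eps\<^sup>2 * (LINT x|lborel. D x) \<le> C1 * eps ^ 3 * P"
 proof -
  have "C1 * eps\<^sup>2 * (LINT x|lborel. D x) \<le> C1 * eps\<^sup>2 * (eps * P)" using Dle eps by (intro mult_left_mono) auto
  then show ?thesis by (simp add: power2_eq_square power3_eq_cube mult_ac)
 qed
 show "\<delta> * (LINT x|lborel. \<phi> x) \<le> C1 * eps ^ 3 * P + C2 * (LINT x|lborel. E x)"
  using ineq e2D A0 eps mult_nonneg_nonneg[of eps "LINT x|lborel. A x"] by linarith
 show "(LINT x|lborel. \<phi> x) \<le> 2 * R * ((2 * C1 + 8 / r1) * eps\<^sup>2 * P + (2 * C2 / eps + n) * (LINT x|lborel. E x))"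
  if R: "0 < R" "2 * P \<le> measure lborel (ball (0::'a) R)"
 proof -
  have sup: "measure lborel {x. \<phi> x \<noteq> 0} \<le> P"
  proof -
   have "{x. \<phi> x \<noteq> 0} \<subseteq> S" by (auto simp: phi Y_def S_def max_def split: if_splits)
   moreover have "open {x. \<phi> x \<noteq> 0}"
   proof -
    have "continuous_on UNIV \<phi>" by (rule C1_on_continuous_on[OF c1c_C1[OF c2]])
    then show ?thesis by (intro open_Collect_neq) auto
   qed
   ultimately show ?thesis unfolding P_def S_def[symmetric]
    using Sopen Sfin by (intro measure_mono_fmeasurable) (auto simp: fmeasurable_def)
  qed
  \<comment> \<open>Product rule: \<open>A\<close> carries the gradient of v - z, \<open>D\<close>
    that of the paraboloid, and \<open>E\<close> that of the cut-off.\<close>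
  have gle: "norm (grad \<phi> x) \<le> 2 * A x + 8 / r1 * eps * D x + n * E x" for x
  proof (cases "x \<in> K")
   case False
   then show ?thesis using gphi0[OF False] AD0[OF False] E0[of x] by simp
  next
   case True
   then have xV: "x \<in> V" using K by auto
   have "norm (grad \<phi> x) \<le> norm ((\<kappa> x ^ n * (2 * Y x)) *\<^sub>R (g x + eps *\<^sub>R \<zeta>' x)) + norm (((Y x)\<^sup>2 * (n * \<kappa> x ^ (n - 1))) *\<^sub>R \<kappa>' x)"
    unfolding gphi[OF xV] by (rule norm_triangle_ineq)
   moreover have "norm ((\<kappa> x ^ n * (2 * Y x)) *\<^sub>R (g x + eps *\<^sub>R \<zeta>' x)) \<le> 2 * A x + 8 / r1 * eps * D x"
   proof -
    have "norm (g x + eps *\<^sub>R \<zeta>' x) \<le> norm (g x) + eps * (4 / r1)"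
     using norm_triangle_ineq[of "g x" "eps *\<^sub>R \<zeta>' x"] mult_left_mono[OF z'[OF True], of eps] eps by simp
    then have "(\<kappa> x ^ n * (2 * Y x)) * norm (g x + eps *\<^sub>R \<zeta>' x) \<le> (\<kappa> x ^ n * (2 * Y x)) * (norm (g x) + eps * (4 / r1))"
     using kap[of x] Yle[of x] by (intro mult_left_mono) auto
    moreover have "norm ((\<kappa> x ^ n * (2 * Y x)) *\<^sub>R (g x + eps *\<^sub>R \<zeta>' x)) = (\<kappa> x ^ n * (2 * Y x)) * norm (g x + eps *\<^sub>R \<zeta>' x)"
     using kap[of x] Yle[of x] by (simp only: norm_scaleR) (simp add: abs_mult)
    moreover have "(\<kappa> x ^ n * (2 * Y x)) * (norm (g x) + eps * (4 / r1)) = 2 * A x + 8 / r1 * eps * D x"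
     by (simp add: A_def D_def algebra_simps)
    ultimately show ?thesis by linarith
   qed
   moreover have "norm (((Y x)\<^sup>2 * (n * \<kappa> x ^ (n - 1))) *\<^sub>R \<kappa>' x) \<le> n * E x"
   proof -
    have "\<kappa> x ^ (n - 1) \<le> 1" "0 \<le> \<kappa> x ^ (n - 1)" using kap[of x] by (auto intro: power_le_one)
    moreover have "(Y x)\<^sup>2 \<le> 1" using Yle[of x] eps by (auto intro!: power_le_one)
    moreover have "norm (\<kappa>' x) \<le> E x"
    proof -
     have "norm (\<kappa>' x) \<le> norm (\<kappa>' x) powr p + (if norm (\<kappa>' x) = 0 then 0 else 1)"
     proof (cases "1 \<le> norm (\<kappa>' x)")
      case True then show ?thesis using powr_mono[of 1 p "norm (\<kappa>' x)"] p by (auto intro: add_increasing2)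
     qed (auto intro: add_increasing)
     then show ?thesis using yE[of x] by linarith
    qed
    ultimately have "(Y x)\<^sup>2 * (n * \<kappa> x ^ (n - 1)) * norm (\<kappa>' x) \<le> 1 * (real n * 1) * E x"
     by (intro mult_mono) auto
    then show ?thesis using kap[of x] by (simp add: abs_mult)
   qed
   ultimately show ?thesis by linarith
  qed
  have i: "integrable lborel (\<lambda>x. norm (grad \<phi> x))"
   by (rule integrable_compact_support[OF K(1)])
    (use gphi0 C1_onD(2)[OF c1c_C1[OF c2, of K]] in \<open>auto intro!: continuous_intros\<close>)
  have "(LINT x|lborel. \<phi> x) \<le> 2 * R * (LINT x|lborel. norm (grad \<phi> x))"
   using sobolev_small_support[OF c2 sup R] ph0 by simp
  also have "(LINT x|lborel. norm (grad \<phi> x)) \<le> (LINT x|lborel. 2 * A x + 8 / r1 * eps * D x + n * E x)"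
   using Aint Dint Eint by (intro integral_mono i gle) auto
  also have "\<dots> = 2 * (LINT x|lborel. A x) + 8 / r1 * eps * (LINT x|lborel. D x) + n * (LINT x|lborel. E x)"
   using Aint Dint Eint by simp
  also have "\<dots> \<le> (2 * C1 + 8 / r1) * eps\<^sup>2 * P + (2 * C2 / eps + n) * (LINT x|lborel. E x)"
  proof -
   have "eps * (LINT x|lborel. A x) \<le> eps * (C1 * eps\<^sup>2 * P + C2 / eps * (LINT x|lborel. E x))"
   proof -
    have "0 \<le> \<delta> * (LINT x|lborel. \<phi> x)" using p0 eps by simp
    then have "eps * (LINT x|lborel. A x) \<le> C1 * eps ^ 3 * P + C2 * (LINT x|lborel. E x)"
     using ineq e2D by linarith
    moreover have "eps * (C1 * eps\<^sup>2 * P + C2 / eps * (LINT x|lborel. E x)) = C1 * eps ^ 3 * P + C2 * (LINT x|lborel. E x)"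
     using eps by (simp add: algebra_simps power2_eq_square power3_eq_cube)
    ultimately show ?thesis by simp
   qed
   then have a: "(LINT x|lborel. A x) \<le> C1 * eps\<^sup>2 * P + C2 / eps * (LINT x|lborel. E x)" using eps by simp
   have b: "8 / r1 * eps * (LINT x|lborel. D x) \<le> 8 / r1 * eps * (eps * P)"
    using Dle eps r1 by (intro mult_left_mono) auto
   have e: "(2 * C1 + 8 / r1) * eps\<^sup>2 * P + (2 * C2 / eps + n) * (LINT x|lborel. E x)
    = 2 * (C1 * eps\<^sup>2 * P + C2 / eps * (LINT x|lborel. E x)) + 8 / r1 * eps * (eps * P) + n * (LINT x|lborel. E x)"
    by (simp add: algebra_simps power2_eq_square)
   have "2 * s + t + c' \<le> 2 * s' + t' + c'" if "s \<le> s'" "t \<le> t'" for s s' t t' c' :: real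
    using that by simp
   from this[OF a b] show ?thesis unfolding e .
  qed
  finally show ?thesis using R by (simp add: mult_left_mono)
 qed
qed

lemma open_measure_pos:
 fixes S :: "'a::euclidean_space set"
 assumes "open S" "x \<in> S" "emeasure lborel S < \<infinity>"
 shows "0 < measure lborel S"
proof -
 obtain e where e: "0 < e" "ball x e \<subseteq> S" using assms openE by blast
 have "0 < measure lborel (ball x e)" using e by (simp add: content_ball_pos)
 also have "\<dots> \<le> measure lborel S"
  using assms e by (intro measure_mono_fmeasurable) (auto simp: fmeasurable_def)
 finally show ?thesis .
qed

text \<open>De Giorgi iteration over the levels \<open>(1 - 2\<^sup>-\<^sup>j) / 2\<close>. The smallness needed to start it comes from
 the strict inequality \<open>a2 < a1\<close>. At the point \<open>x0\<close> itself nothing is assumed about one of the two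
 functions, since a point has zero \<open>p\<close>-capacity.\<close>

lemma touching_impossible:
 fixes x0 \<xi> :: "'a::euclidean_space" and v z :: "'a \<Rightarrow> real" and p q a1 a2 r M :: real
 assumes p: "1 < p" "p \<le> DIM('a)" and q: "0 < q" "q \<le> p" and a: "a2 < a1" and r: "0 < r"
  and v: "wsol p q a1 (ball x0 r - {x0}) v" and z: "wsol p q a2 (ball x0 r - {x0}) z"
  and M: "\<And>x. x \<in> ball x0 r - {x0} \<Longrightarrow> v x - z x \<le> M"
  and fr: "\<And>e. 0 < e \<Longrightarrow> \<exists>\<^sub>F x in at x0. M - e < v x - z x"
  and xi: "\<xi> \<noteq> 0" "(grad v \<longlongrightarrow> \<xi>) (at x0) \<or> (grad z \<longlongrightarrow> \<xi>) (at x0)"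
 shows False
proof -
 obtain \<rho> c C \<delta> where pos: "0 < \<rho>" "0 < c" "0 < C" "0 < \<delta>"
  and reg: "\<forall>\<alpha> \<beta>. (norm (\<alpha> - \<xi>) \<le> \<rho> \<or> norm (\<beta> - \<xi>) \<le> \<rho>) \<longrightarrow> norm (\<alpha> - \<beta>) \<le> \<rho> \<longrightarrow>
   c * (norm (\<alpha> - \<beta>))\<^sup>2 \<le> (vflux p \<alpha> - vflux p \<beta>) \<bullet> (\<alpha> - \<beta>)
   \<and> norm (vflux p \<alpha> - vflux p \<beta>) \<le> C * norm (\<alpha> - \<beta>)
   \<and> a2 * norm \<beta> powr q - a1 * norm \<alpha> powr q \<le> - \<delta>"
  "\<forall>\<alpha> \<beta>. (norm (\<alpha> - \<xi>) \<le> \<rho> \<or> norm (\<beta> - \<xi>) \<le> \<rho>) \<longrightarrow> \<rho> \<le> norm (\<alpha> - \<beta>) \<longrightarrow>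
   c * norm (\<alpha> - \<beta>) powr p \<le> (vflux p \<alpha> - vflux p \<beta>) \<bullet> (\<alpha> - \<beta>)
   \<and> norm (vflux p \<alpha> - vflux p \<beta>) \<le> C * norm (\<alpha> - \<beta>) powr (p - 1)
   \<and> a2 * norm \<beta> powr q - a1 * norm \<alpha> powr q \<le> C * norm (\<alpha> - \<beta>) powr p"
  by (rule two_regimes[OF xi(1) p(1) q a])
 note reg1 = reg(1)[rule_format] and reg2 = reg(2)[rule_format]
 have "\<exists>d>0. \<forall>x. x \<noteq> x0 \<and> dist x x0 < d \<longrightarrow> norm (grad v x - \<xi>) \<le> \<rho> \<or> norm (grad z x - \<xi>) \<le> \<rho>"
  using xi(2)
 proof
  assume "(grad v \<longlongrightarrow> \<xi>) (at x0)"
  from tendstoD[OF this pos(1)] show ?thesis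
   unfolding eventually_at by (rule ex_forward) (simp add: dist_norm less_imp_le)
 next
  assume "(grad z \<longlongrightarrow> \<xi>) (at x0)"
  from tendstoD[OF this pos(1)] show ?thesis
   unfolding eventually_at by (rule ex_forward) (simp add: dist_norm less_imp_le)
 qed
 then obtain d where d: "0 < d" "\<And>x. x \<noteq> x0 \<Longrightarrow> dist x x0 < d \<Longrightarrow> norm (grad v x - \<xi>) \<le> \<rho> \<or> norm (grad z x - \<xi>) \<le> \<rho>"
  by blast
 define r1 where "r1 = min r d"
 define V where "V = ball x0 r1 - {x0}"
 have r1: "0 < r1" using r d by (simp add: r1_def)
 have Vsub: "V \<subseteq> ball x0 r - {x0}" by (auto simp: V_def r1_def)
 have nearV: "norm (grad v x - \<xi>) \<le> \<rho> \<or> norm (grad z x - \<xi>) \<le> \<rho>" if "x \<in> V" for x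
  using d(2)[of x] that by (auto simp: V_def r1_def dist_commute)
 note vV = wsol_subset[OF v Vsub] and zV = wsol_subset[OF z Vsub]
 have MV: "v x - z x \<le> M" if "x \<in> V" for x using M that Vsub by blast
 have Vo: "open V" by (auto simp: V_def)
 \<comment> \<open>An integer power at least p, as the Young inequality with cut-off
   requires.\<close>
 define n where "n = nat \<lceil>p\<rceil>"
 have pn: "p \<le> n" unfolding n_def by linarith
 have Z: "0 \<le> 4 / r1" using r1 by simp
 obtain eps0 C1 C2 where e0: "0 < eps0" "eps0 \<le> 1" and C12: "0 \<le> C1" "0 \<le> C2" and
  PW0: "\<forall>eps Y (\<kappa>::real) x S H f y. 0 < eps \<longrightarrow> eps \<le> eps0 \<longrightarrow> 0 \<le> Y \<longrightarrow> Y \<le> eps \<longrightarrow> 0 \<le> \<kappa> \<longrightarrow> \<kappa> \<le> 1 \<longrightarrow>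
   0 \<le> x \<longrightarrow> 0 \<le> y \<longrightarrow>
   (x \<le> \<rho> \<longrightarrow> c * x\<^sup>2 \<le> S \<and> H \<le> C * x \<and> f \<le> - \<delta>) \<longrightarrow>
   (\<rho> \<le> x \<longrightarrow> c * x powr p \<le> S \<and> H \<le> C * x powr (p - 1) \<and> f \<le> C * x powr p) \<longrightarrow>
   eps * \<kappa> ^ n * Y * x + \<delta> * \<kappa> ^ n * Y\<^sup>2 - C1 * eps\<^sup>2 * \<kappa> ^ n * Y - C2 * (y powr p + (if y = 0 then 0 else 1))
   \<le> 2 * Y * \<kappa> ^ n * (S - eps * (4 / r1) * H) - n * \<kappa> ^ (n - 1) * Y\<^sup>2 * (H * y) - f * \<kappa> ^ n * Y\<^sup>2"
  by (rule energy_pointwise[OF p(1) pn pos Z])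
 note PW = PW0[rule_format]
 define Psi where "Psi eps l x = v x - z x - M + eps * (1 - (norm (x - x0))\<^sup>2 / (r1 / 2)\<^sup>2 - l)" for eps l x
 define S where "S eps l = {x \<in> V. 0 < Psi eps l x}" for eps l
 define P where "P eps l = measure lborel (S eps l)" for eps l
 have contW: "continuous_on V (Psi eps l)" for eps l
  unfolding Psi_def[abs_def]
  by (intro continuous_intros C1_on_continuous_on[OF wsol_C1[OF vV]] C1_on_continuous_on[OF wsol_C1[OF zV]]) (use r1 in auto)
 have So: "open (S eps l)" for eps l
 proof -
  have "S eps l = V \<inter> Psi eps l -` {0<..}" by (auto simp: S_def)
  then show ?thesis using continuous_open_preimage[OF contW Vo, of "{0<..}"] by simp
 qed
 define Vol where "Vol = measure lborel (ball x0 r1)"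
 have Sfin: "emeasure lborel (S eps l) < \<infinity>" for eps l
 proof -
  have "emeasure lborel (S eps l) \<le> emeasure lborel (ball x0 r1)" by (intro emeasure_mono) (auto simp: S_def V_def)
  then show ?thesis using emeasure_lborel_ball_finite[of x0 r1] by simp
 qed
 have Sfm: "S eps l \<in> fmeasurable lborel" for eps l using So Sfin by (auto simp: fmeasurable_def)
 have Bfm: "ball x s \<in> fmeasurable lborel" for x :: 'a and s using emeasure_lborel_ball_finite[of x s] by (auto simp: fmeasurable_def)
 have P0: "0 \<le> P eps l" for eps l by (simp add: P_def)
 have PVol: "P eps l \<le> Vol" for eps l
  unfolding P_def Vol_def using So Bfm by (intro measure_mono_fmeasurable) (auto simp: S_def V_def)
 define E where "E m x = norm (grad (hole_cutoff m) (x - x0)) powr p + indicator (ball x0 (1 / 2 ^ m)) x" for m x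
 define b where "b m = measure lborel (ball x0 (1 / 2 ^ m))" for m
 have El: "(\<lambda>m. LINT x|lborel. E m x) \<longlonglongrightarrow> 0" and bl: "b \<longlonglongrightarrow> 0"
  using hole_energy(2,3)[OF p, of x0] by (simp_all add: E_def[abs_def] b_def[abs_def])
 \<comment> \<open>The hole in the cut-off is closed by m -> infinity: the cut-off energy and the
   measure of the hole tend to 0. Outside the hole, \<open>\<phi>\<close> is at least (eps (l' -
   l))^2 on the superlevel set of l'.\<close>
 have step: "\<delta> * ((eps * (l' - l))\<^sup>2 * P eps l') \<le> C1 * eps ^ 3 * P eps l"
  "0 < R \<Longrightarrow> 2 * P eps l \<le> measure lborel (ball (0::'a) R) \<Longrightarrow>
   (eps * (l' - l))\<^sup>2 * P eps l' \<le> 2 * R * ((2 * C1 + 8 / r1) * eps\<^sup>2 * P eps l)"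
  if e: "0 < eps" "eps \<le> eps0" and l: "0 \<le> l" "l < l'" for eps l l' R
 proof -
  define \<phi> where "\<phi> m x = hole_cutoff m (x - x0) ^ n * (if x \<in> V then max 0 (Psi eps l x) else 0)\<^sup>2" for m x
  have LE: "integrable lborel (\<phi> m)"
   "\<delta> * (LINT x|lborel. \<phi> m x) \<le> C1 * eps ^ 3 * P eps l + C2 * (LINT x|lborel. E m x)"
   "0 < R \<Longrightarrow> 2 * P eps l \<le> measure lborel (ball (0::'a) R) \<Longrightarrow>
   (LINT x|lborel. \<phi> m x) \<le> 2 * R * ((2 * C1 + 8 / r1) * eps\<^sup>2 * P eps l + (2 * C2 / eps + n) * (LINT x|lborel. E m x))" for m R
  proof -
   have A: "eps \<le> 1" using e e0 by simp
   note L = level_energy[OF p pn q(1) r1 vV[unfolded V_def] zV[unfolded V_def] MV[unfolded V_def]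
     reg1[OF nearV[unfolded V_def]] reg2[OF nearV[unfolded V_def]] PW[OF e] e(1) A l(1) C12 pos(4),
     folded V_def Psi_def E_def, folded S_def, folded P_def, folded \<phi>_def]
   show "integrable lborel (\<phi> m)"
    "\<delta> * (LINT x|lborel. \<phi> m x) \<le> C1 * eps ^ 3 * P eps l + C2 * (LINT x|lborel. E m x)"
    "0 < R \<Longrightarrow> 2 * P eps l \<le> measure lborel (ball (0::'a) R) \<Longrightarrow>
   (LINT x|lborel. \<phi> m x) \<le> 2 * R * ((2 * C1 + 8 / r1) * eps\<^sup>2 * P eps l + (2 * C2 / eps + n) * (LINT x|lborel. E m x))"
    using L by blast+
  qed
  have low: "(eps * (l' - l))\<^sup>2 * (P eps l' - b m) \<le> (LINT x|lborel. \<phi> m x)" for m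
  proof -
   define S' where "S' = S eps l' - ball x0 (1 / 2 ^ m)"
   have S'm: "S' \<in> fmeasurable lborel" unfolding S'_def using Sfm Bfm by (intro fmeasurable_Diff) auto
   have "P eps l' \<le> measure lborel (S' \<union> ball x0 (1 / 2 ^ m))"
    unfolding P_def
   proof (rule measure_mono_fmeasurable)
    show "S' \<union> ball x0 (1 / 2 ^ m) \<in> fmeasurable lborel" using S'm Bfm by (rule fmeasurable.Un)
   qed (use So in \<open>auto simp: S'_def\<close>)
   also have "\<dots> \<le> measure lborel S' + b m"
    unfolding b_def using S'm Bfm by (intro measure_Un_le) auto
   finally have 1: "P eps l' - b m \<le> measure lborel S'" by simp
   have "(eps * (l' - l))\<^sup>2 * measure lborel S' = (LINT x|lborel. (eps * (l' - l))\<^sup>2 * indicator S' x)"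
    using S'm by simp
   also have "\<dots> \<le> (LINT x|lborel. \<phi> m x)"
   proof (rule integral_mono)
    show "integrable lborel (\<lambda>x. (eps * (l' - l))\<^sup>2 * indicator S' x)"
     using S'm by (intro integrable_mult_right integrable_real_indicator) (auto simp: fmeasurable_def)
    fix x
    show "(eps * (l' - l))\<^sup>2 * indicator S' x \<le> \<phi> m x"
    proof (cases "x \<in> S'")
     case True
     then have xV: "x \<in> V" and Ps: "0 < Psi eps l' x" and far: "1 / 2 ^ m \<le> norm (x - x0)"
      by (auto simp: S'_def S_def dist_norm norm_minus_commute)
     have "Psi eps l x = Psi eps l' x + eps * (l' - l)" by (simp add: Psi_def algebra_simps)
     then have "eps * (l' - l) \<le> max 0 (Psi eps l x)" using Ps by simp
     then have "(eps * (l' - l))\<^sup>2 \<le> (max 0 (Psi eps l x))\<^sup>2" using e l by (intro power_mono) auto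
     then show ?thesis using True xV hole_cutoff_props(4)[OF far] by (simp add: \<phi>_def)
    qed (simp add: \<phi>_def hole_cutoff_props(1))
   qed (rule LE)
   finally show ?thesis using mult_left_mono[OF 1, of "(eps * (l' - l))\<^sup>2"] by simp
  qed
  have lim1: "(\<lambda>m. (eps * (l' - l))\<^sup>2 * (P eps l' - b m)) \<longlonglongrightarrow> (eps * (l' - l))\<^sup>2 * (P eps l' - 0)"
   by (intro tendsto_intros bl)
  show "\<delta> * ((eps * (l' - l))\<^sup>2 * P eps l') \<le> C1 * eps ^ 3 * P eps l"
  proof -
   have "\<delta> * ((eps * (l' - l))\<^sup>2 * (P eps l' - 0)) \<le> C1 * eps ^ 3 * P eps l + C2 * 0"
   proof (rule LIMSEQ_le)
    show "(\<lambda>m. \<delta> * ((eps * (l' - l))\<^sup>2 * (P eps l' - b m))) \<longlonglongrightarrow> \<delta> * ((eps * (l' - l))\<^sup>2 * (P eps l' - 0))"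
     by (intro tendsto_intros bl)
    show "(\<lambda>m. C1 * eps ^ 3 * P eps l + C2 * (LINT x|lborel. E m x)) \<longlonglongrightarrow> C1 * eps ^ 3 * P eps l + C2 * 0"
     by (intro tendsto_intros El)
    show "\<exists>N. \<forall>m\<ge>N. \<delta> * ((eps * (l' - l))\<^sup>2 * (P eps l' - b m)) \<le> C1 * eps ^ 3 * P eps l + C2 * (LINT x|lborel. E m x)"
     using mult_left_mono[OF low less_imp_le[OF pos(4)]] LE(2) by (meson order_trans)
   qed
   then show ?thesis by simp
  qed
  show "(eps * (l' - l))\<^sup>2 * P eps l' \<le> 2 * R * ((2 * C1 + 8 / r1) * eps\<^sup>2 * P eps l)"
   if R: "0 < R" "2 * P eps l \<le> measure lborel (ball (0::'a) R)"
  proof -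
   have "(eps * (l' - l))\<^sup>2 * (P eps l' - 0) \<le> 2 * R * ((2 * C1 + 8 / r1) * eps\<^sup>2 * P eps l + (2 * C2 / eps + n) * 0)"
   proof (rule LIMSEQ_le[OF lim1])
    show "(\<lambda>m. 2 * R * ((2 * C1 + 8 / r1) * eps\<^sup>2 * P eps l + (2 * C2 / eps + n) * (LINT x|lborel. E m x)))
     \<longlonglongrightarrow> 2 * R * ((2 * C1 + 8 / r1) * eps\<^sup>2 * P eps l + (2 * C2 / eps + n) * 0)"
     by (intro tendsto_intros El)
    show "\<exists>N. \<forall>m\<ge>N. (eps * (l' - l))\<^sup>2 * (P eps l' - b m) \<le> 2 * R * ((2 * C1 + 8 / r1) * eps\<^sup>2 * P eps l + (2 * C2 / eps + n) * (LINT x|lborel. E m x))"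
     using low LE(3)[OF R] by (meson order_trans)
   qed
   then show ?thesis by simp
  qed
 qed
 define \<omega> where "\<omega> = unit_ball_vol DIM('a)"
 define N where "N = real DIM('a)"
 define \<alpha> where "\<alpha> = 1 / N"
 have om: "0 < \<omega>" by (simp add: \<omega>_def)
 have N: "0 < N" by (simp add: N_def)
 have al: "0 < \<alpha>" using N by (simp add: \<alpha>_def)
 define C4 where "C4 = 2 * (2 / \<omega>) powr \<alpha> * (2 * C1 + 8 / r1)"
 have C4: "0 < C4" using om C12 r1 by (auto simp: C4_def intro!: mult_pos_pos add_nonneg_pos)
 have iter: "(l' - l)\<^sup>2 * P eps l' \<le> C4 * P eps l powr (1 + \<alpha>)"
  if e: "0 < eps" "eps \<le> eps0" and l: "0 \<le> l" "l < l'" for eps l l'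
 proof (cases "P eps l = 0")
  case True
  have "\<delta> * ((eps * (l' - l))\<^sup>2 * P eps l') \<le> 0" using step(1)[OF e l] True by simp
  moreover have "0 < (eps * (l' - l))\<^sup>2" using e l by simp
  ultimately have "P eps l' \<le> 0" using pos(4) by (simp add: mult_le_0_iff zero_less_mult_iff)
  then show ?thesis using True P0[of eps l'] by simp
 next
  case False
  then have Pp: "0 < P eps l" using P0[of eps l] by simp
  \<comment> \<open>The radius for which the ball has exactly twice the measure of the superlevel
    set.\<close>
  define R where "R = (2 * P eps l / \<omega>) powr \<alpha>"
  have R: "0 < R" using Pp om by (simp add: R_def)
  have "R ^ DIM('a) = 2 * P eps l / \<omega>"
  proof -
   have "R ^ DIM('a) = R powr N" using R by (simp add: N_def powr_realpow)
   also have "\<dots> = (2 * P eps l / \<omega>) powr (\<alpha> * N)" by (simp add: R_def powr_powr)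
   also have "\<alpha> * N = 1" using N by (simp add: \<alpha>_def)
   finally show ?thesis using Pp om by simp
  qed
  moreover have "measure lborel (ball (0::'a) R) = \<omega> * R ^ DIM('a)" using R by (simp add: content_ball \<omega>_def)
  ultimately have "2 * P eps l \<le> measure lborel (ball (0::'a) R)" using om by simp
  note s = step(2)[OF e l R this]
  have e1: "(eps * (l' - l))\<^sup>2 * P eps l' = eps\<^sup>2 * ((l' - l)\<^sup>2 * P eps l')"
   by (simp add: power_mult_distrib)
  have e2: "2 * R * ((2 * C1 + 8 / r1) * eps\<^sup>2 * P eps l) = eps\<^sup>2 * (2 * R * (2 * C1 + 8 / r1) * P eps l)"
   by (simp only: mult_ac)
  have "eps\<^sup>2 * ((l' - l)\<^sup>2 * P eps l') \<le> eps\<^sup>2 * (2 * R * (2 * C1 + 8 / r1) * P eps l)"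
   using s unfolding e1 e2 .
  then have "(l' - l)\<^sup>2 * P eps l' \<le> 2 * R * (2 * C1 + 8 / r1) * P eps l" using e by simp
  also have "R = (2 / \<omega>) powr \<alpha> * P eps l powr \<alpha>" using Pp om by (simp add: R_def powr_mult powr_divide)
  also have "2 * ((2 / \<omega>) powr \<alpha> * P eps l powr \<alpha>) * (2 * C1 + 8 / r1) * P eps l = C4 * P eps l powr (1 + \<alpha>)"
   using Pp by (simp add: C4_def powr_add)
  finally show ?thesis .
 qed
 \<comment> \<open>The first bound of \<open>step\<close> between the levels 0 and 1/4 gives X 0 <=
   k eps, the 16 being (1/4)^(-2). \<open>\<theta>\<close> is the threshold for X 0^\<alpha> in
   \<open>fast_geometric_decay\<close> with constant 64 C4, and eps is chosen to get below
   it.\<close>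
 define k where "k = 16 * C1 * Vol / \<delta>"
 have k: "0 \<le> k" using C12 pos by (simp add: k_def Vol_def)
 define \<theta> where "\<theta> = 4 powr (- 1 / \<alpha>) / (64 * C4)"
 have th: "0 < \<theta>" using C4 by (simp add: \<theta>_def)
 define eps where "eps = min eps0 (\<theta> powr (1 / \<alpha>) / (k + 1))"
 have e: "0 < eps" "eps \<le> eps0" using e0 th k by (auto simp: eps_def)
 have ke: "k * eps \<le> \<theta> powr (1 / \<alpha>)"
 proof -
  have "k * eps \<le> (k + 1) * (\<theta> powr (1 / \<alpha>) / (k + 1))" using e k by (intro mult_mono) (auto simp: eps_def)
  then show ?thesis using k by simp
 qed
 define l where "l j = (1 - (1 / 2) ^ j) / (2::real)" for j :: nat
 have lj: "0 \<le> l j" "l j < l (Suc j)" "l j < 1 / 2" "l (Suc j) - l j = (1 / 2) ^ j / 4" for j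
  by (auto simp: l_def power_le_one field_simps)
 define X where "X j = P eps (l (Suc j))" for j
 \<comment> \<open>Consecutive levels entering the recursion for X j differ by 2^(-j-3), and the
   inverse square of this is 64 * 4^j.\<close>
 have "X \<longlonglongrightarrow> 0"
 proof (rule fast_geometric_decay[where C="64 * C4" and \<alpha>=\<alpha>])
  show "X (Suc j) \<le> 64 * C4 * 4 ^ j * X j powr (1 + \<alpha>)" for j
  proof -
   have "((1 / 2) ^ Suc j / 4)\<^sup>2 * X (Suc j) \<le> C4 * X j powr (1 + \<alpha>)"
    using iter[OF e lj(1) lj(2), of "Suc j"] unfolding lj(4) X_def .
   moreover have "((1 / 2) ^ Suc j / 4)\<^sup>2 = 1 / (64 * 4 ^ j :: real)"
   proof -
    have "(2::real) ^ (j * 2) = 4 ^ j" by (metis power_mult power2_eq_square mult.commute numeral_times_numeral semiring_norm(12,13))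
    then show ?thesis by (simp add: power2_eq_square power_divide field_simps flip: power_mult_distrib)
   qed
   ultimately show ?thesis by (simp add: field_simps)
  qed
  have "\<delta> * ((eps * (l (Suc 0) - l 0))\<^sup>2 * X 0) \<le> C1 * eps ^ 3 * P eps (l 0)"
   using step(1)[OF e lj(1) lj(2), of 0] by (simp add: X_def)
  also have "\<dots> \<le> C1 * eps ^ 3 * Vol" using PVol C12 e by (intro mult_left_mono) auto
  finally have "eps\<^sup>2 * (\<delta> * X 0) \<le> eps\<^sup>2 * (16 * C1 * Vol * eps)"
   unfolding lj(4) by (simp add: power2_eq_square power3_eq_cube field_simps)
  then have "\<delta> * X 0 \<le> 16 * C1 * Vol * eps" using e by simp
  then have "X 0 \<le> k * eps" using pos by (simp add: k_def field_simps)
  then have "X 0 \<le> \<theta> powr (1 / \<alpha>)" using ke by simp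
  then have "X 0 powr \<alpha> \<le> (\<theta> powr (1 / \<alpha>)) powr \<alpha>" using al P0 by (intro powr_mono2) (auto simp: X_def)
  also have "\<dots> = \<theta>" using al th by (simp add: powr_powr)
  finally show "64 * C4 * X 0 powr \<alpha> \<le> 4 powr (- 1 / \<alpha>)" using C4 by (simp add: \<theta>_def field_simps)
 qed (use P0 al C4 in \<open>auto simp: X_def\<close>)
 moreover have "P eps (1 / 2) \<le> X j" for j
  unfolding X_def P_def
 proof (intro measure_mono_fmeasurable)
  have "Psi eps (1 / 2) x \<le> Psi eps (l (Suc j)) x" for x
   unfolding Psi_def using lj(3)[of "Suc j"] e by (intro add_left_mono mult_left_mono) auto
  then show "S eps (1 / 2) \<subseteq> S eps (l (Suc j))" unfolding S_def by (auto intro: less_le_trans)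
 qed (use So Sfm in auto)
 ultimately have "P eps (1 / 2) \<le> 0" by (intro LIMSEQ_le_const) auto
 moreover have "\<exists>x. x \<in> S eps (1 / 2)"
 proof -
  \<comment> \<open>Near x0 the paraboloid term at level 1/2 is at least eps (1 - 1/4 - 1/2) = eps /
    4, more than the deficit eps / 8 of v - z. So the superlevel set at 1/2 is open and nonempty,
    yet has measure 0.\<close>
  have "\<exists>\<^sub>F x in at x0. M - eps / 8 < v x - z x" using e by (intro fr) auto
  moreover have "\<forall>\<^sub>F x in at x0. x \<in> V \<and> norm (x - x0) < r1 / 4"
  proof -
   have "\<forall>\<^sub>F x in at x0. x \<noteq> x0 \<and> x \<in> ball x0 (r1 / 4)"
    using r1 by (intro eventually_conj eventually_neq_at_within eventually_at_in_open') auto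
   then show ?thesis by (rule eventually_mono) (use r1 in \<open>auto simp: V_def dist_norm norm_minus_commute\<close>)
  qed
  ultimately obtain x where x: "M - eps / 8 < v x - z x" "x \<in> V" "norm (x - x0) < r1 / 4"
   using frequently_ex[OF frequently_eventually_conj] by blast
  have "(norm (x - x0))\<^sup>2 \<le> (r1 / 4)\<^sup>2" using x by (intro power_mono) auto
  then have "(norm (x - x0))\<^sup>2 / (r1 / 2)\<^sup>2 \<le> 1 / 4" using r1 by (simp add: power2_eq_square field_simps)
  then have "eps * (1 / 4) \<le> eps * (1 - (norm (x - x0))\<^sup>2 / (r1 / 2)\<^sup>2 - 1 / 2)" using e by (intro mult_left_mono) auto
  then have "0 < Psi eps (1 / 2) x" using x e unfolding Psi_def by linarith
  then show ?thesis using x by (auto simp: S_def)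
 qed
 ultimately show False using open_measure_pos[OF So _ Sfin] unfolding P_def by (metis not_less)
qed

section \<open>Radial solutions\<close>

lemma grad_cmult': "C1_on U u \<Longrightarrow> x \<in> U \<Longrightarrow> grad (\<lambda>x. c * u x) x = c *\<^sub>R grad u x"
 by (intro grad_cmult C1_on_differentiable)

lemma wsol_minus:
 assumes "wsol p q a U u" shows "wsol p q (- a) U (\<lambda>x. - u x)"
 unfolding wsol_def
proof (intro conjI allI impI)
 note C = wsol_C1[OF assms]
 show "C1_on U (\<lambda>x. - u x)" using C1_on_cmult[OF C, of "-1"] by simp
 fix \<phi> :: "'a \<Rightarrow> real" assume phi: "c1c U \<phi>"
 obtain K where K: "K \<subseteq> U" "\<And>x. x \<notin> K \<Longrightarrow> \<phi> x = 0" "\<And>x. x \<notin> K \<Longrightarrow> grad \<phi> x = 0"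
  using c1c_E[OF phi] by metis
 have "(\<lambda>x. vflux p (grad (\<lambda>x. - u x) x) \<bullet> grad \<phi> x + - a * norm (grad (\<lambda>x. - u x) x) powr q * \<phi> x)
  = (\<lambda>x. - (vflux p (grad u x) \<bullet> grad \<phi> x + a * norm (grad u x) powr q * \<phi> x))"
 proof
  fix x
  show "vflux p (grad (\<lambda>x. - u x) x) \<bullet> grad \<phi> x + - a * norm (grad (\<lambda>x. - u x) x) powr q * \<phi> x
   = - (vflux p (grad u x) \<bullet> grad \<phi> x + a * norm (grad u x) powr q * \<phi> x)"
  proof (cases "x \<in> K")
   case True
   then have "grad (\<lambda>x. - u x) x = - grad u x" using grad_cmult'[OF C, of x "-1"] K by auto
   then show ?thesis by (simp add: vflux_minus)
  qed (simp add: K)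
 qed
 then have "(LINT x|lborel. vflux p (grad (\<lambda>x. - u x) x) \<bullet> grad \<phi> x + - a * norm (grad (\<lambda>x. - u x) x) powr q * \<phi> x)
  = - (LINT x|lborel. vflux p (grad u x) \<bullet> grad \<phi> x + a * norm (grad u x) powr q * \<phi> x)"
  by (simp only: Bochner_Integration.integral_minus)
 then show "(LINT x|lborel. vflux p (grad (\<lambda>x. - u x) x) \<bullet> grad \<phi> x + - a * norm (grad (\<lambda>x. - u x) x) powr q * \<phi> x) = 0"
  using assms phi by (simp only: wsol_def minus_zero)
qed

lemma GDERIV_radial:
 assumes "x \<noteq> (0::'a::euclidean_space)" "DERIV B (norm x) :> b"
 shows "GDERIV (\<lambda>x. B (norm x)) x :> (b / norm x) *\<^sub>R x"
 using GDERIV_DERIV_compose[OF GDERIV_norm[OF assms(1)] assms(2)] by (simp add: sgn_div_norm divide_inverse)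

text \<open>The flux is h(|x|) x with h = sg r^(-N) w, and the integral of x . grad g + N g for g =
  h \<phi> vanishes. Expanding it leaves h x . grad \<phi> plus \<phi> times r h' + N h = sg r^(1-N)
  w', which is the lower-order term by \<open>eq\<close>.\<close>

lemma wsol_radial:
 fixes p q a sg :: real and w :: "real \<Rightarrow> real"
 defines "N \<equiv> real DIM('a::euclidean_space)"
 assumes p: "1 < p" and q: "0 < q" and I: "open I" "I \<subseteq> {0<..}"
  and B: "\<And>r. r \<in> I \<Longrightarrow> DERIV B r :> sg * (r powr (1 - N) * w r) powr (1 / (p - 1))"
  and sg: "\<bar>sg\<bar> = 1" and w: "\<And>r. r \<in> I \<Longrightarrow> 0 < w r" "\<And>r. r \<in> I \<Longrightarrow> DERIV w r :> w' r" "continuous_on I w'"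
  and eq: "\<And>r. r \<in> I \<Longrightarrow> sg * r powr (1 - N) * w' r = a * (r powr (1 - N) * w r) powr (q / (p - 1))"
 shows "wsol p q a {x::'a. norm x \<in> I} (\<lambda>x. B (norm x))"
  "\<And>x::'a. norm x \<in> I \<Longrightarrow> grad (\<lambda>x. B (norm x)) x = (sg * (norm x powr (1 - N) * w (norm x)) powr (1 / (p - 1)) / norm x) *\<^sub>R x"
proof -
 define U where "U = {x::'a. norm x \<in> I}"
 define b where "b r = sg * (r powr (1 - N) * w r) powr (1 / (p - 1))" for r
 have U0: "x \<noteq> 0" "0 < norm x" if "x \<in> U" for x using that I by (auto simp: U_def)
 have Uo: "open U"
  unfolding U_def using open_vimage[OF I(1) continuous_on_norm_id] by (simp add: vimage_def)
 have cw: "continuous_on I w" using w(2) DERIV_isCont by (blast intro: continuous_at_imp_continuous_on)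
 have ri: "continuous_on I (\<lambda>r. r powr t)" for t using I(2) by (intro continuous_intros) auto
 have cb: "continuous_on I b" unfolding b_def
  by (intro continuous_intros cw ri) (use w(1) I(2) in \<open>force simp: mult_pos_pos\<close>)
 have cn: "continuous_on U (\<lambda>x. h (norm x))" if "continuous_on I h" for h :: "real \<Rightarrow> real"
  by (rule continuous_on_compose2[OF that]) (auto simp: U_def intro: continuous_intros)
 have G: "GDERIV (\<lambda>x. B (norm x)) x :> (b (norm x) / norm x) *\<^sub>R x" if "x \<in> U" for x
  using GDERIV_radial[OF U0(1)[OF that] B[of "norm x"]] that by (simp add: U_def b_def)
 then show gr: "norm x \<in> I \<Longrightarrow> grad (\<lambda>x. B (norm x)) x = (sg * (norm x powr (1 - N) * w (norm x)) powr (1 / (p - 1)) / norm x) *\<^sub>R x" for x :: 'a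
  using grad_eqI[OF G, of x] by (simp add: U_def b_def)
 have C: "C1_on U (\<lambda>x. B (norm x))"
  by (rule C1_onI[OF G]) (use U0 in \<open>auto intro!: continuous_intros cn[OF cb]\<close>)
 define h where "h r = sg * r powr (- N) * w r" for r
 define h' where "h' r = sg * (- N * r powr (- N - 1) * w r + r powr (- N) * w' r)" for r
 have hd: "DERIV h r :> h' r" if "r \<in> I" for r
 proof -
  have "r > 0" using that I by auto
  then have 1: "DERIV (\<lambda>r. r powr (- N)) r :> - N * r powr (- N - 1)" by (rule has_real_derivative_powr)
  show ?thesis unfolding h_def[abs_def] h'_def
   using DERIV_cmult[OF DERIV_mult[OF 1 w(2)[OF that]], of sg] by (simp add: algebra_simps)
 qed
 have ch': "continuous_on I h'" unfolding h'_def by (intro continuous_intros cw w(3) ri)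
 have pw: "vflux p (grad (\<lambda>x. B (norm x)) x) = h (norm x) *\<^sub>R x"
  "norm (grad (\<lambda>x. B (norm x)) x) powr q = (norm x powr (1 - N) * w (norm x)) powr (q / (p - 1))" if "x \<in> U" for x
 proof -
  define r where "r = norm x"
  have r: "r \<in> I" "0 < r" using that U0 by (auto simp: r_def U_def)
  define y where "y = r powr (1 - N) * w r"
  have y: "0 < y" using r w(1) by (simp add: y_def)
  have g: "grad (\<lambda>x. B (norm x)) x = (b r / r) *\<^sub>R x" using grad_eqI[OF G[OF that]] by (simp add: r_def)
  have nb: "norm (grad (\<lambda>x. B (norm x)) x) = y powr (1 / (p - 1))"
   unfolding g using r sg by (simp add: b_def y_def r_def[symmetric] abs_mult)
  show "norm (grad (\<lambda>x. B (norm x)) x) powr q = (norm x powr (1 - N) * w (norm x)) powr (q / (p - 1))"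
   unfolding nb by (simp add: powr_powr y_def r_def)
  have "(y powr (1 / (p - 1))) powr (p - 2) * y powr (1 / (p - 1)) = y powr ((1 / (p - 1)) * (p - 2) + 1 / (p - 1))"
   by (simp add: powr_powr powr_add)
  also have "(1 / (p - 1)) * (p - 2) + 1 / (p - 1) = 1" using p by (simp add: field_simps)
  finally have y1: "(y powr (1 / (p - 1))) powr (p - 2) * y powr (1 / (p - 1)) = y" using y by simp
  have "vflux p (grad (\<lambda>x. B (norm x)) x) = ((y powr (1 / (p - 1))) powr (p - 2) * (sg * y powr (1 / (p - 1)) / r)) *\<^sub>R x"
   unfolding vflux_def nb by (simp add: g b_def y_def)
  also have "(y powr (1 / (p - 1))) powr (p - 2) * (sg * y powr (1 / (p - 1)) / r) = sg * y / r"
   using y1 by (simp add: mult.left_commute mult.commute)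
  also have "y / r = r powr (- N) * w r"
  proof -
   have "r powr (1 - N) = r powr (- N) * r" using powr_add[of r "- N" 1] r by simp
   then show ?thesis using r by (simp add: y_def)
  qed
  then have "sg * (y / r) = h r" by (simp add: h_def)
  then have "sg * y / r = h r" by (simp only: times_divide_eq_right)
  finally show "vflux p (grad (\<lambda>x. B (norm x)) x) = h (norm x) *\<^sub>R x" by (simp add: r_def)
 qed
 show "wsol p q a {x::'a. norm x \<in> I} (\<lambda>x. B (norm x))"
  unfolding wsol_def U_def[symmetric]
 proof (intro conjI allI impI C)
  fix \<phi> :: "'a \<Rightarrow> real" assume phi: "c1c U \<phi>"
  obtain K where K: "compact K" "K \<subseteq> U" "\<And>x. x \<notin> K \<Longrightarrow> \<phi> x = 0" "\<And>x. x \<notin> K \<Longrightarrow> grad \<phi> x = 0"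
   "C1_on UNIV \<phi>" using c1c_E[OF phi] by metis
  define g where "g x = h (norm x) * \<phi> x" for x
  have hG: "GDERIV (\<lambda>x. h (norm x)) x :> (h' (norm x) / norm x) *\<^sub>R x" if "x \<in> U" for x
   using GDERIV_radial[OF U0(1)[OF that] hd[of "norm x"]] that by (simp add: U_def)
  have hC: "C1_on U (\<lambda>x. h (norm x))"
   by (rule C1_onI[OF hG]) (use U0 in \<open>auto intro!: continuous_intros cn[OF ch']\<close>)
  have gC: "C1_on U g" unfolding g_def[abs_def] by (rule C1_on_mult[OF hC C1_on_subset[OF K(5)]]) simp
  have gc: "c1c UNIV g"
   by (rule c1c_I[OF Uo gC K(1,2)]) (auto simp: g_def K(3))
  have gg: "grad g x = h (norm x) *\<^sub>R grad \<phi> x + (\<phi> x * h' (norm x) / norm x) *\<^sub>R x" if "x \<in> U" for x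
   unfolding g_def[abs_def] using grad_eqI[OF GDERIV_mult[OF hG[OF that] C1_onD(1)[OF K(5) UNIV_I]]] by simp
  have "x \<bullet> grad g x + DIM('a) * g x = vflux p (grad (\<lambda>x. B (norm x)) x) \<bullet> grad \<phi> x
   + a * norm (grad (\<lambda>x. B (norm x)) x) powr q * \<phi> x" for x
  proof (cases "x \<in> K")
   case True
   then have xU: "x \<in> U" using K by auto
   define r where "r = norm x"
   have r: "r \<in> I" "0 < r" using xU U0 by (auto simp: r_def U_def)
   have e1: "r powr (- N - 1) * r = r powr (- N)" "r powr (- N) * r = r powr (1 - N)"
    using powr_add[of r "- N - 1" 1] powr_add[of r "- N" 1] r by simp_all
   have "h' r * r + N * h r = sg * (r powr (- N) * r) * w' r"
   proof -
    have "h' r * r = sg * (- N * (r powr (- N - 1) * r) * w r + r powr (- N) * r * w' r)"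
     by (simp add: h'_def algebra_simps)
    then show ?thesis unfolding e1 h_def by (simp add: algebra_simps)
   qed
   then have e2: "h' r * r + N * h r = a * (r powr (1 - N) * w r) powr (q / (p - 1))"
    unfolding e1 using eq[OF r(1)] by simp
   have "x \<bullet> grad g x + DIM('a) * g x = h r * (x \<bullet> grad \<phi> x) + \<phi> x * (h' r * r + N * h r)"
    unfolding gg[OF xU] g_def using r
    by (simp add: inner_add_right r_def[symmetric] dot_square_norm N_def power2_eq_square algebra_simps)
   then show ?thesis unfolding e2 pw[OF xU] by (simp add: r_def)
  next
   case False
   have "grad g x = 0"
    using grad_local[of "- K" x g "\<lambda>_. 0"] False K by (simp add: g_def compact_imp_closed open_Compl)
   then show ?thesis using K(3,4)[OF False] by (simp add: g_def)
  qed
  then show "(LINT x|lborel. vflux p (grad (\<lambda>x. B (norm x)) x) \<bullet> grad \<phi> x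
   + a * norm (grad (\<lambda>x. B (norm x)) x) powr q * \<phi> x) = 0"
   using integral_dilation_zero[OF gc] by simp
 qed
qed

definition mur :: "real \<Rightarrow> real \<Rightarrow> real \<Rightarrow> real"
 where "mur p N r = (if p = N then - ln r else r powr ((p - N) / (p - 1)))"

lemma mu_mur: "mu p (x::'a::euclidean_space) = mur p (real DIM('a)) (norm x)"
 by (simp add: mu_def mur_def)

text \<open>The dimension enters as a real number, which keeps the ordinary differential equation
  apart from the space; statements about functions on the space add the equation
  \<open>dim\<close>.\<close>

locale exponents =
 fixes p q N :: real
 assumes N2: "2 \<le> N" and p1: "1 < p" and pN: "p \<le> N" and q1: "p - 1 < q" and qc: "q < N * (p - 1) / (N - 1)"
begin

text \<open>If the flux of a radial function is \<open>- r\<^bsup>1-N\<^esup> w(r) x/r\<close>, the equation reads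
 \<open>- r\<^bsup>1-N\<^esup> w' = a (r\<^bsup>1-N\<^esup> w)\<^bsup>q/(p-1)\<^esup>\<close>, so that \<open>w\<^bsup>-s1\<^esup>\<close> is \<open>den a K\<close> with a constant of integration \<open>K\<close>.
 Then \<open>slope a K\<close> is minus the radial derivative of the solution \<open>J a K R\<close> vanishing on \<open>|x| = R\<close>.\<close>

definition "s1 = (q - p + 1) / (p - 1)"
definition "\<theta> = 1 - (N - 1) * s1"
definition "\<gamma> = 1 / (q - p + 1)"
definition "cf a = a * s1 / \<theta>"
definition "den a K r = K + cf a * r powr \<theta>"
definition "slope a K r = r powr ((1 - N) / (p - 1)) * den a K r powr (- \<gamma>)"
definition "J a K R r = integral {r..R} (slope a K)"
definition "cmu = (if p = N then 1 else (N - p) / (p - 1))"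

text \<open>Subcriticality enters here: q < q_c is equivalent to \<theta> > 0. Since p <= N, also
  q_c <= p, whence q < p, and this is \<gamma> > 1.\<close>

lemma exps: "0 < q" "q < p" "0 < s1" "0 < \<theta>" "1 < \<gamma>" "0 < cmu" "\<gamma> * (p - 1) = 1 / s1"
proof -
 show q0: "0 < q" using p1 q1 by simp
 have h: "q * (N - 1) < N * (p - 1)" using qc N2 by (simp add: field_simps)
 have "N * (p - 1) \<le> p * (N - 1)" using pN by (simp add: algebra_simps)
 then have "q * (N - 1) < p * (N - 1)" using h by simp
 then show qp: "q < p" using N2 by simp
 show "0 < s1" using p1 q1 by (simp add: s1_def)
 show "1 < \<gamma>" using q1 qp by (simp add: \<gamma>_def)
 have "(N - 1) * (q - p + 1) < p - 1" using h by (simp add: algebra_simps)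
 then show "0 < \<theta>" using p1 by (simp add: \<theta>_def s1_def)
 show "0 < cmu" using p1 pN by (auto simp: cmu_def)
 show "\<gamma> * (p - 1) = 1 / s1" by (simp add: \<gamma>_def s1_def)
qed

lemma slope_eq:
 assumes "0 < r"
 shows "slope a K r = (r powr (1 - N) * den a K r powr (- 1 / s1)) powr (1 / (p - 1))"
proof -
 have "1 / s1 / (p - 1) = \<gamma>" unfolding exps(7)[symmetric] using p1 by simp
 then have "- 1 / s1 * (1 / (p - 1)) = - \<gamma>" by simp
 moreover have "(1 - N) * (1 / (p - 1)) = (1 - N) / (p - 1)" by simp
 ultimately show ?thesis
  unfolding slope_def powr_mult[of "r powr (1 - N)" _ "1 / (p - 1)"] powr_powr by simp
qed

lemma slope_pos: "0 < r \<Longrightarrow> 0 < den a K r \<Longrightarrow> 0 < slope a K r"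
 by (simp add: slope_def)

lemma continuous_on_slope:
 assumes "\<And>r. r \<in> S \<Longrightarrow> 0 < r \<and> 0 < den a K r"
 shows "continuous_on S (slope a K)"
proof -
 have "continuous_on S (den a K)" unfolding den_def[abs_def]
  by (intro continuous_intros) (use assms in force)
 then show ?thesis unfolding slope_def[abs_def]
  by (intro continuous_intros) (use assms in force)+
qed

lemma J_deriv:
 assumes r: "0 \<le> r0" "r0 < r" "r < R" and d: "\<And>t. r0 < t \<Longrightarrow> t \<le> R \<Longrightarrow> 0 < den a K t"
 shows "DERIV (J a K R) r :> - slope a K r"
proof -
 define c where "c = (r0 + r) / 2"
 have c: "r0 < c" "c < r" "0 < c" using r by (auto simp: c_def)
 have cont: "continuous_on {c..R} (slope a K)"
  by (rule continuous_on_slope) (use c d in auto)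
 then have int: "slope a K integrable_on {c..R}" by (rule integrable_continuous_real)
 have "((\<lambda>u. integral {c..u} (slope a K)) has_real_derivative slope a K r) (at r within {c..R})"
  by (rule integral_has_real_derivative[OF cont]) (use c r in auto)
 then have 1: "((\<lambda>u. integral {c..u} (slope a K)) has_real_derivative slope a K r) (at r)"
  using at_within_interior[of r "{c..R}"] c r by simp
 have "DERIV (\<lambda>u. integral {c..R} (slope a K) - integral {c..u} (slope a K)) r :> - slope a K r"
  using DERIV_diff[OF DERIV_const 1] by simp
 then show ?thesis
 proof (rule has_field_derivative_transform_within_open[of _ _ _ "{c<..<R}"])
  fix u assume u: "u \<in> {c<..<R}"
  have "integral {c..u} (slope a K) + integral {u..R} (slope a K) = integral {c..R} (slope a K)"
   by (rule Henstock_Kurzweil_Integration.integral_combine[OF _ _ int]) (use u in auto)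
  then show "integral {c..R} (slope a K) - integral {c..u} (slope a K) = J a K R u" by (simp add: J_def)
 qed (use c r in auto)
qed

lemma J_continuous:
 assumes r: "0 < c" and d: "\<And>t. c \<le> t \<Longrightarrow> t \<le> R \<Longrightarrow> 0 < den a K t"
 shows "continuous_on {c..R} (J a K R)"
proof -
 have cont: "continuous_on {c..R} (slope a K)" by (rule continuous_on_slope) (use r d in auto)
 then have int: "slope a K integrable_on {c..R}" by (rule integrable_continuous_real)
 have "continuous_on {c..R} (\<lambda>u. integral {c..R} (slope a K) - integral {c..u} (slope a K))"
  by (intro continuous_intros indefinite_integral_continuous_1 int)
 then show ?thesis
 proof (rule continuous_on_eq)
  fix u assume u: "u \<in> {c..R}"
  have "integral {c..u} (slope a K) + integral {u..R} (slope a K) = integral {c..R} (slope a K)"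
   by (rule Henstock_Kurzweil_Integration.integral_combine[OF _ _ int]) (use u in auto)
  then show "integral {c..R} (slope a K) - integral {c..u} (slope a K) = J a K R u" by (simp add: J_def)
 qed
qed

lemma J_bounds:
 assumes r: "0 < r" "r \<le> R" and d: "\<And>t. r \<le> t \<Longrightarrow> t \<le> R \<Longrightarrow> 0 < den a K t"
 shows "(\<And>t. r \<le> t \<Longrightarrow> t \<le> R \<Longrightarrow> m \<le> slope a K t) \<Longrightarrow> m * (R - r) \<le> J a K R r"
  "(\<And>t. r \<le> t \<Longrightarrow> t \<le> R \<Longrightarrow> slope a K t \<le> m) \<Longrightarrow> J a K R r \<le> m * (R - r)" "0 \<le> J a K R r"
proof -
 have cont: "continuous_on {r..R} (slope a K)" by (rule continuous_on_slope) (use r d in auto)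
 then have int: "slope a K integrable_on {r..R}" by (rule integrable_continuous_real)
 have c: "integral {r..R} (\<lambda>_. m) = m * (R - r)" for m using r by simp
 show "m * (R - r) \<le> J a K R r" if "\<And>t. r \<le> t \<Longrightarrow> t \<le> R \<Longrightarrow> m \<le> slope a K t" for m
  unfolding J_def c[symmetric] by (rule integral_le[OF _ int]) (use that in auto)
 show "J a K R r \<le> m * (R - r)" if "\<And>t. r \<le> t \<Longrightarrow> t \<le> R \<Longrightarrow> slope a K t \<le> m"
  unfolding J_def c[symmetric] by (rule integral_le[OF int]) (use that in auto)
 show "0 \<le> J a K R r" unfolding J_def
  by (rule Henstock_Kurzweil_Integration.integral_nonneg[OF int]) (use r d in \<open>auto simp: slope_def\<close>)
qed

lemma J_R [simp]: "J a K R R = 0"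
 by (simp add: J_def)

text \<open>\<open>J\<close> decreases in r, so its flux is minus r^(1-N) w with w = den^(-1/s1);
  \<open>slope\<close> is by construction the (p-1)-th root of the modulus of this flux.\<close>

lemma wsol_J0:
 assumes dim: "N = real DIM('a::euclidean_space)" and r: "0 \<le> r0" and d: "\<And>t. r0 < t \<Longrightarrow> t \<le> R \<Longrightarrow> 0 < den a K t"
 shows "wsol p q a {x::'a. norm x \<in> {r0<..<R}} (\<lambda>x. J a K R (norm x))"
  "\<And>x::'a. norm x \<in> {r0<..<R} \<Longrightarrow> grad (\<lambda>x. J a K R (norm x)) x = (- slope a K (norm x) / norm x) *\<^sub>R x"
proof -
 define w where "w r = den a K r powr (- 1 / s1)" for r
 define w' where "w' r = - 1 / s1 * den a K r powr (- 1 / s1 - 1) * (cf a * (\<theta> * r powr (\<theta> - 1)))" for r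
 have p0: "0 < t" if "t \<in> {r0<..<R}" for t using that r by auto
 have dp: "0 < den a K t" if "t \<in> {r0<..<R}" for t using that d by auto
 have dd: "DERIV (den a K) t :> cf a * (\<theta> * t powr (\<theta> - 1))" if "t \<in> {r0<..<R}" for t
  unfolding den_def[abs_def] using p0[OF that]
  by (auto intro!: derivative_eq_intros has_real_derivative_powr)
 have wd: "DERIV w t :> w' t" if "t \<in> {r0<..<R}" for t
  using DERIV_chain2[OF has_real_derivative_powr[OF dp[OF that], of "- 1 / s1"] dd[OF that]]
  by (simp add: w_def[abs_def] w'_def)
 have cw': "continuous_on {r0<..<R} w'"
 proof -
  have "continuous_on {r0<..<R} (den a K)" using dd DERIV_isCont by (blast intro: continuous_at_imp_continuous_on)
  then show ?thesis unfolding w'_def[abs_def] using p0 dp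
   by (intro continuous_intros) force+
 qed
 note R = wsol_radial[where 'a='a, folded dim, of p q "{r0<..<R}" "J a K R" "-1" w w' a, OF p1 exps(1)]
 \<comment> \<open>Matching exponents: q/(p-1) = s1 + 1 and (1-N)(s1+1) = (1-N) + (\<theta>-1); the
   factor in \<open>cf\<close> cancels \<theta>/s1.\<close>
 have eq: "-1 * t powr (1 - N) * w' t = a * (t powr (1 - N) * w t) powr (q / (p - 1))" if t: "t \<in> {r0<..<R}" for t
 proof -
  have qs: "q / (p - 1) = s1 + 1" using p1 by (simp add: s1_def field_simps)
  have "- 1 / s1 * (s1 + 1) = - 1 / s1 - 1" using exps(3) by (simp add: field_simps)
  then have 1: "w t powr (s1 + 1) = den a K t powr (- 1 / s1 - 1)" by (simp add: w_def powr_powr)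
  have "(1 - N) * (s1 + 1) = (1 - N) + (\<theta> - 1)" by (simp add: \<theta>_def algebra_simps)
  then have 2: "(t powr (1 - N)) powr (s1 + 1) = t powr (1 - N) * t powr (\<theta> - 1)"
   unfolding powr_powr by (simp only: powr_add)
  have "cf a * \<theta> / s1 = a" using exps by (simp add: cf_def)
  then have 3: "-1 * t powr (1 - N) * w' t = a * (t powr (1 - N) * t powr (\<theta> - 1) * den a K t powr (- 1 / s1 - 1))"
   unfolding w'_def using exps by (simp add: field_simps)
  show ?thesis unfolding 3 qs powr_mult 1 2 by simp
 qed
 have dJ: "DERIV (J a K R) t :> - 1 * (t powr (1 - N) * w t) powr (1 / (p - 1))" if "t \<in> {r0<..<R}" for t
  using J_deriv[OF r _ _ d, of t R] that p0[OF that] by (simp add: slope_eq w_def)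
 have wp: "0 < w t" if "t \<in> {r0<..<R}" for t using dp[OF that] by (simp add: w_def)
 show "wsol p q a {x::'a. norm x \<in> {r0<..<R}} (\<lambda>x. J a K R (norm x))"
  by (rule R(1)) (use r dJ wp wd cw' eq in auto)
 fix x :: 'a assume x: "norm x \<in> {r0<..<R}"
 have "grad (\<lambda>x. J a K R (norm x)) x = (-1 * (norm x powr (1 - N) * w (norm x)) powr (1 / (p - 1)) / norm x) *\<^sub>R x"
  by (rule R(2)) (use r dJ wp wd cw' eq x in auto)
 then show "grad (\<lambda>x. J a K R (norm x)) x = (- slope a K (norm x) / norm x) *\<^sub>R x"
  using p0[OF x] by (simp add: slope_eq w_def)
qed

text \<open>Centred anywhere, these are the barriers of all later arguments; their gradients never
  vanish, so the elementary comparison principle applies to them.\<close>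

lemma wsol_J:
 fixes y :: "'a::euclidean_space"
 assumes dim: "N = real DIM('a)" and r: "0 \<le> r0" and d: "\<And>t. r0 < t \<Longrightarrow> t \<le> R \<Longrightarrow> 0 < den a K t"
 shows "wsol p q a {x. norm (x - y) \<in> {r0<..<R}} (\<lambda>x. J a K R (norm (x - y)))"
  "\<And>x. norm (x - y) \<in> {r0<..<R} \<Longrightarrow> grad (\<lambda>x. J a K R (norm (x - y))) x \<noteq> 0"
proof -
 have W1: "wsol p q a {x::'a. norm x \<in> {r0<..<R}} (\<lambda>x. J a K R (norm x))"
  by (rule wsol_J0(1)[OF dim r]) (rule d)
 have "wsol p q a {x::'a. x + - y \<in> {x. norm x \<in> {r0<..<R}}} (\<lambda>x. J a K R (norm (x + - y)))"
  by (rule wsol_translate[OF W1 p1 exps(1)])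
 then show "wsol p q a {x. norm (x - y) \<in> {r0<..<R}} (\<lambda>x. J a K R (norm (x - y)))" by simp
 fix x assume x: "norm (x - y) \<in> {r0<..<R}"
 have n0: "0 < norm (x - y)" using x r by auto
 have g1: "GDERIV (\<lambda>x. J a K R (norm x)) (x - y) :> grad (\<lambda>x. J a K R (norm x)) (x - y)"
  by (rule C1_onD(1)[OF wsol_C1[OF W1]]) (use x in auto)
 have g2: "grad (\<lambda>x. J a K R (norm x)) (x - y) = (- slope a K (norm (x - y)) / norm (x - y)) *\<^sub>R (x - y)"
  by (rule wsol_J0(2)[OF dim r]) (use d x in auto)
 have "grad (\<lambda>x. J a K R (norm (x - y))) x = (- slope a K (norm (x - y)) / norm (x - y)) *\<^sub>R (x - y)"
  using grad_eqI[OF GDERIV_translate[OF g1]] unfolding g2 .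
 moreover have "0 < slope a K (norm (x - y))" using n0 d x by (intro slope_pos) auto
 ultimately show "grad (\<lambda>x. J a K R (norm (x - y))) x \<noteq> 0" using n0 by auto
qed

end

section \<open>Asymptotics of radial solutions and maximum principles\<close>

lemma filterlim_powr_neg_at_right_0:
 fixes s :: real assumes "s < 0"
 shows "LIM r at_right 0. r powr s :> at_top"
proof -
 have "LIM r at_right 0. s * ln r :> at_top"
  unfolding filterlim_uminus_at_top
  using filterlim_tendsto_pos_mult_at_bot[OF tendsto_const _ ln_at_0, of "- s"] assms by simp
 from filterlim_compose[OF exp_at_top this] have "LIM r at_right 0. exp (s * ln r) :> at_top" .
 then show ?thesis
  by (rule filterlim_cong[OF refl refl, THEN iffD1, rotated])
    (auto simp: eventually_at powr_def intro!: exI[of _ 1])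
qed

context exponents begin

lemma mur_deriv:
 assumes "0 < r" shows "DERIV (mur p N) r :> - cmu * r powr ((1 - N) / (p - 1))"
proof (cases "p = N")
 case True
 then have "(1 - N) / (p - 1) = - 1" using p1 by (simp add: field_simps)
 moreover have "DERIV (\<lambda>r. - ln r) r :> - (1 / r)"
  using assms by (auto intro!: derivative_eq_intros)
 moreover have "r powr (- 1) = 1 / r" using assms by (simp add: powr_minus_divide)
 moreover have "cmu = 1" unfolding cmu_def using True by simp
 moreover have "mur p N = (\<lambda>r. - ln r)" using True by (simp add: mur_def[abs_def])
 ultimately show ?thesis by simp
next
 case False
 have "(p - N) / (p - 1) - 1 = (1 - N) / (p - 1)" using p1 by (simp add: field_simps)
 then have "DERIV (\<lambda>r. r powr ((p - N) / (p - 1))) r :> (p - N) / (p - 1) * r powr ((1 - N) / (p - 1))"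
  using has_real_derivative_powr[OF assms, of "(p - N) / (p - 1)"] by simp
 moreover have "(p - N) / (p - 1) = - cmu" using False p1 by (simp add: cmu_def field_simps)
 ultimately show ?thesis using False by (simp add: mur_def[abs_def])
qed

lemma mur_at_top: "LIM r at_right 0. mur p N r :> at_top"
proof (cases "p = N")
 case True
 have "LIM r at_right 0. - ln (r::real) :> at_top"
  using ln_at_0[unfolded filterlim_uminus_at_bot] .
 then show ?thesis using True by (simp add: mur_def[abs_def])
next
 case False
 then have "(p - N) / (p - 1) < 0" using p1 pN by (intro divide_neg_pos) auto
 from filterlim_powr_neg_at_right_0[OF this] show ?thesis using False by (simp add: mur_def[abs_def])
qed

text \<open>L'Hopital: the quotient of the derivatives is den^(-\<gamma>) / cmu, and den tends to K
  because \<theta> > 0.\<close>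

lemma J_mur_tendsto:
 assumes K: "0 < K" and R: "0 < R" and d: "\<And>t. 0 < t \<Longrightarrow> t \<le> R \<Longrightarrow> 0 < den a K t"
 shows "((\<lambda>r. J a K R r / mur p N r) \<longlongrightarrow> K powr (- \<gamma>) / cmu) (at_right 0)"
proof (rule lhopital_right_0_at_top[OF mur_at_top, where f'="\<lambda>r. - slope a K r" and g'="\<lambda>r. - cmu * r powr ((1 - N) / (p - 1))"])
 have ev: "\<forall>\<^sub>F r in at_right 0. 0 < r \<and> r < R"
  using R by (auto simp: eventually_at_right_field)
 show "\<forall>\<^sub>F r in at_right 0. - cmu * r powr ((1 - N) / (p - 1)) \<noteq> 0"
  using ev by (rule eventually_mono) (use exps(6) in auto)
 show "\<forall>\<^sub>F r in at_right 0. DERIV (J a K R) r :> - slope a K r"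
  using ev by (rule eventually_mono) (use J_deriv[of 0 _ R a K] d in auto)
 show "\<forall>\<^sub>F r in at_right 0. DERIV (mur p N) r :> - cmu * r powr ((1 - N) / (p - 1))"
  using ev by (rule eventually_mono) (use mur_deriv in auto)
 have "((\<lambda>r. den a K r powr (- \<gamma>) / cmu) \<longlongrightarrow> (K + cf a * 0) powr (- \<gamma>) / cmu) (at_right 0)"
  unfolding den_def
 proof (intro tendsto_intros)
  show "((\<lambda>r. r powr \<theta>) \<longlongrightarrow> 0) (at_right 0)"
   by (rule tendsto_zero_powrI[OF tendsto_ident_at tendsto_const]) (use exps in \<open>auto simp: eventually_at_right_field intro!: exI[of _ 1]\<close>)
 qed (use K exps in auto)
 then have "((\<lambda>r. den a K r powr (- \<gamma>) / cmu) \<longlongrightarrow> K powr (- \<gamma>) / cmu) (at_right 0)" by simp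
 then show "((\<lambda>r. - slope a K r / (- cmu * r powr ((1 - N) / (p - 1)))) \<longlongrightarrow> K powr (- \<gamma>) / cmu) (at_right 0)"
 proof (rule Lim_transform_eventually)
  show "\<forall>\<^sub>F r in at_right 0. den a K r powr - \<gamma> / cmu = - slope a K r / (- cmu * r powr ((1 - N) / (p - 1)))"
   using ev by (rule eventually_mono) (use exps in \<open>auto simp: slope_def\<close>)
 qed
qed

definition "\<beta>q = (p - q) / (q + 1 - p)"

text \<open>The second and third identities make \<open>slope 1 0\<close> a multiple of
  r^(-\<beta>q-1); the fourth identifies the multiple with the base of the power in
  \<open>lambda\<close>.\<close>

lemma \<beta>q: "0 < \<beta>q" "- \<beta>q - 1 = - \<gamma>" "(1 - N) / (p - 1) - \<theta> * \<gamma> = - \<gamma>" "1 / cf 1 = \<beta>q * (p - 1) + p - N" "0 < cf 1"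
proof -
 have t: "0 < q - p + 1" using q1 by simp
 show "0 < \<beta>q" using exps(2) q1 by (simp add: \<beta>q_def)
 show "- \<beta>q - 1 = - \<gamma>" using t by (simp add: \<beta>q_def \<gamma>_def field_simps)
 have sg: "s1 * \<gamma> = 1 / (p - 1)" using t by (simp add: s1_def \<gamma>_def)
 have "\<theta> * \<gamma> = \<gamma> - (N - 1) * (s1 * \<gamma>)" by (simp add: \<theta>_def algebra_simps)
 then show "(1 - N) / (p - 1) - \<theta> * \<gamma> = - \<gamma>" unfolding sg using p1 by (simp add: field_simps)
 show "0 < cf 1" using exps by (simp add: cf_def)
 have "1 / cf 1 = 1 / s1 - (N - 1)" using exps by (simp add: cf_def \<theta>_def diff_divide_distrib)
 also have "1 / s1 = (p - 1) / (q - p + 1)" by (simp add: s1_def)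
 also have "\<beta>q * (p - 1) + p - 1 = (p - 1) * ((p - q) / (q + 1 - p) + 1)" by (simp add: \<beta>q_def algebra_simps)
 then have "(p - 1) / (q - p + 1) = \<beta>q * (p - 1) + p - 1" using t by (simp add: field_simps)
 finally show "1 / cf 1 = \<beta>q * (p - 1) + p - N" by simp
qed

lemma J_strong_tendsto:
 assumes R: "0 < R"
 shows "((\<lambda>r. J 1 0 R r / r powr (- \<beta>q)) \<longlongrightarrow> inverse \<beta>q * (\<beta>q * (p - 1) + p - N) powr \<gamma>) (at_right 0)"
proof (rule lhopital_right_0_at_top[OF filterlim_powr_neg_at_right_0, where f'="\<lambda>r. - slope 1 0 r" and g'="\<lambda>r. - \<beta>q * r powr (- \<beta>q - 1)"])
 have ev: "\<forall>\<^sub>F r in at_right 0. 0 < r \<and> r < R"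
  using R by (auto simp: eventually_at_right_field)
 have d: "0 < den 1 0 t" if "0 < t" for t using that \<beta>q(5) by (simp add: den_def)
 show "\<forall>\<^sub>F r in at_right 0. - \<beta>q * r powr (- \<beta>q - 1) \<noteq> 0"
  using ev by (rule eventually_mono) (use \<beta>q in auto)
 show "\<forall>\<^sub>F r in at_right 0. DERIV (J 1 0 R) r :> - slope 1 0 r"
  using ev by (rule eventually_mono) (use J_deriv[of 0 _ R 1 0] d in auto)
 show "\<forall>\<^sub>F r in at_right 0. DERIV (\<lambda>r. r powr (- \<beta>q)) r :> - \<beta>q * r powr (- \<beta>q - 1)"
  using ev by (rule eventually_mono) (use has_real_derivative_powr[of _ "- \<beta>q"] in simp)
 have sl: "slope 1 0 r = (\<beta>q * (p - 1) + p - N) powr \<gamma> * r powr (- \<beta>q - 1)" if "0 < r" for r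
 proof -
  have "den 1 0 r powr (- \<gamma>) = cf 1 powr (- \<gamma>) * r powr (\<theta> * (- \<gamma>))"
   using that \<beta>q(5) by (simp add: den_def powr_mult powr_powr)
  moreover have "r powr ((1 - N) / (p - 1)) * r powr (\<theta> * (- \<gamma>)) = r powr (- \<beta>q - 1)"
   unfolding powr_add[symmetric] \<beta>q(2) using \<beta>q(3) by simp
  moreover have "cf 1 powr (- \<gamma>) = (1 / cf 1) powr \<gamma>"
   using \<beta>q(5) by (simp add: powr_minus_divide powr_divide)
  ultimately show ?thesis unfolding slope_def \<beta>q(4)[symmetric] by (simp add: mult.left_commute mult.commute)
 qed
 have "\<forall>\<^sub>F r in at_right 0. inverse \<beta>q * (\<beta>q * (p - 1) + p - N) powr \<gamma> = - slope 1 0 r / (- \<beta>q * r powr (- \<beta>q - 1))"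
  using ev by (rule eventually_mono) (use \<beta>q(1) in \<open>auto simp: sl field_simps\<close>)
 then show "((\<lambda>r. - slope 1 0 r / (- \<beta>q * r powr (- \<beta>q - 1))) \<longlongrightarrow> inverse \<beta>q * (\<beta>q * (p - 1) + p - N) powr \<gamma>) (at_right 0)"
  by (rule Lim_transform_eventually[OF tendsto_const])
qed (use \<beta>q in auto)

text \<open>A large K flattens the profile. With B bounding the variable part of \<open>den\<close>
  on (0,R], the choice K = B + y keeps den >= y for any sign of a, and y makes the slope on [r,R] as
  small as desired.\<close>

lemma J_small:
 assumes r: "0 < r" "r \<le> R" and e: "0 < \<eta>"
 obtains K where "0 < K" "\<And>t. 0 < t \<Longrightarrow> t \<le> R \<Longrightarrow> 0 < den a K t" "J a K R r \<le> \<eta>"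
proof -
 define B where "B = \<bar>cf a\<bar> * R powr \<theta>"
 define c where "c = r powr ((1 - N) / (p - 1))"
 have c: "0 < c" using r by (simp add: c_def)
 define m where "m = \<eta> / (c * (R + 1))"
 have m: "0 < m" using c e r by (simp add: m_def)
 define y where "y = m powr (- 1 / \<gamma>)"
 have y: "0 < y" using m by (simp add: y_def)
 have ym: "y powr (- \<gamma>) = m" using m exps by (simp add: y_def powr_powr)
 have dl: "y \<le> den a (B + y) t" if "0 < t" "t \<le> R" for t
 proof -
  have "t powr \<theta> \<le> R powr \<theta>" using that exps by (intro powr_mono2) auto
  then have "\<bar>cf a * t powr \<theta>\<bar> \<le> B" by (simp add: B_def abs_mult mult_left_mono)
  then show ?thesis unfolding den_def by linarith
 qed
 show ?thesis
 proof (rule that[of "B + y"])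
  show "0 < B + y" using y by (simp add: B_def add_nonneg_pos)
  show pos: "0 < den a (B + y) t" if "0 < t" "t \<le> R" for t using dl[OF that] y by simp
  have "J a (B + y) R r \<le> (c * m) * (R - r)"
  proof (rule J_bounds(2)[OF r])
   fix t assume t: "r \<le> t" "t \<le> R"
   have "t powr ((1 - N) / (p - 1)) \<le> c" unfolding c_def
    using t r N2 p1 by (intro powr_mono2') (auto intro: divide_nonpos_pos)
   moreover have "den a (B + y) t powr (- \<gamma>) \<le> m" unfolding ym[symmetric]
    using dl[of t] y exps t r by (intro powr_mono2') auto
   ultimately show "slope a (B + y) t \<le> c * m" unfolding slope_def using c by (intro mult_mono) auto
  qed (use pos r in auto)
  also have "\<dots> \<le> (c * m) * (R + 1)" using c m r by (intro mult_left_mono) auto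
  also have "\<dots> = \<eta>" using c r by (simp add: m_def)
  finally show "J a (B + y) R r \<le> \<eta>" .
 qed
qed

end

section \<open>Comparison away from critical points and maximum principles\<close>

text \<open>At an interior maximum of v - z the two gradients agree; if the common value were
  nonzero, \<open>touching_impossible\<close> would apply with it as limit.\<close>

lemma interior_max_critical:
 fixes x0 :: "'a::euclidean_space" and p q a1 a2 r :: real
 assumes p: "1 < p" "p \<le> DIM('a)" and q: "0 < q" "q \<le> p" and a: "a2 < a1" and r: "0 < r"
  and v: "wsol p q a1 (ball x0 r) v" and z: "wsol p q a2 (ball x0 r) z"
  and M: "\<And>x. x \<in> ball x0 r \<Longrightarrow> v x - z x \<le> v x0 - z x0"
 shows "grad v x0 = 0" "grad z x0 = 0"
proof -
 have x0: "x0 \<in> ball x0 r" using r by simp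
 note Cv = wsol_C1[OF v] and Cz = wsol_C1[OF z]
 have "((\<lambda>x. v x - z x) has_derivative (\<lambda>h. h \<bullet> (grad v x0 - grad z x0))) (at x0)"
  using GDERIV_diff[OF C1_onD(1)[OF Cv x0] C1_onD(1)[OF Cz x0]] by (simp add: gderiv_def)
 from differential_zero_maxmin[OF x0 open_ball this] M
 have "(\<lambda>h. h \<bullet> (grad v x0 - grad z x0)) = (\<lambda>h. 0)" by blast
 then have "(grad v x0 - grad z x0) \<bullet> (grad v x0 - grad z x0) = 0" by metis
 then have eq: "grad v x0 = grad z x0" by simp
 have False if "grad v x0 \<noteq> 0"
 proof (rule touching_impossible[OF p q a r wsol_subset[OF v] wsol_subset[OF z] _ _ that])
  show "v x - z x \<le> v x0 - z x0" if "x \<in> ball x0 r - {x0}" for x using M that by auto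
  have "isCont (grad v) x0" using C1_onD(2)[OF Cv] x0 continuous_on_eq_continuous_at[OF open_ball] by blast
  then show "(grad v \<longlongrightarrow> grad v x0) (at x0) \<or> (grad z \<longlongrightarrow> grad v x0) (at x0)" by (simp add: isCont_def)
  have "isCont (\<lambda>x. v x - z x) x0" using C1_on_isCont[OF Cv x0] C1_on_isCont[OF Cz x0] by (intro continuous_intros)
  then have t: "((\<lambda>x. v x - z x) \<longlongrightarrow> v x0 - z x0) (at x0)" by (simp add: isCont_def)
  show "\<exists>\<^sub>F x in at x0. v x0 - z x0 - e < v x - z x" if "0 < e" for e
   by (rule eventually_frequently) (use order_tendstoD(1)[OF t, of "v x0 - z x0 - e"] that in auto)
 qed auto
 then show "grad v x0 = 0" "grad z x0 = 0" using eq by auto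
qed

text \<open>A maximum of v - z inside U would be critical for both functions, which
  \<open>nc\<close> excludes, so the maximum lies on C - U.\<close>

lemma noncritical_comparison:
 fixes p q a1 a2 k :: real and U C :: "'a::euclidean_space set"
 assumes p: "1 < p" "p \<le> DIM('a)" and q: "0 < q" "q \<le> p" and a: "a2 < a1"
  and U: "open U" "U \<subseteq> C" and C: "compact C"
  and v: "wsol p q a1 U v" and z: "wsol p q a2 U z"
  and cont: "continuous_on C v" "continuous_on C z"
  and nc: "\<And>x. x \<in> U \<Longrightarrow> grad v x \<noteq> 0 \<or> grad z x \<noteq> 0"
  and bd: "\<And>x. x \<in> C - U \<Longrightarrow> v x \<le> z x + k" and x: "x \<in> C"
 shows "v x \<le> z x + k"
proof -
 obtain x0 where x0: "x0 \<in> C" "\<And>y. y \<in> C \<Longrightarrow> v y - z y \<le> v x0 - z x0"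
  using continuous_attains_sup[OF C, of "\<lambda>x. v x - z x"] x cont by (auto intro!: continuous_intros)
 have "x0 \<notin> U"
 proof
  assume "x0 \<in> U"
  then obtain r where r: "0 < r" "ball x0 r \<subseteq> U" using U openE by blast
  have "grad v x0 = 0 \<and> grad z x0 = 0"
   using interior_max_critical[OF p q a r(1) wsol_subset[OF v r(2)] wsol_subset[OF z r(2)]] x0(2) r U by blast
  then show False using nc[OF \<open>x0 \<in> U\<close>] by blast
 qed
 then have "v x0 - z x0 \<le> k" using bd[of x0] x0 by simp
 then show ?thesis using x0(2)[OF x] by simp
qed

context exponents begin

text \<open>Hopf's argument: if u x is below the maximum, take the point x1 of the contact set
  nearest to x. In an annulus about x that reaches x1, a radial barrier forces u to decrease
  linearly from x1 towards x, although the gradient of u vanishes at the interior maximum x1. The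
  radius \<rho>/4 keeps the annulus inside the domain.\<close>

lemma strong_maximum:
 fixes x0 :: "'a::euclidean_space"
 assumes dim: "N = real DIM('a)" and u: "wsol p q a (ball x0 \<rho>) u" and r: "0 < \<rho>"
  and M: "\<And>x. x \<in> ball x0 \<rho> \<Longrightarrow> u x \<le> u x0" and x: "x \<in> ball x0 (\<rho> / 4)"
 shows "u x = u x0"
proof (rule ccontr)
 assume neq: "u x \<noteq> u x0"
 note C = wsol_C1[OF u]
 define S where "S = {z \<in> cball x0 (\<rho> / 2). u z = u x0}"
 have cu: "continuous_on (cball x0 (\<rho> / 2)) u"
  using C1_on_continuous_on[OF C] r by (rule_tac continuous_on_subset) auto
 have S: "closed S" "x0 \<in> S"
  using continuous_closed_preimage_constant[OF cu closed_cball, of "u x0"] r by (auto simp: S_def)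
 define d where "d = infdist x S"
 obtain x1 where x1: "x1 \<in> S" "d = dist x x1" using infdist_attains_inf[OF S(1)] S(2) unfolding d_def by blast
 have "x \<notin> S" using neq by (auto simp: S_def)
 then have d0: "0 < d" using x1 by auto
 have dle: "d < \<rho> / 4" using infdist_le[OF S(2), of x] x by (simp add: d_def dist_commute)
 have inb: "norm (y - x) \<le> d \<Longrightarrow> y \<in> ball x0 \<rho> \<and> y \<in> cball x0 (\<rho> / 2)" for y
  using dist_triangle[of x0 y x] x dle r by (simp add: dist_norm norm_minus_commute)
 have lt: "u y < u x0" if "norm (y - x) < d" for y
 proof -
  have "y \<notin> S" using infdist_le[of y S x] that by (auto simp: d_def dist_norm norm_minus_commute)
  then show ?thesis using inb[of y] that M[of y] by (auto simp: S_def order_less_le)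
 qed
 have cu2: "continuous_on {y. norm (y - x) \<le> d} u"
  by (rule continuous_on_subset[OF cu]) (use inb in auto)
 have comp: "compact {y. d / 2 \<le> norm (y - x) \<and> norm (y - x) \<le> d}" "compact {y. norm (y - x) = d / 2}"
 proof -
  have "{y. d / 2 \<le> norm (y - x) \<and> norm (y - x) \<le> d} = cball x d - ball x (d / 2)"
   "{y. norm (y - x) = d / 2} = sphere x (d / 2)"
   by (auto simp: dist_norm norm_minus_commute)
  then show "compact {y. d / 2 \<le> norm (y - x) \<and> norm (y - x) \<le> d}" "compact {y. norm (y - x) = d / 2}"
   by (auto intro: compact_diff)
 qed
 obtain \<eta> where eta: "0 < \<eta>" "\<And>y. norm (y - x) = d / 2 \<Longrightarrow> u y \<le> u x0 - \<eta>"
 proof (cases "{y. norm (y - x) = d / 2} = {}")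
  case True then show ?thesis using that[of 1] by auto
 next
  case False
  obtain y0 where y0: "norm (y0 - x) = d / 2" "\<And>y. norm (y - x) = d / 2 \<Longrightarrow> u y \<le> u y0"
  proof -
   have "continuous_on {y. norm (y - x) = d / 2} u" by (rule continuous_on_subset[OF cu2]) (use d0 in auto)
   from continuous_attains_sup[OF comp(2) False this] show thesis using that by blast
  qed
  show ?thesis using that[of "u x0 - u y0"] y0 lt[of y0] d0 by auto
 qed
 \<comment> \<open>With coefficient 1 - a for J, its negative has coefficient a - 1 < a, the strict
   order that comparison asks for. The height of J on the inner sphere stays below the gap
   \<open>\<eta>\<close>.\<close>
 obtain K where K: "0 < K" "\<And>t. 0 < t \<Longrightarrow> t \<le> d \<Longrightarrow> 0 < den (1 - a) K t" "J (1 - a) K d (d / 2) \<le> \<eta>"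
  using J_small[of "d / 2" d \<eta> "1 - a"] d0 eta(1) by auto
 let ?J = "J (1 - a) K d"
 let ?U = "{y. norm (y - x) \<in> {d/2<..<d}}" and ?C = "{y. d / 2 \<le> norm (y - x) \<and> norm (y - x) \<le> d}"
 define b where "b y = - ?J (norm (y - x))" for y
 have Jw: "wsol p q (1 - a) ?U (\<lambda>y. ?J (norm (y - x)))" "\<And>y. y \<in> ?U \<Longrightarrow> grad (\<lambda>y. ?J (norm (y - x))) y \<noteq> 0"
 proof -
  show "wsol p q (1 - a) ?U (\<lambda>y. ?J (norm (y - x)))" by (rule wsol_J(1)[OF dim]) (use K d0 in auto)
  show "grad (\<lambda>y. ?J (norm (y - x))) y \<noteq> 0" if "y \<in> ?U" for y
   by (rule wsol_J(2)[OF dim, where ?r0.0="d / 2"]) (use that K d0 in auto)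
 qed
 have bw: "wsol p q (- (1 - a)) ?U b" unfolding b_def[abs_def] by (rule wsol_minus[OF Jw(1)])
 have bg: "grad b y \<noteq> 0" if "y \<in> ?U" for y
 proof -
  have "grad b y = -1 *\<^sub>R grad (\<lambda>y. ?J (norm (y - x))) y"
   using grad_cmult'[OF wsol_C1[OF Jw(1)] that, of "-1"] by (simp add: b_def[abs_def])
  then show ?thesis using Jw(2)[OF that] by simp
 qed
 have cJ: "continuous_on {d/2..d} ?J" by (rule J_continuous) (use d0 K in auto)
 have main: "u y \<le> b y + u x0" if y: "y \<in> ?C" for y
 proof (rule noncritical_comparison[where U="?U" and C="?C" and p=p and q=q and ?a1.0=a and ?a2.0="- (1 - a)"])
  show "wsol p q a ?U u" by (rule wsol_subset[OF u]) (use inb in auto)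
  have "open (norm -` {d/2<..<d} :: 'a set)" by (rule open_vimage) (auto intro: continuous_intros)
  then have "open ((\<lambda>y. y - x) -` (norm -` {d/2<..<d}))" by (intro open_vimage) (auto intro: continuous_intros)
  then show "open ?U" by (simp add: vimage_def)
  show "continuous_on ?C u" by (rule continuous_on_subset[OF cu2]) auto
  show "continuous_on ?C b" unfolding b_def[abs_def]
   by (intro continuous_intros continuous_on_compose2[OF cJ]) auto
  show "u y \<le> b y + u x0" if "y \<in> ?C - ?U" for y
  proof -
   have "norm (y - x) = d / 2 \<or> norm (y - x) = d" using that by auto
   then show ?thesis
   proof
    assume e: "norm (y - x) = d / 2"
    show ?thesis using eta(2)[OF e] K(3) unfolding b_def e by simp
   next
    assume "norm (y - x) = d" then show ?thesis using inb[of y] M[of y] by (simp add: b_def)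
   qed
  qed
 qed (use p1 pN dim exps bw bg comp y in auto)
 obtain m where m: "0 < m" "\<And>t. d / 2 \<le> t \<Longrightarrow> t \<le> d \<Longrightarrow> m \<le> slope (1 - a) K t"
 proof -
  have "continuous_on {d/2..d} (slope (1 - a) K)" by (rule continuous_on_slope) (use d0 K in auto)
  from continuous_attains_inf[OF compact_Icc _ this] d0
  obtain t0 where t0: "t0 \<in> {d/2..d}" "\<And>t. t \<in> {d/2..d} \<Longrightarrow> slope (1 - a) K t0 \<le> slope (1 - a) K t" by auto
  show ?thesis by (rule that[of "slope (1 - a) K t0"]) (use t0 K d0 slope_pos in auto)
 qed
 have x1b: "x1 \<in> ball x0 \<rho>" "u x1 = u x0" "norm (x1 - x) = d"
  using x1 inb[of x1] by (auto simp: S_def dist_norm norm_minus_commute)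
 have dx1: "(u has_derivative (\<lambda>h. h \<bullet> grad u x1)) (at x1)" using C1_onD(1)[OF C x1b(1)] by (simp add: gderiv_def)
 have "(\<lambda>h. h \<bullet> grad u x1) = (\<lambda>h. 0)"
  by (rule differential_zero_maxmin[OF x1b(1) open_ball dx1]) (use M x1b in auto)
 then have "(u has_derivative (\<lambda>h. 0)) (at x1)" using dx1 by simp
 then have lim: "((\<lambda>h. norm (u (x1 + h) - u x1 - 0) / norm h) \<longlongrightarrow> 0) (at 0)"
  by (simp add: has_derivative_at)
 then have "\<forall>\<^sub>F h in at 0. norm (u (x1 + h) - u x1 - 0) / norm h < m / 2"
  using m(1) by (intro order_tendstoD(2)[OF lim]) auto
 then obtain s where s: "0 < s" "\<And>h. h \<noteq> 0 \<Longrightarrow> norm h < s \<Longrightarrow> \<bar>u (x1 + h) - u x1\<bar> / norm h < m / 2"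
  by (auto simp: eventually_at dist_norm)
 define t where "t = min (s / 2) (d / 2)"
 have t: "0 < t" "t < s" "t \<le> d / 2" using s d0 by (auto simp: t_def)
 \<comment> \<open>A step of length t from x1 towards x: the barrier gives a drop of at least m t,
   differentiability at x1 a change below m t / 2.\<close>
 define h where "h = (t / d) *\<^sub>R (x - x1)"
 have hn: "norm h = t" using t d0 x1b(3) by (simp add: h_def norm_minus_commute)
 have pos: "norm (x1 + h - x) = d - t"
 proof -
  have "x1 + h - x = (1 - t / d) *\<^sub>R (x1 - x)" by (simp add: h_def algebra_simps)
  moreover have "0 \<le> 1 - t / d" using t d0 by (simp add: field_simps)
  ultimately have "norm (x1 + h - x) = (1 - t / d) * norm (x1 - x)" by (simp only: norm_scaleR abs_of_nonneg)
  then show ?thesis using x1b(3) d0 by (simp add: left_diff_distrib)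
 qed
 have "u (x1 + h) \<le> b (x1 + h) + u x0" using main[of "x1 + h"] pos t d0 by auto
 moreover have "m * (d - (d - t)) \<le> ?J (d - t)"
  by (rule J_bounds(1)) (use m K t d0 in auto)
 ultimately have "m * t \<le> u x1 - u (x1 + h)" using pos x1b(2) by (simp add: b_def)
 moreover have "\<bar>u (x1 + h) - u x1\<bar> < m / 2 * t"
  using s(2)[of h] hn t by (auto simp: field_simps)
 moreover have "0 < m * t" using m t by simp
 ultimately show False by linarith
qed

text \<open>A barrier J with K > 0 and coefficient a - 1 grows like L \<open>mu\<close> at 0, faster
  than u, and can be taken at most \<open>\<eta>\<close> at the given x. So u <= J + m on a small
  sphere, on the outer sphere, and hence at x.\<close>

lemma removable_maximum:
 fixes u :: "'a::euclidean_space \<Rightarrow> real"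
 assumes dim: "N = real DIM('a)" and u: "wsol p q a (ball 0 R0 - {0}) u" and r: "0 < r" "r < R0"
  and lim: "\<And>k. 0 < k \<Longrightarrow> \<forall>\<^sub>F x in at 0. u x \<le> k * mu p x"
  and m: "\<And>x. norm x = r \<Longrightarrow> u x \<le> m" and x: "x \<noteq> 0" "norm x \<le> r"
 shows "u x \<le> m"
proof (rule field_le_epsilon)
 fix \<eta> :: real assume eta: "0 < \<eta>"
 have x0: "0 < norm x" using x by simp
 obtain K where K: "0 < K" "\<And>t. 0 < t \<Longrightarrow> t \<le> r \<Longrightarrow> 0 < den (a - 1) K t" "J (a - 1) K r (norm x) \<le> \<eta>"
  using J_small[OF x0 x(2) eta, of "a - 1"] by metis
 let ?J = "J (a - 1) K r"
 define L where "L = K powr (- \<gamma>) / cmu"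
 have L: "0 < L" using K exps by (simp add: L_def)
 have "\<forall>\<^sub>F t in at_right 0. L / 2 < ?J t / mur p N t"
  using order_tendstoD(1)[OF J_mur_tendsto[OF K(1) r(1) K(2)], of "L / 2" ] L by (simp add: L_def)
 \<comment> \<open>The threshold gives (L/4) mur >= |m|, so that J + m >= (L/2) mur - |m| >= (L/4)
   mur >= u on the small sphere, also for negative m.\<close>
 moreover have "\<forall>\<^sub>F t in at_right 0. 4 * \<bar>m\<bar> / L + 1 < mur p N t"
  using mur_at_top by (simp add: filterlim_at_top_dense)
 ultimately have "\<forall>\<^sub>F t in at_right 0. L / 2 < ?J t / mur p N t \<and> 4 * \<bar>m\<bar> / L + 1 < mur p N t"
  by (rule eventually_conj)
 then obtain \<delta>1 where d1: "0 < \<delta>1" "\<And>t. 0 < t \<Longrightarrow> t < \<delta>1 \<Longrightarrow> L / 2 < ?J t / mur p N t \<and> 4 * \<bar>m\<bar> / L + 1 < mur p N t"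
  by (auto simp: eventually_at_right_field)
 have "\<forall>\<^sub>F x in at 0. u x \<le> (L / 4) * mu p x" using L by (intro lim) auto
 then obtain \<delta>2 where d2: "0 < \<delta>2" "\<And>x. x \<noteq> 0 \<Longrightarrow> norm x < \<delta>2 \<Longrightarrow> u x \<le> (L / 4) * mu p x"
  by (auto simp: eventually_at dist_norm)
 define \<delta> where "\<delta> = min (norm x) (min \<delta>1 \<delta>2 / 2)"
 have d: "0 < \<delta>" "\<delta> \<le> norm x" "\<delta> < \<delta>1" "\<delta> < \<delta>2" using x0 d1 d2 by (auto simp: \<delta>_def)
 let ?U = "{y::'a. norm (y - 0) \<in> {\<delta><..<r}}" and ?C = "{y::'a. \<delta> \<le> norm y \<and> norm y \<le> r}"
 have Jw: "wsol p q (a - 1) ?U (\<lambda>y. ?J (norm (y - 0)))" "\<And>y. y \<in> ?U \<Longrightarrow> grad (\<lambda>y. ?J (norm (y - 0))) y \<noteq> 0"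
 proof -
  show "wsol p q (a - 1) ?U (\<lambda>y. ?J (norm (y - 0)))" by (rule wsol_J(1)[OF dim]) (use K d in auto)
  show "grad (\<lambda>y. ?J (norm (y - 0))) y \<noteq> 0" if "y \<in> ?U" for y
   by (rule wsol_J(2)[OF dim, where ?r0.0=\<delta>]) (use that K d in auto)
 qed
 have cJ: "continuous_on {\<delta>..r} ?J" by (rule J_continuous) (use d K in auto)
 have Csub: "?C \<subseteq> ball 0 R0 - {0}" using d r by auto
 have "u x \<le> ?J (norm (x - 0)) + m"
 proof (rule noncritical_comparison[where U="?U" and C="?C" and p=p and q=q and ?a1.0=a and ?a2.0="a - 1"
   and v=u and z="\<lambda>y. ?J (norm (y - 0))" and k=m and x=x])
  show "wsol p q a ?U u" by (rule wsol_subset[OF u]) (use d r in auto)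
  have "open (norm -` {\<delta><..<r} :: 'a set)" by (rule open_vimage) (auto intro: continuous_intros)
  then show "open ?U" by (simp add: vimage_def)
  have "?C = cball 0 r - ball 0 \<delta>" by auto
  then show "compact ?C" by (auto intro: compact_diff)
  show "continuous_on ?C u" by (rule continuous_on_subset[OF C1_on_continuous_on[OF wsol_C1[OF u]] Csub])
  show "continuous_on ?C (\<lambda>y. ?J (norm (y - 0)))"
   by (intro continuous_intros continuous_on_compose2[OF cJ]) auto
  show "u y \<le> ?J (norm (y - 0)) + m" if "y \<in> ?C - ?U" for y
  proof -
   have "norm y = \<delta> \<or> norm y = r" using that by auto
   then show ?thesis
   proof
    assume y: "norm y = \<delta>"
    have y0: "y \<noteq> 0" using y d by auto
    have J1: "L / 2 < ?J \<delta> / mur p N \<delta>" "4 * \<bar>m\<bar> / L + 1 < mur p N \<delta>" using d1(2)[of \<delta>] d by auto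
    have mp: "0 < mur p N \<delta>" using J1(2) L by (smt (verit) abs_ge_zero divide_nonneg_pos)
    have j1: "L / 2 * mur p N \<delta> < ?J \<delta>" using J1(1) mp by (simp add: field_simps)
    have j2: "u y \<le> L / 4 * mur p N \<delta>" using d2(2)[OF y0] y d by (simp add: mu_mur dim)
    have "L / 4 * (4 * \<bar>m\<bar> / L + 1) \<le> L / 4 * mur p N \<delta>" using J1(2) L by (intro mult_left_mono) auto
    moreover have "L / 4 * (4 * \<bar>m\<bar> / L + 1) = \<bar>m\<bar> + L / 4" using L by (simp add: field_simps)
    ultimately have "\<bar>m\<bar> \<le> L / 4 * mur p N \<delta>" using L by linarith
    then show ?thesis using y j1 j2 by simp
   qed (use m in simp)
  qed
 qed (use p1 pN dim exps Jw x d in auto)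
 then show "u x \<le> m + \<eta>" using K(3) by simp
qed

end

section \<open>Comparison across an isolated singularity\<close>

lemma usc_attains_max:
 fixes \<Phi> :: "'a::metric_space \<Rightarrow> real"
 assumes S: "compact S" "S \<noteq> {}"
  and usc: "\<And>x e. x \<in> S \<Longrightarrow> 0 < e \<Longrightarrow> \<exists>d>0. \<forall>y\<in>S. dist y x < d \<longrightarrow> \<Phi> y < \<Phi> x + e"
 obtains x where "x \<in> S" "\<And>y. y \<in> S \<Longrightarrow> \<Phi> y \<le> \<Phi> x"
proof (rule ccontr)
 assume "\<not> thesis"
 with that have "\<forall>x\<in>S. \<exists>y\<in>S. \<Phi> x < \<Phi> y" by (meson not_le)
 then obtain Y where Y: "\<And>x. x \<in> S \<Longrightarrow> Y x \<in> S \<and> \<Phi> x < \<Phi> (Y x)" by metis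
 have "\<forall>x\<in>S. \<exists>d>0. \<forall>y\<in>S. dist y x < d \<longrightarrow> \<Phi> y < \<Phi> (Y x)"
 proof
  fix x assume x: "x \<in> S"
  have "0 < \<Phi> (Y x) - \<Phi> x" using Y[OF x] by simp
  from usc[OF x this] show "\<exists>d>0. \<forall>y\<in>S. dist y x < d \<longrightarrow> \<Phi> y < \<Phi> (Y x)" by simp
 qed
 then obtain d where d: "\<And>x. x \<in> S \<Longrightarrow> 0 < d x \<and> (\<forall>y\<in>S. dist y x < d x \<longrightarrow> \<Phi> y < \<Phi> (Y x))" by metis
 have "S \<subseteq> (\<Union>x\<in>S. ball x (d x))" using d by force
 then obtain F where F: "F \<subseteq> S" "finite F" "S \<subseteq> (\<Union>x\<in>F. ball x (d x))"
  using compactE_image[OF S(1), of S "\<lambda>x. ball x (d x)"] by auto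
 have Fne: "F \<noteq> {}" using F(3) S(2) by auto
 have "Max ((\<lambda>x. \<Phi> (Y x)) ` F) \<in> (\<lambda>x. \<Phi> (Y x)) ` F" using F(2) Fne by (intro Max_in) auto
 then obtain k where k0: "k \<in> F" "Max ((\<lambda>x. \<Phi> (Y x)) ` F) = \<Phi> (Y k)" by auto
 have k: "k \<in> F" "\<Phi> (Y x) \<le> \<Phi> (Y k)" if "x \<in> F" for x
  using k0 F(2) that Max_ge[of "(\<lambda>x. \<Phi> (Y x)) ` F" "\<Phi> (Y x)"] by auto
 have "Y k \<in> S" using Y k0 F by blast
 then obtain i where i: "i \<in> F" "Y k \<in> ball i (d i)" using F(3) by blast
 then have "\<Phi> (Y k) < \<Phi> (Y i)" using d[of i] F \<open>Y k \<in> S\<close> by (auto simp: dist_commute)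
 then show False using k(2)[OF i(1)] by simp
qed

context exponents begin

lemma strong_maximum':
 fixes x0 :: "'a::euclidean_space"
 assumes dim: "N = real DIM('a)" and u: "wsol p q a U u" and U: "open U" "x0 \<in> U"
  and M: "\<And>x. x \<in> U \<Longrightarrow> u x \<le> u x0"
 shows "\<exists>s>0. ball x0 s \<subseteq> U \<and> (\<forall>x\<in>ball x0 s. u x = u x0)"
proof -
 obtain r where r: "0 < r" "ball x0 r \<subseteq> U" using U openE by blast
 have 1: "u x = u x0" if "x \<in> ball x0 (r / 4)" for x
  by (rule strong_maximum[OF dim wsol_subset[OF u r(2)] r(1) _ that]) (use M r in auto)
 have 2: "ball x0 (r / 4) \<subseteq> U" using r subset_ball[of "r / 4" r x0] by auto
 show ?thesis
  by (intro exI[of _ "r / 4"] conjI ballI 2, use r(1) in simp, rule 1)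
qed

text \<open>The set where w = w0 is open by the strong maximum principle and closed in the punctured
  ball, which is connected in dimension at least 2. Were it empty, the maximum over a sphere would
  be below w0, and \<open>removable_maximum\<close> would carry this bound to the origin, against
  \<open>fr\<close>.\<close>

lemma punctured_maximum:
 fixes w :: "'a::euclidean_space \<Rightarrow> real"
 assumes dim: "N = real DIM('a)" and w: "wsol p q a (ball 0 r - {0}) w" and r: "0 < r"
  and M: "\<And>x. x \<in> ball 0 r - {0} \<Longrightarrow> w x \<le> w0" and fr: "\<And>e. 0 < e \<Longrightarrow> \<exists>\<^sub>F x in at 0. w0 - e < w x"
  and x: "x \<in> ball 0 r - {0}"
 shows "w x = w0"
proof -
 define P where "P = ball (0::'a) r - {0}"
 define T where "T = {x \<in> P. w x = w0}"
 have d2: "2 \<le> DIM('a)" using dim N2 by simp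
 have Po: "open P" by (auto simp: P_def)
 have cP: "connected P" unfolding P_def by (rule connected_punctured_ball[OF d2])
 have cw: "continuous_on P w" using C1_on_continuous_on[OF wsol_C1[OF w]] by (simp add: P_def)
 have "open T"
 proof (rule openI)
  fix y assume y: "y \<in> T"
  have "\<exists>s>0. ball y s \<subseteq> P \<and> (\<forall>x\<in>ball y s. w x = w y)"
   by (rule strong_maximum'[OF dim w[folded P_def] Po]) (use y M in \<open>auto simp: T_def P_def\<close>)
  then obtain s where s: "0 < s" "ball y s \<subseteq> P" "\<And>x. x \<in> ball y s \<Longrightarrow> w x = w y" by blast
  have wy: "w y = w0" using y by (simp add: T_def)
  have "ball y s \<subseteq> T"
  proof
   fix x assume "x \<in> ball y s"
   with s(2) s(3)[OF this] wy show "x \<in> T" by (simp add: T_def subset_iff)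
  qed
  then show "\<exists>e>0. ball y e \<subseteq> T" using s(1) by blast
 qed
 moreover have "closedin (top_of_set P) T"
  unfolding T_def by (rule continuous_closedin_preimage_constant[OF cw])
 moreover have "T \<noteq> {}"
 proof
  assume Te: "T = {}"
  have sph: "sphere (0::'a) (r / 2) \<subseteq> P" using r by (auto simp: P_def)
  have ne: "sphere (0::'a) (r / 2) \<noteq> {}" using r d2 by simp
  obtain y where y: "y \<in> sphere 0 (r / 2)" "\<And>x. x \<in> sphere 0 (r / 2) \<Longrightarrow> w x \<le> w y"
   using continuous_attains_sup[OF compact_sphere ne continuous_on_subset[OF cw sph]] by blast
  have wy: "w y < w0" using y sph Te M[folded P_def] by (force simp: T_def order_less_le)
  have R: "w x \<le> w y" if "x \<noteq> 0" "norm x \<le> r / 2" for x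
  proof (rule removable_maximum[OF dim w, of "r / 2"])
   fix k :: real assume k: "0 < k"
   have "\<forall>\<^sub>F t in at_right 0. \<bar>w0\<bar> / k + 1 < mur p N t"
    using mur_at_top by (simp add: filterlim_at_top_dense)
   then obtain s where s: "0 < s" "\<And>t. 0 < t \<Longrightarrow> t < s \<Longrightarrow> \<bar>w0\<bar> / k + 1 < mur p N t"
    by (auto simp: eventually_at_right_field)
   have "w x \<le> k * mu p x" if "x \<noteq> 0" "norm x < min s r" for x
   proof -
    have "\<bar>w0\<bar> / k + 1 < mu p x" using s(2)[of "norm x"] that by (simp add: mu_mur dim)
    then have "k * (\<bar>w0\<bar> / k + 1) < k * mu p x" using k by (intro mult_strict_left_mono) auto
    then have "\<bar>w0\<bar> + k < k * mu p x" using k by (simp add: distrib_left)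
    then show ?thesis using M[of x] that k by simp
   qed
   then show "\<forall>\<^sub>F x in at 0. w x \<le> k * mu p x"
    unfolding eventually_at dist_norm using s(1) r by (intro exI[of _ "min s r"]) simp
  qed (use r y that in auto)
  have "\<forall>\<^sub>F x in at 0. w x \<le> w y"
   unfolding eventually_at dist_norm using R r by (intro exI[of _ "r / 2"]) simp
  moreover have "\<exists>\<^sub>F x in at 0. w0 - (w0 - w y) < w x" using wy by (intro fr) auto
  ultimately have "\<exists>x. w x \<le> w y \<and> w0 - (w0 - w y) < w x"
   using frequently_ex[OF frequently_eventually_conj] by blast
  then show False by auto
 qed
 moreover have "T \<subseteq> P" by (auto simp: T_def)
 ultimately have "T = P"
  using cP open_subset[of T P] unfolding connected_clopen by blast
 moreover have "x \<in> P" using x by (simp only: P_def)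
 ultimately have "x \<in> T" by simp
 then show ?thesis by (simp add: T_def)
qed

end

text \<open>Upper semicontinuity relative to K: at the origin the compared functions have only
  one-sided limits, chosen as their values there.\<close>

definition usc_on :: "'a::metric_space set \<Rightarrow> ('a \<Rightarrow> real) \<Rightarrow> bool"
 where "usc_on K f \<longleftrightarrow> (\<forall>x\<in>K. \<forall>e>0. \<exists>d>0. \<forall>y\<in>K. dist y x < d \<longrightarrow> f y < f x + e)"

lemma usc_on_hole:
 fixes f :: "'a::euclidean_space \<Rightarrow> real"
 assumes cont: "continuous_on (K - {0}) f"
  and hole: "\<And>e. 0 \<in> K \<Longrightarrow> 0 < e \<Longrightarrow> \<forall>\<^sub>F x in at 0. f x < f 0 + e"
 shows "usc_on K f"
 unfolding usc_on_def
proof (intro ballI allI impI)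
 fix x e assume x: "x \<in> K" and e: "(0::real) < e"
 show "\<exists>d>0. \<forall>y\<in>K. dist y x < d \<longrightarrow> f y < f x + e"
 proof (cases "x = 0")
  case True
  obtain d where d: "0 < d" "\<forall>y. y \<noteq> 0 \<and> dist y 0 < d \<longrightarrow> f y < f 0 + e"
   using hole[of e] x e True unfolding eventually_at by auto
  show ?thesis
  proof (intro exI[of _ d] conjI d ballI impI)
   fix y assume "dist y x < d"
   then show "f y < f x + e" using d(2) True e by (cases "y = 0") auto
  qed
 next
  case False
  obtain d where d: "0 < d" "\<forall>y\<in>K - {0}. dist y x < d \<longrightarrow> dist (f y) (f x) < e"
   using cont x False e unfolding continuous_on_iff by blast
  show ?thesis
  proof (intro exI[of _ "min d (norm x)"] conjI ballI impI)
   show "0 < min d (norm x)" using d False by simp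
   fix y assume y: "y \<in> K" "dist y x < min d (norm x)"
   then have "y \<noteq> 0" by (auto simp: dist_norm)
   then have "dist (f y) (f x) < e" using d y by auto
   then show "f y < f x + e" by (auto simp: dist_real_def)
  qed
 qed
qed

lemma usc_on_pair:
 fixes v z :: "'a::euclidean_space \<Rightarrow> real"
 assumes v: "usc_on K v" and z: "usc_on K (\<lambda>x. - z x)" and S: "S \<subseteq> K \<times> K"
  and ab: "(a, b) \<in> S" and e: "0 < e"
 shows "\<exists>d>0. \<forall>y\<in>S. dist y (a, b) < d \<longrightarrow> v (snd y) - z (fst y) - \<eta> * dist (fst y) (snd y) < (v b - z a - \<eta> * dist a b) + e"
proof -
 have K: "a \<in> K" "b \<in> K" using ab S by auto
 have e3: "0 < e / 3" using e by simp
 obtain d1 where d1: "0 < d1" "\<forall>y\<in>K. dist y b < d1 \<longrightarrow> v y < v b + e / 3"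
  using v[unfolded usc_on_def, rule_format, OF K(2) e3] by blast
 obtain d2 where d2: "0 < d2" "\<forall>y\<in>K. dist y a < d2 \<longrightarrow> - z y < - z a + e / 3"
  using z[unfolded usc_on_def, rule_format, OF K(1) e3] by blast
 have "isCont (\<lambda>y::'a \<times> 'a. \<eta> * dist (fst y) (snd y)) (a, b)" by (intro continuous_intros)
 from this[unfolded continuous_at_eps_delta, rule_format, OF e3]
 obtain d3 where d3: "0 < d3" "\<forall>y. dist y (a, b) < d3 \<longrightarrow> dist (\<eta> * dist (fst y) (snd y)) (\<eta> * dist a b) < e / 3"
  by auto
 show ?thesis
 proof (intro exI[of _ "min d1 (min d2 d3)"] conjI ballI impI)
  show "0 < min d1 (min d2 d3)" using d1 d2 d3 by simp
  fix y assume y: "y \<in> S" "dist y (a, b) < min d1 (min d2 d3)"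
  have "dist (fst y) a \<le> dist y (a, b)" "dist (snd y) b \<le> dist y (a, b)"
   using dist_fst_le[of y "(a, b)"] dist_snd_le[of y "(a, b)"] by simp_all
  moreover have "fst y \<in> K" "snd y \<in> K" using y S by auto
  ultimately have "v (snd y) < v b + e / 3" "- z (fst y) < - z a + e / 3"
   using d1 d2 y by auto
  moreover have "dist (\<eta> * dist (fst y) (snd y)) (\<eta> * dist a b) < e / 3" using d3(2) y by simp
  then have "- (\<eta> * dist (fst y) (snd y)) < - (\<eta> * dist a b) + e / 3"
   unfolding dist_real_def by linarith
  ultimately show "v (snd y) - z (fst y) - \<eta> * dist (fst y) (snd y) < (v b - z a - \<eta> * dist a b) + e"
   by linarith
 qed
qed

text \<open>By compactness of B (a Lebesgue number), the strict inequality on B extends to pairs of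
  nearby points, one of which lies in B.\<close>

lemma usc_near_boundary:
 fixes v z :: "'a::euclidean_space \<Rightarrow> real"
 assumes v: "usc_on K v" and z: "usc_on K (\<lambda>x. - z x)" and B: "compact B" "B \<subseteq> K"
  and bd: "\<And>x. x \<in> B \<Longrightarrow> v x - z x < D"
 obtains \<rho> where "0 < \<rho>" "\<And>x y. x \<in> K \<Longrightarrow> y \<in> K \<Longrightarrow> dist x y \<le> \<rho> \<Longrightarrow> x \<in> B \<or> y \<in> B \<Longrightarrow> v y - z x < D"
proof -
 have "\<forall>x\<in>B. \<exists>d>0. \<forall>a\<in>K. \<forall>b\<in>K. dist a x < d \<longrightarrow> dist b x < d \<longrightarrow> v b - z a < D"
 proof
  fix x assume x: "x \<in> B"
  define e where "e = (D - (v x - z x)) / 2"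
  have e: "0 < e" using bd[OF x] by (simp add: e_def)
  obtain d1 where d1: "0 < d1" "\<forall>y\<in>K. dist y x < d1 \<longrightarrow> v y < v x + e"
   using v x B e unfolding usc_on_def by blast
  obtain d2 where d2: "0 < d2" "\<forall>y\<in>K. dist y x < d2 \<longrightarrow> - z y < - z x + e"
   using z x B e unfolding usc_on_def by blast
  show "\<exists>d>0. \<forall>a\<in>K. \<forall>b\<in>K. dist a x < d \<longrightarrow> dist b x < d \<longrightarrow> v b - z a < D"
  proof (intro exI[of _ "min d1 d2"] conjI ballI impI)
   fix a b assume "a \<in> K" "b \<in> K" "dist a x < min d1 d2" "dist b x < min d1 d2"
   then have "v b < v x + e" "- z a < - z x + e" using d1 d2 by auto
   then show "v b - z a < D" by (simp add: e_def field_simps)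
  qed (use d1 d2 in simp)
 qed
 then obtain d where d: "\<And>x. x \<in> B \<Longrightarrow> 0 < d x \<and> (\<forall>a\<in>K. \<forall>b\<in>K. dist a x < d x \<longrightarrow> dist b x < d x \<longrightarrow> v b - z a < D)"
  by metis
 have cov: "B \<subseteq> \<Union>((\<lambda>x. ball x (d x)) ` B)" using d by force
 have opn: "open G" if "G \<in> (\<lambda>x. ball x (d x)) ` B" for G using that by auto
 then obtain e where e: "0 < e" "\<And>x. x \<in> B \<Longrightarrow> \<exists>G\<in>(\<lambda>x. ball x (d x)) ` B. ball x e \<subseteq> G"
  using Heine_Borel_lemma[OF B(1) cov opn] by blast
 have key: "v y - z x < D" if h: "x \<in> K" "y \<in> K" "dist x y \<le> e / 2" "w \<in> B" "w = x \<or> w = y" for x y w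
 proof -
  obtain b where b: "b \<in> B" "ball w e \<subseteq> ball b (d b)" using e(2)[OF h(4)] by auto
  have "x \<in> ball w e" "y \<in> ball w e" using h(3,5) e(1) by (auto simp: dist_commute)
  then have "dist x b < d b" "dist y b < d b" using b(2) by (auto simp: dist_commute)
  then show ?thesis using d[OF b(1)] h by blast
 qed
 show ?thesis
 proof (rule that[of "e / 2"])
  show "0 < e / 2" using e(1) by simp
 qed (use key in blast)
qed

lemma gradient_zero_decrease:
 fixes u :: "'a::euclidean_space \<Rightarrow> real"
 assumes u: "GDERIV u x :> 0" and e: "0 < \<eta>" and h: "h \<noteq> 0"
 obtains T where "0 < T" "T < 1" "\<And>t. 0 < t \<Longrightarrow> t < T \<Longrightarrow> \<bar>u (x + t *\<^sub>R h) - u x\<bar> < \<eta> * (t * norm h)"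
proof -
 have "(u has_derivative (\<lambda>h. 0)) (at x)" using u by (simp add: gderiv_def)
 then have lim: "((\<lambda>h. norm (u (x + h) - u x - 0) / norm h) \<longlongrightarrow> 0) (at 0)"
  by (simp add: has_derivative_at)
 then have "\<forall>\<^sub>F h in at 0. norm (u (x + h) - u x - 0) / norm h < \<eta>"
  using e by (intro order_tendstoD(2)[OF lim]) auto
 then obtain s where s: "0 < s" "\<And>k. k \<noteq> 0 \<Longrightarrow> norm k < s \<Longrightarrow> \<bar>u (x + k) - u x\<bar> / norm k < \<eta>"
  by (auto simp: eventually_at dist_norm)
 define T where "T = min (1 / 2) (s / norm h)"
 have T: "0 < T" "T < 1" using s h by (auto simp: T_def)
 show ?thesis
 proof (rule that[OF T])
  fix t assume t: "0 < t" "t < T"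
  then have "t < s / norm h" by (simp add: T_def)
  then have "t * norm h < s" using h by (simp add: field_simps)
  then have "\<bar>u (x + t *\<^sub>R h) - u x\<bar> / norm (t *\<^sub>R h) < \<eta>" using s(2)[of "t *\<^sub>R h"] t h by auto
  then show "\<bar>u (x + t *\<^sub>R h) - u x\<bar> < \<eta> * (t * norm h)" using t h by (simp add: field_simps)
 qed
qed

lemma frequently_at_translate:
 fixes b h :: "'a::real_normed_vector"
 assumes "\<exists>\<^sub>F x in at b. P x" "b = a + h" shows "\<exists>\<^sub>F x in at a. P (x + h)"
proof -
 have "at b = filtermap (\<lambda>x. x + h) (at a)"
  using assms(2) filtermap_at_shift[of "- h" a] by (simp add: add.commute)
 then show ?thesis using assms(1) by (simp add: frequently_def eventually_filtermap)
qed

context exponents begin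

text \<open>Maximising \<open>v y - z x - \<eta> |x - y|\<close> over \<open>|x - y| \<le> \<rho>\<close>: at an off-diagonal maximum the gradients
 vanish by \<open>touching_impossible\<close>, so that moving the points towards each other would increase the value.
 Hence the maximum of \<open>v y - z x\<close> is that of \<open>v - z\<close>, and every maximum point of \<open>v - z\<close> is a local
 maximum of \<open>v\<close> and a local minimum of \<open>z\<close>, where the strong maximum principle applies.\<close>

theorem comparison:
 fixes v z :: "'a::euclidean_space \<Rightarrow> real"
 assumes dim: "N = real DIM('a)" and U: "open U" "bounded U" "0 \<in> closure U \<Longrightarrow> 0 \<in> U"
  and v: "wsol p q a1 (U - {0}) v" and z: "wsol p q a2 (U - {0}) z" and a: "a2 < a1"
  and cv: "continuous_on (closure U - {0}) v" and cz: "continuous_on (closure U - {0}) z"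
  and bd: "\<And>x. x \<in> closure U - U \<Longrightarrow> v x \<le> z x"
  and v1: "\<And>e. 0 \<in> U \<Longrightarrow> 0 < e \<Longrightarrow> \<forall>\<^sub>F x in at 0. v x < v 0 + e"
  and v2: "\<And>e. 0 \<in> U \<Longrightarrow> 0 < e \<Longrightarrow> \<exists>\<^sub>F x in at 0. v 0 - e < v x"
  and z1: "\<And>e. 0 \<in> U \<Longrightarrow> 0 < e \<Longrightarrow> \<forall>\<^sub>F x in at 0. z 0 - e < z x"
  and z2: "\<And>e. 0 \<in> U \<Longrightarrow> 0 < e \<Longrightarrow> \<exists>\<^sub>F x in at 0. z x < z 0 + e"
  and x: "x \<in> U"
 shows "v x \<le> z x"
proof (rule ccontr)
 assume neg: "\<not> v x \<le> z x"
 define K where "K = closure U"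
 have K: "compact K" "U \<subseteq> K" using U closure_subset by (auto simp: K_def)
 note Cv = wsol_C1[OF v] and Cz = wsol_C1[OF z]
 have nz: "wsol p q (- a2) (U - {0}) (\<lambda>x. - z x)" by (rule wsol_minus[OF z])
 have uv: "usc_on K v"
  by (rule usc_on_hole) (use cv v1 U(3) in \<open>auto simp: K_def\<close>)
 have uz: "usc_on K (\<lambda>x. - z x)"
 proof (rule usc_on_hole)
  show "continuous_on (K - {0}) (\<lambda>x. - z x)" using cz by (auto simp: K_def intro: continuous_intros)
  show "\<forall>\<^sub>F x in at 0. - z x < - z 0 + e" if "0 \<in> K" "0 < e" for e
   using z1[of e] that U(3) by (auto simp: K_def elim: eventually_mono)
 qed
 have uscP: "\<exists>d>0. \<forall>y\<in>S. dist y w < d \<longrightarrow> v (snd y) - z (fst y) - \<eta> * dist (fst y) (snd y) < (v (snd w) - z (fst w) - \<eta> * dist (fst w) (snd w)) + e"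
  if "S \<subseteq> K \<times> K" "w \<in> S" "0 < e" for S w e \<eta>
  using usc_on_pair[OF uv uz that(1), of "fst w" "snd w" e \<eta>] that by auto
 \<comment> \<open>The maximum over the diagonal of K x K is the maximum D of v - z, attained by
   semicontinuity.\<close>
 define diag where "diag = (\<lambda>x. (x, x)) ` K"
 have diag: "compact diag" "diag \<noteq> {}" "diag \<subseteq> K \<times> K"
  using K x by (auto simp: diag_def intro!: compact_continuous_image continuous_intros)
 obtain w where w: "w \<in> diag" "\<And>y. y \<in> diag \<Longrightarrow> v (snd y) - z (fst y) - 0 * dist (fst y) (snd y) \<le> v (snd w) - z (fst w) - 0 * dist (fst w) (snd w)"
  using usc_attains_max[OF diag(1,2) uscP[OF diag(3)], of 0] by blast
 define D where "D = v (snd w) - z (fst w)"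
 have D: "v y - z y \<le> D" if "y \<in> K" for y using w(2)[of "(y, y)"] that by (auto simp: diag_def D_def)
 have D0: "0 < D" using D[of x] x K neg by auto
 define B where "B = K - U"
 have B: "compact B" "B \<subseteq> K" using K U by (auto simp: B_def intro: compact_diff)
 have bdB: "v x - z x < D" if "x \<in> B" for x using bd[of x] D0 that by (simp add: B_def K_def)
 obtain \<rho> where rho: "0 < \<rho>" "\<And>x y. x \<in> K \<Longrightarrow> y \<in> K \<Longrightarrow> dist x y \<le> \<rho> \<Longrightarrow> x \<in> B \<or> y \<in> B \<Longrightarrow> v y - z x < D"
  using usc_near_boundary[OF uv uz B bdB] by blast
 define S where "S = {y \<in> K \<times> K. dist (fst y) (snd y) \<le> \<rho>}"
 have S: "compact S" "S \<subseteq> K \<times> K"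
 proof -
  have "S = (K \<times> K) \<inter> {y. dist (fst y) (snd y) \<le> \<rho>}" by (auto simp: S_def)
  moreover have "closed {y::'a\<times>'a. dist (fst y) (snd y) \<le> \<rho>}" by (intro closed_Collect_le continuous_intros)
  ultimately show "compact S" using K by (auto intro: compact_Int_closed compact_Times)
 qed (auto simp: S_def)
 have dS: "(y, y) \<in> S" if "y \<in> K" for y using that rho by (auto simp: S_def)
 \<comment> \<open>At the maximum (b, c) of the penalised difference the value of v c - z b is at
   least D, so neither point is near the boundary, by the choice of \<open>\<rho>\<close>. It
   remains to see b = c.\<close>
 have step: "v y - z x' - \<eta> * dist x' y \<le> D" if xy: "(x', y) \<in> S" and eta: "0 < \<eta>" for x' y \<eta>
 proof -
  have "S \<noteq> {}" using xy by auto
  from usc_attains_max[OF S(1) this uscP[OF S(2)], of \<eta>]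
  obtain m where m: "m \<in> S" "\<And>y. y \<in> S \<Longrightarrow> v (snd y) - z (fst y) - \<eta> * dist (fst y) (snd y) \<le> v (snd m) - z (fst m) - \<eta> * dist (fst m) (snd m)"
   by blast
  obtain b c where bc: "m = (b, c)" by (cases m)
  have max: "v y - z x - \<eta> * dist x y \<le> v c - z b - \<eta> * dist b c" if "(x, y) \<in> S" for x y
   using m(2)[OF that] by (simp add: bc)
  have bcK: "b \<in> K" "c \<in> K" "dist b c \<le> \<rho>" using m(1) by (auto simp: bc S_def)
  have "snd w \<in> K" "fst w = snd w" using w(1) by (auto simp: diag_def)
  then have "D \<le> v c - z b - \<eta> * dist b c" using max[OF dS, of "snd w"] by (simp add: D_def)
  moreover have "0 \<le> \<eta> * dist b c" using eta by simp
  ultimately have Dle: "D \<le> v c - z b" by linarith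
  have bcU: "b \<in> U" "c \<in> U"
   using rho(2)[OF bcK] Dle bcK by (auto simp: B_def)
  have "b = c"
  proof (rule ccontr)
   assume ne: "b \<noteq> c"
   define h where "h = c - b"
   have h: "h \<noteq> 0" "c = b + h" using ne by (auto simp: h_def)
   obtain r1 where r1: "0 < r1" "ball b r1 \<subseteq> U" using U(1) bcU openE by blast
   obtain r2 where r2: "0 < r2" "ball c r2 \<subseteq> U" using U(1) bcU openE by blast
   \<comment> \<open>The balls of this radius about b and c, without their centres, avoid the
     origin; if b or c is the origin, it is the removed centre.\<close>
   define r where "r = Min {r1, r2, if b = 0 then 1 else norm b, if c = 0 then 1 else norm c}"
   have r: "0 < r" "r \<le> r1" "r \<le> r2" "b \<noteq> 0 \<Longrightarrow> r \<le> norm b" "c \<noteq> 0 \<Longrightarrow> r \<le> norm c"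
    using r1 r2 by (auto simp: r_def)
   have bsub: "ball b r - {b} \<subseteq> U - {0}"
   proof
    fix y assume y: "y \<in> ball b r - {b}"
    have "y \<noteq> 0" using y r(4) by (cases "b = 0") auto
    then show "y \<in> U - {0}" using y r1 r(2) by auto
   qed
   have csub: "y + h \<in> U - {0}" if y: "y \<in> ball b r - {b}" for y
   proof -
    have yc: "y + h \<in> ball c r - {c}" using y h(2) by (auto simp: dist_norm)
    have "y + h \<noteq> 0" using yc r(5) by (cases "c = 0") auto
    then show ?thesis using yc r2 r(3) by auto
   qed
   have zw: "wsol p q a2 (ball b r - {b}) z" by (rule wsol_subset[OF z bsub])
   have vw: "wsol p q a1 (ball b r - {b}) (\<lambda>x. v (x + h))"
    by (rule wsol_subset[OF wsol_translate[OF v p1 exps(1)]]) (use csub in auto)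
   have Mx: "v (x + h) - z x \<le> v c - z b" if x: "x \<in> ball b r - {b}" for x
   proof -
    have "(x, x + h) \<in> S"
     using x bsub csub[OF x] K bcK by (auto simp: S_def dist_norm h_def norm_minus_commute)
    from max[OF this] show ?thesis by (simp add: dist_norm h_def)
   qed
   have one: "b \<noteq> 0 \<or> c \<noteq> 0" using ne by auto
   have cont_v: "isCont v c" if "c \<noteq> 0" using C1_on_isCont[OF Cv] bcU that by auto
   have cont_z: "isCont z b" if "b \<noteq> 0" using C1_on_isCont[OF Cz] bcU that by auto
   have sh: "((\<lambda>x. x + h) \<longlongrightarrow> c) (at b)" unfolding h(2) by (intro tendsto_intros)
   have evv: "\<forall>\<^sub>F x in at b. v c - e / 2 < v (x + h)" if "c \<noteq> 0" "0 < e" for e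
   proof -
    have "((\<lambda>x. v (x + h)) \<longlongrightarrow> v c) (at b)"
     by (rule isCont_tendsto_compose[OF cont_v[OF that(1)] sh])
    from order_tendstoD(1)[OF this, of "v c - e / 2"] that show ?thesis by simp
   qed
   have evz: "\<forall>\<^sub>F x in at b. z x < z b + e / 2" if "b \<noteq> 0" "0 < e" for e
    using order_tendstoD(2)[OF cont_z[OF that(1), unfolded isCont_def], of "z b + e / 2"] that by simp
   have fr: "\<exists>\<^sub>F x in at b. v c - z b - e < v (x + h) - z x" if e: "0 < e" for e
   proof (cases "c = 0")
    case True
    then have b0: "b \<noteq> 0" using one by simp
    have "\<exists>\<^sub>F x in at (0::'a). v 0 - e / 2 < v x" using v2[of "e / 2"] True bcU e by simp
    from frequently_at_translate[OF this, of b h] True h(2)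
    have "\<exists>\<^sub>F x in at b. v c - e / 2 < v (x + h)" by simp
    from frequently_eventually_conj[OF this evz[OF b0 e]]
    show ?thesis by (rule frequently_elim1) auto
   next
    case False
    have "\<exists>\<^sub>F x in at b. z x < z b + e / 2"
    proof (cases "b = 0")
     case True
     then show ?thesis using z2[of "e / 2"] bcU e by simp
    next
     case b0: False
     show ?thesis by (rule eventually_frequently[OF _ evz[OF b0 e]]) simp
    qed
    from frequently_eventually_conj[OF this evv[OF False e]]
    show ?thesis by (rule frequently_elim1) auto
   qed
   \<comment> \<open>Since b and c differ, at most one of them is the origin. A nonzero gradient at
     one that is not would be the limit required by \<open>touching_impossible\<close> for v(. + h)
     and z at b, where |x - y| is constant along the translated pairs.\<close>
   have gz: "(grad v c = 0 \<or> c = 0) \<and> (grad z b = 0 \<or> b = 0)"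
   proof (rule ccontr)
    assume "\<not> ?thesis"
    then have "\<exists>\<xi>. \<xi> \<noteq> 0 \<and> ((grad (\<lambda>x. v (x + h)) \<longlongrightarrow> \<xi>) (at b) \<or> (grad z \<longlongrightarrow> \<xi>) (at b))"
    proof (cases "grad z b = 0 \<or> b = 0")
     case False
     have "isCont (grad z) b"
      using C1_onD(2)[OF Cz] False bcU continuous_on_eq_continuous_at[of "U - {0}" "grad z"] U(1)
      by (simp add: open_Diff)
     then show ?thesis using False by (auto simp: isCont_def)
    next
     case True
     assume "\<not> ((grad v c = 0 \<or> c = 0) \<and> (grad z b = 0 \<or> b = 0))"
     then have c: "grad v c \<noteq> 0" "c \<noteq> 0" using True by auto
     have "isCont (grad v) c"
      using C1_onD(2)[OF Cv] c bcU continuous_on_eq_continuous_at[of "U - {0}" "grad v"] U(1)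
      by (simp add: open_Diff)
     then have "((\<lambda>x. grad v (x + h)) \<longlongrightarrow> grad v c) (at b)" using isCont_tendsto_compose sh by blast
     moreover have "\<forall>\<^sub>F x in at b. grad v (x + h) = grad (\<lambda>x. v (x + h)) x"
     proof -
      have "\<forall>\<^sub>F x in at b. x \<noteq> b \<and> x \<in> ball b r"
       using r(1) by (intro eventually_conj eventually_neq_at_within eventually_at_in_open') auto
      then show ?thesis
      proof (rule eventually_mono)
       fix x assume "x \<noteq> b \<and> x \<in> ball b r"
       then have "x + h \<in> U - {0}" by (intro csub) auto
       then show "grad v (x + h) = grad (\<lambda>x. v (x + h)) x"
        using grad_eqI[OF GDERIV_translate[of v x "- h"]] C1_onD(1)[OF Cv, of "x + h"] by simp
      qed
     qed
     ultimately have "(grad (\<lambda>x. v (x + h)) \<longlongrightarrow> grad v c) (at b)" by (rule Lim_transform_eventually)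
     then show ?thesis using c by blast
    qed
    then obtain \<xi> where xi: "\<xi> \<noteq> 0" "(grad (\<lambda>x. v (x + h)) \<longlongrightarrow> \<xi>) (at b) \<or> (grad z \<longlongrightarrow> \<xi>) (at b)" by blast
    show False
     by (rule touching_impossible[OF p1 _ exps(1) _ a r(1) vw zw Mx fr xi]) (use pN dim exps in auto)
   qed
   \<comment> \<open>Moving c towards b (or b towards c, when c is the origin) shortens the distance
     by the full displacement, while a vanishing gradient changes the function by less than
     \<open>\<eta>\<close> times it: the penalised value would increase.\<close>
   show False
   proof (cases "c = 0")
    case False
    have hn: "- h \<noteq> 0" using h(1) by simp
    have gc: "GDERIV v c :> 0" using C1_onD(1)[OF Cv, of c] gz bcU False by simp
    obtain T where T: "0 < T" "T < 1" "\<And>t. 0 < t \<Longrightarrow> t < T \<Longrightarrow> \<bar>v (c + t *\<^sub>R - h) - v c\<bar> < \<eta> * (t * norm (- h))"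
     using gradient_zero_decrease[OF gc eta hn] by blast
    define t where "t = min (T / 2) (r2 / (2 * norm h))"
    have t: "0 < t" "t < T" "t < 1" "t * norm h < r2"
    proof -
     have "t * norm h \<le> r2 / (2 * norm h) * norm h" using h(1) by (intro mult_right_mono) (auto simp: t_def)
     then show "t * norm h < r2" using r2 h(1) by simp
    qed (use T r2 h(1) in \<open>auto simp: t_def\<close>)
    define c' where "c' = c + t *\<^sub>R - h"
    have "b - c' = - ((1 - t) *\<^sub>R h)" by (simp add: c'_def h_def algebra_simps)
    then have "norm (b - c') = (1 - t) * norm h" using t by simp
    then have dd: "dist b c' = dist b c - t * norm h" by (simp add: dist_norm h_def norm_minus_commute left_diff_distrib)
    have "c' \<in> ball c r2" using t by (simp add: c'_def dist_norm)
    then have "c' \<in> K" using r2 K by auto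
    moreover have "dist b c' \<le> \<rho>" using dd bcK t by (smt (verit) mult_nonneg_nonneg norm_ge_zero)
    ultimately have "(b, c') \<in> S" using bcK by (simp add: S_def)
    from max[OF this] have "v c' - \<eta> * dist b c' \<le> v c - \<eta> * dist b c" by simp
    then have "v c' + \<eta> * (t * norm h) \<le> v c" unfolding dd by (simp add: right_diff_distrib)
    moreover have "\<bar>v c' - v c\<bar> < \<eta> * (t * norm h)" using T(3)[OF t(1,2)] by (simp add: c'_def)
    ultimately show False by linarith
   next
    case True
    then have b0: "b \<noteq> 0" using one by simp
    then have gb: "GDERIV z b :> 0" using C1_onD(1)[OF Cz, of b] gz bcU by simp
    obtain T where T: "0 < T" "T < 1" "\<And>t. 0 < t \<Longrightarrow> t < T \<Longrightarrow> \<bar>z (b + t *\<^sub>R h) - z b\<bar> < \<eta> * (t * norm h)"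
     using gradient_zero_decrease[OF gb eta h(1)] by blast
    define t where "t = min (T / 2) (r1 / (2 * norm h))"
    have t: "0 < t" "t < T" "t < 1" "t * norm h < r1"
    proof -
     have "t * norm h \<le> r1 / (2 * norm h) * norm h" using h(1) by (intro mult_right_mono) (auto simp: t_def)
     then show "t * norm h < r1" using r1 h(1) by simp
    qed (use T r1 h(1) in \<open>auto simp: t_def\<close>)
    define b' where "b' = b + t *\<^sub>R h"
    have "b' - c = - ((1 - t) *\<^sub>R h)" by (simp add: b'_def h_def algebra_simps)
    then have "norm (b' - c) = (1 - t) * norm h" using t by simp
    then have dd: "dist b' c = dist b c - t * norm h" by (simp add: dist_norm h_def norm_minus_commute left_diff_distrib)
    have "b' \<in> ball b r1" using t by (simp add: b'_def dist_norm)
    then have "b' \<in> K" using r1 K by auto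
    moreover have "dist b' c \<le> \<rho>" using dd bcK t by (smt (verit) mult_nonneg_nonneg norm_ge_zero)
    ultimately have "(b', c) \<in> S" using bcK by (simp add: S_def)
    from max[OF this] have "z b - \<eta> * dist b' c \<le> z b' - \<eta> * dist b c" by simp
    then have "z b + \<eta> * (t * norm h) \<le> z b'" unfolding dd by (simp add: right_diff_distrib)
    moreover have "\<bar>z b' - z b\<bar> < \<eta> * (t * norm h)" using T(3)[OF t(1,2)] by (simp add: b'_def)
    ultimately show False by linarith
   qed
  qed
  then have "v c - z b - \<eta> * dist b c \<le> D" using D[OF bcK(1)] by simp
  then show ?thesis using max[OF xy] by simp
 qed
 \<comment> \<open>The penalty is removed by letting \<open>\<eta>\<close> tend to 0.\<close>
 have flat: "v y - z x' \<le> D" if xy: "(x', y) \<in> S" for x' y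
 proof (rule field_le_epsilon)
  fix e :: real assume e: "0 < e"
  define \<eta> where "\<eta> = e / (dist x' y + 1)"
  have eta: "0 < \<eta>" using e by (simp add: \<eta>_def add_nonneg_pos)
  have "\<eta> * dist x' y \<le> \<eta> * (dist x' y + 1)" using eta by (intro mult_left_mono) auto
  also have "\<dots> = e"
  proof -
   have "dist x' y + 1 \<noteq> 0" using zero_le_dist[of x' y] by linarith
   then show ?thesis by (simp add: \<eta>_def)
  qed
  finally show "v y - z x' \<le> D + e" using step[OF xy eta] by simp
 qed
 define Z where "Z = {x \<in> K. D \<le> v x - z x}"
 have ZU: "x \<in> U" if "x \<in> Z" for x
  using that bd[of x] D0 by (auto simp: Z_def K_def)
 have Zeq: "v x - z x = D" if "x \<in> Z" for x using that D[of x] by (auto simp: Z_def)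
 have "closed Z"
 proof -
  have "open (- Z)"
  proof (rule openI)
   fix y assume y: "y \<in> - Z"
   show "\<exists>e>0. ball y e \<subseteq> - Z"
   proof (cases "y \<in> K")
    case False
    then obtain e where "0 < e" "ball y e \<subseteq> - K" using K(1) openE[of "- K" y] by (auto simp: compact_imp_closed open_Compl)
    then show ?thesis by (auto simp: Z_def)
   next
    case True
    define e where "e = (D - (v y - z y)) / 2"
    have e: "0 < e" using y True by (auto simp: e_def Z_def)
    obtain d1 where d1: "0 < d1" "\<forall>x\<in>K. dist x y < d1 \<longrightarrow> v x < v y + e"
     using uv[unfolded usc_on_def, rule_format, OF True e] by blast
    obtain d2 where d2: "0 < d2" "\<forall>x\<in>K. dist x y < d2 \<longrightarrow> - z x < - z y + e"
     using uz[unfolded usc_on_def, rule_format, OF True e] by blast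
    have "ball y (min d1 d2) \<subseteq> - Z"
    proof
     fix x assume x: "x \<in> ball y (min d1 d2)"
     show "x \<in> - Z"
     proof
      assume xZ: "x \<in> Z"
      then have "v x < v y + e" "- z x < - z y + e" using d1 d2 x by (auto simp: Z_def dist_commute)
      then have "v x - z x < D" by (simp add: e_def field_simps)
      then show False using Zeq[OF xZ] by simp
     qed
    qed
    then show ?thesis using d1 d2 by (intro exI[of _ "min d1 d2"]) auto
   qed
  qed
  then show ?thesis by (simp add: open_closed)
 qed
 moreover have "open Z"
 proof (rule openI)
  fix y assume y: "y \<in> Z"
  then have yU: "y \<in> U" by (rule ZU)
  obtain r1 where r1: "0 < r1" "ball y r1 \<subseteq> U" using U(1) yU openE by blast
  define r where "r = Min {r1, \<rho>, if y = 0 then 1 else norm y}"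
  have r: "0 < r" "r \<le> r1" "r \<le> \<rho>" "y \<noteq> 0 \<Longrightarrow> r \<le> norm y" using r1 rho by (auto simp: r_def)
  have sub: "ball y r \<subseteq> U" using r1 r(2) by auto
  \<comment> \<open>Equality v y - z y = D and \<open>flat\<close> with one of the two points kept
    at y.\<close>
  have loc: "v x \<le> v y" "z y \<le> z x" if "x \<in> ball y r" for x
  proof -
   have "x \<in> K" "y \<in> K" using that sub yU K(2) by blast+
   then have "(y, x) \<in> S" "(x, y) \<in> S" using that r(3) by (auto simp: S_def dist_commute)
   then show "v x \<le> v y" "z y \<le> z x" using flat[of y x] flat[of x y] Zeq[OF y] by auto
  qed
  have sub0: "ball y r - {0} \<subseteq> U - {0}" using sub by auto
  have "\<exists>s>0. \<forall>x\<in>ball y s. x \<in> U \<and> v x = v y \<and> z x = z y"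
  proof (cases "y = 0")
   case False
   have "ball y r \<subseteq> U - {0}" using sub r(4)[OF False] by auto
   note vb = wsol_subset[OF v this] and zb = wsol_subset[OF nz this]
   have yb: "y \<in> ball y r" using r(1) by simp
   have "\<exists>s>0. ball y s \<subseteq> ball y r \<and> (\<forall>x\<in>ball y s. v x = v y)"
    by (rule strong_maximum'[OF dim vb open_ball yb loc(1)])
   then obtain s1 where s1: "0 < s1" "ball y s1 \<subseteq> ball y r" "\<And>x. x \<in> ball y s1 \<Longrightarrow> v x = v y" by blast
   have "\<exists>s>0. ball y s \<subseteq> ball y r \<and> (\<forall>x\<in>ball y s. - z x = - z y)"
    by (rule strong_maximum'[OF dim zb open_ball yb]) (use loc(2) in simp)
   then obtain s2 where s2: "0 < s2" "\<And>x. x \<in> ball y s2 \<Longrightarrow> - z x = - z y" by blast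
   show ?thesis
   proof (intro exI[of _ "min s1 s2"] conjI ballI)
    fix x assume "x \<in> ball y (min s1 s2)"
    then have x: "x \<in> ball y s1" "x \<in> ball y s2" by auto
    show "x \<in> U" using x(1) s1(2) sub by blast
    show "v x = v y" by (rule s1(3)[OF x(1)])
    show "z x = z y" using s2(2)[OF x(2)] by simp
   qed (use s1(1) s2(1) in simp)
  next
   case True
   have vb: "wsol p q a1 (ball 0 r - {0}) v" and zb: "wsol p q (- a2) (ball 0 r - {0}) (\<lambda>x. - z x)"
    using wsol_subset[OF v sub0] wsol_subset[OF nz sub0] True by auto
   have v0: "v x = v 0" if "x \<in> ball 0 r - {0}" for x
   proof (rule punctured_maximum[OF dim vb r(1) _ _ that])
    show "v x \<le> v 0" if "x \<in> ball 0 r - {0}" for x using loc(1)[of x] that True by simp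
    show "\<exists>\<^sub>F x in at 0. v 0 - e < v x" if "0 < e" for e using v2[of e] that yU True by simp
   qed
   have z0: "- z x = - z 0" if "x \<in> ball 0 r - {0}" for x
   proof (rule punctured_maximum[OF dim zb r(1) _ _ that])
    show "\<exists>\<^sub>F x in at 0. - z 0 - e < - z x" if "0 < e" for e
     using z2[of e] that yU True by (auto elim: frequently_elim1)
    show "- z x \<le> - z 0" if "x \<in> ball 0 r - {0}" for x using loc(2)[of x] that True by simp
   qed
   show ?thesis
   proof (intro exI[of _ r] conjI r(1) ballI)
    fix x assume x: "x \<in> ball y r"
    show "x \<in> U" using x sub by auto
    show "v x = v y"
    proof (cases "x = 0")
     case False
     then have "v x = v 0" using x True by (intro v0) auto
     then show ?thesis using True by simp
    qed (simp add: True)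
    show "z x = z y"
    proof (cases "x = 0")
     case False
     then have "- z x = - z 0" using x True by (intro z0) auto
     then show ?thesis using True by simp
    qed (simp add: True)
   qed
  qed
  then obtain s where s: "0 < s" "\<And>x. x \<in> ball y s \<Longrightarrow> x \<in> U \<and> v x = v y \<and> z x = z y" by blast
  have "ball y s \<subseteq> Z"
  proof
   fix x assume "x \<in> ball y s"
   from s(2)[OF this] Zeq[OF y] K(2) show "x \<in> Z" by (auto simp: Z_def)
  qed
  then show "\<exists>e>0. ball y e \<subseteq> Z" using s(1) by blast
 qed
 moreover have "snd w \<in> Z" using w(1) by (auto simp: Z_def D_def diag_def)
 \<comment> \<open>Z is open, closed and nonempty, hence the whole space, but contained in the
   bounded set K.\<close>
 ultimately have "Z = UNIV" using clopen by blast
 then have "bounded (UNIV :: 'a set)" using K(1) compact_imp_bounded bounded_subset[of K Z] by (auto simp: Z_def)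
 then show False using not_bounded_UNIV by blast
qed

end

section \<open>Reflections and classification of the singular behaviour\<close>

text \<open>The lower limit at 0, in the two-sided form that \<open>comparison\<close> requires of a
  value at the origin.\<close>

lemma real_liminf_exists:
 fixes f :: "'a::euclidean_space \<Rightarrow> real"
 assumes low: "\<forall>\<^sub>F x in at 0. b < f x" and up: "\<exists>\<^sub>F x in at 0. f x \<le> B"
 shows "\<exists>L. (\<forall>e>0. \<forall>\<^sub>F x in at 0. L - e < f x) \<and> (\<forall>e>0. \<exists>\<^sub>F x in at 0. f x < L + e)"
proof -
 define S where "S = {c. \<forall>\<^sub>F x in at 0. c < f x}"
 have ne: "S \<noteq> {}" using low by (auto simp: S_def)
 have bd: "c \<le> B" if "c \<in> S" for c
 proof -
  have "\<exists>x. c < f x \<and> f x \<le> B"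
   using frequently_ex[OF frequently_eventually_conj[OF up]] that by (auto simp: S_def)
  then show ?thesis by auto
 qed
 then have bdd: "bdd_above S" by (rule bdd_aboveI)
 show ?thesis
 proof (intro exI[of _ "Sup S"] conjI allI impI)
  fix e :: real assume e: "0 < e"
  obtain c where c: "c \<in> S" "Sup S - e < c" using less_cSup_iff[OF ne bdd, of "Sup S - e"] e by auto
  then show "\<forall>\<^sub>F x in at 0. Sup S - e < f x" by (auto simp: S_def elim: eventually_mono)
  have "Sup S + e / 2 \<notin> S" using cSup_upper[OF _ bdd, of "Sup S + e / 2"] e by auto
  then have "\<exists>\<^sub>F x in at 0. \<not> Sup S + e / 2 < f x" by (simp add: S_def not_eventually)
  then show "\<exists>\<^sub>F x in at 0. f x < Sup S + e" by (rule frequently_elim1) (use e in auto)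
 qed
qed

section \<open>Reflections and the oscillation of solutions on small spheres\<close>

definition refl :: "'a::euclidean_space \<Rightarrow> 'a \<Rightarrow> 'a" where "refl e w = w - (2 * (w \<bullet> e)) *\<^sub>R e"

lemma refl_props:
 assumes "norm e = 1"
 shows "linear (refl e)" "norm (refl e w) = norm w" "refl e (refl e w) = w" "refl e w \<bullet> e = - (w \<bullet> e)"
proof -
 have ee: "e \<bullet> e = 1" using assms by (simp add: dot_square_norm)
 show "linear (refl e)" by (rule linearI) (auto simp: refl_def inner_add_left algebra_simps)
 show 1: "refl e w \<bullet> e = - (w \<bullet> e)" by (simp add: refl_def inner_diff_left ee)
 have "refl e w \<bullet> refl e w = w \<bullet> w"
  by (simp add: refl_def inner_diff_left inner_diff_right ee inner_commute)
 then show "norm (refl e w) = norm w" by (simp add: norm_eq_sqrt_inner)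
 have "refl e (refl e w) = refl e w - (2 * (refl e w \<bullet> e)) *\<^sub>R e" by (simp add: refl_def)
 also have "\<dots> = w" unfolding 1 by (simp add: refl_def)
 finally show "refl e (refl e w) = w" .
qed

context exponents begin

text \<open>The source of all strictness: q > p - 1 puts the coefficient of l u below that of u. The
  factor 1 matches the form given by \<open>wsol_scale\<close>.\<close>

lemma scale_strict: "1 < l \<Longrightarrow> 1 * l powr (p - 1 - q) < 1"
 using q1 by (simp add: powr_less_one)

text \<open>The perpendicular bisector of x and y has 0 and x on one side because |x| < |y|. On that
  side, inside radius 2 R, the reflected solution v is regular even at 0, while l u + C may be
  singular there. On the hyperplane v = u; on the sphere the reflected point has norm between 2 R
  and 4 R, so v <= C. Comparison at x gives the claim, since the reflection of x is y.\<close>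

lemma reflection_step:
 fixes u :: "'a::euclidean_space \<Rightarrow> real"
 assumes dim: "N = real DIM('a)" and u: "wsol p q 1 (\<Omega> - {0}) u" and R: "0 < R" "cball 0 (4 * R) \<subseteq> \<Omega>"
  and nn: "\<And>w. w \<in> \<Omega> - {0} \<Longrightarrow> 0 \<le> u w"
  and C: "0 \<le> C" "\<And>w. 2 * R \<le> norm w \<Longrightarrow> norm w \<le> 4 * R \<Longrightarrow> u w \<le> C"
  and xy: "x \<noteq> 0" "norm x < norm y" "norm y \<le> R" and l: "1 < l"
 shows "u y \<le> l * u x + C"
proof -
 define e where "e = (y - x) /\<^sub>R norm (y - x)"
 have yx: "y \<noteq> x" using xy by auto
 have e1: "norm e = 1" using yx by (simp add: e_def)
 have ee: "e \<bullet> e = 1" using e1 by (simp add: dot_square_norm)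
 have ye: "y - x = norm (y - x) *\<^sub>R e" using yx by (simp add: e_def)
 \<comment> \<open>The distance of the bisecting hyperplane, with unit normal e, from the
   origin.\<close>
 define k where "k = ((1/2) *\<^sub>R (x + y)) \<bullet> e"
 have k0: "0 < k"
 proof -
  have "(x + y) \<bullet> (y - x) = (norm y)\<^sup>2 - (norm x)\<^sup>2"
   by (simp add: inner_add_left inner_diff_right inner_commute[of x y] power2_norm_eq_inner)
  moreover have "(norm x)\<^sup>2 < (norm y)\<^sup>2" using xy by (intro power_strict_mono) auto
  ultimately have "0 < (x + y) \<bullet> (y - x)" by simp
  then show ?thesis using yx by (simp add: k_def e_def zero_less_mult_iff)
 qed
 have kR: "k \<le> R"
 proof -
  have "k \<le> norm ((1/2) *\<^sub>R (x + y)) * norm e" unfolding k_def by (rule norm_cauchy_schwarz)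
  also have "\<dots> \<le> R" using norm_triangle_ineq[of x y] xy e1 by simp
  finally show ?thesis .
 qed
 have xe: "x \<bullet> e < k"
 proof -
  have "y \<bullet> e = x \<bullet> e + norm (y - x)" using arg_cong[OF ye, of "\<lambda>t. t \<bullet> e"] by (simp add: inner_diff_left ee)
  then show ?thesis using yx by (simp add: k_def inner_add_left)
 qed
 note Q = refl_props[OF e1]
 define b where "b = (2 * k) *\<^sub>R e"
 define T where "T w = refl e w + b" for w
 have Tx: "T x = y"
 proof -
  have "2 * k - 2 * (x \<bullet> e) = (y - x) \<bullet> e" by (simp add: k_def inner_add_left inner_diff_left)
  also have "\<dots> = norm (y - x)" using arg_cong[OF ye, of "\<lambda>t. t \<bullet> e"] by (simp add: ee)
  finally have "(2 * k) *\<^sub>R e - (2 * (x \<bullet> e)) *\<^sub>R e = y - x" using ye by (simp flip: scaleR_diff_left)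
  then show ?thesis by (simp add: T_def refl_def b_def algebra_simps)
 qed
 have Te: "T w \<bullet> e = 2 * k - w \<bullet> e" for w by (simp add: T_def inner_add_left Q(4) b_def ee)
 \<comment> \<open>Points with w . e < k are moved away from the origin.\<close>
 have Tn: "(norm (T w))\<^sup>2 = (norm w)\<^sup>2 + 4 * k * (k - w \<bullet> e)" for w
 proof -
  have "(norm (T w))\<^sup>2 = (norm (refl e w))\<^sup>2 + 2 * (refl e w \<bullet> b) + (norm b)\<^sup>2"
   by (simp add: T_def power2_norm_eq_inner inner_add_left inner_add_right inner_commute)
  then show ?thesis using e1 by (simp add: Q b_def algebra_simps power2_eq_square)
 qed
 have Tle: "norm (T w) \<le> norm w + 2 * R" for w
 proof -
  have "norm (T w) \<le> norm w + norm b" unfolding T_def using norm_triangle_ineq[of "refl e w" b] Q(2) by simp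
  then show ?thesis using e1 k0 kR by (simp add: b_def)
 qed
 define H where "H = {w. w \<bullet> e < k}"
 define U where "U = ball 0 (2 * R) \<inter> H"
 have Ho: "open H" unfolding H_def by (intro open_Collect_less continuous_intros)
 have Uo: "open U" "bounded U" by (auto simp: U_def Ho bounded_Int)
 have clU: "w \<in> cball 0 (2 * R) \<and> w \<bullet> e \<le> k" if "w \<in> closure U" for w
 proof -
  have "closed (cball 0 (2 * R) \<inter> {w. w \<bullet> e \<le> k})" by (intro closed_Int closed_cball closed_Collect_le continuous_intros)
  moreover have "U \<subseteq> cball 0 (2 * R) \<inter> {w. w \<bullet> e \<le> k}" by (auto simp: U_def H_def)
  ultimately have "closure U \<subseteq> cball 0 (2 * R) \<inter> {w. w \<bullet> e \<le> k}" by (intro closure_minimal)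
  then show ?thesis using that by auto
 qed
 have T0: "T w \<in> \<Omega> - {0}" if "w \<in> closure U" for w
 proof -
  have "norm (T w) \<le> 4 * R" using Tle[of w] clU[OF that] by simp
  moreover have "T w \<noteq> 0" using Te[of w] clU[OF that] k0 by auto
  ultimately show ?thesis using R by auto
 qed
 have clO: "w \<in> \<Omega>" if "w \<in> closure U" for w using clU[OF that] R by (intro subsetD[OF R(2)]) auto
 define v where "v w = u (T w)" for w
 have vw: "wsol p q 1 {w. T w \<in> \<Omega> - {0}} v"
  using wsol_isometry[OF Q(1,2,3) u p1 exps(1), of b] by (simp add: v_def[abs_def] T_def)
 have vU: "wsol p q 1 U v" by (rule wsol_subset[OF vw]) (use T0 closure_subset in blast)
 have zU: "wsol p q (1 * l powr (p - 1 - q)) (\<Omega> - {0}) (\<lambda>w. l * u w + C)"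
  by (rule wsol_add_const[OF wsol_scale[OF u _ p1 exps(1)]]) (use l in simp)
 have U0: "0 \<in> U" using R k0 by (simp add: U_def H_def)
 have xU: "x \<in> U" using xy xe R by (simp add: U_def H_def)
 have cu: "continuous_on (\<Omega> - {0}) u" by (rule C1_on_continuous_on[OF wsol_C1[OF u]])
 have cv: "continuous_on (closure U) v"
  by (rule continuous_on_subset[OF C1_on_continuous_on[OF wsol_C1[OF vw]]]) (use T0 in auto)
 have cz: "continuous_on (closure U - {0}) (\<lambda>w. l * u w + C)"
  by (intro continuous_intros continuous_on_subset[OF cu]) (use clO in auto)
 have lu: "u w \<le> l * u w" if "w \<in> \<Omega> - {0}" for w using nn[OF that] l by (simp add: mult_le_cancel_right1)
 have bd: "v w \<le> l * u w + C" if w: "w \<in> closure U - U" for w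
 proof -
  have wU: "w \<in> closure U" "w \<notin> U" using w by auto
  have w0: "w \<noteq> 0" using U0 wU by auto
  have wO: "w \<in> \<Omega> - {0}" using clO wU w0 by auto
  show ?thesis
  proof (cases "w \<bullet> e = k")
   case True
   have "T w = w" by (simp add: T_def refl_def b_def True)
   then show ?thesis using lu[OF wO] C(1) by (simp add: v_def)
  next
   case False
   then have "w \<bullet> e < k" "norm w = 2 * R" using wU clU[OF wU(1)] by (auto simp: U_def H_def)
   then have "(norm w)\<^sup>2 \<le> (norm (T w))\<^sup>2" unfolding Tn using k0 by simp
   then have "norm w \<le> norm (T w)" by (rule power2_le_imp_le) simp
   then have "u (T w) \<le> C" using C(2)[of "T w"] Tle[of w] \<open>norm w = 2 * R\<close> by simp
   then show ?thesis using nn[OF wO] l by (simp add: v_def add_increasing)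
  qed
 qed
 have vc: "(v \<longlongrightarrow> v 0) (at 0)"
  using C1_on_isCont[OF wsol_C1[OF vU] U0] by (simp add: isCont_def)
 \<comment> \<open>If u tends to infinity at 0, the inequality is clear near 0 and a small ball is
   removed. Otherwise u has a finite lower limit L, and with the value l L + C at 0 the comparison
   goes across the origin.\<close>
 have "v x \<le> l * u x + C"
 proof (cases "\<forall>B. \<forall>\<^sub>F w in at 0. B < u w")
  case True
  have "\<forall>\<^sub>F w in at 0. v w < v 0 + 1" using order_tendstoD(2)[OF vc, of "v 0 + 1"] by simp
  moreover have "\<forall>\<^sub>F w in at 0. v 0 + 1 < u w" using True by blast
  ultimately have "\<forall>\<^sub>F w in at 0. v w < u w" by eventually_elim simp
  then obtain d where d: "0 < d" "\<And>w. w \<noteq> 0 \<Longrightarrow> norm w < d \<Longrightarrow> v w < u w"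
   by (auto simp: eventually_at dist_norm)
  obtain d2 where d2: "0 < d2" "ball 0 d2 \<subseteq> U" using openE[OF Uo(1) U0] by blast
  define r where "r = min (d / 2) (d2 / 2)"
  have r: "0 < r" "r < d" "cball 0 r \<subseteq> U" using d d2 by (auto simp: r_def)
  have small: "v w \<le> l * u w + C" if "w \<noteq> 0" "norm w \<le> r" for w
  proof -
   have "w \<in> U" using r(3) that by auto
   then have "w \<in> \<Omega> - {0}" using clO[of w] closure_subset that by auto
   then show ?thesis using d(2)[of w] that r lu[of w] C(1) by simp
  qed
  show ?thesis
  proof (cases "norm x \<le> r")
   case False
   define U' where "U' = U - cball 0 r"
   have U'o: "open U'" "bounded U'" using Uo by (auto simp: U'_def intro: bounded_subset)
   have clU': "w \<in> closure U \<and> r \<le> norm w" if "w \<in> closure U'" for w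
   proof -
    have "closed (closure U \<inter> {w. r \<le> norm w})" by (intro closed_Int closed_closure closed_Collect_le continuous_intros)
    moreover have "U' \<subseteq> closure U \<inter> {w. r \<le> norm w}" using closure_subset by (auto simp: U'_def)
    ultimately show ?thesis using closure_minimal that by blast
   qed
   have n0: "0 \<notin> U'" "0 \<notin> closure U'" using clU'[of 0] r by (auto simp: U'_def)
   show ?thesis
   proof (rule comparison[OF dim U'o, where ?a1.0=1 and ?a2.0="1 * l powr (p - 1 - q)" and v=v and z="\<lambda>w. l * u w + C"])
    show "wsol p q 1 (U' - {0}) v" by (rule wsol_subset[OF vU]) (auto simp: U'_def)
    have "U' - {0} \<subseteq> \<Omega> - {0}" using clO closure_subset[of U] by (auto simp: U'_def)
    then show "wsol p q (1 * l powr (p - 1 - q)) (U' - {0}) (\<lambda>w. l * u w + C)" by (rule wsol_subset[OF zU])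
    show "continuous_on (closure U' - {0}) v" by (rule continuous_on_subset[OF cv]) (use clU' in auto)
    show "continuous_on (closure U' - {0}) (\<lambda>w. l * u w + C)" by (rule continuous_on_subset[OF cz]) (use clU' in auto)
    show "v w \<le> l * u w + C" if w: "w \<in> closure U' - U'" for w
    proof (cases "w \<in> U")
     case True
     then have "norm w \<le> r" using w by (auto simp: U'_def)
     moreover have "w \<noteq> 0" using w n0 by auto
     ultimately show ?thesis by (intro small)
    next
     case False then show ?thesis using clU'[of w] w by (intro bd) auto
    qed
    show "x \<in> U'" using xU False by (simp add: U'_def)
   qed (use n0 l in \<open>auto simp: scale_strict[simplified]\<close>)
  qed (use small xy in auto)
 next
  case False
  then obtain B where B: "\<exists>\<^sub>F w in at 0. u w \<le> B" by (auto simp: not_eventually not_less)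
  have "\<forall>\<^sub>F w in at 0. -1 < u w"
  proof -
   have "\<forall>\<^sub>F w in at 0. w \<noteq> 0 \<and> w \<in> ball 0 (4 * R)"
    using R by (intro eventually_conj eventually_neq_at_within eventually_at_in_open') auto
   then show ?thesis
   proof (rule eventually_mono)
    fix w assume w: "w \<noteq> (0::'a) \<and> w \<in> ball 0 (4 * R)"
    then have "w \<in> \<Omega> - {0}" using subsetD[OF R(2), of w] by auto
    then show "- 1 < u w" using nn[of w] by linarith
   qed
  qed
  from real_liminf_exists[OF this B]
  obtain L where L: "\<And>e. 0 < e \<Longrightarrow> \<forall>\<^sub>F w in at 0. L - e < u w" "\<And>e. 0 < e \<Longrightarrow> \<exists>\<^sub>F w in at 0. u w < L + e" by blast
  define z where "z w = (if w = 0 then l * L + C else l * u w + C)" for w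
  have zx: "z w = l * u w + C" if "w \<noteq> 0" for w using that by (simp add: z_def)
  have ev0: "\<forall>\<^sub>F w in at (0::'a). w \<noteq> 0" by (rule eventually_neq_at_within)
  have "v x \<le> z x"
  proof (rule comparison[OF dim Uo, where ?a1.0=1 and ?a2.0="1 * l powr (p - 1 - q)"])
   show "wsol p q 1 (U - {0}) v" by (rule wsol_subset[OF vU]) auto
   have "U - {0} \<subseteq> \<Omega> - {0}" using clO closure_subset[of U] by auto
   from wsol_subset[OF zU this] show "wsol p q (1 * l powr (p - 1 - q)) (U - {0}) z"
    by (rule wsol_cong[rotated 2]) (use Uo in \<open>auto simp: zx\<close>)
   show "continuous_on (closure U - {0}) v" by (rule continuous_on_subset[OF cv]) auto
   show "continuous_on (closure U - {0}) z" by (rule continuous_on_eq[OF cz]) (auto simp: zx)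
   show "v w \<le> z w" if "w \<in> closure U - U" for w using bd[OF that] that U0 by (auto simp: z_def)
   show "\<forall>\<^sub>F w in at 0. v w < v 0 + e" if "0 < e" for e
    using order_tendstoD(2)[OF vc, of "v 0 + e"] that by simp
   show "\<exists>\<^sub>F w in at 0. v 0 - e < v w" if "0 < e" for e
    by (rule eventually_frequently) (use order_tendstoD(1)[OF vc, of "v 0 - e"] that in auto)
   show "\<forall>\<^sub>F w in at 0. z 0 - e < z w" if "0 < e" for e
   proof -
    have "\<forall>\<^sub>F w in at 0. L - e / l < u w" using that l by (intro L) auto
    then show ?thesis using ev0
    proof eventually_elim
     case (elim w)
     then have "l * (L - e / l) < l * u w" using l by (intro mult_strict_left_mono) auto
     then show ?case using elim l by (simp add: z_def right_diff_distrib)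
    qed
   qed
   show "\<exists>\<^sub>F w in at 0. z w < z 0 + e" if "0 < e" for e
   proof -
    have "\<exists>\<^sub>F w in at 0. u w < L + e / l" using that l by (intro L) auto
    from frequently_eventually_conj[OF this ev0] show ?thesis
    proof (rule frequently_elim1)
     fix w assume w: "w \<noteq> 0 \<and> u w < L + e / l"
     then have "l * u w < l * (L + e / l)" using l by (intro mult_strict_left_mono) auto
     then show "z w < z 0 + e" using w l by (simp add: z_def distrib_left)
    qed
   qed
  qed (use U0 xU l in \<open>auto simp: scale_strict[simplified]\<close>)
  then show ?thesis using xy by (simp add: z_def)
 qed
 then show ?thesis by (simp add: v_def Tx)
qed


text \<open>C bounds u on the annulus between 2 R and 4 R; in \<open>reflection_step\<close> the
  factor l tends to 1. Spheres of equal radius are reached by continuity.\<close>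

lemma oscillation_bound:
 fixes u :: "'a::euclidean_space \<Rightarrow> real"
 assumes dim: "N = real DIM('a)" and u: "wsol p q 1 (\<Omega> - {0}) u" and R: "0 < R" "cball 0 (4 * R) \<subseteq> \<Omega>"
  and nn: "\<And>w. w \<in> \<Omega> - {0} \<Longrightarrow> 0 \<le> u w"
 obtains C where "0 \<le> C" "\<And>x y. x \<noteq> 0 \<Longrightarrow> norm x \<le> norm y \<Longrightarrow> norm y \<le> R \<Longrightarrow> u y \<le> u x + C"
proof -
 define A where "A = cball (0::'a) (4 * R) - ball 0 (2 * R)"
 have A: "compact A" "A \<subseteq> \<Omega> - {0}" using R by (auto simp: A_def intro: compact_diff)
 have cu: "continuous_on (\<Omega> - {0}) u" by (rule C1_on_continuous_on[OF wsol_C1[OF u]])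
 have "bounded (u ` A)" by (intro compact_imp_bounded compact_continuous_image A continuous_on_subset[OF cu])
 then obtain C where C: "0 < C" "\<And>w. w \<in> A \<Longrightarrow> \<bar>u w\<bar> \<le> C" by (auto simp: bounded_pos)
 have CA: "u w \<le> C" if "2 * R \<le> norm w" "norm w \<le> 4 * R" for w
  using C(2)[of w] that by (auto simp: A_def)
 have strict: "u y \<le> u x + C" if xy: "x \<noteq> 0" "norm x < norm y" "norm y \<le> R" for x y
 proof (rule field_le_epsilon)
  fix e :: real assume e: "0 < e"
  have "x \<in> \<Omega> - {0}" using xy R subsetD[OF R(2), of x] by auto
  then have ux: "0 \<le> u x" by (rule nn)
  define l where "l = 1 + e / (u x + 1)"
  have l: "1 < l" using e ux by (simp add: l_def)
  have "l * u x = u x + e / (u x + 1) * u x" by (simp add: l_def distrib_right)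
  also have "e / (u x + 1) * u x \<le> e" using e ux by (simp add: field_simps)
  finally have "l * u x \<le> u x + e" by simp
  moreover have "u y \<le> l * u x + C"
   by (rule reflection_step[OF dim u R nn _ CA xy l]) (use C in auto)
  ultimately show "u y \<le> u x + C + e" by simp
 qed
 show ?thesis
 proof (rule that[of C])
  show "0 \<le> C" using C by simp
  fix x y :: 'a assume xy: "x \<noteq> 0" "norm x \<le> norm y" "norm y \<le> R"
  have "x \<in> \<Omega> - {0}" using xy R subsetD[OF R(2), of x] by auto
  then have "isCont u x" using C1_on_isCont[OF wsol_C1[OF u]] by blast
  \<comment> \<open>Shrinking x slightly produces the strict inequality of norms that
    \<open>strict\<close> requires.\<close>
  moreover have "(\<lambda>n. (1 - 1 / (real n + 2)) *\<^sub>R x) \<longlonglongrightarrow> (1 - 0) *\<^sub>R x"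
  proof -
   have "(\<lambda>n. 1 / (real n + 2)) \<longlonglongrightarrow> 0"
    using LIMSEQ_ignore_initial_segment[OF lim_1_over_n[where 'a=real], of 2] by (simp add: add.commute)
   then show ?thesis by (intro tendsto_intros)
  qed
  ultimately have "(\<lambda>n. u ((1 - 1 / (real n + 2)) *\<^sub>R x) + C) \<longlonglongrightarrow> u x + C"
   by (intro tendsto_intros isCont_tendsto_compose[of x u]) auto
  then show "u y \<le> u x + C"
  proof (rule LIMSEQ_le_const)
   have "u y \<le> u ((1 - 1 / (real n + 2)) *\<^sub>R x) + C" for n
   proof (rule strict)
    have t: "0 < 1 - 1 / (real n + 2)" "1 - 1 / (real n + 2) < 1" by (auto simp: field_simps)
    show "(1 - 1 / (real n + 2)) *\<^sub>R x \<noteq> 0" using t xy by auto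
    have "(1 - 1 / (real n + 2)) * norm x < 1 * norm x" using t xy by (intro mult_strict_right_mono) auto
    moreover have "norm ((1 - 1 / (real n + 2)) *\<^sub>R x) = (1 - 1 / (real n + 2)) * norm x"
     unfolding norm_scaleR using t by (simp only: abs_of_pos)
    ultimately show "norm ((1 - 1 / (real n + 2)) *\<^sub>R x) < norm y" using xy(2) by linarith
   qed (use xy in auto)
   then show "\<exists>M. \<forall>n\<ge>M. u y \<le> u ((1 - 1 / (real n + 2)) *\<^sub>R x) + C" by blast
  qed
 qed
qed

section \<open>Radial solutions as functions of the parameter K\<close>

lemma J_antimono:
 assumes "0 < r" "r \<le> R" "K1 \<le> K2" and d: "\<And>t. r \<le> t \<Longrightarrow> t \<le> R \<Longrightarrow> 0 < den a K1 t"
 shows "J a K2 R r \<le> J a K1 R r"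
proof -
 have d2: "0 < den a K2 t" if "r \<le> t" "t \<le> R" for t using d[OF that] assms(3) by (simp add: den_def)
 have i: "slope a K1 integrable_on {r..R}" "slope a K2 integrable_on {r..R}"
  by (intro integrable_continuous_real continuous_on_slope; use assms d d2 in auto)+
 show ?thesis unfolding J_def
 proof (rule integral_le[OF i(2) i(1)])
  fix t assume t: "t \<in> {r..R}"
  have "den a K2 t powr (- \<gamma>) \<le> den a K1 t powr (- \<gamma>)"
   using d[of t] t assms(3) exps by (intro powr_mono2') (auto simp: den_def)
  then show "slope a K2 t \<le> slope a K1 t" unfolding slope_def by (intro mult_left_mono) auto
 qed
qed

lemma den1_pos: "0 < r \<Longrightarrow> r \<le> t \<Longrightarrow> 0 < K + cf 1 * r powr \<theta> \<Longrightarrow> 0 < den 1 K t"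
proof -
 assume h: "0 < r" "r \<le> t" "0 < K + cf 1 * r powr \<theta>"
 have "cf 1 * r powr \<theta> \<le> cf 1 * t powr \<theta>" using h \<beta>q(5) exps by (intro mult_left_mono powr_mono2) auto
 then show ?thesis using h by (simp add: den_def)
qed

lemma J_continuous_param:
 assumes r: "0 < r" "r \<le> R"
 shows "continuous_on {K. 0 < K + cf 1 * r powr \<theta>} (\<lambda>K. J 1 K R r)"
proof -
 have "continuous_on ({K. 0 < K + cf 1 * r powr \<theta>} \<times> cbox r R) (\<lambda>(K, t). slope 1 K t)"
 proof -
  have "den 1 (fst y) (snd y) \<noteq> 0 \<and> snd y \<noteq> 0 \<and> 0 \<le> snd y" if "y \<in> {K. 0 < K + cf 1 * r powr \<theta>} \<times> cbox r R" for y
   using that den1_pos[OF r(1), of "snd y" "fst y"] r by auto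
  then show ?thesis unfolding slope_def split_beta den_def
   by (intro continuous_intros) (auto simp: den_def)
 qed
 from integral_continuous_on_param[OF this] show ?thesis by (simp add: J_def)
qed

text \<open>Intermediate value theorem in K. For large K the value is small by
  \<open>J_small\<close>. As K decreases to -cf 1 eps^\<theta>, which is negative,
  \<open>den\<close> vanishes at eps to first order and the integral of den^(-\<gamma>) diverges
  because \<gamma> > 1.\<close>

lemma J_solve:
 assumes e: "0 < eps" "eps < R" and T: "0 < T"
 obtains K where "0 < K + cf 1 * eps powr \<theta>" "J 1 K R eps = T"
proof -
 define A where "A = cf 1"
 have A: "0 < A" using \<beta>q(5) by (simp add: A_def)
 obtain K2 where K2: "0 < K2" "J 1 K2 R eps \<le> T" using J_small[OF e(1) less_imp_le[OF e(2)] T, of 1] by metis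
 define L where "L = \<theta> * max (eps powr (\<theta> - 1)) (R powr (\<theta> - 1))"
 have L: "0 < L" using exps e by (simp add: L_def less_max_iff_disj)
 have lip: "t powr \<theta> - eps powr \<theta> \<le> L * (t - eps)" if t: "eps < t" "t \<le> R" for t
 proof -
  have "\<exists>z>eps. z < t \<and> t powr \<theta> - eps powr \<theta> = (t - eps) * (\<theta> * z powr (\<theta> - 1))"
   by (rule MVT2[OF t(1)]) (use e has_real_derivative_powr in auto)
  then obtain z where z: "eps < z" "z < t" "t powr \<theta> - eps powr \<theta> = (t - eps) * (\<theta> * z powr (\<theta> - 1))" by auto
  have "z powr (\<theta> - 1) \<le> max (eps powr (\<theta> - 1)) (R powr (\<theta> - 1))"
   using powr_between(2)[OF e(1), of z R "\<theta> - 1"] z t by auto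
  then have "\<theta> * z powr (\<theta> - 1) \<le> L" unfolding L_def using exps by (intro mult_left_mono) auto
  then show ?thesis unfolding z(3) using t by (simp add: mult.commute mult_left_mono)
 qed
 define c where "c = R powr ((1 - N) / (p - 1)) * (1 + A * L) powr (- \<gamma>)"
 have "0 < 1 + A * L" using A L by (simp add: add_pos_pos)
 then have c: "0 < c" using e by (simp add: c_def)
 \<comment> \<open>The solution of c k1^(1-\<gamma>) = T.\<close>
 define k1 where "k1 = (T / c) powr (1 / (1 - \<gamma>))"
 have k1: "0 < k1" "k1 powr (1 - \<gamma>) = T / c" using c T exps by (auto simp: k1_def powr_powr)
 \<comment> \<open>The value of \<open>den\<close> at eps. On [eps, eps + \<kappa>] it is at most (1
   + A L) \<kappa>, so this interval alone contributes c \<kappa>^(1-\<gamma>). The bounds in the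
   minimum give J >= T, an interval inside [eps, R], and K1 <= 0 < K2.\<close>
 define \<kappa> where "\<kappa> = min k1 (min (R - eps) (A * eps powr \<theta>))"
 have k: "0 < \<kappa>" "\<kappa> \<le> k1" "\<kappa> \<le> R - eps" "\<kappa> \<le> A * eps powr \<theta>" using k1 e A by (auto simp: \<kappa>_def)
 define K1 where "K1 = \<kappa> - A * eps powr \<theta>"
 have K1: "0 < K1 + cf 1 * eps powr \<theta>" "K1 \<le> K2" using k K2 by (auto simp: K1_def A_def)
 have d1: "0 < den 1 K1 t" if "eps \<le> t" for t by (rule den1_pos[OF e(1) that K1(1)])
 have "T \<le> J 1 K1 R eps"
 proof -
  have "(c * \<kappa> powr (- \<gamma>)) * ((eps + \<kappa>) - eps) \<le> J 1 K1 (eps + \<kappa>) eps"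
  proof (rule J_bounds(1))
   fix t assume t: "eps \<le> t" "t \<le> eps + \<kappa>"
   have "A * (t powr \<theta> - eps powr \<theta>) \<le> A * (L * \<kappa>)"
   proof (rule mult_left_mono)
    show "t powr \<theta> - eps powr \<theta> \<le> L * \<kappa>"
    proof (cases "t = eps")
     case False
     then have "t powr \<theta> - eps powr \<theta> \<le> L * (t - eps)" using t k by (intro lip) auto
     also have "\<dots> \<le> L * \<kappa>" using t L by (intro mult_left_mono) auto
     finally show ?thesis .
    qed (use L k in auto)
   qed (use A in simp)
   then have "den 1 K1 t \<le> (1 + A * L) * \<kappa>" by (simp add: den_def K1_def A_def algebra_simps)
   then have "((1 + A * L) * \<kappa>) powr (- \<gamma>) \<le> den 1 K1 t powr (- \<gamma>)" using d1[OF t(1)] exps by (intro powr_mono2') auto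
   moreover have "R powr ((1 - N) / (p - 1)) \<le> t powr ((1 - N) / (p - 1))"
    using t k e N2 p1 by (intro powr_mono2') (auto intro: divide_nonpos_pos)
   ultimately have "R powr ((1 - N) / (p - 1)) * ((1 + A * L) * \<kappa>) powr (- \<gamma>) \<le> slope 1 K1 t"
    unfolding slope_def by (intro mult_mono) auto
   then show "c * \<kappa> powr (- \<gamma>) \<le> slope 1 K1 t" using A L k by (simp add: c_def powr_mult mult.assoc)
  qed (use e k d1 in auto)
  also have "J 1 K1 (eps + \<kappa>) eps \<le> J 1 K1 R eps"
  proof -
   have int: "slope 1 K1 integrable_on {eps..R}"
    by (intro integrable_continuous_real continuous_on_slope) (use e d1 in auto)
   have "integral {eps..eps + \<kappa>} (slope 1 K1) + integral {eps + \<kappa>..R} (slope 1 K1) = integral {eps..R} (slope 1 K1)"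
    by (rule Henstock_Kurzweil_Integration.integral_combine[OF _ _ int]) (use k in auto)
   moreover have "0 \<le> J 1 K1 R (eps + \<kappa>)" by (rule J_bounds(3)) (use e k d1 in auto)
   ultimately show ?thesis by (simp add: J_def)
  qed
  finally have 1: "c * (\<kappa> powr (- \<gamma>) * \<kappa>) \<le> J 1 K1 R eps" by simp
  have "\<kappa> powr (- \<gamma>) * \<kappa> = \<kappa> powr (1 - \<gamma>)" using powr_add[of \<kappa> "- \<gamma>" 1] k by simp
  moreover have "k1 powr (1 - \<gamma>) \<le> \<kappa> powr (1 - \<gamma>)" using k exps by (intro powr_mono2') auto
  ultimately have "T / c \<le> \<kappa> powr (- \<gamma>) * \<kappa>" using k1 by simp
  then have "T \<le> c * (\<kappa> powr (- \<gamma>) * \<kappa>)" using c by (simp add: field_simps)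
  then show ?thesis using 1 by simp
 qed
 moreover have "continuous_on {K1..K2} (\<lambda>K. J 1 K R eps)"
  by (rule continuous_on_subset[OF J_continuous_param[OF e(1) less_imp_le[OF e(2)]]]) (use K1 in auto)
 ultimately obtain K where "K1 \<le> K" "K \<le> K2" "J 1 K R eps = T"
  using IVT2'[of "\<lambda>K. J 1 K R eps" K2 T K1] K2 K1 by auto
 then show ?thesis using that[of K] K1 by simp
qed

text \<open>The gradient of J never vanishes, so \<open>noncritical_comparison\<close> works in both
  directions: u against l J and J against l u. Nonnegativity of J and u keeps the boundary
  inequalities when the right-hand side is multiplied by l > 1.\<close>

lemma annulus_sandwich:
 fixes u :: "'a::euclidean_space \<Rightarrow> real"
 assumes dim: "N = real DIM('a)" and u: "wsol p q 1 (\<Omega> - {0}) u" and R: "cball 0 R \<subseteq> \<Omega>"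
  and nn: "\<And>w. w \<in> \<Omega> - {0} \<Longrightarrow> 0 \<le> u w" and e: "0 < eps" "eps < R" and K: "0 < K + cf 1 * eps powr \<theta>"
  and bd: "\<And>w. norm w = eps \<or> norm w = R \<Longrightarrow> \<bar>u w - b - J 1 K R (norm w)\<bar> \<le> C"
  and w: "eps \<le> norm w" "norm w \<le> R"
 shows "\<bar>u w - b - J 1 K R (norm w)\<bar> \<le> C"
proof -
 have d: "0 < den 1 K t" if "eps \<le> t" for t by (rule den1_pos[OF e(1) that K])
 let ?U = "{y::'a. norm (y - 0) \<in> {eps<..<R}}" and ?C = "{y::'a. eps \<le> norm y \<and> norm y \<le> R}"
 let ?J = "\<lambda>y::'a. J 1 K R (norm (y - 0))"
 have Jw: "wsol p q 1 ?U ?J" by (rule wsol_J(1)[OF dim]) (use e d in auto)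
 have Jg: "grad ?J y \<noteq> 0" if "y \<in> ?U" for y
  by (rule wsol_J(2)[OF dim, where ?r0.0=eps]) (use that e d in auto)
 have CO: "?C \<subseteq> \<Omega> - {0}" using R e by auto
 have uU: "wsol p q 1 ?U u" by (rule wsol_subset[OF u]) (use R e in auto)
 have cu: "continuous_on ?C u" by (rule continuous_on_subset[OF C1_on_continuous_on[OF wsol_C1[OF u]] CO])
 have cJ0: "continuous_on {eps..R} (J 1 K R)" by (rule J_continuous) (use e d in auto)
 have cJ: "continuous_on ?C ?J" by (intro continuous_on_compose2[OF cJ0] continuous_intros) auto
 have J0: "0 \<le> J 1 K R t" if "eps \<le> t" "t \<le> R" for t by (rule J_bounds(3)) (use that e d in auto)
 have "open (norm -` {eps<..<R} :: 'a set)" by (rule open_vimage) (auto intro: continuous_intros)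
 then have Uo: "open ?U" by (simp add: vimage_def)
 have "?C = cball 0 R - ball 0 eps" by auto
 then have Cc: "compact ?C" by (auto intro: compact_diff)
 have UC: "?U \<subseteq> ?C" by auto
 have sub: "norm y = eps \<or> norm y = R" if "y \<in> ?C - ?U" for y using that by auto
 have pd: "p \<le> real DIM('a)" using pN dim by simp
 have qp: "q \<le> p" using exps by simp
 \<comment> \<open>Lets l tend to 1 at the fixed point w.\<close>
 have lim: "X \<le> Y" if "0 \<le> Z" "\<And>l. 1 < l \<Longrightarrow> X \<le> l * Z + (Y - Z)" for X Y Z :: real
 proof (rule field_le_epsilon)
  fix e :: real assume e: "0 < e"
  have "X \<le> (1 + e / (Z + 1)) * Z + (Y - Z)" using e that(1) by (intro that(2)) simp
  also have "\<dots> = Y + e / (Z + 1) * Z" by (simp add: distrib_right)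
  also have "e / (Z + 1) * Z \<le> e" using e that(1) by (simp add: field_simps)
  finally show "X \<le> Y + e" by simp
 qed
 have wC: "w \<in> ?C" using w by simp
 have up: "u w \<le> J 1 K R (norm w) + (b + C)"
 proof (rule lim[of "J 1 K R (norm w)"])
  show "0 \<le> J 1 K R (norm w)" using w by (rule J0)
  fix l :: real assume l: "1 < l"
  have "u w \<le> l * ?J w + (b + C)"
  proof (rule noncritical_comparison[OF p1 pd exps(1) qp _ Uo UC Cc uU, where z="\<lambda>y. l * ?J y" and ?a2.0="1 * l powr (p - 1 - q)"])
   show "wsol p q (1 * l powr (p - 1 - q)) ?U (\<lambda>y. l * ?J y)" by (rule wsol_scale[OF Jw _ p1 exps(1)]) (use l in simp)
   show "continuous_on ?C (\<lambda>y. l * ?J y)" by (intro continuous_intros cJ)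
   show "grad u y \<noteq> 0 \<or> grad (\<lambda>y. l * ?J y) y \<noteq> 0" if "y \<in> ?U" for y
    using grad_cmult'[OF wsol_C1[OF Jw] that, of l] Jg[OF that] l by simp
   show "u y \<le> l * ?J y + (b + C)" if "y \<in> ?C - ?U" for y
   proof -
    have "0 \<le> J 1 K R (norm y)" using that by (intro J0) auto
    then have "J 1 K R (norm y) \<le> l * J 1 K R (norm y)" using l by (simp add: mult_le_cancel_right1)
    then show ?thesis using bd[OF sub[OF that]] by simp
   qed
  qed (use l wC cu in \<open>auto simp: scale_strict[simplified]\<close>)
  then show "u w \<le> l * J 1 K R (norm w) + (J 1 K R (norm w) + (b + C) - J 1 K R (norm w))" by simp
 qed
 have low: "J 1 K R (norm w) \<le> u w + (C - b)"
 proof (rule lim[of "u w"])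
  show "0 \<le> u w" using wC CO by (intro nn) auto
  fix l :: real assume l: "1 < l"
  have "?J w \<le> l * u w + (C - b)"
  proof (rule noncritical_comparison[OF p1 pd exps(1) qp _ Uo UC Cc Jw, where z="\<lambda>y. l * u y" and ?a2.0="1 * l powr (p - 1 - q)"])
   show "wsol p q (1 * l powr (p - 1 - q)) ?U (\<lambda>y. l * u y)" by (rule wsol_scale[OF uU _ p1 exps(1)]) (use l in simp)
   show "continuous_on ?C (\<lambda>y. l * u y)" by (intro continuous_intros cu)
   show "grad ?J y \<noteq> 0 \<or> grad (\<lambda>y. l * u y) y \<noteq> 0" if "y \<in> ?U" for y using Jg[OF that] by simp
   show "?J y \<le> l * u y + (C - b)" if "y \<in> ?C - ?U" for y
   proof -
    have "0 \<le> u y" using that CO by (intro nn) auto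
    then have "u y \<le> l * u y" using l by (simp add: mult_le_cancel_right1)
    then show ?thesis using bd[OF sub[OF that]] by simp
   qed
  qed (use l wC cJ in \<open>auto simp: scale_strict[simplified]\<close>)
  then show "J 1 K R (norm w) \<le> l * u w + (u w + (C - b) - u w)" by simp
 qed
 show ?thesis using up low by simp
qed

end

lemma filterlim_norm_at_0: "filterlim norm (at_right 0) (at (0::'a::real_normed_vector))"
 unfolding filterlim_at by (auto intro!: tendsto_norm_zero simp: eventually_at_filter)

context exponents begin

section \<open>Shrinking the hole and classification\<close>

text \<open>An error bounded by C is negligible against a gauge m that tends to infinity.\<close>

lemma near_radial_tendsto:
 fixes u :: "'a::euclidean_space \<Rightarrow> real"
 assumes R: "0 < R" and bd: "\<And>w. w \<noteq> 0 \<Longrightarrow> norm w \<le> R \<Longrightarrow> \<bar>u w - g (norm w)\<bar> \<le> C"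
  and top: "filterlim m at_top (at_right 0)" and g: "((\<lambda>r. g r / m r) \<longlongrightarrow> k) (at_right 0)"
 shows "((\<lambda>x. u x / m (norm x)) \<longlongrightarrow> k) (at 0)"
proof -
 have m: "filterlim (\<lambda>x::'a. m (norm x)) at_top (at 0)" by (rule filterlim_compose[OF top filterlim_norm_at_0])
 have "((\<lambda>x::'a. (u x - g (norm x)) / m (norm x)) \<longlongrightarrow> 0) (at 0)"
 proof (rule Lim_null_comparison)
  show "((\<lambda>x::'a. C / m (norm x)) \<longlongrightarrow> 0) (at 0)"
   by (rule tendsto_divide_0[OF tendsto_const]) (rule filterlim_at_top_imp_at_infinity[OF m])
  have "\<forall>\<^sub>F x::'a in at 0. 0 < m (norm x)" using m by (auto simp: filterlim_at_top_dense)
  moreover have "\<forall>\<^sub>F x::'a in at 0. x \<noteq> 0 \<and> norm x \<le> R" using R by (auto simp: eventually_at intro!: exI[of _ R])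
  ultimately show "\<forall>\<^sub>F x::'a in at 0. norm ((u x - g (norm x)) / m (norm x)) \<le> C / m (norm x)"
   by eventually_elim (auto intro!: divide_right_mono bd)
 qed
 moreover have "((\<lambda>x::'a. g (norm x) / m (norm x)) \<longlongrightarrow> k) (at 0)" by (rule filterlim_compose[OF g filterlim_norm_at_0])
 ultimately have "((\<lambda>x::'a. (u x - g (norm x)) / m (norm x) + g (norm x) / m (norm x)) \<longlongrightarrow> 0 + k) (at 0)" by (rule tendsto_add)
 then show ?thesis by (simp add: add_divide_distrib[symmetric])
qed

text \<open>For each small eps, choose K so that J + b matches u at one point of the sphere of
  radius eps, b being the value of u at one point of the outer sphere; the oscillation bound
  supplies the error C on both spheres. The parameters stay bounded as eps tends to 0 and
  subconverge.\<close>

lemma blow_up_radial: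
 fixes u :: "'a::euclidean_space \<Rightarrow> real"
 assumes dim: "N = real DIM('a)" and u: "wsol p q 1 (\<Omega> - {0}) u" and R: "0 < R" "cball 0 R \<subseteq> \<Omega>"
  and nn: "\<And>w. w \<in> \<Omega> - {0} \<Longrightarrow> 0 \<le> u w"
  and osc: "\<And>x y. x \<noteq> 0 \<Longrightarrow> norm x \<le> norm y \<Longrightarrow> norm y \<le> R \<Longrightarrow> u y \<le> u x + C"
  and blow: "\<And>M. \<exists>\<delta>>0. \<forall>x. x \<noteq> 0 \<and> norm x < \<delta> \<longrightarrow> M < u x"
 obtains K b where "0 \<le> K" "\<forall>w. w \<noteq> 0 \<and> norm w \<le> R \<longrightarrow> \<bar>u w - (b + J 1 K R (norm w))\<bar> \<le> C"
proof -
 obtain e0 :: 'a where e0: "norm e0 = 1" using vector_choose_size[of 1] by auto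
 define b where "b = u (R *\<^sub>R e0)"
 obtain \<delta> where \<delta>: "0 < \<delta>" "\<And>x. x \<noteq> 0 \<Longrightarrow> norm x < \<delta> \<Longrightarrow> \<bar>C\<bar> + 1 + b < u x" using blow[of "\<bar>C\<bar> + 1 + b"] by auto
 \<comment> \<open>At this radius u exceeds b by more than |C| + 1, so the matching parameters
   cannot become large.\<close>
 define r0 where "r0 = min \<delta> R / 2"
 have r0: "0 < r0" "r0 < \<delta>" "r0 < R" using \<delta> R by (auto simp: r0_def)
 have eqn: "\<bar>u x - u y\<bar> \<le> C" if "x \<noteq> 0" "norm x = norm y" "norm y \<le> R" for x y
 proof -
  have "y \<noteq> 0" using that by auto
  then show ?thesis using osc[of x y] osc[of y x] that by (simp add: abs_le_iff)
 qed
 have ex: "\<exists>K. 0 < K + cf 1 * eps powr \<theta> \<and> (\<forall>w. eps \<le> norm w \<and> norm w \<le> R \<longrightarrow> \<bar>u w - b - J 1 K R (norm w)\<bar> \<le> C)"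
  if e: "0 < eps" "eps < r0" for eps
 proof -
  have eR: "eps < R" using e r0 by simp
  have "\<bar>C\<bar> + 1 + b < u (eps *\<^sub>R e0)" using e e0 r0 by (intro \<delta>) auto
  then have T: "0 < u (eps *\<^sub>R e0) - b" by simp
  obtain K where K: "0 < K + cf 1 * eps powr \<theta>" "J 1 K R eps = u (eps *\<^sub>R e0) - b" using J_solve[OF e(1) eR T] by blast
  have "\<bar>u w - b - J 1 K R (norm w)\<bar> \<le> C" if w: "eps \<le> norm w" "norm w \<le> R" for w
  proof (rule annulus_sandwich[OF dim u R(2) nn e(1) eR K(1) _ w])
   fix y :: 'a assume y: "norm y = eps \<or> norm y = R"
   show "\<bar>u y - b - J 1 K R (norm y)\<bar> \<le> C"
   proof (cases "norm y = eps")
    case True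
    then show ?thesis using eqn[of y "eps *\<^sub>R e0"] e eR e0 K by auto
   next
    case False
    then show ?thesis using eqn[of y "R *\<^sub>R e0"] R e0 y J_R by (auto simp: b_def)
   qed
  qed
  then show ?thesis using K by blast
 qed
 define eps where "eps n = r0 / (real n + 2)" for n
 have ep: "0 < eps n" "eps n < r0" for n
  using r0 by (auto simp: eps_def divide_less_eq distrib_left intro: add_pos_nonneg)
 have e0lim: "eps \<longlonglongrightarrow> 0"
 proof -
  have "(\<lambda>n. 1 / (real n + 2)) \<longlonglongrightarrow> 0"
   using LIMSEQ_ignore_initial_segment[OF lim_1_over_n[where 'a=real], of 2] by (simp add: add.commute)
  then have "(\<lambda>n. r0 * (1 / (real n + 2))) \<longlonglongrightarrow> r0 * 0" by (intro tendsto_intros)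
  then show ?thesis by (simp add: eps_def[abs_def])
 qed
 have "\<forall>n. \<exists>K. 0 < K + cf 1 * eps n powr \<theta> \<and> (\<forall>w. eps n \<le> norm w \<and> norm w \<le> R \<longrightarrow> \<bar>u w - b - J 1 K R (norm w)\<bar> \<le> C)"
  using ex[OF ep] by blast
 from choice[OF this] obtain \<kappa> where kap: "\<And>n. 0 < \<kappa> n + cf 1 * eps n powr \<theta>"
  "\<And>n w. eps n \<le> norm w \<Longrightarrow> norm w \<le> R \<Longrightarrow> \<bar>u w - b - J 1 (\<kappa> n) R (norm w)\<bar> \<le> C" by blast
 \<comment> \<open>For K >= K' the profile at r0 is at most 1/2, incompatible with being within C of
   u - b > |C| + 1.\<close>
 obtain K' where K': "0 < K'" "\<And>t. 0 < t \<Longrightarrow> t \<le> R \<Longrightarrow> 0 < den 1 K' t" "J 1 K' R r0 \<le> 1 / 2"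
  using J_small[OF r0(1) less_imp_le[OF r0(3)], of "1/2" 1] by auto
 have up: "\<kappa> n \<le> K'" for n
 proof (rule ccontr)
  assume "\<not> \<kappa> n \<le> K'"
  then have "J 1 (\<kappa> n) R r0 \<le> J 1 K' R r0" using r0 K' by (intro J_antimono) auto
  moreover have "\<bar>u (r0 *\<^sub>R e0) - b - J 1 (\<kappa> n) R (norm (r0 *\<^sub>R e0))\<bar> \<le> C"
   using r0 e0 ep[of n] by (intro kap(2)[of n]) auto
  moreover have "\<bar>C\<bar> + 1 + b < u (r0 *\<^sub>R e0)" using e0 r0 by (intro \<delta>) auto
  moreover have "norm (r0 *\<^sub>R e0) = r0" using r0 e0 by simp
  ultimately show False using K'(3) by simp
 qed
 have "bounded (range \<kappa>)"
 proof (rule boundedI)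
  fix x assume "x \<in> range \<kappa>"
  then obtain n where n: "x = \<kappa> n" by auto
  have "cf 1 * eps n powr \<theta> \<le> cf 1 * r0 powr \<theta>" using \<beta>q(5) exps ep[of n] by (intro mult_left_mono powr_mono2) auto
  moreover have "0 \<le> cf 1 * r0 powr \<theta>" using \<beta>q(5) by simp
  ultimately show "norm x \<le> K' + cf 1 * r0 powr \<theta>" using kap(1)[of n] up[of n] K'(1) unfolding n real_norm_def by linarith
 qed
 then obtain K \<sigma> where \<sigma>: "strict_mono \<sigma>" "(\<kappa> \<circ> \<sigma>) \<longlonglongrightarrow> K" using bounded_imp_convergent_subsequence by blast
 have es: "(\<lambda>n. eps (\<sigma> n)) \<longlonglongrightarrow> 0" using LIMSEQ_subseq_LIMSEQ[OF e0lim \<sigma>(1)] by (simp add: o_def)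
 have ks: "(\<lambda>n. \<kappa> (\<sigma> n)) \<longlonglongrightarrow> K" using \<sigma>(2) by (simp add: o_def)
 \<comment> \<open>Positivity of \<open>den\<close> at eps only bounds K from below by -cf 1
   eps^\<theta>; in the limit this becomes K >= 0, again by \<theta> > 0.\<close>
 have "(\<lambda>n. \<kappa> (\<sigma> n) + cf 1 * eps (\<sigma> n) powr \<theta>) \<longlonglongrightarrow> K + cf 1 * 0"
  using exps by (intro tendsto_intros ks tendsto_zero_powrI[OF es tendsto_const]) (use ep in \<open>auto simp: less_imp_le\<close>)
 then have K0: "0 \<le> K" by (intro LIMSEQ_le_const[of _ "K" 0]) (use kap(1) in \<open>auto simp: less_imp_le\<close>)
 show ?thesis
 proof (rule that[OF K0, of b], intro allI impI, elim conjE)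
  fix w :: 'a assume w: "w \<noteq> 0" "norm w \<le> R"
  have "\<forall>\<^sub>F n in sequentially. eps (\<sigma> n) < norm w" using order_tendstoD(2)[OF es] w by simp
  then have ev: "\<forall>\<^sub>F n in sequentially. eps (\<sigma> n) \<le> norm w" by (rule eventually_mono) simp
  have cont: "continuous_on {K. 0 < K + cf 1 * norm w powr \<theta>} (\<lambda>K. J 1 K R (norm w))"
   using w by (intro J_continuous_param) auto
  have Kw: "0 < K + cf 1 * norm w powr \<theta>" using K0 \<beta>q(5) w by (intro add_nonneg_pos) auto
  have evK: "\<forall>\<^sub>F n in sequentially. \<kappa> (\<sigma> n) \<in> {K. 0 < K + cf 1 * norm w powr \<theta>}"
   using ev
  proof (rule eventually_mono)
   fix n assume "eps (\<sigma> n) \<le> norm w"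
   then have "cf 1 * eps (\<sigma> n) powr \<theta> \<le> cf 1 * norm w powr \<theta>" using \<beta>q(5) exps ep[of "\<sigma> n"] by (intro mult_left_mono powr_mono2) auto
   then show "\<kappa> (\<sigma> n) \<in> {K. 0 < K + cf 1 * norm w powr \<theta>}" using kap(1)[of "\<sigma> n"] by simp
  qed
  have "(\<lambda>n. J 1 (\<kappa> (\<sigma> n)) R (norm w)) \<longlonglongrightarrow> J 1 K R (norm w)"
   by (rule continuous_on_tendsto_compose[OF cont ks _ evK]) (use Kw in simp)
  then have "(\<lambda>n. \<bar>u w - b - J 1 (\<kappa> (\<sigma> n)) R (norm w)\<bar>) \<longlonglongrightarrow> \<bar>u w - b - J 1 K R (norm w)\<bar>" by (intro tendsto_intros)
  then have "\<bar>u w - b - J 1 K R (norm w)\<bar> \<le> C"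
  proof (rule tendsto_upperbound)
   show "\<forall>\<^sub>F n in sequentially. \<bar>u w - b - J 1 (\<kappa> (\<sigma> n)) R (norm w)\<bar> \<le> C"
    using ev by (rule eventually_mono) (use kap(2) w in blast)
  qed simp
  then show "\<bar>u w - (b + J 1 K R (norm w))\<bar> \<le> C" by (simp add: diff_diff_eq)
 qed
qed

lemma add_const_tendsto_ratio:
 assumes "filterlim m at_top F" "((\<lambda>r. f r / m r) \<longlongrightarrow> k) F"
 shows "((\<lambda>r. (b + f r) / m r) \<longlongrightarrow> (k::real)) F"
proof -
 have "((\<lambda>r. b / m r) \<longlongrightarrow> 0) F"
  by (rule tendsto_divide_0[OF tendsto_const]) (rule filterlim_at_top_imp_at_infinity[OF assms(1)])
 from tendsto_add[OF this assms(2)] show ?thesis by (simp add: add_divide_distrib)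
qed

theorem classification:
 fixes u :: "'a::euclidean_space \<Rightarrow> real"
 assumes dim: "N = real DIM('a)" and u: "wsol p q 1 (\<Omega> - {0}) u" and \<Omega>: "open \<Omega>" "0 \<in> \<Omega>"
  and nn: "\<And>w. w \<in> \<Omega> - {0} \<Longrightarrow> 0 \<le> u w"
 shows "(\<exists>k\<ge>0. mu_behaviour p k u) \<or> strong_behaviour p q u"
proof -
 obtain R0 where R0: "0 < R0" "cball 0 R0 \<subseteq> \<Omega>" using \<Omega> open_contains_cball by blast
 define R where "R = R0 / 4"
 have R: "0 < R" "cball 0 (4 * R) \<subseteq> \<Omega>" "cball 0 R \<subseteq> \<Omega>" using R0 by (auto simp: R_def)
 obtain C where C: "0 \<le> C" "\<And>x y. x \<noteq> 0 \<Longrightarrow> norm x \<le> norm y \<Longrightarrow> norm y \<le> R \<Longrightarrow> u y \<le> u x + C"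
  using oscillation_bound[OF dim u R(1,2) nn] by blast
 have mu: "mu_behaviour p k u \<longleftrightarrow> ((\<lambda>x. u x / mur p N (norm x)) \<longlongrightarrow> k) (at 0)" for k
  by (simp add: mu_behaviour_def mu_mur dim)
 show ?thesis
 proof (cases "\<forall>M. \<exists>\<delta>>0. \<forall>x. x \<noteq> 0 \<and> norm x < \<delta> \<longrightarrow> M < u x")
  case False
  then have "\<exists>M. \<forall>\<delta>>0. \<exists>x. x \<noteq> 0 \<and> norm x < \<delta> \<and> \<not> M < u x" by blast
  then obtain M where M: "\<And>\<delta>. 0 < \<delta> \<Longrightarrow> \<exists>x. x \<noteq> 0 \<and> norm x < \<delta> \<and> u x \<le> M"
   unfolding not_less by blast
  \<comment> \<open>Values at most M occur arbitrarily near 0, and the oscillation bound carries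
    them outwards: u is bounded.\<close>
  have "\<bar>u w - 0\<bar> \<le> M + C" if w: "w \<noteq> 0" "norm w \<le> R" for w
  proof -
   have "0 < norm w" unfolding zero_less_norm_iff by (rule w(1))
   from M[OF this] obtain x where x: "x \<noteq> 0" "norm x < norm w" "u x \<le> M" by blast
   have "u w \<le> u x + C" by (rule C(2)[OF x(1) less_imp_le[OF x(2)] w(2)])
   then have "u w \<le> M + C" using x(3) by linarith
   moreover have "0 \<le> u w" using w R(3) by (intro nn) auto
   ultimately show ?thesis by simp
  qed
  from near_radial_tendsto[of R u "\<lambda>_. 0", OF R(1) this mur_at_top, of 0]
  have "mu_behaviour p 0 u" by (simp add: mu)
  then show ?thesis by auto
 next
  case True
  have blow: "\<exists>\<delta>>0. \<forall>x. x \<noteq> 0 \<and> norm x < \<delta> \<longrightarrow> M < u x" for M using True by blast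
  obtain K b where K: "0 \<le> K" and Kw: "\<forall>w. w \<noteq> 0 \<and> norm w \<le> R \<longrightarrow> \<bar>u w - (b + J 1 K R (norm w))\<bar> \<le> C"
   by (rule blow_up_radial[OF dim u R(1,3) nn C(2) blow])
  have K2: "\<bar>u w - (b + J 1 K R (norm w))\<bar> \<le> C" if "w \<noteq> 0" "norm w \<le> R" for w using Kw that by blast
  show ?thesis
  proof (cases "K = 0")
   case False
   then have "0 < den 1 K t" if "0 < t" for t using K \<beta>q(5) by (simp add: den_def add_pos_nonneg)
   then have "((\<lambda>r. J 1 K R r / mur p N r) \<longlongrightarrow> K powr (- \<gamma>) / cmu) (at_right 0)"
    using False K R(1) by (intro J_mur_tendsto) auto
   then have "mu_behaviour p (K powr (- \<gamma>) / cmu) u" unfolding mu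
    by (intro near_radial_tendsto[where g="\<lambda>r. b + J 1 K R r" and R=R and C=C] R K2 add_const_tendsto_ratio mur_at_top)
   then show ?thesis using exps(6) by (intro disjI1 exI[of _ "K powr (- \<gamma>) / cmu"]) auto
  next
   case True
   have "((\<lambda>x. u x / norm x powr (- \<beta>q)) \<longlongrightarrow> inverse \<beta>q * (\<beta>q * (p - 1) + p - N) powr \<gamma>) (at 0)"
    by (intro near_radial_tendsto[where g="\<lambda>r. b + J 1 0 R r" and m="\<lambda>r. r powr (- \<beta>q)" and R=R and C=C] R
      K2[unfolded True] add_const_tendsto_ratio J_strong_tendsto filterlim_powr_neg_at_right_0) (use \<beta>q in auto)
   then have "strong_behaviour p q u"
    unfolding strong_behaviour_def beta_def[of p q] lambda_def \<beta>q_def[symmetric] \<gamma>_def dim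
    by (simp add: powr_minus divide_inverse mult.commute add.commute[of q] diff_add_eq)
   then show ?thesis ..
  qed
 qed
qed

end

section \<open>The flux through the origin\<close>

lemma integrable_except_0:
 fixes f g :: "'a::euclidean_space \<Rightarrow> 'b::{banach, second_countable_topology}"
 assumes "\<And>x. x \<noteq> 0 \<Longrightarrow> f x = g x"
 shows "integrable lborel f \<longleftrightarrow> integrable lborel g" "integral\<^sup>L lborel f = integral\<^sup>L lborel g"
 by (rule integrable_discrete_difference[where X="{0}"] integral_discrete_difference[where X="{0}"]; use assms in auto)+

lemma c1c_integrable:
 fixes X :: "'a::euclidean_space \<Rightarrow> 'a"
 assumes "c1c U \<phi>"
 shows "continuous_on U X \<Longrightarrow> integrable lborel (\<lambda>x. X x \<bullet> grad \<phi> x)"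
  "continuous_on U f \<Longrightarrow> integrable lborel (\<lambda>x. f x * \<phi> x)"
proof -
 obtain K where K: "compact K" "K \<subseteq> U" "\<And>x. x \<notin> K \<Longrightarrow> \<phi> x = 0" "\<And>x. x \<notin> K \<Longrightarrow> grad \<phi> x = 0"
  "C1_on UNIV \<phi>" "continuous_on UNIV (grad \<phi>)" "continuous_on UNIV \<phi>" using c1c_E[OF assms] by metis
 show "integrable lborel (\<lambda>x. X x \<bullet> grad \<phi> x)" if "continuous_on U X"
  by (rule integrable_compact_support[OF K(1)])
   (auto intro!: continuous_intros continuous_on_subset[OF that] continuous_on_subset[OF K(6)] K(2) simp: K(4))
 show "integrable lborel (\<lambda>x. f x * \<phi> x)" if "continuous_on U f"
  by (rule integrable_compact_support[OF K(1)])
   (auto intro!: continuous_intros continuous_on_subset[OF that] continuous_on_subset[OF K(7)] K(2) simp: K(3))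
qed

section \<open>Truncated test functions and one-sided flux estimates\<close>

text \<open>If w tends to infinity at 0, this equals \<zeta> where w <= j (off the origin) and
  vanishes where w >= j + 1, in particular near 0; it is thus admissible in the punctured
  domain.\<close>

definition trunc_test :: "('a::euclidean_space \<Rightarrow> real) \<Rightarrow> ('a \<Rightarrow> real) \<Rightarrow> real \<Rightarrow> 'a \<Rightarrow> real"
 where "trunc_test w \<zeta> j x = (if x = 0 then 0 else (1 - sstep (w x - j)) * \<zeta> x)"

lemma trunc_test:
 fixes w \<zeta> :: "'a::euclidean_space \<Rightarrow> real"
 assumes \<Omega>: "open \<Omega>" and w: "C1_on (\<Omega> - {0}) w" "filterlim w at_top (at 0)" and z: "c1c \<Omega> \<zeta>"
 shows "c1c (\<Omega> - {0}) (trunc_test w \<zeta> j)"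
  "x \<in> \<Omega> - {0} \<Longrightarrow> grad (trunc_test w \<zeta> j) x = (1 - sstep (w x - j)) *\<^sub>R grad \<zeta> x - (\<zeta> x * sstep' (w x - j)) *\<^sub>R grad w x"
proof -
 obtain K where K: "compact K" "K \<subseteq> \<Omega>" "\<And>x. x \<notin> K \<Longrightarrow> \<zeta> x = 0" using c1c_E[OF z] by metis
 have "\<forall>\<^sub>F x in at 0. j + 1 < w x" using w(2) by (auto simp: filterlim_at_top_dense)
 then obtain \<delta> where \<delta>: "0 < \<delta>" "\<And>x. x \<noteq> 0 \<Longrightarrow> norm x < \<delta> \<Longrightarrow> j + 1 < w x" by (auto simp: eventually_at)
 have O: "open (\<Omega> - {0})" using \<Omega> by (simp add: open_delete)
 let ?h = "\<lambda>t. 1 - sstep (t - j)"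
 have D: "DERIV ?h t :> - sstep' (t - j)" for t
 proof -
  have "DERIV (\<lambda>t. sstep (t - j)) t :> sstep' (t - j) * 1"
   by (rule DERIV_chain2[OF DERIV_sstep]) (auto intro!: derivative_eq_intros)
  then show ?thesis by (auto intro!: derivative_eq_intros)
 qed
 have hw: "C1_on (\<Omega> - {0}) (\<lambda>x. ?h (w x))"
  by (rule C1_on_compose[OF w(1) D])
   (auto intro!: continuous_intros continuous_on_compose2[OF continuous_on_sstep'[of UNIV]])
 have hz: "C1_on (\<Omega> - {0}) (\<lambda>x. ?h (w x) * \<zeta> x)" by (rule C1_on_mult[OF hw c1c_C1[OF z]])
 have eq: "?h (w x) * \<zeta> x = trunc_test w \<zeta> j x" if "x \<in> \<Omega> - {0}" for x using that by (simp add: trunc_test_def)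
 show "c1c (\<Omega> - {0}) (trunc_test w \<zeta> j)"
 proof (rule c1c_I[OF O C1_on_cong[OF O eq hz], of "K - ball 0 \<delta>"])
  fix x assume "x \<notin> K - ball 0 \<delta>"
  then show "trunc_test w \<zeta> j x = 0"
   using K(3)[of x] \<delta>(2)[of x] sstep_props(2)[of "w x - j"] by (auto simp: trunc_test_def)
 qed (use K \<delta> in \<open>auto intro: compact_diff\<close>)
 show "grad (trunc_test w \<zeta> j) x = (1 - sstep (w x - j)) *\<^sub>R grad \<zeta> x - (\<zeta> x * sstep' (w x - j)) *\<^sub>R grad w x"
  if x: "x \<in> \<Omega> - {0}"
 proof -
  have dw: "w differentiable (at x)" by (rule C1_on_differentiable[OF w(1) x])
  have "grad (trunc_test w \<zeta> j) x = grad (\<lambda>x. ?h (w x) * \<zeta> x) x" using grad_local[OF O x eq] by simp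
  also have "\<dots> = ?h (w x) *\<^sub>R grad \<zeta> x + \<zeta> x *\<^sub>R grad (\<lambda>x. ?h (w x)) x"
   by (rule grad_mult[OF C1_on_differentiable[OF hw x] C1_on_differentiable[OF c1c_C1[OF z] x]])
  also have "grad (\<lambda>x. ?h (w x)) x = (- sstep' (w x - j)) *\<^sub>R grad w x" by (rule grad_compose[OF dw D])
  finally show ?thesis by simp
 qed
qed

text \<open>The truncation adds -\<zeta> sstep'(w - j) grad w to the gradient, and the sign of X .
  grad w decides in which direction the limiting identity becomes an inequality.\<close>

lemma flux_test:
 fixes w \<zeta> :: "'a::euclidean_space \<Rightarrow> real"
 assumes \<Omega>: "open \<Omega>" and w: "C1_on (\<Omega> - {0}) w" "filterlim w at_top (at 0)" and z: "c1c \<Omega> \<zeta>" "\<And>x. 0 \<le> \<zeta> x"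
  and d: "0 < \<delta>" "\<And>x. norm x \<le> \<delta> \<Longrightarrow> grad \<zeta> x = 0"
  and X: "continuous_on (\<Omega> - {0}) X" and f: "continuous_on (\<Omega> - {0}) f"
  and id: "\<And>\<phi>. c1c (\<Omega> - {0}) \<phi> \<Longrightarrow> (LINT x|lborel. X x \<bullet> grad \<phi> x) + (LINT x|lborel. f x * \<phi> x) = 0"
 obtains j0 where
  "\<And>j. j0 \<le> j \<Longrightarrow> \<forall>x\<in>\<Omega> - {0}. X x \<bullet> grad w x \<le> 0 \<Longrightarrow> (LINT x|lborel. f x * trunc_test w \<zeta> j x) \<le> - (LINT x|lborel. X x \<bullet> grad \<zeta> x)"
  "\<And>j. j0 \<le> j \<Longrightarrow> \<forall>x\<in>\<Omega> - {0}. 0 \<le> X x \<bullet> grad w x \<Longrightarrow> - (LINT x|lborel. X x \<bullet> grad \<zeta> x) \<le> (LINT x|lborel. f x * trunc_test w \<zeta> j x)"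
proof -
 obtain K where K: "compact K" "K \<subseteq> \<Omega>" "\<And>x. x \<notin> K \<Longrightarrow> \<zeta> x = 0" "\<And>x. x \<notin> K \<Longrightarrow> grad \<zeta> x = 0"
  "C1_on UNIV \<zeta>" "continuous_on UNIV (grad \<zeta>)" using c1c_E[OF z(1)] by metis
 define K0 where "K0 = K - ball 0 \<delta>"
 have K0: "compact K0" "K0 \<subseteq> \<Omega> - {0}" using K d by (auto simp: K0_def intro: compact_diff)
 have g0: "grad \<zeta> x = 0" if "x \<notin> K0" for x using that K(4)[of x] d(2)[of x] by (auto simp: K0_def)
 have iz: "integrable lborel (\<lambda>x. X x \<bullet> grad \<zeta> x)"
  by (rule integrable_compact_support[OF K0(1)])
   (auto intro!: continuous_intros continuous_on_subset[OF X] continuous_on_subset[OF K(6)] K0(2) simp: g0)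
 \<comment> \<open>The gradient of \<zeta> lives on a compact set away from 0, where w is bounded by
   some j0; for j >= j0 the truncation is inactive there.\<close>
 have "compact (w ` K0)" by (intro compact_continuous_image continuous_on_subset[OF C1_on_continuous_on[OF w(1)]] K0)
 then have "bdd_above (w ` K0)" by (intro bounded_imp_bdd_above compact_imp_bounded)
 then obtain j0 where "\<forall>v\<in>w ` K0. v \<le> j0" unfolding bdd_above_def by blast
 then have j0: "w x \<le> j0" if "x \<in> K0" for x using that by blast
 let ?\<phi> = "trunc_test w \<zeta>"
 have main: "X x \<bullet> grad (?\<phi> j) x - X x \<bullet> grad \<zeta> x = (if x \<in> \<Omega> - {0} then - (\<zeta> x * sstep' (w x - j)) * (X x \<bullet> grad w x) else 0)"
  if j: "j0 \<le> j" for j x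
 proof (cases "x \<in> \<Omega> - {0}")
  case True
  have "sstep (w x - j) *\<^sub>R grad \<zeta> x = 0"
   using j0[of x] g0[of x] j sstep_props(1)[of "w x - j"] by (cases "x \<in> K0") auto
  then have "grad (?\<phi> j) x = grad \<zeta> x - (\<zeta> x * sstep' (w x - j)) *\<^sub>R grad w x"
   unfolding trunc_test(2)[OF \<Omega> w z(1) True] by (simp add: scaleR_diff_left)
  then show ?thesis using True by (simp add: inner_diff_right)
 next
  case False
  obtain K1 where K1: "K1 \<subseteq> \<Omega> - {0}" "\<And>x. x \<notin> K1 \<Longrightarrow> grad (?\<phi> j) x = 0"
   using c1c_E[OF trunc_test(1)[OF \<Omega> w z(1)]] by metis
  have "x \<notin> K1" "x \<notin> K0" using False K1 K0 by auto
  then have "grad (?\<phi> j) x = 0" "grad \<zeta> x = 0" using K1(2) g0 by auto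
  then show ?thesis using False by auto
 qed
 have ip: "integrable lborel (\<lambda>x. X x \<bullet> grad (?\<phi> j) x)" for j by (rule c1c_integrable(1)[OF trunc_test(1)[OF \<Omega> w z(1)] X])
 have tot: "(LINT x|lborel. f x * ?\<phi> j x) = - (LINT x|lborel. X x \<bullet> grad \<zeta> x) - (LINT x|lborel. X x \<bullet> grad (?\<phi> j) x - X x \<bullet> grad \<zeta> x)" for j
  using id[OF trunc_test(1)[OF \<Omega> w z(1), of j]] Bochner_Integration.integral_diff[OF ip iz, of j] by linarith
 show ?thesis
 proof (rule that[of j0])
  fix j assume j: "j0 \<le> j"
  show "(LINT x|lborel. f x * ?\<phi> j x) \<le> - (LINT x|lborel. X x \<bullet> grad \<zeta> x)" if "\<forall>x\<in>\<Omega> - {0}. X x \<bullet> grad w x \<le> 0"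
  proof -
   have "0 \<le> (LINT x|lborel. X x \<bullet> grad (?\<phi> j) x - X x \<bullet> grad \<zeta> x)" unfolding main[OF j]
    by (rule Bochner_Integration.integral_nonneg) (use that z(2) sstep_props(7) in \<open>auto intro!: mult_nonneg_nonpos\<close>)
   then show ?thesis using tot[of j] by linarith
  qed
  show "- (LINT x|lborel. X x \<bullet> grad \<zeta> x) \<le> (LINT x|lborel. f x * ?\<phi> j x)" if "\<forall>x\<in>\<Omega> - {0}. 0 \<le> X x \<bullet> grad w x"
  proof -
   have "0 \<le> (LINT x|lborel. - (X x \<bullet> grad (?\<phi> j) x - X x \<bullet> grad \<zeta> x))" unfolding main[OF j]
    by (rule Bochner_Integration.integral_nonneg) (use that z(2) sstep_props(7) in \<open>auto intro!: mult_nonneg_nonneg\<close>)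
   then show ?thesis using tot[of j] unfolding Bochner_Integration.integral_minus by linarith
  qed
 qed
qed

lemma sstep_mono: "s \<le> t \<Longrightarrow> sstep s \<le> sstep t"
 by (rule DERIV_nonneg_imp_nondecreasing) (use DERIV_sstep sstep_props(7) in blast)+

text \<open>Monotone convergence as j tends to infinity: the bound does not depend on j, which
  yields integrability up to the origin as well.\<close>

lemma flux_upper:
 fixes w \<zeta> :: "'a::euclidean_space \<Rightarrow> real"
 assumes \<Omega>: "open \<Omega>" and w: "C1_on (\<Omega> - {0}) w" "filterlim w at_top (at 0)" and z: "c1c \<Omega> \<zeta>" "\<And>x. 0 \<le> \<zeta> x"
  and d: "0 < \<delta>" "\<And>x. norm x \<le> \<delta> \<Longrightarrow> grad \<zeta> x = 0"
  and X: "continuous_on (\<Omega> - {0}) X" and f: "continuous_on (\<Omega> - {0}) f"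
  and id: "\<And>\<phi>. c1c (\<Omega> - {0}) \<phi> \<Longrightarrow> (LINT x|lborel. X x \<bullet> grad \<phi> x) + (LINT x|lborel. f x * \<phi> x) = 0"
  and f0: "\<And>x. 0 \<le> f x" and s: "\<forall>x\<in>\<Omega> - {0}. X x \<bullet> grad w x \<le> 0"
 shows "integrable lborel (\<lambda>x. f x * \<zeta> x)" "(LINT x|lborel. f x * \<zeta> x) \<le> - (LINT x|lborel. X x \<bullet> grad \<zeta> x)"
proof -
 obtain j0 where j0: "\<And>j. j0 \<le> j \<Longrightarrow> (LINT x|lborel. f x * trunc_test w \<zeta> j x) \<le> - (LINT x|lborel. X x \<bullet> grad \<zeta> x)"
  by (rule flux_test[OF \<Omega> w z d X f id]) (use s in blast)+
 define g where "g n x = f x * trunc_test w \<zeta> (j0 + real n) x" for n x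
 define G where "G x = (if x = 0 then 0 else f x * \<zeta> x)" for x
 have gi: "integrable lborel (g n)" for n unfolding g_def by (rule c1c_integrable(2)[OF trunc_test(1)[OF \<Omega> w z(1)] f])
 have mono: "mono (\<lambda>n. g n x)" for x
  unfolding g_def trunc_test_def using f0[of x] z(2)[of x]
  by (auto intro!: monoI mult_left_mono mult_right_mono sstep_mono)
 have lim: "(\<lambda>n. g n x) \<longlonglongrightarrow> G x" for x
 proof -
  obtain n0 where n0: "w x - j0 \<le> real n0" using real_arch_simple by blast
  have "g n x = G x" if "n0 \<le> n" for n
   using sstep_props(1)[of "w x - (j0 + real n)"] n0 that by (auto simp: g_def G_def trunc_test_def)
  then show ?thesis by (intro tendsto_eventually) (auto simp: eventually_sequentially)
 qed
 have im: "incseq (\<lambda>n. integral\<^sup>L lborel (g n))"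
  by (intro incseq_SucI integral_mono gi) (use mono in \<open>auto simp: mono_iff_le_Suc\<close>)
 have ub: "integral\<^sup>L lborel (g n) \<le> - (LINT x|lborel. X x \<bullet> grad \<zeta> x)" for n unfolding g_def by (rule j0) simp
 obtain I where I: "(\<lambda>n. integral\<^sup>L lborel (g n)) \<longlonglongrightarrow> I" using incseq_convergent[OF im] ub by metis
 have Gm: "G \<in> borel_measurable lborel" by (rule borel_measurable_LIMSEQ_real[OF lim]) (rule borel_measurable_integrable[OF gi])
 have "integrable lborel G" "integral\<^sup>L lborel G = I"
  using integrable_monotone_convergence[OF gi _ _ I Gm] integral_monotone_convergence[OF gi _ _ I Gm] mono lim by auto
 moreover have "I \<le> - (LINT x|lborel. X x \<bullet> grad \<zeta> x)" by (rule LIMSEQ_le_const2[OF I]) (use ub in auto)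
 ultimately show "integrable lborel (\<lambda>x. f x * \<zeta> x)" "(LINT x|lborel. f x * \<zeta> x) \<le> - (LINT x|lborel. X x \<bullet> grad \<zeta> x)"
  using integrable_except_0[of G "\<lambda>x. f x * \<zeta> x"] by (auto simp: G_def)
qed

lemma flux_lower:
 fixes w \<zeta> :: "'a::euclidean_space \<Rightarrow> real"
 assumes \<Omega>: "open \<Omega>" and w: "C1_on (\<Omega> - {0}) w" "filterlim w at_top (at 0)" and z: "c1c \<Omega> \<zeta>" "\<And>x. 0 \<le> \<zeta> x"
  and d: "0 < \<delta>" "\<And>x. norm x \<le> \<delta> \<Longrightarrow> grad \<zeta> x = 0"
  and X: "continuous_on (\<Omega> - {0}) X" and f: "continuous_on (\<Omega> - {0}) f"
  and id: "\<And>\<phi>. c1c (\<Omega> - {0}) \<phi> \<Longrightarrow> (LINT x|lborel. X x \<bullet> grad \<phi> x) + (LINT x|lborel. f x * \<phi> x) = 0"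
  and f0: "\<And>x. 0 \<le> f x" and s: "\<forall>x\<in>\<Omega> - {0}. 0 \<le> X x \<bullet> grad w x"
  and fi: "integrable lborel (\<lambda>x. f x * \<zeta> x)"
 shows "- (LINT x|lborel. X x \<bullet> grad \<zeta> x) \<le> (LINT x|lborel. f x * \<zeta> x)"
proof -
 obtain j where j: "- (LINT x|lborel. X x \<bullet> grad \<zeta> x) \<le> (LINT x|lborel. f x * trunc_test w \<zeta> j x)"
  by (rule flux_test[OF \<Omega> w z d X f id]) (use s in blast)+
 also have "\<dots> \<le> (LINT x|lborel. f x * \<zeta> x)"
 proof (rule integral_mono[OF c1c_integrable(2)[OF trunc_test(1)[OF \<Omega> w z(1)] f] fi])
  fix x
  have "(1 - sstep (w x - j)) * \<zeta> x \<le> 1 * \<zeta> x" using z(2) sstep_props(3) by (intro mult_right_mono) auto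
  then show "f x * trunc_test w \<zeta> j x \<le> f x * \<zeta> x" using f0 z(2) by (intro mult_left_mono) (auto simp: trunc_test_def)
 qed
 finally show ?thesis .
qed

lemma locally_integrable_punctured:
 fixes g :: "'a::euclidean_space \<Rightarrow> 'b::euclidean_space"
 assumes "continuous_on (\<Omega> - {0}) g" "0 < r" "set_integrable lborel (ball 0 r) g"
 shows "locally_integrable \<Omega> g"
 unfolding locally_integrable_def
proof (intro allI impI, elim conjE)
 fix K :: "'a set" assume K: "compact K" "K \<subseteq> \<Omega>"
 have "compact (K - ball 0 r)" using K by (intro compact_diff) auto
 moreover have "continuous_on (K - ball 0 r) g" using K assms(2) by (intro continuous_on_subset[OF assms(1)]) auto
 ultimately have "set_integrable lborel (K - ball 0 r) g" unfolding set_integrable_def by (rule borel_integrable_compact)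
 moreover have "set_integrable lborel (K \<inter> ball 0 r) g"
  by (rule set_integrable_subset[OF assms(3)]) (use borel_closed[OF compact_imp_closed[OF K(1)]] in auto)
 ultimately have "set_integrable lborel ((K - ball 0 r) \<union> (K \<inter> ball 0 r)) g"
  by (rule set_integrable_Un) (use borel_closed[OF compact_imp_closed[OF K(1)]] in auto)
 moreover have "(K - ball 0 r) \<union> (K \<inter> ball 0 r) = K" by auto
 ultimately show "set_integrable lborel K g" by simp
qed

lemma locally_integrable_c1c:
 fixes X :: "'a::euclidean_space \<Rightarrow> 'a"
 assumes "c1c U \<phi>"
 shows "locally_integrable U X \<Longrightarrow> integrable lborel (\<lambda>x. X x \<bullet> grad \<phi> x)"
  "locally_integrable U f \<Longrightarrow> integrable lborel (\<lambda>x. f x * \<phi> x)"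
proof -
 obtain K where K: "compact K" "K \<subseteq> U" "\<And>x. x \<notin> K \<Longrightarrow> \<phi> x = 0" "\<And>x. x \<notin> K \<Longrightarrow> grad \<phi> x = 0"
  "C1_on UNIV \<phi>" "continuous_on UNIV (grad \<phi>)" "continuous_on UNIV \<phi>" using c1c_E[OF assms] by metis
 have meas: "grad \<phi> \<in> borel_measurable borel" "\<phi> \<in> borel_measurable borel"
  using K(6,7) by (auto intro: borel_measurable_continuous_onI)
 have bounded: "\<exists>M. \<forall>x. norm (h x) \<le> M" if "continuous_on UNIV h" "\<And>x. x \<notin> K \<Longrightarrow> h x = 0" for h :: "'a \<Rightarrow> 'c::euclidean_space"
 proof -
  have "bounded (h ` K)" by (intro compact_imp_bounded compact_continuous_image continuous_on_subset[OF that(1)] K) auto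
  then obtain M where M: "0 < M" "\<And>x. x \<in> K \<Longrightarrow> norm (h x) \<le> M" by (auto simp: bounded_pos)
  have "norm (h x) \<le> M" for x using M that(2)[of x] by (cases "x \<in> K") auto
  then show ?thesis by blast
 qed
 show "integrable lborel (\<lambda>x. X x \<bullet> grad \<phi> x)" if "locally_integrable U X"
 proof -
  have i: "integrable lborel (\<lambda>x. indicator K x *\<^sub>R X x)" using that K by (auto simp: locally_integrable_def set_integrable_def)
  have eq: "X x \<bullet> grad \<phi> x = (indicator K x *\<^sub>R X x) \<bullet> grad \<phi> x" for x using K(4)[of x] by (auto simp: indicator_def)
  obtain M where M: "\<And>x. norm (grad \<phi> x) \<le> M" using bounded[OF K(6,4)] by blast
  have "integrable lborel (\<lambda>x. M * norm (indicator K x *\<^sub>R X x))" using i by (intro integrable_mult_right integrable_norm)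
  then show ?thesis unfolding eq
  proof (rule Bochner_Integration.integrable_bound)
   show "(\<lambda>x. (indicator K x *\<^sub>R X x) \<bullet> grad \<phi> x) \<in> borel_measurable lborel"
    using borel_measurable_integrable[OF i] meas(1) by (intro borel_measurable_inner) auto
   have "norm ((indicator K x *\<^sub>R X x) \<bullet> grad \<phi> x) \<le> norm (M * norm (indicator K x *\<^sub>R X x))" for x
    using Cauchy_Schwarz_ineq2[of "indicator K x *\<^sub>R X x" "grad \<phi> x"]
     mult_left_mono[OF M[of x], of "norm (indicator K x *\<^sub>R X x)"] order_trans[OF norm_ge_zero M[of x]]
    by (simp add: abs_mult mult.commute)
   then show "AE x in lborel. norm ((indicator K x *\<^sub>R X x) \<bullet> grad \<phi> x) \<le> norm (M * norm (indicator K x *\<^sub>R X x))" by simp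
  qed
 qed
 show "integrable lborel (\<lambda>x. f x * \<phi> x)" if "locally_integrable U f"
 proof -
  have i: "integrable lborel (\<lambda>x. indicator K x *\<^sub>R f x)" using that K by (auto simp: locally_integrable_def set_integrable_def)
  have eq: "f x * \<phi> x = (indicator K x *\<^sub>R f x) * \<phi> x" for x using K(3)[of x] by (auto simp: indicator_def)
  obtain M where M: "\<And>x. norm (\<phi> x) \<le> M" using bounded[OF K(7,3)] by blast
  have "integrable lborel (\<lambda>x. M * norm (indicator K x *\<^sub>R f x))" using i by (intro integrable_mult_right integrable_norm)
  then show ?thesis unfolding eq
  proof (rule Bochner_Integration.integrable_bound)
   show "(\<lambda>x. (indicator K x *\<^sub>R f x) * \<phi> x) \<in> borel_measurable lborel"
    using borel_measurable_integrable[OF i] meas(2) by (intro borel_measurable_times) auto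
   have "norm ((indicator K x *\<^sub>R f x) * \<phi> x) \<le> norm (M * norm (indicator K x *\<^sub>R f x))" for x
    using mult_left_mono[OF M[of x], of "norm (indicator K x *\<^sub>R f x)"] order_trans[OF norm_ge_zero M[of x]]
    by (simp add: abs_mult mult.commute)
   then show "AE x in lborel. norm ((indicator K x *\<^sub>R f x) * \<phi> x) \<le> norm (M * norm (indicator K x *\<^sub>R f x))" by simp
  qed
 qed
qed

text \<open>Cut out the origin at scale 1/n. Since |\<psi>| <= M |x|, the product of \<psi> with the
  gradient of the cut-off, of size n on |x| <= 1/n, stays bounded, and dominated convergence
  applies.\<close>

lemma point_mass:
 fixes X :: "'a::euclidean_space \<Rightarrow> 'a"
 assumes X: "locally_integrable \<Omega> X" and f: "locally_integrable \<Omega> f"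
  and id: "\<And>\<phi>. c1c (\<Omega> - {0}) \<phi> \<Longrightarrow> (LINT x|lborel. X x \<bullet> grad \<phi> x) + (LINT x|lborel. f x * \<phi> x) = 0"
  and psi: "c1c \<Omega> \<psi>" "\<psi> 0 = 0"
 shows "(LINT x|lborel. X x \<bullet> grad \<psi> x) + (LINT x|lborel. f x * \<psi> x) = 0"
proof -
 obtain K where K: "compact K" "K \<subseteq> \<Omega>" "\<And>x. x \<notin> K \<Longrightarrow> \<psi> x = 0" "\<And>x. x \<notin> K \<Longrightarrow> grad \<psi> x = 0"
  "C1_on UNIV \<psi>" "continuous_on UNIV (grad \<psi>)" "continuous_on UNIV \<psi>" using c1c_E[OF psi(1)] by metis
 obtain M where M: "0 \<le> M" "\<And>x. norm (grad \<psi> x) \<le> M" "\<And>x y. \<bar>\<psi> x - \<psi> y\<bar> \<le> M * norm (x - y)"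
  using c1c_lipschitz[OF psi(1)] by metis
 have psM: "\<bar>\<psi> x\<bar> \<le> M * norm x" for x using M(3)[of x 0] psi(2) by simp
 obtain C where C: "0 \<le> C" "\<And>y. norm (grad chi (y::'a)) \<le> C"
 proof -
  have "continuous_on UNIV (grad (chi :: 'a \<Rightarrow> real))" by (rule C1_onD(2)[OF chi_props(5)])
  then have "bounded (grad (chi :: 'a \<Rightarrow> real) ` cball 0 1)"
   by (rule compact_imp_bounded[OF compact_continuous_image[OF continuous_on_subset[OF _ subset_UNIV] compact_cball]])
  then obtain C where C: "0 < C" "\<forall>v\<in>grad (chi :: 'a \<Rightarrow> real) ` cball 0 1. norm v \<le> C" unfolding bounded_pos by blast
  have "norm (grad chi (y::'a)) \<le> C" for y
  proof (cases "norm y \<le> 1")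
   case True
   then have "grad chi y \<in> grad chi ` cball (0::'a) 1" by simp
   then show ?thesis using C(2) by blast
  qed (use C(1) chi_props(8)[of y] in simp)
  then show thesis by (rule that[OF less_imp_le[OF C(1)]])
 qed
 define \<psi>n where "\<psi>n n x = chi (real (Suc n) *\<^sub>R x) * \<psi> x" for n x
 have g: "grad (\<psi>n n) x = chi (real (Suc n) *\<^sub>R x) *\<^sub>R grad \<psi> x + (\<psi> x * real (Suc n)) *\<^sub>R grad chi (real (Suc n) *\<^sub>R x)" for n x
  unfolding \<psi>n_def[abs_def]
  using grad_mult[OF C1_on_differentiable[OF chi_scaled(2)] C1_on_differentiable[OF K(5)], of x "real (Suc n)"]
   grad_eqI[OF chi_scaled(1)[of "real (Suc n)" x]] by simp
 have cn: "c1c (\<Omega> - {0}) (\<psi>n n)" for n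
 proof (rule c1c_I[OF open_UNIV, of _ "K - ball 0 (1 / (2 * real (Suc n)))"])
  show "C1_on UNIV (\<psi>n n)" unfolding \<psi>n_def by (rule C1_on_mult[OF chi_scaled(2) K(5)])
  fix x assume x: "x \<notin> K - ball 0 (1 / (2 * real (Suc n)))"
  show "\<psi>n n x = 0"
  proof (cases "x \<in> K")
   case True
   then have "norm x < 1 / (2 * real (Suc n))" using x by auto
   then have "norm (real (Suc n) *\<^sub>R x) \<le> 1 / 2" unfolding norm_scaleR by (simp add: field_simps)
   then show ?thesis unfolding \<psi>n_def by (simp only: chi_props(1) mult_zero_left)
  qed (simp add: \<psi>n_def K(3))
 qed (use K in \<open>auto intro: compact_diff\<close>)
 have ind: "integrable lborel (\<lambda>x. indicator K x *\<^sub>R X x)" "integrable lborel (\<lambda>x. indicator K x *\<^sub>R f x)"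
  using X f K by (auto simp: locally_integrable_def set_integrable_def)
 have lim: "(\<lambda>n. X x \<bullet> grad (\<psi>n n) x) \<longlonglongrightarrow> X x \<bullet> grad \<psi> x" "(\<lambda>n. f x * \<psi>n n x) \<longlonglongrightarrow> f x * \<psi> x" if x: "x \<noteq> 0" for x
 proof -
  obtain n0 where n0: "1 / norm x \<le> real n0" using real_arch_simple by blast
  have "1 \<le> norm (real (Suc n) *\<^sub>R x)" if "n0 \<le> n" for n
  proof -
   have "1 / norm x \<le> real (Suc n)" using n0 that by simp
   then show ?thesis using x by (simp add: divide_le_eq)
  qed
  then have "\<psi>n n x = \<psi> x" "grad (\<psi>n n) x = grad \<psi> x" if "n0 \<le> n" for n
   using that chi_props(2,8)[of "real (Suc n) *\<^sub>R x"] unfolding g by (auto simp: \<psi>n_def)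
  then show "(\<lambda>n. X x \<bullet> grad (\<psi>n n) x) \<longlonglongrightarrow> X x \<bullet> grad \<psi> x" "(\<lambda>n. f x * \<psi>n n x) \<longlonglongrightarrow> f x * \<psi> x"
   by (auto intro!: tendsto_eventually exI[of _ n0] simp: eventually_sequentially)
 qed
 have ne: "AE x in lborel. x \<noteq> (0::'a)" by (rule AE_lborel_singleton)
 have bd1: "norm (grad (\<psi>n n) x) \<le> (M + M * C) * indicator K x" for n x
 proof (cases "x \<in> K")
  case True
  have "norm (chi (real (Suc n) *\<^sub>R x) *\<^sub>R grad \<psi> x) \<le> 1 * M"
   unfolding norm_scaleR using chi_props(3,4)[of "real (Suc n) *\<^sub>R x"] by (intro mult_mono M) auto
  moreover have "norm ((\<psi> x * real (Suc n)) *\<^sub>R grad chi (real (Suc n) *\<^sub>R x)) \<le> M * C"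
  proof (cases "norm (real (Suc n) *\<^sub>R x) \<le> 1")
   case True
   have "\<bar>\<psi> x * real (Suc n)\<bar> \<le> M * norm (real (Suc n) *\<^sub>R x)"
    using mult_right_mono[OF psM[of x], of "real (Suc n)"] by (simp add: abs_mult mult_ac)
   also have "\<dots> \<le> M * 1" using True M(1) by (intro mult_left_mono)
   finally have "\<bar>\<psi> x * real (Suc n)\<bar> \<le> M" by simp
   then show ?thesis unfolding norm_scaleR using C M(1) by (intro mult_mono) auto
  next
   case False
   then show ?thesis using chi_props(8)[of "real (Suc n) *\<^sub>R x"] M C by simp
  qed
  ultimately have "norm (grad (\<psi>n n) x) \<le> 1 * M + M * C" unfolding g by (rule norm_triangle_le[OF add_mono])
  then show ?thesis using True by simp
 next
  case False
  then show ?thesis unfolding g using K by simp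
 qed
 have m0: "(LINT x|lborel. X x \<bullet> grad (\<psi>n n) x) + (LINT x|lborel. f x * \<psi>n n x) = 0" for n by (rule id[OF cn])
 have cO: "c1c \<Omega> (\<psi>n n)" for n by (rule c1c_mono[OF cn]) auto
 note in1 = locally_integrable_c1c(1)[OF cO X] and in2 = locally_integrable_c1c(2)[OF cO f]
 have l1: "(\<lambda>n. LINT x|lborel. X x \<bullet> grad (\<psi>n n) x) \<longlonglongrightarrow> (LINT x|lborel. X x \<bullet> grad \<psi> x)"
 proof (rule integral_dominated_convergence[where w="\<lambda>x. (M + M * C) * norm (indicator K x *\<^sub>R X x)"])
  show "AE x in lborel. (\<lambda>n. X x \<bullet> grad (\<psi>n n) x) \<longlonglongrightarrow> X x \<bullet> grad \<psi> x" using ne by eventually_elim (rule lim)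
  have "norm (X x \<bullet> grad (\<psi>n n) x) \<le> (M + M * C) * norm (indicator K x *\<^sub>R X x)" for n x
   using Cauchy_Schwarz_ineq2[of "X x" "grad (\<psi>n n) x"] mult_left_mono[OF bd1[of n x], of "norm (X x)"] by (simp add: mult_ac)
  then show "AE x in lborel. norm (X x \<bullet> grad (\<psi>n n) x) \<le> (M + M * C) * norm (indicator K x *\<^sub>R X x)" for n by simp
  show "integrable lborel (\<lambda>x. (M + M * C) * norm (indicator K x *\<^sub>R X x))" by (intro integrable_mult_right integrable_norm ind)
 qed (intro borel_measurable_integrable in1 locally_integrable_c1c(1)[OF psi(1) X])+
 have l2: "(\<lambda>n. LINT x|lborel. f x * \<psi>n n x) \<longlonglongrightarrow> (LINT x|lborel. f x * \<psi> x)"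
 proof (rule integral_dominated_convergence[where w="\<lambda>x. norm (f x * \<psi> x)"])
  show "AE x in lborel. (\<lambda>n. f x * \<psi>n n x) \<longlonglongrightarrow> f x * \<psi> x" using ne by eventually_elim (rule lim)
  have "norm (f x * \<psi>n n x) \<le> norm (f x * \<psi> x)" for n x
   unfolding \<psi>n_def using chi_props(3,4)[of "real (Suc n) *\<^sub>R x"] by (simp add: abs_mult mult_left_mono mult_left_le_one_le)
  then show "AE x in lborel. norm (f x * \<psi>n n x) \<le> norm (f x * \<psi> x)" for n by simp
 qed (intro borel_measurable_integrable integrable_norm in2 locally_integrable_c1c(2)[OF psi(1) f])+
 from tendsto_add[OF l1 l2] show ?thesis unfolding m0 by (simp add: LIMSEQ_const_iff)
qed

lemma sstep'_pos: "0 < t \<Longrightarrow> t < 1 \<Longrightarrow> 0 < sstep' t"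
proof -
 assume t: "0 < t" "t < 1"
 then have "0 < pos_sq t" "0 < pos_sq (1 - t)" by (auto simp: pos_sq_def)
 then show ?thesis unfolding sstep'_def using t by (intro divide_pos_pos add_pos_pos mult_pos_pos zero_less_power) auto
qed

definition bump :: "real \<Rightarrow> 'a::euclidean_space \<Rightarrow> real"
 where "bump c x = 1 - chi (c *\<^sub>R x)"

lemma bump_props:
 fixes x :: "'a::euclidean_space"
 assumes c: "0 < c"
 shows "grad (bump c) x = - c *\<^sub>R grad chi (c *\<^sub>R x)" "0 \<le> bump c x" "norm x \<le> 1 / (2 * c) \<Longrightarrow> bump c x = 1"
  "norm x \<le> 1 / (2 * c) \<Longrightarrow> grad (bump c) x = 0" "bump c (0::'a) = 1" "cball 0 (1 / c) \<subseteq> \<Omega> \<Longrightarrow> c1c \<Omega> (bump c :: 'a \<Rightarrow> real)"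
proof -
 have "GDERIV (bump c) x :> 0 - c *\<^sub>R grad chi (c *\<^sub>R x)" unfolding bump_def[abs_def]
  by (intro GDERIV_diff GDERIV_const chi_scaled)
 from grad_eqI[OF this] show g: "grad (bump c) x = - c *\<^sub>R grad chi (c *\<^sub>R x)" by simp
 show "0 \<le> bump c x" unfolding bump_def using chi_props(4)[of "c *\<^sub>R x"] by simp
 have sm: "norm (c *\<^sub>R x) \<le> 1 / 2" if "norm x \<le> 1 / (2 * c)" unfolding norm_scaleR using that c by (simp add: field_simps)
 show "bump c x = 1" if "norm x \<le> 1 / (2 * c)" unfolding bump_def using chi_props(1)[OF sm[OF that]] by simp
 show "grad (bump c) x = 0" if "norm x \<le> 1 / (2 * c)" unfolding g using chi_props(7)[OF sm[OF that]] by simp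
 show "bump c (0::'a) = 1" unfolding bump_def using chi_props(1)[of "0::'a"] by simp
 show "c1c \<Omega> (bump c :: 'a \<Rightarrow> real)" if "cball 0 (1 / c) \<subseteq> \<Omega>"
  unfolding c1c_def
 proof (intro conjI exI[of _ "cball 0 (1 / c)"] allI impI)
  show "C1_on UNIV (bump c :: 'a \<Rightarrow> real)" unfolding bump_def[abs_def] by (rule C1_on_diff[OF C1_on_const chi_scaled(2)])
  fix y :: 'a assume "y \<notin> cball 0 (1 / c)"
  then have "1 \<le> norm (c *\<^sub>R y)" unfolding norm_scaleR using c by (simp add: field_simps)
  then show "bump c y = 0" unfolding bump_def by (simp only: chi_props(2) diff_self)
 qed (use that in auto)
qed

text \<open>The odd extension of the power: multiples of \<open>mu\<close> slightly below k may be
  negative when k = 0.\<close>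

definition spow :: "real \<Rightarrow> real \<Rightarrow> real" where "spow s \<kappa> = sgn \<kappa> * \<bar>\<kappa>\<bar> powr s"

lemma vflux_spow: "vflux p (\<kappa> *\<^sub>R g) = spow (p - 1) \<kappa> *\<^sub>R vflux p g"
proof (cases "0 \<le> \<kappa>")
 case True
 then show ?thesis unfolding vflux_scaleR[OF True] by (cases "\<kappa> = 0") (auto simp: spow_def)
next
 case False
 then have "vflux p (\<kappa> *\<^sub>R g) = - vflux p ((- \<kappa>) *\<^sub>R g)" using vflux_minus[of p "(- \<kappa>) *\<^sub>R g"] by simp
 also have "\<dots> = - ((- \<kappa>) powr (p - 1) *\<^sub>R vflux p g)" by (subst vflux_scaleR) (use False in auto)
 finally show ?thesis using False by (simp add: spow_def)
qed

context exponents begin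

section \<open>The mass carried by a solution comparable to the fundamental solution\<close>

lemma mu_wsol:
 assumes dim: "N = real DIM('a::euclidean_space)"
 shows "wsol p q 0 (UNIV - {0}) (mu p :: 'a \<Rightarrow> real)"
  "x \<noteq> 0 \<Longrightarrow> grad (mu p) (x::'a) = - (cmu * norm x powr ((1 - N) / (p - 1)) / norm x) *\<^sub>R x"
proof -
 have m: "(mu p :: 'a \<Rightarrow> real) = (\<lambda>x. mur p N (norm x))" by (simp add: fun_eq_iff mu_mur dim)
 have c: "(cmu powr (p - 1)) powr (1 / (p - 1)) = cmu" using exps(6) p1 by (simp add: powr_powr)
 have e: "(r powr (1 - N) * cmu powr (p - 1)) powr (1 / (p - 1)) = cmu * r powr ((1 - N) / (p - 1))" for r
  unfolding powr_mult c by (simp add: powr_powr)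
 note R = wsol_radial[where 'a='a, folded dim, OF p1 exps(1), of "{0<..}" "mur p N" "- 1" "\<lambda>_. cmu powr (p - 1)" "\<lambda>_. 0" 0]
 have s: "{x::'a. norm x \<in> {0<..}} = UNIV - {0}" by auto
 show "wsol p q 0 (UNIV - {0}) (mu p :: 'a \<Rightarrow> real)" unfolding m s[symmetric]
  by (rule R(1)) (use exps mur_deriv in \<open>auto simp: e\<close>)
 show "grad (mu p) x = - (cmu * norm x powr ((1 - N) / (p - 1)) / norm x) *\<^sub>R x" if "x \<noteq> 0"
 proof -
  have "GDERIV (mu p) x :> (- cmu * norm x powr ((1 - N) / (p - 1)) / norm x) *\<^sub>R x" unfolding m
   by (rule GDERIV_radial[OF that mur_deriv]) (use that in simp)
  from grad_eqI[OF this] show ?thesis by simp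
 qed
qed

lemma mu_id:
 assumes dim: "N = real DIM('a::euclidean_space)" and "c1c (UNIV - {0}) \<phi>"
 shows "(LINT x|lborel. vflux p (grad (mu p) (x::'a)) \<bullet> grad \<phi> x) = 0"
 using wsolD[OF mu_wsol(1)[OF dim] assms(2) p1 exps(1)] by simp

lemma mu_at_top:
 assumes dim: "N = real DIM('a::euclidean_space)" shows "filterlim (mu p) at_top (at (0::'a))"
proof -
 have "(mu p :: 'a \<Rightarrow> real) = (\<lambda>x. mur p N (norm x))" by (simp add: fun_eq_iff mu_mur dim)
 then show ?thesis using filterlim_compose[OF mur_at_top filterlim_norm_at_0] by simp
qed

text \<open>For \<kappa> > k the function \<kappa> mu - u tends to infinity at 0, and for \<kappa> <
  k so does u - \<kappa> mu. Truncating along these, monotonicity of the flux fixes the sign, and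
  the flux of u plus absorption is squeezed between the fluxes of the multiples \<kappa> mu; then
  \<kappa> tends to k from both sides. Here \<zeta> is constant near 0, so no integrability of the
  flux is presupposed.\<close>

lemma flux_mass:
 fixes u :: "'a::euclidean_space \<Rightarrow> real"
 assumes dim: "N = real DIM('a)" and \<Omega>: "open \<Omega>" and u: "wsol p q 1 (\<Omega> - {0}) u" and k: "mu_behaviour p k u" "0 \<le> k"
  and z: "c1c \<Omega> \<zeta>" "\<And>x. 0 \<le> \<zeta> x" and d: "0 < \<delta>" "\<And>x. norm x \<le> \<delta> \<Longrightarrow> grad \<zeta> x = 0"
 shows "integrable lborel (\<lambda>x. norm (grad u x) powr q * \<zeta> x)"
  "(LINT x|lborel. vflux p (grad u x) \<bullet> grad \<zeta> x) + (LINT x|lborel. norm (grad u x) powr q * \<zeta> x)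
   = k powr (p - 1) * (LINT x|lborel. vflux p (grad (mu p) x) \<bullet> grad \<zeta> x)"
proof -
 define A where "A x = vflux p (grad u x)" for x
 define B where "B x = vflux p (grad (mu p) x)" for x :: 'a
 define f where "f x = norm (grad u x) powr q" for x
 define c where "c = (LINT x|lborel. B x \<bullet> grad \<zeta> x)"
 have O: "open (\<Omega> - {0})" using \<Omega> by (simp add: open_delete)
 have Cu: "C1_on (\<Omega> - {0}) u" by (rule wsol_C1[OF u])
 have Cm: "C1_on (\<Omega> - {0}) (mu p)" by (rule C1_on_subset[OF wsol_C1[OF mu_wsol(1)[OF dim]]]) auto
 have cA: "continuous_on (\<Omega> - {0}) A" and cB: "continuous_on (\<Omega> - {0}) B"
  unfolding A_def B_def by (intro continuous_on_vflux_compose[OF p1] C1_onD(2) Cu Cm)+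
 have cf: "continuous_on (\<Omega> - {0}) f"
  unfolding f_def using exps(1) by (intro continuous_on_norm_powr C1_onD(2)[OF Cu])
 obtain K where K: "compact K" "K \<subseteq> \<Omega>" "\<And>x. x \<notin> K \<Longrightarrow> grad \<zeta> x = 0" "continuous_on UNIV (grad \<zeta>)" using c1c_E[OF z(1)] by metis
 have K0: "compact (K - ball 0 \<delta>)" "K - ball 0 \<delta> \<subseteq> \<Omega> - {0}" using K d by (auto intro: compact_diff)
 have iz: "integrable lborel (\<lambda>x. X x \<bullet> grad \<zeta> x)" if "continuous_on (\<Omega> - {0}) X" for X
  by (rule integrable_compact_support[OF K0(1)])
   (use K(3) d(2) in \<open>auto intro!: continuous_intros continuous_on_subset[OF that] continuous_on_subset[OF K(4)] K0(2)\<close>)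
 note iA = iz[OF cA] and iB = iz[OF cB]
 define X where "X \<kappa> x = A x - spow (p - 1) \<kappa> *\<^sub>R B x" for \<kappa> x
 have cX: "continuous_on (\<Omega> - {0}) (X \<kappa>)" for \<kappa> unfolding X_def by (intro continuous_intros cA cB)
 have XI: "(LINT x|lborel. X \<kappa> x \<bullet> grad \<phi> x) = (LINT x|lborel. A x \<bullet> grad \<phi> x) - spow (p - 1) \<kappa> * (LINT x|lborel. B x \<bullet> grad \<phi> x)"
  if "integrable lborel (\<lambda>x. A x \<bullet> grad \<phi> x)" "integrable lborel (\<lambda>x. B x \<bullet> grad \<phi> x)" for \<kappa> \<phi>
  using that by (simp add: X_def inner_diff_left)
 have id: "(LINT x|lborel. X \<kappa> x \<bullet> grad \<phi> x) + (LINT x|lborel. f x * \<phi> x) = 0" if p: "c1c (\<Omega> - {0}) \<phi>" for \<kappa> \<phi>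
  using wsolD[OF u p p1 exps(1)] mu_id[OF dim c1c_mono[OF p Diff_mono[OF subset_UNIV order_refl]]] XI[OF c1c_integrable(1)[OF p cA] c1c_integrable(1)[OF p cB]]
  by (simp add: A_def B_def f_def)
 have f0: "0 \<le> f x" for x by (simp add: f_def)
 have CW: "C1_on (\<Omega> - {0}) (\<lambda>x. \<kappa> * mu p x - u x)" "C1_on (\<Omega> - {0}) (\<lambda>x. u x - \<kappa> * mu p x)" for \<kappa>
  by (rule C1_on_diff[OF C1_on_cmult[OF Cm] Cu] C1_on_diff[OF Cu C1_on_cmult[OF Cm]])+
 have gW: "grad (\<lambda>x. \<kappa> * mu p x - u x) x = \<kappa> *\<^sub>R grad (mu p) x - grad u x"
  "grad (\<lambda>x. u x - \<kappa> * mu p x) x = grad u x - \<kappa> *\<^sub>R grad (mu p) x" if x: "x \<in> \<Omega> - {0}" for \<kappa> x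
  using grad_diff[OF C1_on_differentiable[OF C1_on_cmult[OF Cm] x] C1_on_differentiable[OF Cu x], of \<kappa>]
   grad_diff[OF C1_on_differentiable[OF Cu x] C1_on_differentiable[OF C1_on_cmult[OF Cm] x], of \<kappa>]
   grad_cmult'[OF Cm x, of \<kappa>] by simp_all
 have mono: "0 \<le> X \<kappa> x \<bullet> (grad u x - \<kappa> *\<^sub>R grad (mu p) x)" for \<kappa> x
  using vflux_monotone[OF p1, of "grad u x" "\<kappa> *\<^sub>R grad (mu p) x"] by (simp add: X_def A_def B_def vflux_spow)
 have s1: "\<forall>x\<in>\<Omega> - {0}. X \<kappa> x \<bullet> grad (\<lambda>x. \<kappa> * mu p x - u x) x \<le> 0" for \<kappa>
  using mono[of \<kappa>] gW(1) by (auto simp: inner_diff_right)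
 have s2: "\<forall>x\<in>\<Omega> - {0}. 0 \<le> X \<kappa> x \<bullet> grad (\<lambda>x. u x - \<kappa> * mu p x) x" for \<kappa> using mono gW(2) by auto
 have top: "filterlim (mu p) at_top (at (0::'a))" by (rule mu_at_top[OF dim])
 have ev: "\<forall>\<^sub>F x::'a in at 0. 0 < mu p x" using top by (auto simp: filterlim_at_top_dense)
 have kl: "((\<lambda>x. u x / mu p x) \<longlongrightarrow> k) (at 0)" using k by (simp add: mu_behaviour_def)
 have t1: "filterlim (\<lambda>x. \<kappa> * mu p x - u x) at_top (at 0)" if "k < \<kappa>" for \<kappa>
 proof (rule filterlim_mono_eventually[OF filterlim_tendsto_pos_mult_at_top[OF _ _ top] order_refl order_refl])
  show "((\<lambda>x. \<kappa> - u x / mu p x) \<longlongrightarrow> \<kappa> - k) (at 0)" by (intro tendsto_intros kl)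
  show "\<forall>\<^sub>F x in at 0. (\<kappa> - u x / mu p x) * mu p x = \<kappa> * mu p x - u x" using ev by eventually_elim (simp add: field_simps)
 qed (use that in simp)
 have t2: "filterlim (\<lambda>x. u x - \<kappa> * mu p x) at_top (at 0)" if "\<kappa> < k" for \<kappa>
 proof (rule filterlim_mono_eventually[OF filterlim_tendsto_pos_mult_at_top[OF _ _ top] order_refl order_refl])
  show "((\<lambda>x. u x / mu p x - \<kappa>) \<longlongrightarrow> k - \<kappa>) (at 0)" by (intro tendsto_intros kl)
  show "\<forall>\<^sub>F x in at 0. (u x / mu p x - \<kappa>) * mu p x = u x - \<kappa> * mu p x" using ev by eventually_elim (simp add: field_simps)
 qed (use that in simp)
 have kk: "k < k + 1" by simp
 show fi: "integrable lborel (\<lambda>x. norm (grad u x) powr q * \<zeta> x)"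
  using flux_upper(1)[OF \<Omega> CW(1) t1[OF kk] z d cX cf id f0 s1] by (simp add: f_def)
 define F where "F = (LINT x|lborel. A x \<bullet> grad \<zeta> x) + (LINT x|lborel. f x * \<zeta> x)"
 have up: "F \<le> spow (p - 1) \<kappa> * c" if "k < \<kappa>" for \<kappa>
  using flux_upper(2)[OF \<Omega> CW(1) t1[OF that] z d cX cf id f0 s1] XI[OF iA iB] by (simp add: F_def c_def)
 have low: "spow (p - 1) \<kappa> * c \<le> F" if "\<kappa> < k" for \<kappa>
  using flux_lower[OF \<Omega> CW(2) t2[OF that] z d cX cf id f0 s2 fi[folded f_def]] XI[OF iA iB] by (simp add: F_def c_def)
 have lim: "((\<lambda>\<kappa>. spow (p - 1) \<kappa> * c) \<longlongrightarrow> k powr (p - 1) * c) (at k)"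
 proof (intro tendsto_intros)
  show "((\<lambda>\<kappa>. spow (p - 1) \<kappa>) \<longlongrightarrow> k powr (p - 1)) (at k)"
  proof (cases "k = 0")
   case True
   have "((\<lambda>\<kappa>::real. \<bar>\<kappa>\<bar> powr (p - 1)) \<longlongrightarrow> \<bar>0\<bar> powr (p - 1)) (at 0)"
    using p1 by (intro tendsto_powr2 tendsto_intros) auto
   then have "((\<lambda>\<kappa>::real. \<bar>\<kappa>\<bar> powr (p - 1)) \<longlongrightarrow> 0) (at 0)" by simp
   then have "((\<lambda>\<kappa>::real. spow (p - 1) \<kappa>) \<longlongrightarrow> 0) (at 0)"
    by (rule Lim_null_comparison[rotated]) (auto simp: spow_def abs_mult sgn_if)
   then show ?thesis using True by simp
  next
   case False
   then have "((\<lambda>\<kappa>. sgn \<kappa> * \<bar>\<kappa>\<bar> powr (p - 1)) \<longlongrightarrow> sgn k * \<bar>k\<bar> powr (p - 1)) (at k)" by (intro tendsto_intros) auto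
   then show ?thesis using False k(2) by (simp add: spow_def[abs_def])
  qed
 qed
 have "k powr (p - 1) * c \<le> F"
  by (rule tendsto_upperbound[OF conjunct1[OF lim[unfolded filterlim_at_split]]])
   (use low in \<open>auto simp: eventually_at_filter\<close>)
 moreover have "F \<le> k powr (p - 1) * c"
  by (rule tendsto_lowerbound[OF conjunct2[OF lim[unfolded filterlim_at_split]]])
   (use up in \<open>auto simp: eventually_at_filter\<close>)
 ultimately show "(LINT x|lborel. vflux p (grad u x) \<bullet> grad \<zeta> x) + (LINT x|lborel. norm (grad u x) powr q * \<zeta> x)
   = k powr (p - 1) * (LINT x|lborel. vflux p (grad (mu p) x) \<bullet> grad \<zeta> x)"
  by (simp add: F_def c_def A_def B_def f_def)
qed

lemma flux_locally_integrable:
 fixes u :: "'a::euclidean_space \<Rightarrow> real"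
 assumes dim: "N = real DIM('a)" and \<Omega>: "open \<Omega>" "0 \<in> \<Omega>" and u: "wsol p q 1 (\<Omega> - {0}) u" and k: "mu_behaviour p k u" "0 \<le> k"
 shows "locally_integrable \<Omega> (\<lambda>x. norm (grad u x) powr q)" "locally_integrable \<Omega> (\<lambda>x. vflux p (grad u x))"
proof -
 obtain R where R: "0 < R" "cball 0 R \<subseteq> \<Omega>" using \<Omega> open_contains_cball by blast
 define c where "c = 1 / R"
 have c: "0 < c" "cball 0 (1 / c) \<subseteq> \<Omega>" using R by (auto simp: c_def)
 define r where "r = 1 / (2 * c)"
 have r: "0 < r" "ball 0 r \<subseteq> \<Omega>" using c R by (auto simp: r_def c_def)
 have Cu: "C1_on (\<Omega> - {0}) u" by (rule wsol_C1[OF u])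
 have cA: "continuous_on (\<Omega> - {0}) (\<lambda>x. vflux p (grad u x))" by (intro continuous_on_vflux_compose[OF p1] C1_onD(2) Cu)
 have cf: "continuous_on (\<Omega> - {0}) (\<lambda>x. norm (grad u x) powr q)" using exps(1) by (intro continuous_on_norm_powr C1_onD(2)[OF Cu])
 have "integrable lborel (\<lambda>x. norm (grad u x) powr q * bump c x)"
  by (rule flux_mass(1)[OF dim \<Omega>(1) u k bump_props(6)[OF c] bump_props(2)[OF c(1)] r(1)])
   (use bump_props(4)[OF c(1)] in \<open>simp add: r_def\<close>)
 then have "integrable lborel (\<lambda>x. indicator (ball 0 r) x *\<^sub>R (norm (grad u x) powr q * bump c x))"
  by (rule integrable_mult_indicator[rotated]) simp
 moreover have "indicator (ball 0 r) x *\<^sub>R (norm (grad u x) powr q * bump c x) = indicator (ball 0 r) x *\<^sub>R norm (grad u x) powr q" for x :: 'a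
  using bump_props(3)[OF c(1), of x] by (auto simp: indicator_def r_def)
 ultimately have fi: "set_integrable lborel (ball 0 r) (\<lambda>x. norm (grad u x) powr q)" unfolding set_integrable_def by (simp only:)
 show "locally_integrable \<Omega> (\<lambda>x. norm (grad u x) powr q)" by (rule locally_integrable_punctured[OF cf r(1) fi])
 have "set_integrable lborel (ball 0 r) (\<lambda>x. vflux p (grad u x))"
 proof -
  let ?g = "\<lambda>x. indicator (ball 0 r - {0}) x *\<^sub>R vflux p (grad u x)"
  have 1: "set_integrable lborel (ball (0::'a) r) (\<lambda>x. 1::real)"
   using emeasure_lborel_ball_finite[of "0::'a" r] by (simp add: set_integrable_def)
  have "integrable lborel (\<lambda>x. indicator (ball 0 r) x *\<^sub>R (1 + norm (grad u x) powr q))"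
   using set_integral_add(1)[OF 1 fi] by (simp add: set_integrable_def)
  then have "integrable lborel ?g"
  proof (rule Bochner_Integration.integrable_bound)
   have "?g \<in> borel_measurable borel"
    by (rule borel_measurable_continuous_on_indicator) (use r in \<open>auto intro: continuous_on_subset[OF cA]\<close>)
   then show "?g \<in> borel_measurable lborel" by simp
   have "norm (?g x) \<le> norm (indicator (ball 0 r) x *\<^sub>R (1 + norm (grad u x) powr q))" for x
   proof -
    \<comment> \<open>The flux has norm |grad u|^(p-1), and q >= p - 1.\<close>
    have "norm (grad u x) powr (p - 1) \<le> 1 + norm (grad u x) powr q"
    proof (cases "norm (grad u x) \<le> 1")
     case True
     then have "norm (grad u x) powr (p - 1) \<le> 1 powr (p - 1)" using p1 by (intro powr_mono2) auto
     then show ?thesis by (simp add: add_increasing2)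
    next
     case False
     then have "norm (grad u x) powr (p - 1) \<le> norm (grad u x) powr q" using q1 by (intro powr_mono) auto
     then show ?thesis by simp
    qed
    then show ?thesis by (auto simp: indicator_def norm_vflux)
   qed
   then show "AE x in lborel. norm (?g x) \<le> norm (indicator (ball 0 r) x *\<^sub>R (1 + norm (grad u x) powr q))" by simp
  qed
  then show ?thesis unfolding set_integrable_def
   using integrable_except_0(1)[of ?g "\<lambda>x. indicator (ball 0 r) x *\<^sub>R vflux p (grad u x)"] by (simp add: indicator_def)
 qed
 then show "locally_integrable \<Omega> (\<lambda>x. vflux p (grad u x))" by (rule locally_integrable_punctured[OF cA r(1)])
qed

section \<open>The mass of the fundamental solution\<close>

text \<open>This turns out to be the constant \<open>c_dirac\<close>; the particular bump does not
  matter since only its value 1 at the origin enters.\<close>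

definition cdir :: "'a::euclidean_space itself \<Rightarrow> real"
 where "cdir _ = (LINT x|lborel. vflux p (grad (mu p) (x::'a)) \<bullet> grad (bump 1) x)"

text \<open>The radial solution with a = K = 1 behaves like \<open>mu\<close> / cmu, so
  \<open>flux_locally_integrable\<close> makes |grad J|^q integrable near 0. Up to constants it
  equals r^((1-N) q/(p-1)), which for r <= 1 dominates r^(1-N), the size of the flux of
  \<open>mu\<close>.\<close>

lemma mu_flux_locally_integrable:
 assumes dim: "N = real DIM('a::euclidean_space)"
 shows "locally_integrable UNIV (\<lambda>x::'a. vflux p (grad (mu p) x))"
proof -
 have d: "0 < den 1 1 t" "1 \<le> den 1 1 t" if "0 < t" for t using \<beta>q(5) by (auto simp: den_def add_pos_nonneg)
 let ?u = "\<lambda>x::'a. J 1 1 1 (norm x)"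
 have U: "{x::'a. norm x \<in> {0<..<1}} = ball 0 1 - {0}" by auto
 have u: "wsol p q 1 (ball 0 1 - {0}) ?u" unfolding U[symmetric]
  by (rule wsol_J0(1)[OF dim order_refl]) (rule d)
 have gu: "grad ?u x = (- slope 1 1 (norm x) / norm x) *\<^sub>R x" if "x \<in> ball 0 1 - {0}" for x
  by (rule wsol_J0(2)[OF dim order_refl]) (use d that in auto)
 have k: "mu_behaviour p (1 / cmu) ?u"
  using filterlim_compose[OF J_mur_tendsto[of 1 1 1, OF _ _ d(1)] filterlim_norm_at_0] by (simp add: mu_behaviour_def mu_mur dim)
 have li: "locally_integrable (ball 0 1) (\<lambda>x. norm (grad ?u x) powr q)"
  by (rule flux_locally_integrable(1)[OF dim _ _ u k]) (use exps in auto)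
 define r :: real where "r = 1 / 2"
 have "set_integrable lborel (cball 0 r) (\<lambda>x. norm (grad ?u x) powr q)"
  using li[unfolded locally_integrable_def, THEN spec, of "cball 0 r"] by (simp add: r_def cball_subset_ball_iff)
 then have fi: "integrable lborel (\<lambda>x. indicator (cball 0 r) x *\<^sub>R norm (grad ?u x) powr q)" by (simp add: set_integrable_def)
 define D where "D = (1 + cf 1) powr (\<gamma> * q) * cmu powr (p - 1)"
 have Cm: "C1_on (UNIV - {0}) (mu p :: 'a \<Rightarrow> real)" by (rule wsol_C1[OF mu_wsol(1)[OF dim]])
 have cB: "continuous_on (UNIV - {0}) (\<lambda>x::'a. vflux p (grad (mu p) x))"
  by (intro continuous_on_vflux_compose[OF p1] C1_onD(2)[OF Cm])
 let ?g = "\<lambda>x::'a. indicator (ball 0 r - {0}) x *\<^sub>R vflux p (grad (mu p) x)"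
 have "integrable lborel (\<lambda>x. D * (indicator (cball 0 r) x *\<^sub>R norm (grad ?u x) powr q))" using fi by (rule integrable_mult_right)
 then have "integrable lborel ?g"
 proof (rule Bochner_Integration.integrable_bound)
  have "?g \<in> borel_measurable borel"
   by (rule borel_measurable_continuous_on_indicator) (auto intro: continuous_on_subset[OF cB])
  then show "?g \<in> borel_measurable lborel" by simp
  have "norm (?g x) \<le> norm (D * (indicator (cball 0 r) x *\<^sub>R norm (grad ?u x) powr q))" for x
  proof (cases "x \<in> ball 0 r - {0}")
   case True
   define t where "t = norm x"
   have t: "0 < t" "t \<le> 1" using True by (auto simp: t_def r_def)
   have "cf 1 * t powr \<theta> \<le> cf 1 * 1" using t exps \<beta>q(5) by (intro mult_left_mono) (auto intro: powr_le1)
   then have "den 1 1 t \<le> 1 + cf 1" by (simp add: den_def)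
   then have de: "den 1 1 t powr (\<gamma> * q) \<le> (1 + cf 1) powr (\<gamma> * q)" using d[OF t(1)] exps by (intro powr_mono2) auto
   have sp: "0 \<le> slope 1 1 t" by (simp add: slope_def)
   have "norm (grad ?u x) = slope 1 1 t" using gu[of x] True sp t by (simp add: t_def r_def)
   then have n1: "norm (grad ?u x) powr q = t powr ((1 - N) / (p - 1) * q) * den 1 1 t powr (- (\<gamma> * q))"
    by (simp add: slope_def powr_mult powr_powr)
   have xn: "x \<noteq> 0" using True by auto
   have "norm (grad (mu p) x) = cmu * t powr ((1 - N) / (p - 1))"
    unfolding mu_wsol(2)[OF dim xn] norm_scaleR using xn exps(6) by (simp add: t_def abs_mult)
   then have "norm (vflux p (grad (mu p) x)) = (cmu * t powr ((1 - N) / (p - 1))) powr (p - 1)"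
    by (simp add: norm_vflux)
   also have "\<dots> = cmu powr (p - 1) * t powr (1 - N)" unfolding powr_mult powr_powr using p1 by simp
   finally have n2: "norm (vflux p (grad (mu p) x)) = cmu powr (p - 1) * t powr (1 - N)" .
   have "t powr (1 - N) \<le> t powr ((1 - N) / (p - 1) * q)"
   proof (rule powr_mono')
    have "1 \<le> q / (p - 1)" using p1 q1 by (simp add: divide_simps)
    then have "(N - 1) * 1 \<le> (N - 1) * (q / (p - 1))" using N2 by (intro mult_left_mono) auto
    then show "(1 - N) / (p - 1) * q \<le> 1 - N" by (simp add: algebra_simps diff_divide_distrib)
   qed (use t in auto)
   also have "t powr ((1 - N) / (p - 1) * q) = den 1 1 t powr (\<gamma> * q) * norm (grad ?u x) powr q"
    unfolding n1 using d(1)[OF t(1)] by (simp add: powr_minus)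
   also have "\<dots> \<le> (1 + cf 1) powr (\<gamma> * q) * norm (grad ?u x) powr q" using de by (rule mult_right_mono) simp
   finally have "cmu powr (p - 1) * t powr (1 - N) \<le> cmu powr (p - 1) * ((1 + cf 1) powr (\<gamma> * q) * norm (grad ?u x) powr q)"
    by (rule mult_left_mono) simp
   then have "norm (vflux p (grad (mu p) x)) \<le> D * norm (grad ?u x) powr q" unfolding n2 by (simp add: D_def mult_ac)
   then show ?thesis using True by simp
  qed simp
  then show "AE x in lborel. norm (?g x) \<le> norm (D * (indicator (cball 0 r) x *\<^sub>R norm (grad ?u x) powr q))" by simp
 qed
 then have "set_integrable lborel (ball 0 r) (\<lambda>x::'a. vflux p (grad (mu p) x))" unfolding set_integrable_def
  using integrable_except_0(1)[of ?g "\<lambda>x::'a. indicator (ball 0 r) x *\<^sub>R vflux p (grad (mu p) x)"] by (simp add: indicator_def)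
 then show ?thesis by (intro locally_integrable_punctured[OF cB]) (auto simp: r_def)
qed

text \<open>The function \<phi> - \<phi>(0) \<zeta> vanishes at the origin, so
  \<open>point_mass\<close> applies and the functional depends on \<phi> only through
  \<phi>(0).\<close>

lemma mass_at_0:
 fixes X :: "'a::euclidean_space \<Rightarrow> 'a"
 assumes X: "locally_integrable \<Omega> X" and f: "locally_integrable \<Omega> f"
  and id: "\<And>\<phi>. c1c (\<Omega> - {0}) \<phi> \<Longrightarrow> (LINT x|lborel. X x \<bullet> grad \<phi> x) + (LINT x|lborel. f x * \<phi> x) = 0"
  and z: "c1c \<Omega> \<zeta>" "\<zeta> 0 = 1" and \<phi>: "c1c \<Omega> \<phi>"
 shows "(LINT x|lborel. X x \<bullet> grad \<phi> x) + (LINT x|lborel. f x * \<phi> x)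
  = \<phi> 0 * ((LINT x|lborel. X x \<bullet> grad \<zeta> x) + (LINT x|lborel. f x * \<zeta> x))"
proof -
 let ?\<psi> = "\<lambda>x. \<phi> x - \<phi> 0 * \<zeta> x"
 obtain K where K: "compact K" "K \<subseteq> \<Omega>" "\<And>x. x \<notin> K \<Longrightarrow> \<phi> x = 0" using c1c_E[OF \<phi>] by metis
 obtain L where L: "compact L" "L \<subseteq> \<Omega>" "\<And>x. x \<notin> L \<Longrightarrow> \<zeta> x = 0" using c1c_E[OF z(1)] by metis
 have C: "C1_on UNIV \<phi>" "C1_on UNIV (\<lambda>x. \<phi> 0 * \<zeta> x)" by (rule c1c_C1[OF \<phi>] C1_on_cmult[OF c1c_C1[OF z(1)]])+
 have psi: "c1c \<Omega> ?\<psi>" unfolding c1c_def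
  by (intro conjI exI[of _ "K \<union> L"] C1_on_diff C) (use K L in auto)
 have g: "grad ?\<psi> x = grad \<phi> x - \<phi> 0 *\<^sub>R grad \<zeta> x" for x
  using grad_diff[OF C1_on_differentiable[OF C(1)] C1_on_differentiable[OF C(2)], of x] grad_cmult'[OF c1c_C1[OF z(1)], of x UNIV "\<phi> 0"] by simp
 have "(LINT x|lborel. X x \<bullet> grad ?\<psi> x) + (LINT x|lborel. f x * ?\<psi> x) = 0"
  by (rule point_mass[OF X f _ psi]) (simp_all add: id z(2))
 then show ?thesis
  using locally_integrable_c1c[OF \<phi>] locally_integrable_c1c[OF z(1)] X f
  by (simp add: g inner_diff_right right_diff_distrib distrib_left mult.left_commute)
qed

lemma mu_mass:
 assumes dim: "N = real DIM('a::euclidean_space)" and "c1c UNIV \<phi>"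
 shows "(LINT x|lborel. vflux p (grad (mu p) (x::'a)) \<bullet> grad \<phi> x) = cdir TYPE('a) * \<phi> 0"
proof -
 have l0: "locally_integrable UNIV (\<lambda>x::'a. 0::real)" by (simp add: locally_integrable_def set_integrable_def)
 have "(LINT x|lborel. vflux p (grad (mu p) (x::'a)) \<bullet> grad \<phi> x) + (LINT x::'a|lborel. 0 * \<phi> x)
   = \<phi> 0 * ((LINT x|lborel. vflux p (grad (mu p) (x::'a)) \<bullet> grad (bump 1) x) + (LINT x::'a|lborel. 0 * bump 1 x))"
  using mu_id[OF dim] by (intro mass_at_0[OF mu_flux_locally_integrable[OF dim] l0 _ bump_props(6,5) assms(2)]) auto
 then show ?thesis by (simp add: cdir_def)
qed

text \<open>The flux of \<open>mu\<close> and the gradient of the bump both point towards the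
  origin; their product is nonnegative, and positive in the open shell 1/2 < |x| < 1.\<close>

lemma cdir_pos:
 assumes dim: "N = real DIM('a::euclidean_space)" shows "0 < cdir TYPE('a)"
proof -
 define h where "h x = vflux p (grad (mu p) x) \<bullet> grad (bump 1) x" for x :: 'a
 have hi: "integrable lborel h" unfolding h_def
  by (rule locally_integrable_c1c(1)[OF bump_props(6) mu_flux_locally_integrable[OF dim]]) auto
 have form: "\<exists>c>0. h x = c * sstep' ((4 / 3) * (norm x)\<^sup>2 - 1 / 3)" if x: "x \<noteq> 0" for x
 proof -
  define b where "b = cmu * norm x powr ((1 - N) / (p - 1)) / norm x"
  have b: "0 < b" using x exps(6) by (simp add: b_def)
  define s where "s = sstep' ((4 / 3) * (norm x)\<^sup>2 - 1 / 3)"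
  have "vflux p (grad (mu p) x) = - (b powr (p - 1) *\<^sub>R vflux p x)"
   using mu_wsol(2)[OF dim x, folded b_def] vflux_minus[of p "b *\<^sub>R x"] vflux_scaleR[of b p x] b by simp
  moreover have "grad (bump 1) x = - (s * (8 / 3)) *\<^sub>R x"
   using bump_props(1)[of 1 x] grad_eqI[OF chi_props(6)[of x]] by (simp add: s_def)
  ultimately have "h x = (b powr (p - 1) * (8 / 3) * (vflux p x \<bullet> x)) * s" by (simp add: h_def)
  moreover have "0 < b powr (p - 1) * (8 / 3) * (vflux p x \<bullet> x)" using b x by (simp add: inner_vflux_self)
  ultimately show ?thesis unfolding s_def by blast
 qed
 have h0: "0 \<le> h x" for x
 proof (cases "x = 0")
  case True
  then show ?thesis using bump_props(4)[of 1 x] by (simp add: h_def)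
 next
  case False
  then show ?thesis using form[OF False] sstep_props(7) by auto
 qed
 have "integral\<^sup>L lborel h \<noteq> 0"
 proof
  assume "integral\<^sup>L lborel h = 0"
  then have ae: "AE x in lborel. h x = 0" using integral_nonneg_eq_0_iff_AE[OF hi] h0 by simp
  define S where "S = {x::'a. 1 / 2 < norm x \<and> norm x < 1}"
  have So: "open S" unfolding S_def by (intro open_Collect_conj open_Collect_less continuous_intros)
  obtain e :: 'a where "norm e = 3 / 4" using vector_choose_size[of "3/4"] by auto
  then have e: "e \<in> S" by (simp add: S_def)
  have "bounded S" by (rule bounded_subset[of "ball 0 1"]) (auto simp: S_def)
  then have pos: "0 < measure lborel S" using emeasure_bounded_finite by (intro open_measure_pos[OF So e]) auto
  have "h x \<noteq> 0" if "x \<in> S" for x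
  proof -
   have x: "1 / 2 < norm x" "norm x < 1" using that by (auto simp: S_def)
   have "(1 / 2)\<^sup>2 < (norm x)\<^sup>2" "(norm x)\<^sup>2 < 1\<^sup>2" using x by (intro power_strict_mono; simp)+
   then have "0 < sstep' ((4 / 3) * (norm x)\<^sup>2 - 1 / 3)" by (intro sstep'_pos) (auto simp: power2_eq_square)
   moreover have "x \<noteq> 0" using x by auto
   from form[OF this] obtain c where "0 < c" "h x = c * sstep' ((4 / 3) * (norm x)\<^sup>2 - 1 / 3)" by blast
   ultimately show ?thesis by simp
  qed
  then have "AE x in lborel. x \<notin> S" using ae by (auto elim: eventually_mono)
  then have "emeasure lborel S = 0" by (subst (asm) AE_iff_measurable[OF _ refl]) (use So in auto)
  then show False using pos by (simp add: measure_def)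
 qed
 moreover have "0 \<le> integral\<^sup>L lborel h" by (rule Bochner_Integration.integral_nonneg) (rule h0)
 ultimately have "0 < integral\<^sup>L lborel h" by simp
 then show ?thesis unfolding cdir_def h_def .
qed

theorem dirac_mass:
 fixes u :: "'a::euclidean_space \<Rightarrow> real"
 assumes dim: "N = real DIM('a)" and \<Omega>: "open \<Omega>" "0 \<in> \<Omega>" and u: "wsol p q 1 (\<Omega> - {0}) u" and k: "mu_behaviour p k u" "0 \<le> k"
  and \<phi>: "c1c \<Omega> \<phi>"
 shows "(LINT x|lborel. vflux p (grad u x) \<bullet> grad \<phi> x) + (LINT x|lborel. norm (grad u x) powr q * \<phi> x)
  = cdir TYPE('a) * k powr (p - 1) * \<phi> 0"
proof -
 obtain R where R: "0 < R" "cball 0 R \<subseteq> \<Omega>" using \<Omega> open_contains_cball by blast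
 define c where "c = 1 / R"
 have c: "0 < c" "cball 0 (1 / c) \<subseteq> \<Omega>" using R by (auto simp: c_def)
 note z = bump_props(6)[OF c]
 have "(LINT x|lborel. vflux p (grad u x) \<bullet> grad \<phi> x) + (LINT x|lborel. norm (grad u x) powr q * \<phi> x)
  = \<phi> 0 * ((LINT x|lborel. vflux p (grad u x) \<bullet> grad (bump c) x) + (LINT x|lborel. norm (grad u x) powr q * bump c x))"
  using flux_locally_integrable(2,1)[OF dim \<Omega> u k] wsolD[OF u _ p1 exps(1)]
  by (intro mass_at_0[OF _ _ _ z bump_props(5)[OF c(1)] \<phi>]) auto
 also have "(LINT x|lborel. vflux p (grad u x) \<bullet> grad (bump c) x) + (LINT x|lborel. norm (grad u x) powr q * bump c x)
  = k powr (p - 1) * (LINT x|lborel. vflux p (grad (mu p) (x::'a)) \<bullet> grad (bump c) x)"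
  by (rule flux_mass(2)[OF dim \<Omega>(1) u k z bump_props(2)[OF c(1)], where \<delta>="1 / (2 * c)"]) (use c bump_props(4) in auto)
 also have "(LINT x|lborel. vflux p (grad (mu p) (x::'a)) \<bullet> grad (bump c) x) = cdir TYPE('a)"
  using mu_mass[OF dim c1c_mono[OF z subset_UNIV]] by (simp add: bump_props(5)[OF c(1)])
 finally show ?thesis by simp
qed

end

section \<open>From smooth to continuously differentiable test functions\<close>

text \<open>The powers of 1/t are carried along so that derivatives stay in the span of the
  family.\<close>

definition flat :: "nat \<Rightarrow> real \<Rightarrow> real"
 where "flat k t = (if t \<le> 0 then 0 else exp (- inverse t) * inverse t ^ k)"

lemma DERIV_flat: "DERIV (flat k) t :> flat (k + 2) t - real k * flat (k + 1) t"
proof (cases t "0::real" rule: linorder_cases)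
 case less
 have "DERIV (\<lambda>_. 0) t :> (0::real)" by simp
 then have "DERIV (flat k) t :> 0"
  by (rule has_field_derivative_transform_within_open[of _ _ _ "{..<0}"]) (use less in \<open>auto simp: flat_def\<close>)
 then show ?thesis using less by (simp add: flat_def)
next
 case equal
 have "((\<lambda>x. x ^ (k + 1) / exp x) \<longlongrightarrow> (0::real)) at_top" by (rule tendsto_power_div_exp_0)
 from filterlim_compose[OF this filterlim_inverse_at_top_right]
 have "((\<lambda>h::real. inverse h ^ (k + 1) / exp (inverse h)) \<longlongrightarrow> 0) (at_right 0)" .
 then have "((\<lambda>h. flat k h / h) \<longlongrightarrow> 0) (at_right 0)"
  by (rule Lim_transform_eventually)
   (auto simp: eventually_at_filter flat_def exp_minus divide_inverse mult_ac)
 moreover have "((\<lambda>h. flat k h / h) \<longlongrightarrow> 0) (at_left 0)"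
  by (rule Lim_transform_eventually[OF tendsto_const]) (auto simp: eventually_at_filter flat_def)
 ultimately have "((\<lambda>h. flat k h / h) \<longlongrightarrow> 0) (at 0)" by (simp add: filterlim_at_split)
 then show ?thesis using equal by (simp add: DERIV_def flat_def)
next
 case greater
 have "DERIV (\<lambda>t. exp (- inverse t) * inverse t ^ k) t :> exp (- inverse t) * (inverse t)\<^sup>2 * inverse t ^ k
   + exp (- inverse t) * (real k * inverse t ^ (k - 1) * - (inverse t)\<^sup>2)"
  using greater by (auto intro!: derivative_eq_intros simp: power2_eq_square)
 moreover have "exp (- inverse t) * (inverse t)\<^sup>2 * inverse t ^ k
   + exp (- inverse t) * (real k * inverse t ^ (k - 1) * - (inverse t)\<^sup>2) = flat (k + 2) t - real k * flat (k + 1) t"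
  using greater by (cases k) (simp_all add: flat_def power2_eq_square algebra_simps)
 ultimately have "DERIV (\<lambda>t. exp (- inverse t) * inverse t ^ k) t :> flat (k + 2) t - real k * flat (k + 1) t" by (simp only:)
 then show ?thesis
  by (rule has_field_derivative_transform_within_open[of _ _ _ "{0<..}"]) (use greater in \<open>auto simp: flat_def\<close>)
qed

text \<open>An algebra closed under directional derivatives; this turns smoothness, a statement
  about all iterated derivatives, into an induction.\<close>

inductive_set bump_algebra :: "real \<Rightarrow> 'a::euclidean_space \<Rightarrow> ('a \<Rightarrow> real) set" for eps y where
 flat: "(\<lambda>x. flat k (eps\<^sup>2 - (norm (x - y))\<^sup>2)) \<in> bump_algebra eps y"
| const: "(\<lambda>x. c) \<in> bump_algebra eps y"
| inner: "(\<lambda>x. x \<bullet> b) \<in> bump_algebra eps y"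
| add: "f \<in> bump_algebra eps y \<Longrightarrow> g \<in> bump_algebra eps y \<Longrightarrow> (\<lambda>x. f x + g x) \<in> bump_algebra eps y"
| mult: "f \<in> bump_algebra eps y \<Longrightarrow> g \<in> bump_algebra eps y \<Longrightarrow> (\<lambda>x. f x * g x) \<in> bump_algebra eps y"

lemma GDERIV_flat_ball:
 fixes x y :: "'a::euclidean_space"
 shows "GDERIV (\<lambda>x. flat k (eps\<^sup>2 - (norm (x - y))\<^sup>2)) x
  :> (- 2 * (flat (k + 2) (eps\<^sup>2 - (norm (x - y))\<^sup>2) - real k * flat (k + 1) (eps\<^sup>2 - (norm (x - y))\<^sup>2))) *\<^sub>R (x - y)"
proof -
 have *: "GDERIV (\<lambda>x. eps\<^sup>2 - (norm (x - y))\<^sup>2) x :> 0 - 2 *\<^sub>R (x - y)" by (intro GDERIV_diff GDERIV_const GDERIV_norm_sq)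
 have e: "A *\<^sub>R (0 - 2 *\<^sub>R (x - y)) = (- 2 * A) *\<^sub>R (x - y)" for A :: real by simp
 from GDERIV_DERIV_compose[OF * DERIV_flat, of k] show ?thesis unfolding e .
qed

lemma bump_algebra_derivative:
 assumes "f \<in> bump_algebra eps (y::'a::euclidean_space)"
 shows "\<exists>D. \<forall>x. (f has_derivative D x) (at x) \<and> (\<forall>v. (\<lambda>x. D x v) \<in> bump_algebra eps y)"
 using assms
proof induction
 case (flat k)
 define D where "D x v = v \<bullet> ((- 2 * (flat (k + 2) (eps\<^sup>2 - (norm (x - y))\<^sup>2) - real k * flat (k + 1) (eps\<^sup>2 - (norm (x - y))\<^sup>2))) *\<^sub>R (x - y))" for x v
 have "((\<lambda>x. flat k (eps\<^sup>2 - (norm (x - y))\<^sup>2)) has_derivative D x) (at x)" for x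
  using GDERIV_flat_ball[of k eps y x] unfolding gderiv_def D_def[abs_def] .
 moreover have "(\<lambda>x. D x v) \<in> bump_algebra eps y" for v
 proof -
  have "(\<lambda>x. D x v) = (\<lambda>x. (- 2 * (flat (k + 2) (eps\<^sup>2 - (norm (x - y))\<^sup>2) + (- real k) * flat (k + 1) (eps\<^sup>2 - (norm (x - y))\<^sup>2))) * (x \<bullet> v + (- (y \<bullet> v))))"
   by (simp add: D_def fun_eq_iff inner_diff_right inner_commute algebra_simps)
  also have "\<dots> \<in> bump_algebra eps y" by (intro bump_algebra.intros)
  finally show ?thesis .
 qed
 ultimately show ?case by blast
next
 case (const c)
 show ?case by (rule exI[of _ "\<lambda>x v. 0"]) (auto intro: bump_algebra.const)
next
 case (inner b)
 have "((\<lambda>x. x \<bullet> b) has_derivative (\<lambda>v. v \<bullet> b)) (at x)" for x by (auto intro!: derivative_eq_intros)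
 then show ?case by (intro exI[of _ "\<lambda>x v. v \<bullet> b"]) (auto intro: bump_algebra.const)
next
 case (add f g)
 then obtain D E where "\<forall>x. (f has_derivative D x) (at x) \<and> (\<forall>v. (\<lambda>x. D x v) \<in> bump_algebra eps y)"
  "\<forall>x. (g has_derivative E x) (at x) \<and> (\<forall>v. (\<lambda>x. E x v) \<in> bump_algebra eps y)" by blast
 then show ?case by (intro exI[of _ "\<lambda>x v. D x v + E x v"]) (auto intro!: derivative_intros bump_algebra.add)
next
 case (mult f g)
 then obtain D E where "\<forall>x. (f has_derivative D x) (at x) \<and> (\<forall>v. (\<lambda>x. D x v) \<in> bump_algebra eps y)"
  "\<forall>x. (g has_derivative E x) (at x) \<and> (\<forall>v. (\<lambda>x. E x v) \<in> bump_algebra eps y)" by blast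
 then show ?case using mult.hyps
  by (intro exI[of _ "\<lambda>x v. f x * E x v + D x v * g x"]) (auto intro!: has_derivative_mult bump_algebra.add bump_algebra.mult)
qed

lemma bump_algebra_smooth:
 assumes "f \<in> bump_algebra eps (y::'a::euclidean_space)" shows "smooth f"
proof -
 have "iterated_deriv vs f \<in> bump_algebra eps y" for vs
 proof (induction vs)
  case (Cons v vs)
  obtain D where D: "\<forall>x. (iterated_deriv vs f has_derivative D x) (at x) \<and> (\<forall>v. (\<lambda>x. D x v) \<in> bump_algebra eps y)"
   using bump_algebra_derivative[OF Cons] by blast
  then have "frechet_derivative (iterated_deriv vs f) (at x) = D x" for x by (intro frechet_derivative_at[symmetric]) blast
  then have "iterated_deriv (v # vs) f = (\<lambda>x. D x v)" by simp
  then show ?case using D by simp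
 qed (use assms in simp)
 then show ?thesis unfolding smooth_def differentiable_def using bump_algebra_derivative by blast
qed

definition sbump :: "real \<Rightarrow> 'a::euclidean_space \<Rightarrow> 'a \<Rightarrow> real"
 where "sbump eps y x = flat 0 (eps\<^sup>2 - (norm (x - y))\<^sup>2)"

lemma sbump_props:
 fixes x y :: "'a::euclidean_space"
 assumes "0 < eps"
 shows "0 \<le> sbump eps y x" "eps \<le> norm (x - y) \<Longrightarrow> sbump eps y x = 0" "norm (x - y) < eps \<Longrightarrow> 0 < sbump eps y x"
  "GDERIV (sbump eps y) x :> (- 2 * flat 2 (eps\<^sup>2 - (norm (x - y))\<^sup>2)) *\<^sub>R (x - y)"
  "sbump eps x y = sbump eps y x" "cball y eps \<subseteq> U \<Longrightarrow> sbump eps y \<in> test_functions U"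
proof -
 show "0 \<le> sbump eps y x" by (simp add: sbump_def flat_def)
 show z: "sbump eps y x = 0" if "eps \<le> norm (x - y)" for x
  using power_mono[OF that, of 2] assms by (simp add: sbump_def flat_def)
 show "0 < sbump eps y x" if "norm (x - y) < eps"
  using power_strict_mono[OF that, of 2] by (simp add: sbump_def flat_def)
 show "GDERIV (sbump eps y) x :> (- 2 * flat 2 (eps\<^sup>2 - (norm (x - y))\<^sup>2)) *\<^sub>R (x - y)"
  using GDERIV_flat_ball[of 0 eps y x] by (simp add: sbump_def[abs_def] numeral_2_eq_2)
 show "sbump eps x y = sbump eps y x" by (simp add: sbump_def norm_minus_commute)
 show "sbump eps y \<in> test_functions U" if U: "cball y eps \<subseteq> U"
 proof -
  have "smooth (sbump eps y)" using bump_algebra_smooth[OF bump_algebra.flat[of 0 eps y]] by (simp add: sbump_def[abs_def])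
  moreover have "support_on UNIV (sbump eps y) \<subseteq> cball y eps"
  proof
   fix x assume "x \<in> support_on UNIV (sbump eps y)"
   then have "sbump eps y x \<noteq> 0" by (simp add: support_on_def)
   then have "\<not> eps \<le> norm (x - y)" using z by blast
   then show "x \<in> cball y eps" by (simp add: dist_norm norm_minus_commute)
  qed
  then have "closure (support_on UNIV (sbump eps y)) \<subseteq> cball y eps" by (rule closure_minimal) simp
  moreover from this have "compact (closure (support_on UNIV (sbump eps y)))"
   by (intro compact_eq_bounded_closed[THEN iffD2] conjI closed_closure bounded_subset[OF bounded_cball])
  ultimately show ?thesis using U by (auto simp: test_functions_def)
 qed
qed

lemma test_function_c1c:
 assumes "\<phi> \<in> test_functions U" shows "c1c U \<phi>"
proof -
 have sm: "smooth \<phi>" and K: "compact (closure (support_on UNIV \<phi>))" "closure (support_on UNIV \<phi>) \<subseteq> U"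
  using assms by (auto simp: test_functions_def)
 have d: "\<phi> differentiable (at x)" for x using sm[unfolded smooth_def, rule_format, of "[]"] by simp
 have dd: "iterated_deriv [b] \<phi> differentiable (at x)" if "b \<in> Basis" for b x
  using sm[unfolded smooth_def, rule_format, of "[b]"] that by simp
 have "frechet_derivative \<phi> (at x) = (\<lambda>h. h \<bullet> grad \<phi> x)" for x
  using frechet_derivative_at GDERIV_grad[OF d] unfolding gderiv_def by metis
 then have "grad \<phi> x = (\<Sum>b\<in>Basis. iterated_deriv [b] \<phi> x *\<^sub>R b)" for x
  by (simp add: inner_commute[of _ "grad \<phi> x"] euclidean_representation)
 then have g: "grad \<phi> = (\<lambda>x. \<Sum>b\<in>Basis. iterated_deriv [b] \<phi> x *\<^sub>R b)" by blast
 have "continuous_on UNIV (iterated_deriv [b] \<phi>)" if "b \<in> Basis" for b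
  using dd[OF that] by (intro differentiable_imp_continuous_on) (auto simp: differentiable_on_def)
 then have "continuous_on UNIV (grad \<phi>)" unfolding g by (intro continuous_on_sum continuous_on_scaleR continuous_on_const)
 then have "C1_on UNIV \<phi>" using d by (simp add: C1_on_def)
 moreover have "\<phi> x = 0" if "x \<notin> closure (support_on UNIV \<phi>)" for x
 proof -
  have "x \<notin> support_on UNIV \<phi>" using that closure_subset by blast
  then show ?thesis by (simp add: support_on_def)
 qed
 ultimately show ?thesis using K unfolding c1c_def by blast
qed

section \<open>Mollification\<close>

text \<open>The dilation identity about the origin is subtracted from the one for the translate of
  g, which is the dilation identity about a; the difference is the directional derivative.\<close>

lemma integral_directional_zero:
 fixes g :: "'a::euclidean_space \<Rightarrow> real"
 assumes g: "c1c UNIV g" shows "(LINT x|lborel. a \<bullet> grad g x) = 0"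
proof -
 obtain K where K: "compact K" "\<And>x. x \<notin> K \<Longrightarrow> g x = 0" and C: "C1_on UNIV g" and cont: "continuous_on UNIV (grad g)" "continuous_on UNIV g"
  using c1c_E[OF g] by metis
 define h where "h x = g (x + a)" for x
 have hg: "GDERIV h x :> grad g (x + a)" for x
 proof -
  have "(g has_derivative (\<lambda>h. h \<bullet> grad g (x + a))) (at (x + a))" using C1_onD(1)[OF C] by (simp add: gderiv_def)
  from has_derivative_compose[where f="\<lambda>x. x + a" and s=UNIV, OF has_derivative_add_const[OF has_derivative_ident] this]
  show ?thesis by (simp add: gderiv_def h_def[abs_def])
 qed
 have hc: "c1c UNIV h" unfolding c1c_def
 proof (intro conjI exI[of _ "(\<lambda>x. x - a) ` K"] allI impI)
  show "C1_on UNIV h" by (rule C1_onI[OF hg]) (auto intro!: continuous_intros continuous_on_compose2[OF cont(1)])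
  show "compact ((\<lambda>x. x - a) ` K)" by (intro compact_continuous_image continuous_intros K)
  fix x assume "x \<notin> (\<lambda>x. x - a) ` K"
  then have "x + a \<notin> K" by (metis add_diff_cancel image_eqI)
  then show "h x = 0" using K(2) by (simp add: h_def)
 qed auto
 have i: "integrable lborel (\<lambda>x. x \<bullet> grad g x + DIM('a) * g x)" "integrable lborel (\<lambda>x. a \<bullet> grad g x)"
  using c1c_integrable(1)[OF g, of "\<lambda>x. x"] c1c_integrable(2)[OF g, of "\<lambda>_. DIM('a)"] c1c_integrable(1)[OF g, of "\<lambda>_. a"] by auto
 have tr: "(LINT x|lborel. F (x + a)) = (LINT x|lborel. F x)" if "continuous_on UNIV F" for F :: "'a \<Rightarrow> real"
  using integral_lborel_isometry[where Q="\<lambda>x. x", OF borel_measurable_continuous_onI[OF that] linear_ident] by simp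
 have "0 = (LINT x|lborel. x \<bullet> grad h x + DIM('a) * h x)" using integral_dilation_zero[OF hc] by simp
 also have "\<dots> = (LINT x|lborel. (\<lambda>x. (x - a) \<bullet> grad g x + DIM('a) * g x) (x + a))"
  using grad_eqI[OF hg] by (simp add: h_def)
 also have "\<dots> = (LINT x|lborel. (x - a) \<bullet> grad g x + DIM('a) * g x)"
  by (rule tr) (intro continuous_intros cont)
 also have "\<dots> = (LINT x|lborel. (x \<bullet> grad g x + DIM('a) * g x) - a \<bullet> grad g x)" by (simp add: inner_diff_left algebra_simps)
 also have "\<dots> = - (LINT x|lborel. a \<bullet> grad g x)" using Bochner_Integration.integral_diff[OF i] integral_dilation_zero[OF g] by simp
 finally show ?thesis by simp
qed

text \<open>Instead of mollifying \<phi>, the weak form is tested with the kernel centred at y,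
  weighted by \<phi>(y) and integrated over y. By Fubini the result is 0; integrated first in y, it
  is close to c times the weak form at \<phi>, where c is the mass of the kernel.\<close>

lemma test_functions_to_c1c:
 fixes X :: "'a::euclidean_space \<Rightarrow> 'a"
 assumes U: "open U" and X: "continuous_on U X" and f: "continuous_on U f"
  and id: "\<And>\<psi>. \<psi> \<in> test_functions U \<Longrightarrow> (LINT x|lborel. X x \<bullet> grad \<psi> x + f x * \<psi> x) = 0"
  and \<phi>: "c1c U \<phi>"
 shows "(LINT x|lborel. X x \<bullet> grad \<phi> x + f x * \<phi> x) = 0"
proof -
 obtain K where K: "compact K" "K \<subseteq> U" "\<And>x. x \<notin> K \<Longrightarrow> \<phi> x = 0" "\<And>x. x \<notin> K \<Longrightarrow> grad \<phi> x = 0"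
  "C1_on UNIV \<phi>" "continuous_on UNIV (grad \<phi>)" "continuous_on UNIV \<phi>" using c1c_E[OF \<phi>] by metis
 obtain e where e: "0 < e" "(\<Union>x\<in>K. cball x e) \<subseteq> U" by (rule compact_subset_open_imp_cball_epsilon_subset[OF K(1) U K(2)])
 define L where "L = (\<Union>x\<in>K. cball x e)"
 have L: "compact L" "L \<subseteq> U" "K \<subseteq> L" using compact_minkowski_sum_cball[OF K(1)] e by (auto simp: L_def)
 have nearL: "x \<in> L" if "y \<in> K" "norm (x - y) \<le> e" for x y
  using that by (auto simp: L_def dist_norm norm_minus_commute intro!: bexI[of _ y])
 define B where "B x = norm (X x) + \<bar>f x\<bar>" for x
 have "continuous_on L B" unfolding B_def by (intro continuous_intros continuous_on_subset[OF X] continuous_on_subset[OF f] L)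
 then have "bounded (B ` L)" by (intro compact_imp_bounded compact_continuous_image L)
 then obtain M where "0 < M" "\<forall>v\<in>B ` L. norm v \<le> M" unfolding bounded_pos by blast
 then have M: "0 < M" "\<And>x. x \<in> L \<Longrightarrow> B x \<le> M" by (auto simp: abs_le_iff)
 define t where "t x = X x \<bullet> grad \<phi> x + f x * \<phi> x" for x
 have ti: "integrable lborel t" unfolding t_def
  by (intro Bochner_Integration.integrable_add c1c_integrable[OF \<phi>] X f)
 have t0: "t x = 0" if "x \<notin> L" for x
 proof -
  have "x \<notin> K" using that L(3) by blast
  then show ?thesis by (simp add: t_def K(3,4))
 qed
 have small: "\<bar>integral\<^sup>L lborel t\<bar> \<le> \<eta> * (M * measure lborel L)" if eta: "0 < \<eta>" for \<eta>
 proof -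
  have "uniformly_continuous_on L (grad \<phi>)" "uniformly_continuous_on L \<phi>"
   by (intro compact_uniformly_continuous continuous_on_subset[OF K(6)] continuous_on_subset[OF K(7)] L; simp)+
  then obtain d1 d2 where d: "0 < d1" "\<And>x y. x \<in> L \<Longrightarrow> y \<in> L \<Longrightarrow> dist x y < d1 \<Longrightarrow> dist (grad \<phi> x) (grad \<phi> y) < \<eta>"
   "0 < d2" "\<And>x y. x \<in> L \<Longrightarrow> y \<in> L \<Longrightarrow> dist x y < d2 \<Longrightarrow> dist (\<phi> x) (\<phi> y) < \<eta>"
   using eta unfolding uniformly_continuous_on_def by metis
  define eps where "eps = min e (min d1 d2)"
  have ep: "0 < eps" "eps \<le> e" "eps \<le> d1" "eps \<le> d2" using e d by (auto simp: eps_def)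
  note sb = sbump_props[OF ep(1)]
  define G where "G x y = (- 2 * flat 2 (eps\<^sup>2 - (norm (x - y))\<^sup>2)) *\<^sub>R (x - y)" for x y :: 'a
  have gs: "grad (sbump eps y) x = G x y" for x y unfolding G_def by (rule grad_eqI[OF sb(4)])
  have G': "G y x = - G x y" for x y by (simp add: G_def norm_minus_commute scaleR_diff_right)
  have flc: "continuous_on UNIV (flat k)" for k using DERIV_flat by (intro DERIV_continuous_on) auto
  have sbC: "C1_on UNIV (sbump eps y)" for y
   by (rule C1_onI[OF sb(4)]) (auto intro!: continuous_intros continuous_on_compose2[OF flc])
  have G0: "G x y = 0" if "eps \<le> norm (x - y)" for x y
   using power_mono[OF that, of 2] ep by (simp add: G_def flat_def)
  define H where "H x y = \<phi> y * (X x \<bullet> G x y + f x * sbump eps y x)" for x y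
  have H0: "H x y = 0" if "(x, y) \<notin> L \<times> K" for x y
  proof (cases "y \<in> K")
   case True
   then have "x \<notin> L" using that by auto
   then have "\<not> norm (x - y) \<le> e" using nearL True by blast
   then have "eps \<le> norm (x - y)" using ep by simp
   then show ?thesis by (simp add: H_def G0 sb(2))
  qed (simp add: H_def K(3))
  have cH: "continuous_on (L \<times> K) (\<lambda>(x, y). H x y)"
   unfolding H_def G_def sbump_def split_beta
   by (intro continuous_intros continuous_on_compose2[OF flc] continuous_on_compose2[OF X] continuous_on_compose2[OF f]
    continuous_on_compose2[OF K(7)]) (use L in auto)
  have iH: "integrable (lborel \<Otimes>\<^sub>M lborel) (\<lambda>(x, y). H x y)" unfolding lborel_prod
   by (rule integrable_compact_support[OF compact_Times[OF L(1) K(1)] cH]) (use H0 in auto)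
  define S where "S x = (LINT y|lborel. H x y)" for x
  have Si: "integrable lborel S" unfolding S_def[abs_def] by (rule lborel_pair.integrable_fst[OF iH])
  have S0: "integral\<^sup>L lborel S = 0"
  proof -
   have "integral\<^sup>L lborel S = (LINT y|lborel. (LINT x|lborel. H x y))"
    unfolding S_def[abs_def] by (rule lborel_pair.Fubini_integral[OF iH, symmetric])
   \<comment> \<open>For fixed y in K the kernel is a smooth test function supported in U.\<close>
   also have "(\<lambda>y. LINT x|lborel. H x y) = (\<lambda>_. 0)"
   proof
    fix y show "(LINT x|lborel. H x y) = 0"
    proof (cases "y \<in> K")
     case True
     have "cball y eps \<subseteq> U" using True e(2) ep(2) by fastforce
     from id[OF sb(6)[OF this]] show ?thesis by (simp add: H_def gs)
    qed (simp add: H_def K(3))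
   qed
   finally show ?thesis by simp
  qed
  have sbc: "c1c UNIV (sbump eps x)" for x using test_function_c1c[OF sb(6)[of x UNIV]] by simp
  define c where "c = (LINT y|lborel. sbump eps (0::'a) y)"
  have sbi: "integrable lborel (sbump eps x)" for x using c1c_integrable(2)[OF sbc, of "\<lambda>_. 1" x] by simp
  have cx: "(LINT y|lborel. sbump eps x y) = c" for x :: 'a
  proof -
   have "(LINT y|lborel. sbump eps (0::'a) (y + - x)) = c" unfolding c_def
    by (rule integral_lborel_isometry[where Q="\<lambda>x. x" and f="sbump eps 0", OF borel_measurable_continuous_onI[OF C1_on_continuous_on[OF sbC]] linear_ident]) simp_all
   then show ?thesis by (simp add: sbump_def)
  qed
  have cpos: "0 < c"
  proof -
   have "0 \<le> c" unfolding c_def by (rule Bochner_Integration.integral_nonneg) (rule sb(1))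
   moreover have "c \<noteq> 0"
   proof
    assume "c = 0"
    have "(integral\<^sup>L lborel (sbump eps (0::'a)) = 0) = (AE y in lborel. sbump eps (0::'a) y = 0)"
     by (rule integral_nonneg_eq_0_iff_AE[OF sbi]) (simp add: sb(1))
    then have "AE y in lborel. sbump eps (0::'a) y = 0" using \<open>c = 0\<close> by (simp add: c_def)
    then have "AE y in lborel. y \<notin> ball (0::'a) eps"
    proof (rule eventually_mono)
     fix y :: 'a assume "sbump eps 0 y = 0"
     then have "\<not> norm (y - 0) < eps" using sb(3)[of y 0] by linarith
     then show "y \<notin> ball 0 eps" by simp
    qed
    then have "emeasure lborel (ball (0::'a) eps) = 0" by (subst (asm) AE_iff_measurable[OF _ refl]) (auto simp: ball_def)
    moreover have "0 < measure lborel (ball (0::'a) eps)"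
     using ep emeasure_lborel_ball_finite[of "0::'a" eps] by (intro open_measure_pos[of _ 0]) auto
    ultimately show False by (simp add: measure_def)
   qed
   ultimately show ?thesis by simp
  qed
  \<comment> \<open>The x-gradient of the kernel is minus its y-gradient; integration by parts in y
    moves it onto \<phi>, with X x as a constant vector.\<close>
  have Sx: "S x = (LINT y|lborel. sbump eps x y * (X x \<bullet> grad \<phi> y + f x * \<phi> y))" for x
  proof -
   let ?g = "\<lambda>y. \<phi> y * sbump eps x y"
   have gc: "c1c UNIV ?g" unfolding c1c_def
    by (intro conjI exI[of _ K] C1_on_mult K(5) sbC) (use K in auto)
   have gg: "grad ?g y = \<phi> y *\<^sub>R G y x + sbump eps x y *\<^sub>R grad \<phi> y" for y
    using grad_mult[OF C1_on_differentiable[OF K(5)] C1_on_differentiable[OF sbC], of y x] by (simp add: gs)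
   have "H x y = sbump eps x y * (X x \<bullet> grad \<phi> y + f x * \<phi> y) - X x \<bullet> grad ?g y" for y :: 'a
    unfolding gg H_def by (simp add: G'[of y x] sb(5)[of y x] inner_add_right algebra_simps)
   then have e: "H x = (\<lambda>y. sbump eps x y * (X x \<bullet> grad \<phi> y + f x * \<phi> y) - X x \<bullet> grad ?g y)" by blast
   have "integrable lborel (\<lambda>y. sbump eps x y * (X x \<bullet> grad \<phi> y + f x * \<phi> y))"
    by (rule integrable_compact_support[OF K(1)])
     (auto intro!: continuous_intros continuous_on_subset[OF K(6)] continuous_on_subset[OF K(7)] continuous_on_subset[OF C1_on_continuous_on[OF sbC]] simp: K(3,4))
   then show ?thesis unfolding S_def e
    using integral_directional_zero[OF gc, of "X x"] Bochner_Integration.integral_diff[OF _ c1c_integrable(1)[OF gc, of "\<lambda>_. X x"]] by simp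
  qed
  \<comment> \<open>Within the support of the kernel, \<phi> and its gradient vary by at most
    \<open>\<eta>\<close>; outside the neighbourhood L of K both sides vanish.\<close>
  have est: "\<bar>c * t x - S x\<bar> \<le> c * (\<eta> * M) * indicator L x" for x
  proof (cases "x \<in> L")
   case False
   have "sbump eps x y * (X x \<bullet> grad \<phi> y + f x * \<phi> y) = 0" for y
   proof (cases "y \<in> K")
    case True
    then have "\<not> norm (x - y) \<le> e" using nearL False by blast
    then have "eps \<le> norm (y - x)" using ep by (simp add: norm_minus_commute)
    then show ?thesis by (simp add: sb(2))
   qed (simp add: K(3,4))
   then have "S x = 0" unfolding Sx by (simp only: integral_zero)
   then show ?thesis using False t0 by simp
  next
   case True
   let ?F = "\<lambda>y. sbump eps x y * t x - sbump eps x y * (X x \<bullet> grad \<phi> y + f x * \<phi> y)"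
   have Fi: "integrable lborel (\<lambda>y. sbump eps x y * (X x \<bullet> grad \<phi> y + f x * \<phi> y))"
    by (rule integrable_compact_support[OF K(1)])
     (auto intro!: continuous_intros continuous_on_subset[OF K(6)] continuous_on_subset[OF K(7)] continuous_on_subset[OF C1_on_continuous_on[OF sbC]] simp: K(3,4))
   have cS: "c * t x - S x = (LINT y|lborel. ?F y)"
    unfolding Sx using Fi sbi[of x] by (simp add: cx mult.commute)
   have pt: "\<bar>?F y\<bar> \<le> sbump eps x y * (\<eta> * M)" for y
   proof (cases "eps \<le> norm (y - x)")
    case True
    then show ?thesis by (simp add: sb(2))
   next
    case False
    have dd: "norm (grad \<phi> x - grad \<phi> y) \<le> \<eta> \<and> \<bar>\<phi> x - \<phi> y\<bar> \<le> \<eta>"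
    proof (cases "x \<in> K \<or> y \<in> K")
     case True
     have "y \<in> L" using True nearL[of x y] L(3) False ep by auto
     moreover have "dist x y < d1" "dist x y < d2" using False ep by (auto simp: dist_norm norm_minus_commute)
     ultimately show ?thesis using d(2)[of x y] d(4)[of x y] \<open>x \<in> L\<close> by (auto simp: dist_norm)
    qed (use K(3,4) eta in auto)
    have "\<bar>t x - (X x \<bullet> grad \<phi> y + f x * \<phi> y)\<bar> = \<bar>X x \<bullet> (grad \<phi> x - grad \<phi> y) + f x * (\<phi> x - \<phi> y)\<bar>"
     by (simp add: t_def inner_diff_right algebra_simps)
    also have "\<dots> \<le> norm (X x) * \<eta> + \<bar>f x\<bar> * \<eta>"
    proof (rule order_trans[OF abs_triangle_ineq add_mono])
     show "\<bar>X x \<bullet> (grad \<phi> x - grad \<phi> y)\<bar> \<le> norm (X x) * \<eta>"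
      by (rule order_trans[OF Cauchy_Schwarz_ineq2 mult_left_mono]) (use dd in auto)
     show "\<bar>f x * (\<phi> x - \<phi> y)\<bar> \<le> \<bar>f x\<bar> * \<eta>" unfolding abs_mult using dd by (intro mult_left_mono) auto
    qed
    also have "\<dots> = \<eta> * B x" by (simp add: B_def algebra_simps)
    also have "\<dots> \<le> \<eta> * M" using M(2)[OF \<open>x \<in> L\<close>] eta by (intro mult_left_mono) auto
    finally have "sbump eps x y * \<bar>t x - (X x \<bullet> grad \<phi> y + f x * \<phi> y)\<bar> \<le> sbump eps x y * (\<eta> * M)" using sb(1) by (rule mult_left_mono)
    then show ?thesis using sb(1)[of x y] by (simp add: right_diff_distrib[symmetric] abs_mult)
   qed
   have "\<bar>LINT y|lborel. ?F y\<bar> \<le> (LINT y|lborel. \<bar>?F y\<bar>)" by (rule integral_abs_bound)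
   also have "\<dots> \<le> (LINT y|lborel. sbump eps x y * (\<eta> * M))"
    by (rule integral_mono) (use pt sbi[of x] Fi in auto)
   finally show ?thesis using True by (simp add: cS cx)
  qed
  have "c * integral\<^sup>L lborel t = (LINT x|lborel. c * t x - S x)" using ti Si S0 by simp
  also have "\<bar>\<dots>\<bar> \<le> (LINT x|lborel. \<bar>c * t x - S x\<bar>)" by (rule integral_abs_bound)
  also have "\<dots> \<le> (LINT x|lborel. c * (\<eta> * M) * indicator L x)"
  proof (rule integral_mono)
   show "integrable lborel (\<lambda>x. c * (\<eta> * M) * indicator L x)"
    using emeasure_compact_finite[OF L(1)] borel_compact[OF L(1)] by (intro integrable_mult_right integrable_real_indicator) auto
  qed (use est ti Si in auto)
  also have "\<dots> = c * (\<eta> * (M * measure lborel L))" using borel_compact[OF L(1)] by simp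
  finally have "c * \<bar>integral\<^sup>L lborel t\<bar> \<le> c * (\<eta> * (M * measure lborel L))" using cpos by (simp add: abs_mult)
  then show ?thesis using cpos by simp
 qed
 have "\<bar>integral\<^sup>L lborel t\<bar> \<le> 0"
 proof (rule field_le_epsilon)
  fix r :: real assume r: "0 < r"
  define m where "m = M * measure lborel L + 1"
  have m: "0 < m" using M(1) by (simp add: m_def add_nonneg_pos)
  have "\<bar>integral\<^sup>L lborel t\<bar> \<le> r / m * (M * measure lborel L)" using r m by (intro small) simp
  also have "\<dots> \<le> r / m * m" using r m by (intro mult_left_mono) (auto simp: m_def)
  finally show "\<bar>integral\<^sup>L lborel t\<bar> \<le> 0 + r" using m by simp
 qed
 then have "integral\<^sup>L lborel t = 0" by simp
 then show ?thesis unfolding t_def[abs_def] .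
qed

section \<open>Uniqueness and the main theorem\<close>

lemma LINT_test_function:
 assumes "c1c U \<phi>"
 shows "(LINT x:U|lborel. X x \<bullet> grad \<phi> x + f x * \<phi> x) = (LINT x|lborel. X x \<bullet> grad \<phi> x + f x * \<phi> x)"
proof -
 obtain K where K: "K \<subseteq> U" "\<And>x. x \<notin> K \<Longrightarrow> \<phi> x = 0" "\<And>x. x \<notin> K \<Longrightarrow> grad \<phi> x = 0" using c1c_E[OF assms] by metis
 have "indicator U x *\<^sub>R (X x \<bullet> grad \<phi> x + f x * \<phi> x) = X x \<bullet> grad \<phi> x + f x * \<phi> x" for x
 proof (cases "x \<in> U")
  case False
  then have "x \<notin> K" using K(1) by blast
  then show ?thesis by (simp add: K(2,3))
 qed simp
 then show ?thesis unfolding set_lebesgue_integral_def by (simp only:)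
qed

context exponents begin

lemma nonneg_solution_wsol:
 fixes u :: "'a::euclidean_space \<Rightarrow> real"
 assumes U: "open U" and s: "nonneg_solution p q U u" shows "wsol p q 1 U u"
proof -
 have C: "C1_on U u" and id: "\<And>\<phi>. \<phi> \<in> test_functions U \<Longrightarrow>
   (LINT x:U|lborel. vflux p (grad u x) \<bullet> grad \<phi> x + norm (grad u x) powr q * \<phi> x) = 0"
  using s by (auto simp: nonneg_solution_def neg_plap_plus_eq_in_distr_def plap_flux_def vflux_def)
 have "(LINT x|lborel. vflux p (grad u x) \<bullet> grad \<phi> x + norm (grad u x) powr q * \<phi> x) = 0" if "c1c U \<phi>" for \<phi>
 proof (rule test_functions_to_c1c[OF U _ _ _ that])
  show "continuous_on U (\<lambda>x. vflux p (grad u x))" by (intro continuous_on_vflux_compose[OF p1] C1_onD(2)[OF C])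
  show "continuous_on U (\<lambda>x. norm (grad u x) powr q)" using exps(1) by (intro continuous_on_norm_powr C1_onD(2)[OF C])
  show "(LINT x|lborel. vflux p (grad u x) \<bullet> grad \<psi> x + norm (grad u x) powr q * \<psi> x) = 0" if "\<psi> \<in> test_functions U" for \<psi>
   using id[OF that] LINT_test_function[OF test_function_c1c[OF that]] by simp
 qed
 then show ?thesis using C by (simp add: wsol_def)
qed

text \<open>Two constants with the defining property agree when tested on one function positive at
  the origin.\<close>

lemma c_dirac_eq:
 assumes dim: "N = real DIM('a::euclidean_space)" shows "c_dirac TYPE('a) p = cdir TYPE('a)"
proof -
 have l0: "locally_integrable UNIV (\<lambda>x::'a. 0::real)" by (simp add: locally_integrable_def set_integrable_def)
 have lf: "locally_integrable UNIV (plap_flux p (mu p :: 'a \<Rightarrow> real))"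
  using mu_flux_locally_integrable[OF dim] by (simp add: plap_flux_def[abs_def] vflux_def)
 have val: "(LINT x:UNIV|lborel. plap_flux p (mu p) x \<bullet> grad \<phi> x + 0 * \<phi> x) = cdir TYPE('a) * \<phi> 0"
  if "\<phi> \<in> test_functions UNIV" for \<phi> :: "'a \<Rightarrow> real"
  using mu_mass[OF dim test_function_c1c[OF that]] LINT_test_function[OF test_function_c1c[OF that], of "plap_flux p (mu p)" "\<lambda>_. 0"]
  by (simp add: plap_flux_def vflux_def)
 show ?thesis unfolding c_dirac_def
 proof (rule the_equality)
  show "0 < cdir TYPE('a) \<and> neg_plap_plus_eq_in_distr (UNIV :: 'a set) p (mu p) (\<lambda>_. 0) (\<lambda>\<phi>. cdir TYPE('a) * dirac \<phi>)"
   unfolding neg_plap_plus_eq_in_distr_def dirac_def using cdir_pos[OF dim] lf l0 val by blast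
  fix c assume c: "0 < c \<and> neg_plap_plus_eq_in_distr (UNIV :: 'a set) p (mu p) (\<lambda>_. 0) (\<lambda>\<phi>. c * dirac \<phi>)"
  have s: "sbump 1 (0::'a) \<in> test_functions UNIV" "0 < sbump 1 (0::'a) 0" using sbump_props(6)[of 1 "0::'a" UNIV] sbump_props(3)[of 1 "0::'a" 0] by auto
  have "cdir TYPE('a) * sbump 1 (0::'a) 0 = c * sbump 1 (0::'a) 0"
   using c val[OF s(1)] s(1) unfolding neg_plap_plus_eq_in_distr_def dirac_def by metis
  then show "c = cdir TYPE('a)" using s(2) by simp
 qed
qed

section \<open>Comparison of solutions with the same behaviour at the origin\<close>

lemma bounded_near_0:
 fixes u :: "'a::euclidean_space \<Rightarrow> real"
 assumes dim: "N = real DIM('a)" and \<Omega>: "open \<Omega>" "0 \<in> \<Omega>" and u: "wsol p q a (\<Omega> - {0}) u" and k: "mu_behaviour p 0 u"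
 obtains m where "\<forall>\<^sub>F x in at 0. u x \<le> m"
proof -
 obtain R where R: "0 < R" "ball 0 R \<subseteq> \<Omega>" using \<Omega> open_contains_ball by blast
 have cu: "continuous_on (sphere 0 (R / 2)) u"
  by (rule continuous_on_subset[OF C1_on_continuous_on[OF wsol_C1[OF u]]]) (use R in auto)
 have "bdd_above (u ` sphere 0 (R / 2))" by (intro bounded_imp_bdd_above compact_imp_bounded compact_continuous_image cu compact_sphere)
 then obtain m where "\<forall>y\<in>u ` sphere 0 (R / 2). y \<le> m" unfolding bdd_above_def by blast
 then have m: "u x \<le> m" if "norm x = R / 2" for x using that by simp
 have lim: "\<forall>\<^sub>F x in at 0. u x \<le> k * mu p x" if "0 < k" for k
 proof -
  have "\<forall>\<^sub>F x::'a in at 0. 0 < mu p x" using mu_at_top[OF dim] by (auto simp: filterlim_at_top_dense)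
  moreover have "\<forall>\<^sub>F x in at 0. u x / mu p x < k" using order_tendstoD(2)[OF k[unfolded mu_behaviour_def] that] .
  ultimately show ?thesis by eventually_elim (simp add: field_simps)
 qed
 have uR: "wsol p q a (ball 0 R - {0}) u" by (rule wsol_subset[OF u]) (use R in auto)
 have "u x \<le> m" if "x \<noteq> 0" "norm x \<le> R / 2" for x
  by (rule removable_maximum[OF dim uR _ _ lim m that]) (use R in auto)
 then have "\<forall>\<^sub>F x in at 0. u x \<le> m" unfolding eventually_at using R(1) by (intro exI[of _ "R / 2"]) auto
 then show ?thesis by (rule that)
qed

text \<open>Where the order is known near 0, a small closed ball can be removed, and the origin no
  longer lies in the domain of comparison.\<close>

lemma ordered_at_infinity_compare:
 fixes u v :: "'a::euclidean_space \<Rightarrow> real"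
 assumes dim: "N = real DIM('a)" and \<Omega>: "open \<Omega>" "0 \<in> \<Omega>" "bounded \<Omega>"
  and u: "wsol p q 1 (\<Omega> - {0}) u" and z: "wsol p q a (\<Omega> - {0}) z" and a: "a < 1"
  and cu: "continuous_on (closure \<Omega> - {0}) u" and cz: "continuous_on (closure \<Omega> - {0}) z"
  and bd: "\<And>x. x \<in> closure \<Omega> - \<Omega> \<Longrightarrow> u x \<le> z x" and near: "\<forall>\<^sub>F x in at 0. u x \<le> z x"
  and x: "x \<in> \<Omega> - {0}"
 shows "u x \<le> z x"
proof -
 obtain \<delta> where d: "0 < \<delta>" "\<And>y. y \<noteq> 0 \<Longrightarrow> norm y < \<delta> \<Longrightarrow> u y \<le> z y" using near by (auto simp: eventually_at)
 define r where "r = \<delta> / 2"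
 have r: "0 < r" "r < \<delta>" using d by (auto simp: r_def)
 let ?U = "\<Omega> - cball 0 r"
 have cl: "closure ?U \<subseteq> closure \<Omega> - ball 0 r"
 proof -
  have "closure ?U \<subseteq> closure \<Omega>" by (intro closure_mono) auto
  moreover have "closure ?U \<subseteq> - ball 0 r" by (intro closure_minimal) auto
  ultimately show ?thesis by auto
 qed
 have 0: "0 \<notin> closure ?U" "0 \<notin> ?U" using cl r by auto
 show ?thesis
 proof (cases "norm x \<le> r")
  case False
  show ?thesis
  proof (rule comparison[OF dim _ _ _ wsol_subset[OF u] wsol_subset[OF z] a])
   show "open ?U" using \<Omega> by auto
   show "bounded ?U" using \<Omega> by (auto intro: bounded_subset)
   show "continuous_on (closure ?U - {0}) u" "continuous_on (closure ?U - {0}) z"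
    by (rule continuous_on_subset[OF cu] continuous_on_subset[OF cz]; use cl in blast)+
   fix y assume y: "y \<in> closure ?U - ?U"
   show "u y \<le> z y"
   proof (cases "y \<in> \<Omega>")
    case True
    then have "norm y \<le> r" "y \<noteq> 0" using y 0 by auto
    then show ?thesis using d r by auto
   qed (use y cl in \<open>auto intro: bd\<close>)
  qed (use 0 False x in auto)
 qed (use d r x in auto)
qed

text \<open>At the origin u receives its upper limit and z its lower limit, the values that
  \<open>comparison\<close> accepts; the order of these two values is then a consequence.\<close>

lemma bounded_compare:
 fixes u v :: "'a::euclidean_space \<Rightarrow> real"
 assumes dim: "N = real DIM('a)" and \<Omega>: "open \<Omega>" "0 \<in> \<Omega>" "bounded \<Omega>"
  and u: "wsol p q 1 (\<Omega> - {0}) u" and z: "wsol p q a (\<Omega> - {0}) z" and a: "a < 1"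
  and cu: "continuous_on (closure \<Omega> - {0}) u" and cz: "continuous_on (closure \<Omega> - {0}) z"
  and bd: "\<And>x. x \<in> closure \<Omega> - \<Omega> \<Longrightarrow> u x \<le> z x"
  and ub: "\<forall>\<^sub>F x in at 0. u x \<le> m" "\<forall>\<^sub>F x in at 0. z x \<le> m"
  and nn: "\<forall>\<^sub>F x in at 0. 0 \<le> u x" "\<forall>\<^sub>F x in at 0. 0 \<le> z x"
  and x: "x \<in> \<Omega> - {0}"
 shows "u x \<le> z x"
proof -
 have nb: "at (0::'a) \<noteq> bot" by simp
 have "\<forall>\<^sub>F x in at 0. - m - 1 < - u x" using ub(1) by (rule eventually_mono) simp
 moreover have "\<exists>\<^sub>F x in at 0. - u x \<le> 0" by (rule eventually_frequently[OF nb]) (use nn(1) in simp)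
 ultimately obtain L1 where L1: "\<forall>e>0. \<forall>\<^sub>F x in at 0. L1 - e < - u x" "\<forall>e>0. \<exists>\<^sub>F x in at 0. - u x < L1 + e"
  using real_liminf_exists[of "- m - 1" "\<lambda>x. - u x" 0] by blast
 have "\<forall>\<^sub>F x in at 0. - 1 < z x" using nn(2) by (rule eventually_mono) simp
 moreover have "\<exists>\<^sub>F x in at 0. z x \<le> m" by (rule eventually_frequently[OF nb ub(2)])
 ultimately obtain L2 where L2: "\<forall>e>0. \<forall>\<^sub>F x in at 0. L2 - e < z x" "\<forall>e>0. \<exists>\<^sub>F x in at 0. z x < L2 + e"
  using real_liminf_exists[of "- 1" z m] by blast
 let ?u = "u(0 := - L1)" and ?z = "z(0 := L2)"
 have O: "open (\<Omega> - {0})" using \<Omega> by (simp add: open_delete)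
 have ne: "\<forall>\<^sub>F x in at 0. x \<noteq> (0::'a)" by (simp add: eventually_at_filter)
 have ev: "\<forall>\<^sub>F x in at 0. P ((f(0 := c)) x)" if "\<forall>\<^sub>F x in at 0. P (f x)" for P and f :: "'a \<Rightarrow> real" and c
  using that ne by eventually_elim auto
 have fr: "\<exists>\<^sub>F x in at 0. P ((f(0 := c)) x)" if "\<exists>\<^sub>F x in at 0. P (f x)" for P and f :: "'a \<Rightarrow> real" and c
  using frequently_eventually_conj[OF that ne] by (rule frequently_elim1) auto
 have "?u x \<le> ?z x"
 proof (rule comparison[OF dim \<Omega>(1,3) \<Omega>(2)])
  show "wsol p q 1 (\<Omega> - {0}) ?u" "wsol p q a (\<Omega> - {0}) ?z"
   by (rule wsol_cong[OF O _ u] wsol_cong[OF O _ z]; simp)+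
  show "continuous_on (closure \<Omega> - {0}) ?u" "continuous_on (closure \<Omega> - {0}) ?z"
   using cu cz by (simp_all cong: continuous_on_cong_simp)
  show "?u y \<le> ?z y" if "y \<in> closure \<Omega> - \<Omega>" for y using bd[OF that] that \<Omega>(2) by auto
  fix e :: real assume e: "0 < e"
  show "\<forall>\<^sub>F x in at 0. ?u x < ?u 0 + e" by (rule ev) (use L1(1) e in \<open>auto elim!: eventually_mono\<close>)
  show "\<exists>\<^sub>F x in at 0. ?u 0 - e < ?u x" by (rule fr) (use L1(2) e in \<open>auto elim!: frequently_elim1\<close>)
  show "\<forall>\<^sub>F x in at 0. ?z 0 - e < ?z x" by (rule ev) (use L2(1) e in auto)
  show "\<exists>\<^sub>F x in at 0. ?z x < ?z 0 + e" by (rule fr) (use L2(2) e in auto)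
 qed (use a x in auto)
 then show ?thesis using x by simp
qed

lemma ratio_eventually_le:
 fixes u v m :: "'a::euclidean_space \<Rightarrow> real"
 assumes "((\<lambda>x. u x / m x) \<longlongrightarrow> k) (at 0)" "((\<lambda>x. v x / m x) \<longlongrightarrow> k) (at 0)" "\<forall>\<^sub>F x in at 0. 0 < m x" "0 < k" "1 < l"
 shows "\<forall>\<^sub>F x in at 0. u x \<le> l * v x"
proof -
 have "((\<lambda>x. l * (v x / m x) - u x / m x) \<longlongrightarrow> l * k - k) (at 0)" by (intro tendsto_intros assms)
 moreover have "0 < l * k - k" using assms(4,5) by simp
 ultimately have "\<forall>\<^sub>F x in at 0. 0 < l * (v x / m x) - u x / m x" by (rule order_tendstoD(1))
 then show ?thesis using assms(3)
 proof eventually_elim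
  case (elim x)
  then have "0 < (l * v x - u x) / m x" by (simp add: diff_divide_distrib)
  then show ?case using elim by (simp add: zero_less_divide_iff)
 qed
qed

lemma uniqueness_le:
 fixes u v :: "'a::euclidean_space \<Rightarrow> real"
 assumes dim: "N = real DIM('a)" and \<Omega>: "open \<Omega>" "0 \<in> \<Omega>" "bounded \<Omega>"
  and u: "wsol p q 1 (\<Omega> - {0}) u" and v: "wsol p q 1 (\<Omega> - {0}) v"
  and nu: "\<And>x. x \<in> \<Omega> - {0} \<Longrightarrow> 0 \<le> u x" and nv: "\<And>x. x \<in> \<Omega> - {0} \<Longrightarrow> 0 \<le> v x"
  and cu: "continuous_on (closure \<Omega> - {0}) u" and cv: "continuous_on (closure \<Omega> - {0}) v"
  and bd: "\<And>x. x \<in> frontier \<Omega> \<Longrightarrow> u x = v x"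
  and beh: "(\<exists>k\<ge>0. mu_behaviour p k u \<and> mu_behaviour p k v) \<or> (strong_behaviour p q u \<and> strong_behaviour p q v)"
  and x: "x \<in> closure \<Omega> - {0}"
 shows "u x \<le> v x"
proof -
 have fr: "closure \<Omega> - \<Omega> = frontier \<Omega>" using \<Omega>(1) by (simp add: frontier_def interior_open)
 \<comment> \<open>A boundary point is a limit of points of the punctured domain, where v >= 0; the
   sign is used to get v <= l v on the boundary.\<close>
 have nvb: "0 \<le> v y" if y: "y \<in> closure \<Omega> - {0}" for y
 proof (cases "y \<in> \<Omega>")
  case False
  have "y islimpt \<Omega>" using y False by (simp add: closure_def)
  moreover have "\<Omega> = insert 0 (\<Omega> - {0})" using \<Omega>(2) by blast
  ultimately have "y islimpt insert 0 (\<Omega> - {0})" by (rule back_subst)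
  then have "y islimpt (\<Omega> - {0})" unfolding islimpt_insert .
  then have "\<not> trivial_limit (at y within \<Omega> - {0})" unfolding trivial_limit_within by simp
  moreover have "(v \<longlongrightarrow> v y) (at y within \<Omega> - {0})"
   using cv y closure_subset[of \<Omega>] unfolding continuous_on_def by (meson Diff_mono order_refl tendsto_within_subset)
  ultimately show ?thesis by (intro tendsto_lowerbound[of v "v y" "at y within \<Omega> - {0}" 0]) (auto simp: eventually_at_filter nv)
 qed (use y nv in auto)
 have near: "\<forall>\<^sub>F x in at 0. x \<in> \<Omega> - {0}"
  using eventually_at_in_open[OF \<Omega>(1,2)] by simp
 have main: "u x \<le> l * v x" if l: "1 < l" and x: "x \<in> \<Omega> - {0}" for l x
 proof -
  let ?z = "\<lambda>x. l * v x"
  have z: "wsol p q (1 * l powr (p - 1 - q)) (\<Omega> - {0}) ?z" by (rule wsol_scale[OF v _ p1 exps(1)]) (use l in simp)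
  have cz: "continuous_on (closure \<Omega> - {0}) ?z" by (intro continuous_intros cv)
  have bz: "u y \<le> l * v y" if y: "y \<in> closure \<Omega> - \<Omega>" for y
  proof -
   have "0 \<le> v y" using y \<Omega>(2) by (intro nvb) auto
   then have "v y \<le> l * v y" using l by (simp add: mult_le_cancel_right1)
   then show ?thesis using bd[of y] y by (simp add: fr)
  qed
  note cmp = ordered_at_infinity_compare[OF dim \<Omega> u z scale_strict[OF l] cu cz bz _ x]
  consider k where "0 < k" "mu_behaviour p k u" "mu_behaviour p k v" | "mu_behaviour p 0 u" "mu_behaviour p 0 v"
   | "strong_behaviour p q u" "strong_behaviour p q v" using beh by (metis order_le_less)
  then show ?thesis
  proof cases
   case 1
   have "\<forall>\<^sub>F x::'a in at 0. 0 < mu p x" using mu_at_top[OF dim] by (auto simp: filterlim_at_top_dense)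
   then show ?thesis using 1 l by (intro cmp ratio_eventually_le[of u "mu p" k]) (auto simp: mu_behaviour_def)
  next
   case 2
   obtain m1 where m1: "\<forall>\<^sub>F x in at 0. u x \<le> m1" by (rule bounded_near_0[OF dim \<Omega>(1,2) u 2(1)])
   obtain m2 where m2: "\<forall>\<^sub>F x in at 0. v x \<le> m2" by (rule bounded_near_0[OF dim \<Omega>(1,2) v 2(2)])
   have "\<forall>\<^sub>F x in at 0. l * v x \<le> max m1 (l * m2)" using m2
   proof eventually_elim
    case (elim x)
    then have "l * v x \<le> l * m2" using l by (intro mult_left_mono) auto
    then show ?case by simp
   qed
   moreover have "\<forall>\<^sub>F x in at 0. u x \<le> max m1 (l * m2)" using m1 by (rule eventually_mono) simp
   moreover have "\<forall>\<^sub>F x in at 0. 0 \<le> u x" using near by (rule eventually_mono) (rule nu)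
   moreover have "\<forall>\<^sub>F x in at 0. 0 \<le> l * v x" using near by (rule eventually_mono) (use nv l in simp)
   ultimately show ?thesis using bounded_compare[OF dim \<Omega> u z scale_strict[OF l] cu cz bz _ _ _ _ x] by blast
  next
   case 3
   have b: "beta p q = \<beta>q" by (simp add: beta_def \<beta>q_def)
   have "\<beta>q * (p - 1) + p - N = 1 / cf 1" using \<beta>q(4) by simp
   then have "0 < \<beta>q * (p - 1) + p - N" using \<beta>q(5) by simp
   then have lam: "0 < lambda TYPE('a) p q" using \<beta>q(1) unfolding lambda_def b dim by (intro mult_pos_pos) auto
   have "\<forall>\<^sub>F x::'a in at 0. 0 < inverse (norm x powr beta p q)" by (simp add: eventually_at_filter)
   then show ?thesis using 3 l lam
    by (intro cmp ratio_eventually_le[of u "\<lambda>x. inverse (norm x powr beta p q)" "lambda TYPE('a) p q"])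
     (auto simp: strong_behaviour_def divide_inverse mult.commute)
  qed
 qed
 show ?thesis
 proof (cases "x \<in> \<Omega>")
  case True
  show ?thesis
  proof (rule field_le_epsilon)
   fix e :: real assume e: "0 < e"
   have v0: "0 \<le> v x" using x by (rule nvb)
   have "u x \<le> (1 + e / (v x + 1)) * v x" using e v0 True x by (intro main) auto
   also have "\<dots> = v x + e / (v x + 1) * v x" by (simp add: distrib_right)
   also have "e / (v x + 1) * v x \<le> e" using e v0 by (simp add: field_simps)
   finally show "u x \<le> v x + e" by simp
  qed
 next
  case False
  then have "x \<in> frontier \<Omega>" using x fr by blast
  then show ?thesis using bd by simp
 qed
qed

lemma dirac_equation:
 fixes u :: "'a::euclidean_space \<Rightarrow> real"
 assumes dim: "N = real DIM('a)" and \<Omega>: "open \<Omega>" "0 \<in> \<Omega>" and u: "wsol p q 1 (\<Omega> - {0}) u" and k: "mu_behaviour p k u" "0 \<le> k"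
 shows "neg_plap_plus_eq_in_distr \<Omega> p u (\<lambda>x. norm (grad u x) powr q) (\<lambda>\<phi>. c_dirac TYPE('a) p * k powr (p - 1) * dirac \<phi>)"
 unfolding neg_plap_plus_eq_in_distr_def
proof (intro conjI ballI)
 have pf: "plap_flux p u = (\<lambda>x. vflux p (grad u x))" by (simp add: fun_eq_iff plap_flux_def vflux_def)
 note li = flux_locally_integrable[OF dim \<Omega> u k]
 show "locally_integrable \<Omega> (plap_flux p u)" "locally_integrable \<Omega> (\<lambda>x. norm (grad u x) powr q)" unfolding pf by (rule li)+
 fix \<phi> :: "'a \<Rightarrow> real" assume "\<phi> \<in> test_functions \<Omega>"
 then have c: "c1c \<Omega> \<phi>" by (rule test_function_c1c)
 show "(LINT x:\<Omega>|lborel. plap_flux p u x \<bullet> grad \<phi> x + norm (grad u x) powr q * \<phi> x) = c_dirac TYPE('a) p * k powr (p - 1) * dirac \<phi>"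
  unfolding LINT_test_function[OF c] pf dirac_def c_dirac_eq[OF dim]
  using dirac_mass[OF dim \<Omega> u k c] locally_integrable_c1c(1)[OF c li(2)] locally_integrable_c1c(2)[OF c li(1)] by simp
qed

end

theorem theorem3p9:
 fixes \<Omega> :: "'a::euclidean_space set" and p q :: real
 assumes "2 \<le> DIM('a)"
  and "1 < p" and "p \<le> real DIM('a)"
  and "p - 1 < q" and "q < q_crit TYPE('a) p"
  and "open \<Omega>" and "0 \<in> \<Omega>"
 shows "(\<forall>u. nonneg_solution p q (\<Omega> - {0}) u \<longrightarrow>
      (\<exists>k\<ge>0. mu_behaviour p k u \<and>
       neg_plap_plus_eq_in_distr \<Omega> p u (\<lambda>x. norm (grad u x) powr q)
        (\<lambda>\<phi>. c_dirac TYPE('a) p * k powr (p - 1) * dirac \<phi>))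
      \<or> strong_behaviour p q u)
    \<and> (bounded \<Omega> \<longrightarrow>
      (\<forall>u v. nonneg_solution p q (\<Omega> - {0}) u \<and> nonneg_solution p q (\<Omega> - {0}) v
       \<and> continuous_on (closure \<Omega> - {0}) u \<and> continuous_on (closure \<Omega> - {0}) v
       \<and> (\<forall>x\<in>frontier \<Omega>. u x = v x)
       \<and> ((\<exists>k\<ge>0. mu_behaviour p k u \<and> mu_behaviour p k v)
         \<or> (strong_behaviour p q u \<and> strong_behaviour p q v))
       \<longrightarrow> (\<forall>x\<in>closure \<Omega> - {0}. u x = v x)))"
proof -
 interpret exponents p q "real DIM('a)"
  by unfold_locales (use assms in \<open>auto simp: q_crit_def\<close>)
 have O: "open (\<Omega> - {0})" using assms(6) by (simp add: open_delete)
 have nn: "\<And>x. x \<in> \<Omega> - {0} \<Longrightarrow> 0 \<le> u x" if "nonneg_solution p q (\<Omega> - {0}) u" for u using that by (simp add: nonneg_solution_def)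
 note ws = nonneg_solution_wsol[OF O]
 show ?thesis
 proof (intro conjI impI allI)
  fix u assume u: "nonneg_solution p q (\<Omega> - {0}) u"
  show "(\<exists>k\<ge>0. mu_behaviour p k u \<and> neg_plap_plus_eq_in_distr \<Omega> p u (\<lambda>x. norm (grad u x) powr q)
    (\<lambda>\<phi>. c_dirac TYPE('a) p * k powr (p - 1) * dirac \<phi>)) \<or> strong_behaviour p q u"
   using classification[OF refl ws[OF u] assms(6,7) nn[OF u]] dirac_equation[OF refl assms(6,7) ws[OF u]] by blast
 next
  fix u v assume b: "bounded \<Omega>" and h: "nonneg_solution p q (\<Omega> - {0}) u \<and> nonneg_solution p q (\<Omega> - {0}) v
       \<and> continuous_on (closure \<Omega> - {0}) u \<and> continuous_on (closure \<Omega> - {0}) v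
       \<and> (\<forall>x\<in>frontier \<Omega>. u x = v x)
       \<and> ((\<exists>k\<ge>0. mu_behaviour p k u \<and> mu_behaviour p k v) \<or> (strong_behaviour p q u \<and> strong_behaviour p q v))"
  then have u: "nonneg_solution p q (\<Omega> - {0}) u" and v: "nonneg_solution p q (\<Omega> - {0}) v"
   and c: "continuous_on (closure \<Omega> - {0}) u" "continuous_on (closure \<Omega> - {0}) v"
   and f: "\<And>x. x \<in> frontier \<Omega> \<Longrightarrow> u x = v x" "\<And>x. x \<in> frontier \<Omega> \<Longrightarrow> v x = u x"
   and be: "(\<exists>k\<ge>0. mu_behaviour p k u \<and> mu_behaviour p k v) \<or> (strong_behaviour p q u \<and> strong_behaviour p q v)"
    "(\<exists>k\<ge>0. mu_behaviour p k v \<and> mu_behaviour p k u) \<or> (strong_behaviour p q v \<and> strong_behaviour p q u)" by auto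
  show "\<forall>x\<in>closure \<Omega> - {0}. u x = v x"
  proof (rule ballI, rule antisym)
   fix x assume x: "x \<in> closure \<Omega> - {0}"
   show "u x \<le> v x" by (rule uniqueness_le[OF refl assms(6,7) b ws[OF u] ws[OF v] nn[OF u] nn[OF v] c f(1) be(1) x])
   show "v x \<le> u x" by (rule uniqueness_le[OF refl assms(6,7) b ws[OF v] ws[OF u] nn[OF v] nn[OF u] c(2,1) f(2) be(2) x])
  qed
 qed
qed

end
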